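(* Let $A$ be a $\mathrm{JBW}$-algebra equipped with a normal finite faithful trace $\tau$ and let $\mathcal{M}$ be the $\mathrm{JBW}^*$-algebra associated to $A$. Suppose that $1\leq p\leq\infty$. The canonical inclusion $A\subset \mathrm{L}^p(\mathcal{M},\tau)$ induces an isometry $\mathrm{L}^{p,I}(A,\tau)\hookrightarrow \mathrm{L}^p(\mathcal{M},\tau)$.
   Context: A $\mathrm{JB}$-algebra is a real Jordan algebra $(A,\circ)$ with a complete norm satisfying $\|x\circ y\|\le\|x\|\|y\|$, $\|x^2\|=\|x\|^2$, $\|x^2\|\le\|x^2+y^2\|$; a $\mathrm{JBW}$-algebra is a $\mathrm{JB}$-algebra which is a dual Banach space (it is then unital, with unique predual $A_*$). Positive elements are squares. A $\mathrm{JBW}^*$-algebra is a complex Jordan algebra with involution $*$ which is a dual Banach space satisfying $\|x\circ y\|\le\|x\|\|y\|$, $\|x^*\|=\|x\|$, $\|\{x,x^*,x\}\|=\|x\|^3$, where $\{x,y,z\}=(x\circ y)\circ z+(y\circ z)\circ x-(x\circ z)\circ y$. For each $\mathrm{JBW}$-algebra $A$ there is a unique $\mathrm{JBW}^*$-algebra $\mathcal{M}=A+\mathrm{i}A$ with selfadjoint part $A$, called the $\mathrm{JBW}^*$-algebra associated to $A$. A normal finite faithful trace $\tau$ on $A$ is a weak* continuous positive linear functional on $A$ with $\tau(x\circ(y\circ z))=\tau((x\circ y)\circ z)$ for all $x,y,z\in A$ and $\tau(x)>0$ for every nonzero positive $x$. It is extended complex-linearly to $\mathcal{M}$, still denoted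 $\tau$. Nonassociative $\mathrm{L}^p$-space: for $x\in\mathcal{M}$ let $\tau_x\in\mathcal{M}_*$, $\tau_x(y)=\tau(x\circ y)$. The injective map $x\mapsto\tau_x$ embeds $\mathcal{M}$ into its predual $\mathcal{M}_*$ and makes $(\mathcal{M},\mathcal{M}_* )$ an interpolation couple. For $1<p<\infty$, $\mathrm{L}^p(\mathcal{M},\tau)=(\mathcal{M},\mathcal{M}_* )_{1/p}$ (Calderón complex interpolation); $\mathrm{L}^\infty(\mathcal{M},\tau)=\mathcal{M}$ and $\mathrm{L}^1(\mathcal{M},\tau)=\mathcal{M}_*$. Via this embedding $A\subset\mathcal{M}\subset\mathrm{L}^p(\mathcal{M},\tau)$; this is the canonical inclusion. Iochum's space: for $1\le p<\infty$, $\mathrm{L}^{p,I}(A,\tau)$ is the real Banach space obtained by completing $A$ for the norm $\|x\|_{\mathrm{L}^{p,I}(A,\tau)}=(\tau(|x|^p))^{1/p}$, where $|x|=(x^2)^{1/2}$ and $|x|^p$ is defined by functional calculus; $\mathrm{L}^{\infty,I}(A,\tau)=A$. *)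

theory Defs
  imports "HOL-Analysis.Analysis"
begin

section \<open>Complex vector spaces and complex Banach spaces\<close>

class complex_vector = real_vector +
  fixes scaleC :: "complex \<Rightarrow> 'a \<Rightarrow> 'a"  (infixr "*\<^sub>C" 75)
  assumes scaleC_add_right: "c *\<^sub>C (x + y) = c *\<^sub>C x + c *\<^sub>C y"
    and scaleC_add_left: "(c + d) *\<^sub>C x = c *\<^sub>C x + d *\<^sub>C x"
    and scaleC_scaleC: "c *\<^sub>C (d *\<^sub>C x) = (c * d) *\<^sub>C x"
    and scaleR_scaleC: "r *\<^sub>R x = complex_of_real r *\<^sub>C x"

class complex_banach = complex_vector + banach +
  assumes norm_scaleC: "norm (c *\<^sub>C x) = cmod c * norm x"

instantiation complex :: complex_banach
begin

definition scaleC_complex :: "complex \<Rightarrow> complex \<Rightarrow> complex"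
  where "scaleC_complex c x = c * x"

instance
  by standard
    (auto simp: scaleC_complex_def algebra_simps scaleR_conv_of_real norm_mult)

end

lemma bounded_linear_scaleC: "bounded_linear (\<lambda>x::'a::complex_banach. c *\<^sub>C x)"
proof (rule bounded_linear_intro[where K = "cmod c"])
  fix r :: real and x :: 'a
  show "c *\<^sub>C (r *\<^sub>R x) = r *\<^sub>R (c *\<^sub>C x)"
    by (simp add: scaleR_scaleC scaleC_scaleC mult.commute)
qed (simp_all add: scaleC_add_right norm_scaleC mult.commute)

instantiation blinfun :: (real_normed_vector, complex_banach) complex_vector
begin

definition scaleC_blinfun :: "complex \<Rightarrow> ('a \<Rightarrow>\<^sub>L 'b) \<Rightarrow> ('a \<Rightarrow>\<^sub>L 'b)"
  where "scaleC_blinfun c f = Blinfun (\<lambda>x. c *\<^sub>C blinfun_apply f x)"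

lemma scaleC_blinfun_apply [simp]:
  "blinfun_apply (c *\<^sub>C f) x = c *\<^sub>C blinfun_apply f x"
  for f :: "'a \<Rightarrow>\<^sub>L 'b"
  unfolding scaleC_blinfun_def
  by (subst bounded_linear_Blinfun_apply)
    (auto intro: bounded_linear_compose[OF bounded_linear_scaleC blinfun.bounded_linear_right])

instance
  by standard
    (auto intro!: blinfun_eqI
      simp: scaleC_add_right scaleC_add_left scaleC_scaleC scaleR_scaleC
        plus_blinfun.rep_eq scaleR_blinfun.rep_eq)

end

instance blinfun :: (real_normed_vector, complex_banach) complex_banach
proof
  fix c :: complex and f :: "'a \<Rightarrow>\<^sub>L 'b"
  have le: "norm (d *\<^sub>C g) \<le> cmod d * norm g" for d and g :: "'a \<Rightarrow>\<^sub>L 'b"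
    by (rule norm_blinfun_bound)
      (auto simp: norm_scaleC mult.assoc intro!: mult_left_mono norm_blinfun)
  show "norm (c *\<^sub>C f) = cmod c * norm f"
  proof (cases "c = 0")
    case True
    then show ?thesis using le[of c f] by simp
  next
    case False
    have "f = (1 *\<^sub>R f)" by simp
    also have "\<dots> = inverse c *\<^sub>C (c *\<^sub>C f)"
      using False by (simp only: scaleR_scaleC scaleC_scaleC) simp
    finally have "norm f \<le> cmod (inverse c) * norm (c *\<^sub>C f)"
      using le[of "inverse c" "c *\<^sub>C f"] by simp
    then have "cmod c * norm f \<le> norm (c *\<^sub>C f)"
      using False by (simp add: norm_divide field_simps)
    with le[of c f] show ?thesis by simp
  qed
qed

definition complex_linear :: "('a::complex_vector \<Rightarrow> 'b::complex_vector) \<Rightarrow> bool"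
  where "complex_linear f \<longleftrightarrow>
    (\<forall>x y. f (x + y) = f x + f y) \<and> (\<forall>c x. f (c *\<^sub>C x) = c *\<^sub>C f x)"


section \<open>JB-algebras, JBW-algebras and their associated JBW*-algebras\<close>

locale jordan_algebra =
  fixes jp :: "'a::real_vector \<Rightarrow> 'a \<Rightarrow> 'a"  (infixl "\<odot>" 70)
  assumes jp_bilinear: "bilinear (\<odot>)"
    and jp_commute: "x \<odot> y = y \<odot> x"
    and jordan_identity: "(x \<odot> x) \<odot> (y \<odot> x) = ((x \<odot> x) \<odot> y) \<odot> x"

locale jb_algebra = jordan_algebra jp
  for jp :: "'a::banach \<Rightarrow> 'a \<Rightarrow> 'a"  (infixl "\<odot>" 70) +
  assumes norm_jp_le: "norm (x \<odot> y) \<le> norm x * norm y"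
    and norm_square: "norm (x \<odot> x) = (norm x)\<^sup>2"
    and norm_square_le: "norm (x \<odot> x) \<le> norm (x \<odot> x + y \<odot> y)"

text \<open>\<open>J\<close> identifies the algebra isometrically with the dual of the Banach space \<open>'x\<close>, its
  predual; with \<open>'x\<close> a type variable, the predual is arbitrary.\<close>

locale jbw_algebra = jb_algebra jp
  for jp :: "'a::banach \<Rightarrow> 'a \<Rightarrow> 'a"  (infixl "\<odot>" 70) +
  fixes J :: "'a \<Rightarrow> ('x::banach \<Rightarrow>\<^sub>L real)"
  assumes dual_linear: "linear J"
    and dual_isometric: "norm (J x) = norm x"
    and dual_onto: "range J = UNIV"

definition jordan_triple :: "('a::ab_group_add \<Rightarrow> 'a \<Rightarrow> 'a) \<Rightarrow> 'a \<Rightarrow> 'a \<Rightarrow> 'a \<Rightarrow> 'a"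
  where "jordan_triple jp x y z = jp (jp x y) z + jp (jp y z) x - jp (jp x z) y"

text \<open>The dual of the complex Banach space \<open>'y\<close> consists of those elements of
  \<open>'y \<Rightarrow>\<^sub>L complex\<close> (a priori only real-linear) which are complex linear; its norm is the
  operator norm.\<close>

locale jbw_star_algebra = jordan_algebra jp
  for jp :: "'m::complex_banach \<Rightarrow> 'm \<Rightarrow> 'm"  (infixl "\<odot>" 70) +
  fixes star :: "'m \<Rightarrow> 'm"
    and K :: "'m \<Rightarrow> ('y::complex_banach \<Rightarrow>\<^sub>L complex)"
  assumes jp_scaleC: "(c *\<^sub>C x) \<odot> y = c *\<^sub>C (x \<odot> y)"
    and star_add: "star (x + y) = star x + star y"
    and star_scaleC: "star (c *\<^sub>C x) = cnj c *\<^sub>C star x"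
    and star_star: "star (star x) = x"
    and star_jp: "star (x \<odot> y) = star x \<odot> star y"
    and norm_jp_le: "norm (x \<odot> y) \<le> norm x * norm y"
    and norm_star: "norm (star x) = norm x"
    and norm_triple: "norm (jordan_triple (\<odot>) x (star x) x) = norm x ^ 3"
    and dual_complex_linear: "complex_linear K"
    and dual_isometric: "norm (K x) = norm x"
    and dual_onto: "range K = {\<phi>. complex_linear (blinfun_apply \<phi>)}"

text \<open>\<open>\<iota>\<close> identifies the JBW-algebra with the selfadjoint part of the JBW*-algebra.\<close>

locale associated_jbw_star_algebra =
  real_part: jbw_algebra jpA J + jbw_star_algebra jpM star K
  for jpA :: "'a::banach \<Rightarrow> 'a \<Rightarrow> 'a"
    and J :: "'a \<Rightarrow> ('x::banach \<Rightarrow>\<^sub>L real)"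
    and jpM :: "'m::complex_banach \<Rightarrow> 'm \<Rightarrow> 'm"
    and star :: "'m \<Rightarrow> 'm"
    and K :: "'m \<Rightarrow> ('y::complex_banach \<Rightarrow>\<^sub>L complex)" +
  fixes \<iota> :: "'a \<Rightarrow> 'm"
  assumes iota_linear: "linear \<iota>"
    and iota_isometric: "norm (\<iota> x) = norm x"
    and iota_jp: "\<iota> (jpA x y) = jpM (\<iota> x) (\<iota> y)"
    and iota_range: "range \<iota> = {x. star x = x}"


section \<open>Normal traces and the predual\<close>

text \<open>On \<open>'x \<Rightarrow>\<^sub>L real\<close> and \<open>'y \<Rightarrow>\<^sub>L complex\<close> the strong operator topology is the topology of
  pointwise convergence, that is, the weak* topology.\<close>

definition weak_star_topology ::
    "('a \<Rightarrow> ('x::real_normed_vector \<Rightarrow>\<^sub>L 'k::real_normed_vector)) \<Rightarrow> 'a topology"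
  where "weak_star_topology J = pullback_topology UNIV J strong_operator_topology"

definition jordan_positive :: "('a \<Rightarrow> 'a \<Rightarrow> 'a) \<Rightarrow> 'a \<Rightarrow> bool"
  where "jordan_positive jp x \<longleftrightarrow> (\<exists>y. x = jp y y)"

locale normal_finite_faithful_trace = jbw_algebra jp J
  for jp :: "'a::banach \<Rightarrow> 'a \<Rightarrow> 'a"  (infixl "\<odot>" 70)
    and J :: "'a \<Rightarrow> ('x::banach \<Rightarrow>\<^sub>L real)" +
  fixes \<tau> :: "'a \<Rightarrow> real"
  assumes trace_linear: "linear \<tau>"
    and trace_normal: "continuous_map (weak_star_topology J) euclideanreal \<tau>"
    and trace_positive: "jordan_positive (\<odot>) x \<Longrightarrow> 0 \<le> \<tau> x"
    and trace_assoc: "\<tau> (x \<odot> (y \<odot> z)) = \<tau> ((x \<odot> y) \<odot> z)"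
    and trace_faithful: "jordan_positive (\<odot>) x \<Longrightarrow> x \<noteq> 0 \<Longrightarrow> 0 < \<tau> x"

text \<open>Complex-linear extension of the trace, \<open>\<iota> a + \<i> \<iota> b \<mapsto> \<tau> a + \<i> \<tau> b\<close>.\<close>

definition trace_ext :: "('m::complex_vector \<Rightarrow> 'm) \<Rightarrow> ('a \<Rightarrow> 'm) \<Rightarrow> ('a \<Rightarrow> real) \<Rightarrow> 'm \<Rightarrow> complex"
  where "trace_ext star \<iota> \<tau> x =
    Complex (\<tau> (inv \<iota> ((1/2) *\<^sub>C (x + star x))))
            (\<tau> (inv \<iota> ((- \<i>/2) *\<^sub>C (x - star x))))"

text \<open>The predual is realised as the space of weak* continuous complex linear functionals, with
  the operator norm.\<close>

definition predual ::
    "('m::complex_banach \<Rightarrow> ('y::complex_banach \<Rightarrow>\<^sub>L complex)) \<Rightarrow> ('m \<Rightarrow>\<^sub>L complex) set"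
  where "predual K = {\<phi>. complex_linear (blinfun_apply \<phi>) \<and>
    continuous_map (weak_star_topology K) euclidean (blinfun_apply \<phi>)}"

text \<open>The map \<open>x \<mapsto> \<tau>\<^sub>x\<close>.\<close>

definition trace_embedding ::
    "('m::complex_banach \<Rightarrow> 'm \<Rightarrow> 'm) \<Rightarrow> ('m \<Rightarrow> 'm) \<Rightarrow> ('a \<Rightarrow> 'm) \<Rightarrow> ('a \<Rightarrow> real)
      \<Rightarrow> 'm \<Rightarrow> ('m \<Rightarrow>\<^sub>L complex)"
  where "trace_embedding jpM star \<iota> \<tau> x = Blinfun (\<lambda>y. trace_ext star \<iota> \<tau> (jpM x y))"


section \<open>Calderon complex interpolation\<close>

text \<open>A couple of Banach spaces inside an ambient complex vector space is given by two carriers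
  \<open>X0\<close>, \<open>X1\<close> with norm functions \<open>N0\<close>, \<open>N1\<close>, which are only relevant on the carriers.\<close>

definition sum_space :: "'v::complex_vector set \<Rightarrow> 'v set \<Rightarrow> 'v set"
  where "sum_space X0 X1 = {a + b | a b. a \<in> X0 \<and> b \<in> X1}"

definition sum_norm ::
    "'v::complex_vector set \<Rightarrow> ('v \<Rightarrow> real) \<Rightarrow> 'v set \<Rightarrow> ('v \<Rightarrow> real) \<Rightarrow> 'v \<Rightarrow> real"
  where "sum_norm X0 N0 X1 N1 v = Inf {N0 a + N1 b | a b. a \<in> X0 \<and> b \<in> X1 \<and> v = a + b}"

definition norm_continuous_on ::
    "('v::complex_vector \<Rightarrow> real) \<Rightarrow> 'd::metric_space set \<Rightarrow> ('d \<Rightarrow> 'v) \<Rightarrow> bool"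
  where "norm_continuous_on N S f \<longleftrightarrow>
    (\<forall>z\<in>S. ((\<lambda>w. N (f w - f z)) \<longlongrightarrow> 0) (at z within S))"

definition norm_holomorphic_on ::
    "'v::complex_vector set \<Rightarrow> ('v \<Rightarrow> real) \<Rightarrow> complex set \<Rightarrow> (complex \<Rightarrow> 'v) \<Rightarrow> bool"
  where "norm_holomorphic_on X N S f \<longleftrightarrow>
    (\<forall>z\<in>S. \<exists>D\<in>X. ((\<lambda>w. N (inverse (w - z) *\<^sub>C (f w - f z) - D)) \<longlongrightarrow> 0) (at z within S))"

definition closed_strip :: "complex set"
  where "closed_strip = {z. 0 \<le> Re z \<and> Re z \<le> 1}"

definition open_strip :: "complex set"
  where "open_strip = {z. 0 < Re z \<and> Re z < 1}"

definition calderon_class ::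
    "'v::complex_vector set \<Rightarrow> ('v \<Rightarrow> real) \<Rightarrow> 'v set \<Rightarrow> ('v \<Rightarrow> real) \<Rightarrow> (complex \<Rightarrow> 'v) set"
  where "calderon_class X0 N0 X1 N1 = {f.
    (\<forall>z\<in>closed_strip. f z \<in> sum_space X0 X1) \<and>
    (\<exists>C. \<forall>z\<in>closed_strip. sum_norm X0 N0 X1 N1 (f z) \<le> C) \<and>
    norm_continuous_on (sum_norm X0 N0 X1 N1) closed_strip f \<and>
    norm_holomorphic_on (sum_space X0 X1) (sum_norm X0 N0 X1 N1) open_strip f \<and>
    (\<forall>t. f (Complex 0 t) \<in> X0) \<and>
    norm_continuous_on N0 UNIV (\<lambda>t. f (Complex 0 t)) \<and>
    ((\<lambda>t. N0 (f (Complex 0 t))) \<longlongrightarrow> 0) at_infinity \<and>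
    (\<forall>t. f (Complex 1 t) \<in> X1) \<and>
    norm_continuous_on N1 UNIV (\<lambda>t. f (Complex 1 t)) \<and>
    ((\<lambda>t. N1 (f (Complex 1 t))) \<longlongrightarrow> 0) at_infinity}"

definition calderon_norm :: "('v \<Rightarrow> real) \<Rightarrow> ('v \<Rightarrow> real) \<Rightarrow> (complex \<Rightarrow> 'v) \<Rightarrow> real"
  where "calderon_norm N0 N1 f =
    max (SUP t. N0 (f (Complex 0 t))) (SUP t. N1 (f (Complex 1 t)))"

definition interp_space ::
    "'v::complex_vector set \<Rightarrow> ('v \<Rightarrow> real) \<Rightarrow> 'v set \<Rightarrow> ('v \<Rightarrow> real) \<Rightarrow> real \<Rightarrow> 'v set"
  where "interp_space X0 N0 X1 N1 \<theta> =
    {f (complex_of_real \<theta>) | f. f \<in> calderon_class X0 N0 X1 N1}"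

definition interp_norm ::
    "'v::complex_vector set \<Rightarrow> ('v \<Rightarrow> real) \<Rightarrow> 'v set \<Rightarrow> ('v \<Rightarrow> real) \<Rightarrow> real \<Rightarrow> 'v \<Rightarrow> real"
  where "interp_norm X0 N0 X1 N1 \<theta> v =
    Inf {calderon_norm N0 N1 f | f.
      f \<in> calderon_class X0 N0 X1 N1 \<and> f (complex_of_real \<theta>) = v}"


section \<open>Nonassociative Lp-spaces\<close>

text \<open>All these spaces are realised inside the predual. In \<open>Lp_space j P p\<close> and \<open>Lp_norm j P p\<close>,
  \<open>P\<close> is the predual and \<open>j\<close> is the embedding of the algebra into it; the algebra itself, with
  its norm transported along \<open>j\<close>, is the case \<open>p = \<infinity>\<close>.\<close>

definition Lp_space ::
    "('m::complex_banach \<Rightarrow> ('m \<Rightarrow>\<^sub>L complex)) \<Rightarrow> ('m \<Rightarrow>\<^sub>L complex) set \<Rightarrow> ereal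
      \<Rightarrow> ('m \<Rightarrow>\<^sub>L complex) set"
  where "Lp_space j P p =
    (if p = \<infinity> then range j
     else if p = 1 then P
     else interp_space (range j) (\<lambda>v. norm (inv j v)) P norm (1 / real_of_ereal p))"

definition Lp_norm ::
    "('m::complex_banach \<Rightarrow> ('m \<Rightarrow>\<^sub>L complex)) \<Rightarrow> ('m \<Rightarrow>\<^sub>L complex) set \<Rightarrow> ereal
      \<Rightarrow> ('m \<Rightarrow>\<^sub>L complex) \<Rightarrow> real"
  where "Lp_norm j P p v =
    (if p = \<infinity> then norm (inv j v)
     else if p = 1 then norm v
     else interp_norm (range j) (\<lambda>v. norm (inv j v)) P norm (1 / real_of_ereal p) v)"


section \<open>Functional calculus and Iochum's norm\<close>

definition jordan_unit :: "('a \<Rightarrow> 'a \<Rightarrow> 'a) \<Rightarrow> 'a"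
  where "jordan_unit jp = (THE e. \<forall>x. jp e x = x)"

text \<open>The closed unital subalgebra generated by \<open>x\<close>; in a JBW-algebra it is associative.\<close>

definition jordan_generated :: "('a::real_normed_vector \<Rightarrow> 'a \<Rightarrow> 'a) \<Rightarrow> 'a \<Rightarrow> 'a set"
  where "jordan_generated jp x = \<Inter>{B. subspace B \<and> closed B \<and>
    (\<forall>a\<in>B. \<forall>b\<in>B. jp a b \<in> B) \<and> jordan_unit jp \<in> B \<and> x \<in> B}"

definition jordan_spectrum :: "('a::real_normed_vector \<Rightarrow> 'a \<Rightarrow> 'a) \<Rightarrow> 'a \<Rightarrow> real set"
  where "jordan_spectrum jp x = {c. \<not> (\<exists>y\<in>jordan_generated jp x.
    jp (x - c *\<^sub>R jordan_unit jp) y = jordan_unit jp)}"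

text \<open>\<open>\<Phi>\<close> is an isometric isomorphism, for the supremum norm, of the algebra of continuous real
  functions on the spectrum of \<open>x\<close> onto the closed unital subalgebra generated by \<open>x\<close>, and maps the
  identity function to \<open>x\<close>. Isometry makes \<open>\<Phi> f\<close> depend only on \<open>f\<close> restricted to the spectrum.\<close>

definition continuous_calculus ::
    "('a::real_normed_vector \<Rightarrow> 'a \<Rightarrow> 'a) \<Rightarrow> 'a \<Rightarrow> ((real \<Rightarrow> real) \<Rightarrow> 'a) \<Rightarrow> bool"
  where "continuous_calculus jp x \<Phi> \<longleftrightarrow>
    (let \<sigma> = jordan_spectrum jp x; C = {f. continuous_on \<sigma> f} in
      \<Phi> ` C = jordan_generated jp x \<and>
      (\<forall>f\<in>C. \<forall>g\<in>C. \<Phi> (\<lambda>t. f t + g t) = \<Phi> f + \<Phi> g) \<and>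
      (\<forall>f\<in>C. \<forall>c. \<Phi> (\<lambda>t. c * f t) = c *\<^sub>R \<Phi> f) \<and>
      (\<forall>f\<in>C. \<forall>g\<in>C. \<Phi> (\<lambda>t. f t * g t) = jp (\<Phi> f) (\<Phi> g)) \<and>
      \<Phi> (\<lambda>t. 1) = jordan_unit jp \<and>
      \<Phi> (\<lambda>t. t) = x \<and>
      (\<forall>f\<in>C. \<forall>c\<ge>0. norm (\<Phi> f) \<le> c \<longleftrightarrow> (\<forall>t\<in>\<sigma>. \<bar>f t\<bar> \<le> c)))"

text \<open>The value \<open>f(x)\<close>; meaningful for \<open>f\<close> continuous on the spectrum of \<open>x\<close>.\<close>

definition functional_calculus ::
    "('a::real_normed_vector \<Rightarrow> 'a \<Rightarrow> 'a) \<Rightarrow> (real \<Rightarrow> real) \<Rightarrow> 'a \<Rightarrow> 'a"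
  where "functional_calculus jp f x = (SOME \<Phi>. continuous_calculus jp x \<Phi>) f"

definition jordan_abs :: "('a::real_normed_vector \<Rightarrow> 'a \<Rightarrow> 'a) \<Rightarrow> 'a \<Rightarrow> 'a"
  where "jordan_abs jp x = functional_calculus jp sqrt (jp x x)"

definition iochum_norm ::
    "('a::real_normed_vector \<Rightarrow> 'a \<Rightarrow> 'a) \<Rightarrow> ('a \<Rightarrow> real) \<Rightarrow> ereal \<Rightarrow> 'a \<Rightarrow> real"
  where "iochum_norm jp \<tau> p x =
    (if p = \<infinity> then norm x
     else (\<tau> (functional_calculus jp (\<lambda>t. t powr real_of_ereal p) (jordan_abs jp x)))
       powr (1 / real_of_ereal p))"

text \<open>The Banach space \<open>'l\<close>, together with \<open>\<kappa>\<close>, is the completion of \<open>'a\<close> for the norm \<open>N\<close>;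
  this determines it up to a unique isometric isomorphism compatible with \<open>\<kappa>\<close>.\<close>

definition is_completion :: "('a::real_vector \<Rightarrow> real) \<Rightarrow> ('a \<Rightarrow> 'l::banach) \<Rightarrow> bool"
  where "is_completion N \<kappa> \<longleftrightarrow>
    linear \<kappa> \<and> (\<forall>x. norm (\<kappa> x) = N x) \<and> closure (range \<kappa>) = UNIV"

end

theory Submission
  imports Defs "HOL-Complex_Analysis.Complex_Analysis"
    "HOL-Computational_Algebra.Fundamental_Theorem_Algebra" "HOL-Real_Asymp.Real_Asymp"
begin

text \<open>
  Write \<open>N(x) = \<tau>(|x|\<^sup>p)\<^sup>1\<^sup>/\<^sup>p\<close> for Iochum's norm, \<open>j x = \<tau>\<^sub>x\<close>, and let \<open>1 < p < \<infinity>\<close>, \<open>\<theta> = 1/p\<close>. If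
  \<open>N(x) < c\<close>, then for small \<open>\<epsilon> > 0\<close> the functions \<open>m(t) = t/(t\<^sup>2 + \<epsilon>\<^sup>2)\<^sup>1\<^sup>/\<^sup>2\<close> and
  \<open>y(t) = p log((t\<^sup>2 + \<epsilon>\<^sup>2)\<^sup>1\<^sup>/\<^sup>2/c)\<close> satisfy \<open>|m| \<le> 1\<close> and \<open>\<tau>(exp(y(x))) \<le> 1\<close>, and the analytic
  family \<open>f(z) = (c m exp(z y))(x)\<close> takes the value \<open>x\<close> at \<open>\<theta>\<close>. On the line \<open>Re z = 0\<close> it is bounded
  by \<open>c\<close> in the algebra, and on \<open>Re z = 1\<close> its image under \<open>j\<close> is bounded by \<open>c\<close> in the predual,
  because \<open>\<parallel>\<tau>\<^sub>a\<parallel> \<le> \<tau>(G(x))\<close> for \<open>a = F(x)\<close> with \<open>|F| \<le> G\<close> (\<open>norm_j_cfc_le\<close>). After multiplication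
  by a Gaussian factor \<open>f\<close> belongs to Calderon's class, so the interpolation norm of \<open>j x\<close> is at
  most \<open>N(x)\<close>. Conversely, any function of Calderon's class can be paired with the reflected family
  of the conjugate exponent; the result is a scalar function on the strip, and the three lines
  theorem turns the boundary estimates into \<open>N(x) \<le> \<parallel>j x\<parallel>\<close> (\<open>pairing_three_lines\<close>,
  \<open>trace_duality_le\<close>). For \<open>p = 1\<close> the same functions \<open>m\<close> give \<open>\<parallel>j x\<parallel> = \<tau>(|x|)\<close> directly.

  An element of the completion is the sum of a series of elements of the algebra whose norms
  decrease geometrically after the first term. The corresponding families can be summed inside
  Calderon's class (\<open>interp_series\<close>), since all estimates on them are proportional to the
  constants \<open>c\<close>. This shows that the image of the completion lies in the interpolation space and
  gives the upper bound for its norm. For the lower bound the image of \<open>u\<close> is written as \<open>j x\<close> minus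
  the image of a small element, which is the reason why \<open>trace_duality_le\<close> has two functions.

  These arguments rest on facts about JBW-algebras that are proved from the axioms. A point of the
  unit ball at which the trace is maximal yields a unit (\<open>unit_exists\<close>); in the presence of a unit every
  element has a continuous functional calculus (\<open>continuous_calculus_exists\<close>). The remaining point
  is that \<open>\<tau>\<^sub>x\<close> belongs to the predual of the JBW*-algebra. Normality of \<open>\<tau>\<close> refers to one predual of
  the selfadjoint part and weak* continuity of \<open>\<tau>\<^sub>x\<close> to another, so it has to be shown that the two
  weak* topologies agree on bounded sets (\<open>weak_star_limits_agree\<close>), and that \<open>\<tau>(x \<circ> \<cdot>)\<close> is
  continuous along with \<open>\<tau>\<close> (\<open>trace_mult_wlim\<close>). Continuity on bounded sets suffices by a
  Krein-Smulian argument (\<open>ball_continuous_representation\<close>).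
\<close>

section \<open>Operator commutation and power associativity in Jordan algebras\<close>

context jordan_algebra
begin

lemmas jp_bilinear_simps [simp] =
  bilinear_ladd[OF jp_bilinear] bilinear_radd[OF jp_bilinear]
  bilinear_lsub[OF jp_bilinear] bilinear_rsub[OF jp_bilinear]
  bilinear_lmul[OF jp_bilinear] bilinear_rmul[OF jp_bilinear]
  bilinear_lneg[OF jp_bilinear] bilinear_rneg[OF jp_bilinear]
  bilinear_lzero[OF jp_bilinear] bilinear_rzero[OF jp_bilinear]

lemma jp_sum_left: "(\<Sum>i\<in>I. f i) \<odot> y = (\<Sum>i\<in>I. f i \<odot> y)"
  by (induction I rule: infinite_finite_induct) auto

lemma jp_sum_right: "y \<odot> (\<Sum>i\<in>I. f i) = (\<Sum>i\<in>I. y \<odot> f i)"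
  by (induction I rule: infinite_finite_induct) auto

text \<open>The part of the Jordan identity at \<open>x + z\<close> that is linear in \<open>z\<close>; it is isolated by comparing the
  identity at \<open>x + z\<close> and \<open>x - z\<close>.\<close>

lemma linearized_once:
  "(x \<odot> x) \<odot> (y \<odot> z) + 2 *\<^sub>R ((x \<odot> z) \<odot> (y \<odot> x))
    = ((x \<odot> x) \<odot> y) \<odot> z + 2 *\<^sub>R (((x \<odot> z) \<odot> y) \<odot> x)"
proof -
  have 1: "((x + z) \<odot> (x + z)) \<odot> (y \<odot> (x + z)) = (((x + z) \<odot> (x + z)) \<odot> y) \<odot> (x + z)"
    by (rule jordan_identity)
  have 2: "((x - z) \<odot> (x - z)) \<odot> (y \<odot> (x - z)) = (((x - z) \<odot> (x - z)) \<odot> y) \<odot> (x - z)"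
    by (rule jordan_identity)
  have 3: "(z \<odot> z) \<odot> (y \<odot> z) = ((z \<odot> z) \<odot> y) \<odot> z"
    by (rule jordan_identity)
  have "2 *\<^sub>R ((x \<odot> x) \<odot> (y \<odot> z) + 2 *\<^sub>R ((x \<odot> z) \<odot> (y \<odot> x)))
    = ((x + z) \<odot> (x + z)) \<odot> (y \<odot> (x + z)) - ((x - z) \<odot> (x - z)) \<odot> (y \<odot> (x - z))
      - 2 *\<^sub>R ((z \<odot> z) \<odot> (y \<odot> z))"
    by (simp add: algebra_simps jp_commute[of z x] scaleR_2)
  also have "\<dots> = (((x + z) \<odot> (x + z)) \<odot> y) \<odot> (x + z)
      - (((x - z) \<odot> (x - z)) \<odot> y) \<odot> (x - z) - 2 *\<^sub>R (((z \<odot> z) \<odot> y) \<odot> z)"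
    by (simp only: 1 2 3)
  also have "\<dots> = 2 *\<^sub>R (((x \<odot> x) \<odot> y) \<odot> z + 2 *\<^sub>R (((x \<odot> z) \<odot> y) \<odot> x))"
    by (simp add: algebra_simps jp_commute[of z x] scaleR_2)
  finally show ?thesis
    by (metis scaleR_cancel_left zero_neq_numeral)
qed

text \<open>The previous identity is quadratic in \<open>x\<close>; polarizing it with \<open>x + w\<close> and \<open>x - w\<close> gives the fully
  linearized Jordan identity.\<close>

lemma linearized:
  "(x \<odot> z) \<odot> (w \<odot> y) + (z \<odot> w) \<odot> (x \<odot> y) + (w \<odot> x) \<odot> (z \<odot> y)
    = w \<odot> ((x \<odot> z) \<odot> y) + x \<odot> ((z \<odot> w) \<odot> y) + z \<odot> ((w \<odot> x) \<odot> y)"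
proof -
  have 1: "((x + w) \<odot> (x + w)) \<odot> (y \<odot> z) + 2 *\<^sub>R (((x + w) \<odot> z) \<odot> (y \<odot> (x + w)))
    = (((x + w) \<odot> (x + w)) \<odot> y) \<odot> z + 2 *\<^sub>R ((((x + w) \<odot> z) \<odot> y) \<odot> (x + w))"
    by (rule linearized_once)
  have 2: "((x - w) \<odot> (x - w)) \<odot> (y \<odot> z) + 2 *\<^sub>R (((x - w) \<odot> z) \<odot> (y \<odot> (x - w)))
    = (((x - w) \<odot> (x - w)) \<odot> y) \<odot> z + 2 *\<^sub>R ((((x - w) \<odot> z) \<odot> y) \<odot> (x - w))"
    by (rule linearized_once)
  have four: "(4::real) *\<^sub>R v = v + v + v + v" for v :: 'a
    using scaleR_left_distrib[of "2::real" 2 v] by (simp add: scaleR_2)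
  have "4 *\<^sub>R ((x \<odot> z) \<odot> (y \<odot> w) + (z \<odot> w) \<odot> (y \<odot> x) + (w \<odot> x) \<odot> (y \<odot> z))
    = (((x + w) \<odot> (x + w)) \<odot> (y \<odot> z) + 2 *\<^sub>R (((x + w) \<odot> z) \<odot> (y \<odot> (x + w))))
     - (((x - w) \<odot> (x - w)) \<odot> (y \<odot> z) + 2 *\<^sub>R (((x - w) \<odot> z) \<odot> (y \<odot> (x - w))))"
    by (simp add: algebra_simps jp_commute[of w x] jp_commute[of w z] four scaleR_2)
  also have "\<dots> = ((((x + w) \<odot> (x + w)) \<odot> y) \<odot> z + 2 *\<^sub>R ((((x + w) \<odot> z) \<odot> y) \<odot> (x + w)))
     - ((((x - w) \<odot> (x - w)) \<odot> y) \<odot> z + 2 *\<^sub>R ((((x - w) \<odot> z) \<odot> y) \<odot> (x - w)))"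
    by (simp only: 1 2)
  also have "\<dots> = 4 *\<^sub>R (((x \<odot> z) \<odot> y) \<odot> w + ((z \<odot> w) \<odot> y) \<odot> x + ((w \<odot> x) \<odot> y) \<odot> z)"
    by (simp add: algebra_simps jp_commute[of w x] jp_commute[of w z] four scaleR_2)
  finally have "(x \<odot> z) \<odot> (y \<odot> w) + (z \<odot> w) \<odot> (y \<odot> x) + (w \<odot> x) \<odot> (y \<odot> z)
    = ((x \<odot> z) \<odot> y) \<odot> w + ((z \<odot> w) \<odot> y) \<odot> x + ((w \<odot> x) \<odot> y) \<odot> z"
    by (metis scaleR_cancel_left zero_neq_numeral)
  then show ?thesis
    by (simp only: jp_commute[of y w] jp_commute[of y x] jp_commute[of y z]
        jp_commute[of "(x \<odot> z) \<odot> y" w] jp_commute[of "(z \<odot> w) \<odot> y" x]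
        jp_commute[of "(w \<odot> x) \<odot> y" z])
qed

text \<open>The left side of the linearized identity is symmetric under exchange of \<open>w\<close> and \<open>y\<close>, so the two
  right sides agree. Read as a formula for \<open>L_{(xz)w}\<close> in terms of multiplications by shorter
  products, this is a recursion for multiplications by powers.\<close>

lemma mult_by_triple_product:
  "((x \<odot> z) \<odot> w) \<odot> y = w \<odot> ((x \<odot> z) \<odot> y) + x \<odot> ((z \<odot> w) \<odot> y) + z \<odot> ((w \<odot> x) \<odot> y)
    - x \<odot> (w \<odot> (z \<odot> y)) - z \<odot> (w \<odot> (x \<odot> y))"
proof -
  have "(x \<odot> z) \<odot> (y \<odot> w) + (z \<odot> y) \<odot> (x \<odot> w) + (y \<odot> x) \<odot> (z \<odot> w)
     = y \<odot> ((x \<odot> z) \<odot> w) + x \<odot> ((z \<odot> y) \<odot> w) + z \<odot> ((y \<odot> x) \<odot> w)"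
    by (rule linearized)
  moreover have "(x \<odot> z) \<odot> (y \<odot> w) = (x \<odot> z) \<odot> (w \<odot> y)" "(z \<odot> y) \<odot> (x \<odot> w) = (w \<odot> x) \<odot> (z \<odot> y)"
    "(y \<odot> x) \<odot> (z \<odot> w) = (z \<odot> w) \<odot> (x \<odot> y)" "y \<odot> ((x \<odot> z) \<odot> w) = ((x \<odot> z) \<odot> w) \<odot> y"
    "x \<odot> ((z \<odot> y) \<odot> w) = x \<odot> (w \<odot> (z \<odot> y))" "z \<odot> ((y \<odot> x) \<odot> w) = z \<odot> (w \<odot> (x \<odot> y))"
    by (simp_all only: jp_commute)
  ultimately show ?thesis
    using linearized[of x z w y] by (simp add: algebra_simps)
qed

definition op_commute :: "'a \<Rightarrow> 'a \<Rightarrow> bool"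
  where "op_commute a b \<longleftrightarrow> (\<forall>y. a \<odot> (b \<odot> y) = b \<odot> (a \<odot> y))"

text \<open>Without a unit there is no zeroth power; the exponent is shifted by one.\<close>

primrec ppow :: "'a \<Rightarrow> nat \<Rightarrow> 'a"
  where "ppow x 0 = x" | "ppow x (Suc n) = x \<odot> ppow x n"

lemma ppow_mult_step:
  "ppow x (Suc (Suc n)) \<odot> y = 2 *\<^sub>R (x \<odot> (ppow x (Suc n) \<odot> y)) + ppow x n \<odot> ((x \<odot> x) \<odot> y)
    - x \<odot> (x \<odot> (ppow x n \<odot> y)) - ppow x n \<odot> (x \<odot> (x \<odot> y))"
  using mult_by_triple_product[of x "ppow x n" x y]
  by (simp add: jp_commute[of "ppow x n" x] jp_commute[of "x \<odot> ppow x n" x] scaleR_2)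

lemma commute_ppow:
  assumes add: "\<And>y z. T (y + z) = T y + T z" and scale: "\<And>c y. T (c *\<^sub>R y) = c *\<^sub>R T y"
    and x: "\<And>y. T (x \<odot> y) = x \<odot> T y" and xx: "\<And>y. T ((x \<odot> x) \<odot> y) = (x \<odot> x) \<odot> T y"
  shows "T (ppow x n \<odot> y) = ppow x n \<odot> T y"
proof -
  have diff: "T (y - z) = T y - T z" for y z
    using add[of y "-1 *\<^sub>R z"] scale[of "-1" z] by simp
  have "\<forall>y. T (ppow x n \<odot> y) = ppow x n \<odot> T y" for n
  proof (induction n rule: less_induct)
    case (less n)
    consider "n = 0" | "n = 1" | m where "n = Suc (Suc m)"
      by (metis One_nat_def not0_implies_Suc)
    then show ?case
    proof cases
      case 3
      have "T (ppow x m \<odot> y) = ppow x m \<odot> T y"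
        "T (ppow x (Suc m) \<odot> y) = ppow x (Suc m) \<odot> T y" for y
        using less.IH[of m] less.IH[of "Suc m"] 3 by auto
      then show ?thesis
        unfolding 3 ppow_mult_step by (simp only: add diff scale x xx) simp
    qed (use x xx in simp_all)
  qed
  then show ?thesis by blast
qed

text \<open>\<open>L_a\<close> for a power \<open>a\<close> of \<open>x\<close> is a polynomial in \<open>L_x\<close> and \<open>L_{x\<^sup>2}\<close>, which commute by the
  Jordan identity.\<close>

lemma op_commute_ppow: "op_commute (ppow x m) (ppow x n)"
proof -
  have base: "(x \<odot> x) \<odot> (x \<odot> y) = x \<odot> ((x \<odot> x) \<odot> y)" for y
    using jordan_identity[of x y] by (simp add: jp_commute)
  have 1: "x \<odot> (ppow x n \<odot> y) = ppow x n \<odot> (x \<odot> y)" for n y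
    by (rule commute_ppow[where T = "\<lambda>y. x \<odot> y"]) (simp_all add: base)
  have 2: "(x \<odot> x) \<odot> (ppow x n \<odot> y) = ppow x n \<odot> ((x \<odot> x) \<odot> y)" for n y
    by (rule commute_ppow[where T = "\<lambda>y. (x \<odot> x) \<odot> y"]) (simp_all add: base)
  show ?thesis
    unfolding op_commute_def
    by (intro allI commute_ppow[where T = "\<lambda>y. ppow x m \<odot> y"]) (simp_all add: 1 2)
qed

lemma ppow_mult: "ppow x m \<odot> ppow x n = ppow x (Suc (m + n))"
proof (induction n)
  case 0
  then show ?case by (simp add: jp_commute)
next
  case (Suc n)
  have "ppow x m \<odot> (x \<odot> ppow x n) = x \<odot> (ppow x m \<odot> ppow x n)"
    using op_commute_ppow[of x m 0] by (simp add: op_commute_def)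
  with Suc show ?case by simp
qed

lemma op_commute_sym: "op_commute a b \<Longrightarrow> op_commute b a"
  by (simp add: op_commute_def)

lemma op_commute_span:
  assumes "\<And>a b. a \<in> G \<Longrightarrow> b \<in> G \<Longrightarrow> op_commute a b" "a \<in> span G" "b \<in> span G"
  shows "op_commute a b"
proof -
  have sub: "subspace {a. op_commute a b}" for b
    by (auto simp: subspace_def op_commute_def)
  have 1: "op_commute a b" if "a \<in> span G" "b \<in> G" for a b
    using span_minimal[of G "{a. op_commute a b}"] that assms(1) sub by blast
  have "span G \<subseteq> {b. op_commute b a}"
    using 1[OF assms(2)] sub by (intro span_minimal) (auto intro: op_commute_sym)
  with assms(3) show ?thesis by (auto intro: op_commute_sym)
qed

lemma span_mult_closed:
  assumes "\<And>a b. a \<in> G \<Longrightarrow> b \<in> G \<Longrightarrow> a \<odot> b \<in> span G" "a \<in> span G" "b \<in> span G"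
  shows "a \<odot> b \<in> span G"
proof -
  have sub: "subspace {a. a \<odot> b \<in> span G}" for b
    by (auto simp: subspace_def intro: span_add span_scale span_zero)
  have 1: "a \<odot> b \<in> span G" if "a \<in> span G" "b \<in> G" for a b
    using span_minimal[of G "{a. a \<odot> b \<in> span G}"] that assms(1) sub by blast
  have "span G \<subseteq> {b. b \<odot> a \<in> span G}"
    by (rule span_minimal[OF _ sub]) (use 1[OF assms(2)] in \<open>auto simp: jp_commute[of _ a]\<close>)
  with assms(3) show ?thesis by (auto simp: jp_commute[of b])
qed

end


section \<open>Closed associative subalgebras of JB-algebras\<close>

lemma subspace_closure:
  fixes S :: "'a::real_normed_vector set"
  assumes "subspace S"
  shows "subspace (closure S)"
  unfolding subspace_def
proof (intro conjI ballI allI)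
  show "0 \<in> closure S"
    using assms closure_subset subspace_0 by blast
  fix x y and c :: real
  assume "x \<in> closure S"
  then obtain f where f: "\<And>n::nat. f n \<in> S" "f \<longlonglongrightarrow> x"
    unfolding closure_sequential by blast
  show "c *\<^sub>R x \<in> closure S"
    unfolding closure_sequential
    by (intro exI[of _ "\<lambda>n. c *\<^sub>R f n"]) (auto intro!: tendsto_intros f subspace_scale[OF assms])
  assume "y \<in> closure S"
  then obtain g where g: "\<And>n::nat. g n \<in> S" "g \<longlonglongrightarrow> y"
    unfolding closure_sequential by blast
  show "x + y \<in> closure S"
    unfolding closure_sequential
    by (intro exI[of _ "\<lambda>n. f n + g n"]) (auto intro!: tendsto_intros f g subspace_add[OF assms])
qed

context jb_algebra
begin

lemma bounded_bilinear_jp: "bounded_bilinear (\<odot>)"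
  by standard (auto intro!: exI[of _ 1] norm_jp_le)

lemmas tendsto_jp = bounded_bilinear.tendsto[OF bounded_bilinear_jp]

definition closed_subalgebra :: "'a set \<Rightarrow> bool"
  where "closed_subalgebra B \<longleftrightarrow> subspace B \<and> closed B \<and> (\<forall>a\<in>B. \<forall>b\<in>B. a \<odot> b \<in> B)"

text \<open>Commutation of the multiplication operators on the whole algebra is what is available for
  powers, and it is stronger than associativity of the subalgebra.\<close>

definition associative_subalgebra :: "'a set \<Rightarrow> bool"
  where "associative_subalgebra B \<longleftrightarrow> closed_subalgebra B \<and> (\<forall>a\<in>B. \<forall>b\<in>B. op_commute a b)"

lemma closure_span_associative:
  assumes "\<And>a b. a \<in> G \<Longrightarrow> b \<in> G \<Longrightarrow> op_commute a b"
    and "\<And>a b. a \<in> G \<Longrightarrow> b \<in> G \<Longrightarrow> a \<odot> b \<in> span G"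
  shows "associative_subalgebra (closure (span G))"
proof -
  have 1: "a \<odot> b \<in> closure (span G)" if a: "a \<in> closure (span G)" and b: "b \<in> closure (span G)" for a b
  proof -
    obtain f g where f: "\<And>n::nat. f n \<in> span G" "f \<longlonglongrightarrow> a" and g: "\<And>n::nat. g n \<in> span G" "g \<longlonglongrightarrow> b"
      using a b unfolding closure_sequential by blast
    have "(\<lambda>n. f n \<odot> g n) \<longlonglongrightarrow> a \<odot> b"
      by (intro tendsto_jp f g)
    moreover have "f n \<odot> g n \<in> span G" for n
      using span_mult_closed[OF assms(2)] f g by blast
    ultimately show ?thesis
      unfolding closure_sequential by (intro exI[of _ "\<lambda>n. f n \<odot> g n"]) simp
  qed
  have 2: "op_commute a b" if a: "a \<in> closure (span G)" and b: "b \<in> closure (span G)" for a b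
  proof -
    obtain f g where f: "\<And>n::nat. f n \<in> span G" "f \<longlonglongrightarrow> a" and g: "\<And>n::nat. g n \<in> span G" "g \<longlonglongrightarrow> b"
      using a b unfolding closure_sequential by blast
    have "a \<odot> (b \<odot> y) = b \<odot> (a \<odot> y)" for y
    proof (rule LIMSEQ_unique)
      show "(\<lambda>n. f n \<odot> (g n \<odot> y)) \<longlonglongrightarrow> a \<odot> (b \<odot> y)"
        by (intro tendsto_jp f g tendsto_const)
      have "f n \<odot> (g n \<odot> y) = g n \<odot> (f n \<odot> y)" for n
        using op_commute_span[OF assms(1)] f g unfolding op_commute_def by blast
      then show "(\<lambda>n. f n \<odot> (g n \<odot> y)) \<longlonglongrightarrow> b \<odot> (a \<odot> y)"
        by (simp add: tendsto_jp f g)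
    qed
    then show ?thesis by (simp add: op_commute_def)
  qed
  show ?thesis
    unfolding associative_subalgebra_def closed_subalgebra_def
    using 1 2 by (auto intro: subspace_closure)
qed

lemma associative_subalgebraD:
  assumes "associative_subalgebra B"
  shows "subspace B" "closed B" "a \<in> B \<Longrightarrow> b \<in> B \<Longrightarrow> a \<odot> b \<in> B"
    "a \<in> B \<Longrightarrow> b \<in> B \<Longrightarrow> op_commute a b"
    "a \<in> B \<Longrightarrow> c \<in> B \<Longrightarrow> (a \<odot> b) \<odot> c = a \<odot> (b \<odot> c)"
    "a \<in> B \<Longrightarrow> b \<in> B \<Longrightarrow> a \<odot> (b \<odot> c) = b \<odot> (a \<odot> c)"
proof -
  show "subspace B" "closed B" "a \<in> B \<Longrightarrow> b \<in> B \<Longrightarrow> a \<odot> b \<in> B"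
    and op: "a \<in> B \<Longrightarrow> b \<in> B \<Longrightarrow> op_commute a b" for a b
    using assms by (simp_all add: associative_subalgebra_def closed_subalgebra_def)
  show "a \<in> B \<Longrightarrow> b \<in> B \<Longrightarrow> a \<odot> (b \<odot> c) = b \<odot> (a \<odot> c)"
    using op[of a b] by (simp add: op_commute_def)
  assume "a \<in> B" "c \<in> B"
  then have "c \<odot> (a \<odot> b) = a \<odot> (c \<odot> b)"
    using op[of c a] by (simp add: op_commute_def)
  then show "(a \<odot> b) \<odot> c = a \<odot> (b \<odot> c)"
    by (simp only: jp_commute[of "a \<odot> b" c] jp_commute[of b c])
qed

lemma square_difference_norm:
  "norm (a \<odot> a - b \<odot> b) \<le> (norm a + norm b) * norm (a - b)"
proof -
  have "a \<odot> a - b \<odot> b = (a + b) \<odot> (a - b)"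
    by (simp add: jp_commute algebra_simps)
  then have "norm (a \<odot> a - b \<odot> b) \<le> norm (a + b) * norm (a - b)"
    by (simp only: norm_jp_le)
  also have "\<dots> \<le> (norm a + norm b) * norm (a - b)"
    by (intro mult_right_mono norm_triangle_ineq) auto
  finally show ?thesis .
qed

text \<open>The element \<open>w\<close> is \<open>1 - (1 - v)\<^sup>1\<^sup>/\<^sup>2\<close>; in this form no unit is involved. The map
  \<open>w \<mapsto> (v + w\<^sup>2)/2\<close> is a contraction of the ball of radius \<open>\<parallel>v\<parallel>\<close>.\<close>

lemma square_root_fixpoint:
  assumes B: "closed_subalgebra B" and v: "v \<in> B" "norm v < 1"
  obtains w where "w \<in> B" "2 *\<^sub>R w = v + w \<odot> w"
proof -
  let ?k = "norm v"
  let ?S = "B \<inter> cball 0 ?k"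
  let ?f = "\<lambda>w. (1/2) *\<^sub>R (v + w \<odot> w)"
  have sub: "subspace B" "closed B" "\<And>a b. a \<in> B \<Longrightarrow> b \<in> B \<Longrightarrow> a \<odot> b \<in> B"
    using B by (auto simp: closed_subalgebra_def)
  have "\<exists>!w\<in>?S. ?f w = w"
  proof (rule Banach_fix)
    show "complete ?S"
      using sub by (simp add: complete_eq_closed closed_Int)
    show "?S \<noteq> {}"
      using subspace_0[OF sub(1)] by (metis IntI centre_in_cball emptyE norm_ge_zero)
    show "0 \<le> ?k" "?k < 1" using v by auto
    show "?f ` ?S \<subseteq> ?S"
    proof clarify
      fix w assume w: "w \<in> B" "w \<in> cball 0 ?k"
      have "norm (v + w \<odot> w) \<le> ?k + norm w * norm w"
        by (rule norm_triangle_le) (simp add: norm_jp_le)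
      also have "norm w * norm w \<le> ?k * 1"
        using w v by (intro mult_mono) auto
      finally have "norm (?f w) \<le> ?k" by simp
      moreover have "?f w \<in> B"
        using sub w v by (intro subspace_scale subspace_add) auto
      ultimately show "?f w \<in> ?S" by simp
    qed
    fix x y assume x: "x \<in> ?S" and y: "y \<in> ?S"
    have "dist (?f x) (?f y) = (1/2) * norm (x \<odot> x - y \<odot> y)"
      by (simp add: dist_norm flip: scaleR_diff_right)
    also have "\<dots> \<le> (1/2) * ((norm x + norm y) * norm (x - y))"
      by (intro mult_left_mono square_difference_norm) auto
    also have "\<dots> \<le> (1/2) * ((?k + ?k) * norm (x - y))"
      using x y by (intro mult_left_mono mult_right_mono add_mono) auto
    finally show "dist (?f x) (?f y) \<le> ?k * dist x y"
      by (simp add: dist_norm)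
  qed
  then obtain w where w: "w \<in> B" "?f w = w" by auto
  have "2 *\<^sub>R w = 2 *\<^sub>R ?f w" using w by simp
  also have "\<dots> = v + w \<odot> w" by (simp del: scaleR_add_right)
  finally show ?thesis using that w by blast
qed

text \<open>The element \<open>u\<close> is \<open>(1 - v)\<^sup>-\<^sup>1 - 1\<close>.\<close>

lemma neumann_fixpoint:
  assumes B: "closed_subalgebra B" and v: "v \<in> B" "norm v < 1"
  obtains u where "u \<in> B" "u = v + v \<odot> u"
proof -
  have sub: "subspace B" "closed B" "\<And>a b. a \<in> B \<Longrightarrow> b \<in> B \<Longrightarrow> a \<odot> b \<in> B"
    using B by (auto simp: closed_subalgebra_def)
  have "\<exists>!u\<in>B. v + v \<odot> u = u"
  proof (rule Banach_fix)
    show "complete B" "B \<noteq> {}"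
      using sub by (auto simp: complete_eq_closed dest: subspace_0)
    show "0 \<le> norm v" "norm v < 1" using v by auto
    show "(\<lambda>u. v + v \<odot> u) ` B \<subseteq> B"
      using sub v by (auto intro!: subspace_add)
    show "dist (v + v \<odot> x) (v + v \<odot> y) \<le> norm v * dist x y" for x y
      using norm_jp_le[of v "x - y"] by (simp add: dist_norm)
  qed
  then show ?thesis using that by metis
qed

end

section \<open>Order and spectrum in unital JB-algebras\<close>

locale unital_jb_algebra = jb_algebra jp
  for jp :: "'a::banach \<Rightarrow> 'a \<Rightarrow> 'a"  (infixl "\<odot>" 70) +
  fixes e :: 'a
  assumes unit_left [simp]: "e \<odot> x = x"
begin

lemma unit_right [simp]: "x \<odot> e = x"
  using unit_left[of x] by (simp only: jp_commute)

lemma jordan_unit_eq: "jordan_unit (\<odot>) = e"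
  unfolding jordan_unit_def
proof (rule the_equality)
  show "e' = e" if "\<forall>x. e' \<odot> x = x" for e'
    using that unit_right[of e'] by metis
qed simp

lemma norm_unit_cases: "norm e = 0 \<or> norm e = 1"
  using norm_square[of e] by (simp add: power2_eq_square)

lemma norm_unit_le [simp]: "norm e \<le> 1"
  using norm_unit_cases by auto

lemma norm_unit: "e \<noteq> 0 \<Longrightarrow> norm e = 1"
  using norm_unit_cases by auto

lemma trivial_if_unit_zero: "e = 0 \<Longrightarrow> (x :: 'a) = 0"
  using unit_left[of x] by simp

lemma norm_scaleR_unit: "norm (r *\<^sub>R e) \<le> \<bar>r\<bar>"
  using mult_left_mono[OF norm_unit_le, of "\<bar>r\<bar>"] by simp

abbreviation gen :: "'a \<Rightarrow> 'a set"
  where "gen x \<equiv> jordan_generated (\<odot>) x"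

abbreviation spec :: "'a \<Rightarrow> real set"
  where "spec x \<equiv> jordan_spectrum (\<odot>) x"

lemma powers_associative:
  "associative_subalgebra (closure (span (insert e (range (ppow x)))))"
proof (rule closure_span_associative)
  fix a b assume a: "a \<in> insert e (range (ppow x))" and b: "b \<in> insert e (range (ppow x))"
  show "op_commute a b"
    using a b op_commute_ppow[of x] by (auto simp: op_commute_def)
  show "a \<odot> b \<in> span (insert e (range (ppow x)))"
  proof -
    have "ppow x m \<odot> ppow x n \<in> insert e (range (ppow x))" for m n
      unfolding ppow_mult by blast
    then have "a \<odot> b \<in> insert e (range (ppow x))"
      using a b by auto
    then show ?thesis by (rule span_base)
  qed
qed

lemma gen_eq: "gen x = closure (span (insert e (range (ppow x))))"
proof
  note A = associative_subalgebraD[OF powers_associative[of x]]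
  have mem: "z \<in> closure (span (insert e (range (ppow x))))" if "z \<in> insert e (range (ppow x))" for z
    using that by (meson closure_subset span_base subsetD)
  have "x = ppow x 0" by simp
  then have "x \<in> insert e (range (ppow x))" by blast
  then show "gen x \<subseteq> closure (span (insert e (range (ppow x))))"
    unfolding jordan_generated_def using A mem by (intro Inter_lower) (auto simp: jordan_unit_eq)
  show "closure (span (insert e (range (ppow x)))) \<subseteq> gen x"
    unfolding jordan_generated_def jordan_unit_eq
  proof (rule Inter_greatest)
    fix B assume "B \<in> {B. subspace B \<and> closed B \<and> (\<forall>a\<in>B. \<forall>b\<in>B. a \<odot> b \<in> B) \<and> e \<in> B \<and> x \<in> B}"
    then have B: "subspace B" "closed B" "\<And>a b. a \<in> B \<Longrightarrow> b \<in> B \<Longrightarrow> a \<odot> b \<in> B" "e \<in> B" "x \<in> B"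
      by auto
    have "ppow x n \<in> B" for n by (induction n) (auto intro: B)
    then show "closure (span (insert e (range (ppow x)))) \<subseteq> B"
      using B by (intro closure_minimal span_minimal) auto
  qed
qed

lemma gen_associative: "associative_subalgebra (gen x)"
  by (simp add: gen_eq powers_associative)

lemmas gen_simps = associative_subalgebraD[OF gen_associative]

lemma gen_closed_subalgebra: "closed_subalgebra (gen x)"
  using gen_associative associative_subalgebra_def by blast

lemma unit_in_gen [simp, intro]: "e \<in> gen x" and self_in_gen [simp, intro]: "x \<in> gen x"
  by (auto simp: jordan_generated_def jordan_unit_eq)

lemma gen_scale [simp, intro]: "a \<in> gen x \<Longrightarrow> c *\<^sub>R a \<in> gen x"
  and gen_add [simp, intro]: "a \<in> gen x \<Longrightarrow> b \<in> gen x \<Longrightarrow> a + b \<in> gen x"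
  and gen_diff [simp, intro]: "a \<in> gen x \<Longrightarrow> b \<in> gen x \<Longrightarrow> a - b \<in> gen x"
  and gen_mult [simp, intro]: "a \<in> gen x \<Longrightarrow> b \<in> gen x \<Longrightarrow> a \<odot> b \<in> gen x"
  and gen_zero [simp, intro]: "0 \<in> gen x"
  using gen_simps(3)
  by (blast intro: subspace_add[OF gen_simps(1)] subspace_diff[OF gen_simps(1)]
      subspace_scale[OF gen_simps(1)] subspace_0[OF gen_simps(1)])+

text \<open>This is positivity in the order unit sense. Squares are positive in this sense by the third norm
  axiom; the converse has to wait for the functional calculus.\<close>

definition pos :: "'a \<Rightarrow> bool"
  where "pos a \<longleftrightarrow> (\<exists>r. norm (r *\<^sub>R e - a) \<le> r)"

lemma square_root_near_unit:
  assumes "closed_subalgebra B" "e \<in> B" "v \<in> B" "norm v < 1"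
  obtains s where "s \<in> B" "s \<odot> s = e - v"
proof -
  obtain w where w: "w \<in> B" "2 *\<^sub>R w = v + w \<odot> w"
    using square_root_fixpoint[OF assms(1,3,4)] .
  have "(e - w) \<odot> (e - w) = e - (w + w) + w \<odot> w"
    by (simp add: algebra_simps)
  also have "w + w = v + w \<odot> w"
    using w by (simp add: scaleR_2)
  finally have "(e - w) \<odot> (e - w) = e - v" by simp
  moreover have "e - w \<in> B"
    using assms w by (auto simp: closed_subalgebra_def intro: subspace_diff)
  ultimately show ?thesis using that by blast
qed

text \<open>If \<open>\<parallel>r - a\<parallel> \<le> r\<close> then \<open>(a + \<epsilon>)/(r + \<epsilon>) = 1 - v\<close> with \<open>\<parallel>v\<parallel> < 1\<close>.\<close>

lemma pos_approx_square:
  assumes "pos a" "0 < \<epsilon>" "closed_subalgebra B" "e \<in> B" "a \<in> B"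
  obtains s where "s \<in> B" "s \<odot> s = a + \<epsilon> *\<^sub>R e"
proof -
  obtain r where r: "norm (r *\<^sub>R e - a) \<le> r" using assms by (auto simp: pos_def)
  then have r0: "0 \<le> r" using norm_ge_zero order_trans by blast
  define v where "v = (1 / (r + \<epsilon>)) *\<^sub>R (r *\<^sub>R e - a)"
  have "norm v = norm (r *\<^sub>R e - a) / (r + \<epsilon>)"
    using r0 assms(2) by (simp add: v_def)
  then have "norm v < 1"
    using r r0 assms(2) by simp
  moreover have "v \<in> B"
    using assms by (auto simp: v_def closed_subalgebra_def intro!: subspace_scale subspace_diff)
  ultimately obtain s where s: "s \<in> B" "s \<odot> s = e - v"
    using square_root_near_unit assms by metis
  have "(sqrt (r + \<epsilon>) *\<^sub>R s) \<odot> (sqrt (r + \<epsilon>) *\<^sub>R s) = (r + \<epsilon>) *\<^sub>R (e - v)"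
    using r0 assms(2) s by simp
  also have "\<dots> = (r + \<epsilon>) *\<^sub>R e - (r *\<^sub>R e - a)"
    using r0 assms(2) by (subst scaleR_diff_right) (simp add: v_def)
  also have "\<dots> = a + \<epsilon> *\<^sub>R e"
    by (simp add: algebra_simps)
  finally show ?thesis
    using that[of "sqrt (r + \<epsilon>) *\<^sub>R s"] s assms(3) by (auto simp: closed_subalgebra_def intro: subspace_scale)
qed

text \<open>If \<open>\<parallel>s\<^sup>2\<parallel> < R\<close> then \<open>1 - s\<^sup>2/R\<close> is a square \<open>t\<^sup>2\<close>, and \<open>\<parallel>t\<^sup>2\<parallel> \<le> \<parallel>t\<^sup>2 + s\<^sup>2/R\<parallel> \<le> 1\<close>.\<close>

lemma norm_unit_minus_square:
  assumes "norm (s \<odot> s) < R"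
  shows "norm (R *\<^sub>R e - s \<odot> s) \<le> R"
proof -
  have R: "R > 0" using assms norm_ge_zero[of "s \<odot> s"] by linarith
  have "norm ((1/R) *\<^sub>R (s \<odot> s)) < 1" using assms R by simp
  then obtain t where t: "t \<odot> t = e - (1/R) *\<^sub>R (s \<odot> s)"
    using square_root_near_unit[OF gen_closed_subalgebra[of s], of "(1/R) *\<^sub>R (s \<odot> s)"] by auto
  define s' where "s' = (1 / sqrt R) *\<^sub>R s"
  have s': "s' \<odot> s' = (1/R) *\<^sub>R (s \<odot> s)" using R by (simp add: s'_def)
  have "norm (t \<odot> t) \<le> norm (t \<odot> t + s' \<odot> s')"
    by (rule norm_square_le)
  then have "norm (t \<odot> t) \<le> 1" by (simp add: t s' order_trans[OF _ norm_unit_le])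
  moreover have "R *\<^sub>R e - s \<odot> s = R *\<^sub>R (t \<odot> t)" using R by (simp add: t algebra_simps)
  ultimately show ?thesis using R by simp
qed

lemma pos_norm_unit_minus:
  assumes "pos a" "norm a \<le> R"
  shows "norm (R *\<^sub>R e - a) \<le> R"
proof (rule field_le_epsilon)
  fix \<epsilon> :: real assume \<epsilon>: "0 < \<epsilon>"
  obtain s where s: "s \<odot> s = a + (\<epsilon>/4) *\<^sub>R e"
    using pos_approx_square[OF assms(1) _ gen_closed_subalgebra[of a], of "\<epsilon>/4"] \<epsilon> by auto
  have "norm (s \<odot> s) \<le> norm a + \<epsilon>/4"
    unfolding s by (rule norm_triangle_le) (use norm_scaleR_unit[of "\<epsilon>/4"] \<epsilon> in auto)
  then have 1: "norm ((R + \<epsilon>/2) *\<^sub>R e - s \<odot> s) \<le> R + \<epsilon>/2"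
    using assms \<epsilon> by (intro norm_unit_minus_square) auto
  have "R *\<^sub>R e - a = ((R + \<epsilon>/2) *\<^sub>R e - s \<odot> s) - (\<epsilon>/4) *\<^sub>R e"
    unfolding s by (simp add: algebra_simps flip: scaleR_left_distrib)
  also have "norm \<dots> \<le> (R + \<epsilon>/2) + \<epsilon>/4"
    by (rule order_trans[OF norm_triangle_ineq4 add_mono[OF 1 order_trans[OF norm_scaleR_unit]]])
      (use \<epsilon> in simp)
  also have "\<dots> \<le> R + \<epsilon>" using \<epsilon> by simp
  finally show "norm (R *\<^sub>R e - a) \<le> R + \<epsilon>" .
qed

lemma pos_iff: "pos a \<longleftrightarrow> norm (norm a *\<^sub>R e - a) \<le> norm a"
  using pos_norm_unit_minus[of a "norm a"] by (auto simp: pos_def)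

lemma closed_pos: "closed {a. pos a}"
  unfolding pos_iff by (intro closed_Collect_le continuous_intros)

lemma pos_add: "pos a \<Longrightarrow> pos b \<Longrightarrow> pos (a + b)"
  unfolding pos_def
proof (elim exE)
  fix r s assume *: "norm (r *\<^sub>R e - a) \<le> r" "norm (s *\<^sub>R e - b) \<le> s"
  have "(r + s) *\<^sub>R e - (a + b) = (r *\<^sub>R e - a) + (s *\<^sub>R e - b)" by (simp add: algebra_simps)
  then show "\<exists>t. norm (t *\<^sub>R e - (a + b)) \<le> t"
    using * norm_triangle_le[of "r *\<^sub>R e - a" "s *\<^sub>R e - b" "r + s"] by (metis add_mono)
qed

lemma pos_scale: "pos a \<Longrightarrow> 0 \<le> c \<Longrightarrow> pos (c *\<^sub>R a)"
  unfolding pos_def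
proof (elim exE)
  fix r assume *: "norm (r *\<^sub>R e - a) \<le> r" "0 \<le> c"
  have "(c * r) *\<^sub>R e - c *\<^sub>R a = c *\<^sub>R (r *\<^sub>R e - a)" by (simp add: algebra_simps)
  then have "norm ((c * r) *\<^sub>R e - c *\<^sub>R a) \<le> c * r"
    using * by (simp add: mult_left_mono)
  then show "\<exists>t. norm (t *\<^sub>R e - c *\<^sub>R a) \<le> t" by blast
qed

lemma pos_zero [simp]: "pos 0"
  by (auto simp: pos_def intro!: exI[of _ 0])

lemma pos_square [simp]: "pos (s \<odot> s)"
  using norm_unit_minus_square[of s "norm (s \<odot> s) + 1"] by (auto simp: pos_def)

lemma pos_unit [simp]: "pos e"
  using pos_square[of e] by simp

lemma pos_unit_minus: "norm a \<le> R \<Longrightarrow> pos (R *\<^sub>R e - a)"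
  unfolding pos_def by (rule exI[of _ R]) simp

lemma pos_unit_plus: "norm a \<le> R \<Longrightarrow> pos (R *\<^sub>R e + a)"
  using pos_unit_minus[of "-a" R] by simp

lemma pos_limit:
  assumes "F \<noteq> bot" "(f \<longlongrightarrow> a) F" "\<forall>\<^sub>F n in F. pos (f n)"
  shows "pos a"
  using Lim_in_closed_set[OF closed_pos _ assms(1) assms(2)] assms(3) by simp

text \<open>Up to \<open>\<epsilon>\<close> both factors are squares in \<open>B\<close>, and there the product of two squares is a square.\<close>

lemma pos_mult:
  assumes B: "associative_subalgebra B" "e \<in> B" and a: "a \<in> B" "pos a" and b: "b \<in> B" "pos b"
  shows "pos (a \<odot> b)"
proof (rule pos_limit)
  note A = associative_subalgebraD[OF B(1)]
  have "((\<lambda>\<epsilon>. (a + \<epsilon> *\<^sub>R e) \<odot> (b + \<epsilon> *\<^sub>R e)) \<longlongrightarrow> (a + 0 *\<^sub>R e) \<odot> (b + 0 *\<^sub>R e)) (at_right 0)"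
    by (intro tendsto_intros tendsto_jp)
  then show "((\<lambda>\<epsilon>. (a + \<epsilon> *\<^sub>R e) \<odot> (b + \<epsilon> *\<^sub>R e)) \<longlongrightarrow> a \<odot> b) (at_right 0)" by simp
  have "pos ((a + \<epsilon> *\<^sub>R e) \<odot> (b + \<epsilon> *\<^sub>R e))" if \<epsilon>: "0 < \<epsilon>" for \<epsilon>
  proof -
    have cl: "closed_subalgebra B" using B by (simp add: associative_subalgebra_def)
    obtain s where s: "s \<in> B" "s \<odot> s = a + \<epsilon> *\<^sub>R e"
      using pos_approx_square[OF a(2) \<epsilon> cl B(2) a(1)] .
    obtain t where t: "t \<in> B" "t \<odot> t = b + \<epsilon> *\<^sub>R e"
      using pos_approx_square[OF b(2) \<epsilon> cl B(2) b(1)] .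
    have "(s \<odot> t) \<odot> (s \<odot> t) = s \<odot> (t \<odot> (s \<odot> t))"
      using s t A(3) by (intro A(5)) auto
    also have "t \<odot> (s \<odot> t) = s \<odot> (t \<odot> t)" using s t by (intro A(6)) auto
    also have "s \<odot> (s \<odot> (t \<odot> t)) = (s \<odot> s) \<odot> (t \<odot> t)"
      using s(1) t(1) A(3) by (intro A(5)[symmetric]) auto
    finally show ?thesis using s t pos_square[of "s \<odot> t"] by simp
  qed
  then show "\<forall>\<^sub>F \<epsilon> in at_right 0. pos ((a + \<epsilon> *\<^sub>R e) \<odot> (b + \<epsilon> *\<^sub>R e))"
    by (auto intro: eventually_at_rightI[of 0 1])
qed simp

text \<open>Up to \<open>\<epsilon>\<close> both \<open>a\<close> and \<open>R - a\<close> are squares, with sum \<open>R\<close>, so the third norm axiom applies.\<close>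

lemma norm_le_if_pos:
  assumes "pos a" "pos (R *\<^sub>R e - a)" "0 \<le> R"
  shows "norm a \<le> R"
proof (rule field_le_epsilon)
  fix \<epsilon> :: real assume \<epsilon>: "0 < \<epsilon>"
  obtain s where s: "s \<odot> s = a + (\<epsilon>/4) *\<^sub>R e"
    using pos_approx_square[OF assms(1) _ gen_closed_subalgebra[of a], of "\<epsilon>/4"] \<epsilon> by auto
  obtain t where t: "t \<odot> t = R *\<^sub>R e - a + (\<epsilon>/4) *\<^sub>R e"
    using pos_approx_square[OF assms(2) _ gen_closed_subalgebra[of a], of "\<epsilon>/4"] \<epsilon> by auto
  have "s \<odot> s + t \<odot> t = (R + \<epsilon>/2) *\<^sub>R e"
    by (simp add: s t algebra_simps flip: scaleR_left_distrib)
  then have "norm (s \<odot> s) \<le> norm ((R + \<epsilon>/2) *\<^sub>R e)"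
    using norm_square_le[of s t] by simp
  also have "\<dots> \<le> R + \<epsilon>/2"
    using norm_scaleR_unit[of "R + \<epsilon>/2"] \<epsilon> assms(3) by simp
  finally have "norm (s \<odot> s) \<le> R + \<epsilon>/2" .
  moreover have "a = s \<odot> s - (\<epsilon>/4) *\<^sub>R e" using s by simp
  then have "norm a \<le> norm (s \<odot> s) + \<epsilon>/4"
    using order_trans[OF norm_triangle_ineq4[of "s \<odot> s" "(\<epsilon>/4) *\<^sub>R e"]
        add_left_mono[OF norm_scaleR_unit[of "\<epsilon>/4"]]] \<epsilon> by simp
  ultimately show "norm a \<le> R + \<epsilon>" using \<epsilon> by simp
qed

lemma neumann_inverse:
  assumes "closed_subalgebra B" "e \<in> B" "v \<in> B" "norm v < 1"
  obtains d where "d \<in> B" "(e - v) \<odot> d = e"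
proof -
  obtain u where u: "u \<in> B" "u = v + v \<odot> u"
    using neumann_fixpoint[OF assms(1,3,4)] .
  have "(e - v) \<odot> (e + u) = e + (u - (v + v \<odot> u))"
    by (simp add: algebra_simps)
  with u have "(e - v) \<odot> (e + u) = e" by simp
  moreover have "e + u \<in> B"
    using assms u by (auto simp: closed_subalgebra_def intro: subspace_add)
  ultimately show ?thesis using that by blast
qed

lemma pos_shift_invertible:
  assumes "closed_subalgebra B" "e \<in> B" "p \<in> B" "pos p" "0 < \<beta>"
  obtains d where "d \<in> B" "(p + \<beta> *\<^sub>R e) \<odot> d = e"
proof -
  obtain r where r: "norm (r *\<^sub>R e - p) \<le> r" using assms by (auto simp: pos_def)
  then have r0: "0 \<le> r" using norm_ge_zero order_trans by blast
  define v where "v = (1 / (r + \<beta>)) *\<^sub>R (r *\<^sub>R e - p)"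
  have "norm v = norm (r *\<^sub>R e - p) / (r + \<beta>)"
    using r0 assms(5) by (simp add: v_def)
  then have "norm v < 1"
    using r r0 assms(5) by simp
  moreover have "v \<in> B"
    using assms by (auto simp: v_def closed_subalgebra_def intro!: subspace_scale subspace_diff)
  ultimately obtain d where d: "d \<in> B" "(e - v) \<odot> d = e"
    using neumann_inverse assms by metis
  have "(r + \<beta>) *\<^sub>R (e - v) = (r + \<beta>) *\<^sub>R e - (r *\<^sub>R e - p)"
    using r0 assms(5) by (subst scaleR_diff_right) (simp add: v_def)
  then have "p + \<beta> *\<^sub>R e = (r + \<beta>) *\<^sub>R (e - v)"
    by (simp add: algebra_simps)
  then have "(p + \<beta> *\<^sub>R e) \<odot> ((1 / (r + \<beta>)) *\<^sub>R d) = (1 / (r + \<beta>)) *\<^sub>R (r + \<beta>) *\<^sub>R ((e - v) \<odot> d)"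
    by (simp only: jp_bilinear_simps)
  also have "\<dots> = e" using d r0 assms(5) by simp
  finally have "(p + \<beta> *\<^sub>R e) \<odot> ((1 / (r + \<beta>)) *\<^sub>R d) = e" .
  moreover have "(1 / (r + \<beta>)) *\<^sub>R d \<in> B"
    using d(1) assms(1) by (simp add: closed_subalgebra_def subspace_scale)
  ultimately show ?thesis by (rule that[rotated])
qed

text \<open>An inverse of \<open>\<parallel>b\<parallel>\<^sup>2 - b\<^sup>2\<close> would be positive and bounded, which pushes \<open>b\<^sup>2\<close> strictly below
  \<open>\<parallel>b\<parallel>\<^sup>2\<close>. So \<open>\<parallel>b\<parallel>\<close> or \<open>-\<parallel>b\<parallel>\<close> is a spectral value.\<close>

lemma norm_attained_on_spectrum:
  assumes B: "associative_subalgebra B" "e \<in> B" and b: "b \<in> B" and d: "d \<in> B"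
    and e: "e \<noteq> 0"
  shows "((norm b)\<^sup>2 *\<^sub>R e - b \<odot> b) \<odot> d \<noteq> e"
proof
  note A = associative_subalgebraD[OF B(1)]
  define m where "m = (norm b)\<^sup>2"
  define c where "c = m *\<^sub>R e - b \<odot> b"
  assume "((norm b)\<^sup>2 *\<^sub>R e - b \<odot> b) \<odot> d = e"
  then have cd: "c \<odot> d = e" by (simp add: c_def m_def)
  have nb: "norm (b \<odot> b) = m" by (simp add: norm_square m_def)
  have c: "c \<in> B" using A(1,3) B(2) b by (auto simp: c_def intro!: subspace_diff subspace_scale)
  have pc: "pos c" unfolding c_def by (rule pos_unit_minus) (simp add: nb)
  have "c \<odot> (d \<odot> d) = d"
    using A(5)[OF c d, of d] cd by simp
  then have pd: "pos d"
    using pos_mult[OF B c pc A(3)[OF d d]] by simp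
  define D where "D = norm d"
  have D: "D > 0" using cd e by (auto simp: D_def)
  have "D *\<^sub>R e - d \<in> B" using A(1) B(2) d by (auto intro!: subspace_diff subspace_scale)
  then have "pos (c \<odot> (D *\<^sub>R e - d))"
    using pos_unit_minus[of d D] by (intro pos_mult[OF B c pc]) (simp_all add: D_def)
  then have "pos ((1/D) *\<^sub>R (c \<odot> (D *\<^sub>R e - d)))" using D by (intro pos_scale) auto
  also have "(1/D) *\<^sub>R (c \<odot> (D *\<^sub>R e - d)) = (m - 1/D) *\<^sub>R e - b \<odot> b"
    using D by (simp add: cd scaleR_diff_right) (simp add: c_def algebra_simps)
  finally have p: "pos ((m - 1/D) *\<^sub>R e - b \<odot> b)" .
  have "0 \<le> m - 1/D"
  proof (rule ccontr)
    assume neg: "\<not> 0 \<le> m - 1/D"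
    have "pos ((m - 1/D) *\<^sub>R e)" using pos_add[OF p pos_square[of b]] by simp
    then have "norm (norm ((m - 1/D) *\<^sub>R e) *\<^sub>R e - (m - 1/D) *\<^sub>R e) \<le> norm ((m - 1/D) *\<^sub>R e)"
      by (simp add: pos_iff)
    then show False using neg norm_unit[OF e] by (simp flip: scaleR_left_diff_distrib)
  qed
  from norm_le_if_pos[OF pos_square p this] show False using D nb by simp
qed

subsection \<open>Polynomials of an element\<close>

definition ev :: "'a \<Rightarrow> real poly \<Rightarrow> 'a"
  where "ev x q = fold_coeffs (\<lambda>a y. a *\<^sub>R e + x \<odot> y) q 0"

lemma ev_0 [simp]: "ev x 0 = 0"
  by (simp add: ev_def)

lemma ev_pCons [simp]: "ev x (pCons a q) = a *\<^sub>R e + x \<odot> ev x q"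
  by (cases "q = 0 \<and> a = 0") (auto simp: ev_def)

lemma ev_add [simp]: "ev x (p + q) = ev x p + ev x q"
  by (induction p q rule: poly_induct2) (simp_all add: algebra_simps)

lemma ev_smult [simp]: "ev x (smult c q) = c *\<^sub>R ev x q"
  by (induction q) (simp_all add: algebra_simps)

lemma ev_minus [simp]: "ev x (- q) = - ev x q"
  using ev_smult[of x "-1" q] by simp

lemma ev_diff [simp]: "ev x (p - q) = ev x p - ev x q"
  using ev_add[of x p "- q"] by simp

lemma ev_1 [simp]: "ev x 1 = e"
  by (simp add: one_pCons)

lemma ev_in_gen [simp, intro]: "ev x q \<in> gen x"
  by (induction q) auto

lemma ev_mult [simp]: "ev x (p * q) = ev x p \<odot> ev x q"
proof (induction p)
  case (pCons a p)
  have "x \<odot> (ev x p \<odot> ev x q) = (x \<odot> ev x p) \<odot> ev x q"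
    by (rule gen_simps(5)[of _ x, symmetric]) auto
  with pCons show ?case by simp
qed simp

lemma gen_eq_closure_ev: "gen x = closure (range (ev x))"
proof
  have "subspace (range (ev x))"
    unfolding subspace_def
    by (auto intro: rangeI[of "ev x" 0, simplified])
      (metis ev_add rangeI, metis ev_smult rangeI)
  moreover have "e \<in> range (ev x)" by (metis ev_1 rangeI)
  moreover have "ppow x n \<in> range (ev x)" for n
  proof -
    have "ev x (monom 1 (Suc n)) = ppow x n"
      by (induction n) (simp_all add: monom_Suc monom_0)
    then show ?thesis by (metis rangeI)
  qed
  ultimately have "span (insert e (range (ppow x))) \<subseteq> range (ev x)"
    by (intro span_minimal) auto
  then show "gen x \<subseteq> closure (range (ev x))"
    unfolding gen_eq by (rule closure_mono)
  show "closure (range (ev x)) \<subseteq> gen x"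
    using gen_simps(2) by (intro closure_minimal) auto
qed

lemma spec_iff: "c \<in> spec x \<longleftrightarrow> \<not> (\<exists>y\<in>gen x. (x - c *\<^sub>R e) \<odot> y = e)"
  by (simp add: jordan_spectrum_def jordan_unit_eq)

lemma invertible_mult:
  assumes "a \<in> gen x" "b \<in> gen x" "\<exists>y\<in>gen x. a \<odot> y = e" "\<exists>y\<in>gen x. b \<odot> y = e"
  shows "\<exists>y\<in>gen x. (a \<odot> b) \<odot> y = e"
proof -
  obtain y z where y: "y \<in> gen x" "a \<odot> y = e" and z: "z \<in> gen x" "b \<odot> z = e"
    using assms by blast
  have "(a \<odot> b) \<odot> (y \<odot> z) = a \<odot> (b \<odot> (y \<odot> z))"
    using assms y z by (intro gen_simps(5)[of _ x]) auto
  also have "b \<odot> (y \<odot> z) = y \<odot> (b \<odot> z)"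
    using assms y z by (intro gen_simps(6)[of _ x]) auto
  finally show ?thesis using y z by (intro bexI[of _ "y \<odot> z"]) auto
qed

text \<open>The polynomial is split into real factors. Linear factors are invertible by the definition of
  the spectrum; a quadratic factor without real roots has the form \<open>(x - a)\<^sup>2 + b\<^sup>2\<close> and is invertible
  because squares are positive.\<close>

lemma ev_invertible:
  assumes "q \<noteq> 0" "\<And>c. c \<in> spec x \<Longrightarrow> poly q c \<noteq> 0"
  shows "\<exists>y\<in>gen x. ev x q \<odot> y = e"
  using assms
proof (induction "degree q" arbitrary: q rule: less_induct)
  case less
  show ?case
  proof (cases "degree q = 0")
    case True
    then obtain c where c: "q = [:c:]" using degree_eq_zeroE by blast
    with less.prems have "c \<noteq> 0" by auto
    then show ?thesis by (intro bexI[of _ "(1/c) *\<^sub>R e"]) (simp_all add: c)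
  next
    case False
    let ?C = "map_poly complex_of_real"
    have hom: "?C (a * b + r) = ?C a * ?C b + ?C r" for a b r
      by (auto intro!: poly_eqI simp: coeff_map_poly coeff_mult)
    have "degree (?C q) = degree q" by (simp add: degree_map_poly)
    then have "\<not> constant (poly (?C q))"
      using False by (simp add: constant_degree)
    then obtain z where z: "poly (?C q) z = 0"
      using fundamental_theorem_of_algebra by blast
    obtain s where s: "s dvd q" "0 < degree s" "\<exists>y\<in>gen x. ev x s \<odot> y = e"
    proof (cases "Im z = 0")
      case True
      define a where "a = Re z"
      have za: "z = complex_of_real a" using True by (simp add: a_def complex_eq_iff)
      have "poly (?C p) (complex_of_real a) = complex_of_real (poly p a)" for p
        by (induction p) (simp_all add: map_poly_pCons)
      with z za have "poly q a = 0" by (metis of_real_eq_0_iff)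
      then have dvd: "[:-a, 1:] dvd q" by (simp add: poly_eq_0_iff_dvd)
      moreover have "a \<notin> spec x" using less.prems \<open>poly q a = 0\<close> by auto
      then have "\<exists>y\<in>gen x. ev x [:-a, 1:] \<odot> y = e"
        by (auto simp: spec_iff algebra_simps)
      ultimately show ?thesis using that[of "[:-a, 1:]"] by auto
    next
      case False
      define a b where "a = Re z" and "b = Im z"
      define s where "s = [:a\<^sup>2 + b\<^sup>2, -2 * a, 1:]"
      have "s \<noteq> 0" by (simp add: s_def)
      have degs: "degree s = 2" by (simp add: s_def)
      define r where "r = q mod s"
      have q: "q = s * (q div s) + r" by (simp add: r_def)
      have "degree r < 2" using degree_mod_less'[of s q] degs \<open>s \<noteq> 0\<close>
        by (cases "r = 0") (auto simp: r_def)
      then obtain c d where r: "r = [:c, d:]"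
        by (metis degree_eq_zeroE less_2_cases pCons_0_0 degree_pCons_eq_if One_nat_def Suc_inject pCons_cases)
      have "poly (?C s) z = 0"
        by (simp add: s_def map_poly_pCons complex_eq_iff a_def b_def power2_eq_square algebra_simps)
      then have "poly (?C r) z = 0"
        using z hom[of s "q div s" r] q by simp
      then have "complex_of_real c + z * complex_of_real d = 0"
        by (simp add: r map_poly_pCons)
      then have "c + a * d = 0" "b * d = 0" by (simp_all add: complex_eq_iff a_def b_def)
      then have "r = 0" using False by (simp add: r b_def)
      then have "s dvd q" using q by (metis add.right_neutral dvd_triv_left)
      moreover have "\<exists>y\<in>gen x. ev x s \<odot> y = e"
      proof -
        have "ev x s = (x - a *\<^sub>R e) \<odot> (x - a *\<^sub>R e) + b\<^sup>2 *\<^sub>R e"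
          by (simp add: s_def algebra_simps power2_eq_square flip: scaleR_2)
        moreover have "b\<^sup>2 > 0" using False by (simp add: b_def)
        ultimately show ?thesis
          using pos_shift_invertible[OF gen_closed_subalgebra[of x] unit_in_gen _ pos_square, of "x - a *\<^sub>R e" "b\<^sup>2"]
          by (metis gen_diff gen_mult gen_scale self_in_gen unit_in_gen)
      qed
      ultimately show ?thesis using that[of s] degs by auto
    qed
    then obtain t where t: "q = s * t" by blast
    have "t \<noteq> 0" "s \<noteq> 0" using t less.prems by auto
    then have "degree t < degree q" using s t by (simp add: degree_mult_eq)
    moreover have "poly t c \<noteq> 0" if "c \<in> spec x" for c using less.prems(2)[OF that] t by auto
    ultimately have "\<exists>y\<in>gen x. ev x t \<odot> y = e" using less.hyps \<open>t \<noteq> 0\<close> by blast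
    then show ?thesis unfolding t ev_mult by (intro invertible_mult s(3)) auto
  qed
qed

text \<open>If \<open>|q(c)| > \<parallel>q(x)\<parallel>\<close>, then \<open>q(c) - q(x)\<close> is invertible by the Neumann series, hence so is its
  factor \<open>x - c\<close>.\<close>

lemma poly_spec_le_norm:
  assumes c: "c \<in> spec x"
  shows "\<bar>poly q c\<bar> \<le> norm (ev x q)"
proof (rule ccontr)
  assume *: "\<not> \<bar>poly q c\<bar> \<le> norm (ev x q)"
  define v where "v = (1 / poly q c) *\<^sub>R ev x q"
  have nz: "poly q c \<noteq> 0" using * by auto
  have "norm v < 1" using * nz by (simp add: v_def field_simps)
  then obtain d where d: "d \<in> gen x" "(e - v) \<odot> d = e"
    using neumann_inverse[OF gen_closed_subalgebra unit_in_gen, of v x] by (auto simp: v_def)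
  have "poly (q - [:poly q c:]) c = 0" by simp
  then obtain r where r: "q - [:poly q c:] = [:-c, 1:] * r"
    using poly_eq_0_iff_dvd[of "q - [:poly q c:]" c] by blast
  have "ev x q - poly q c *\<^sub>R e = (x - c *\<^sub>R e) \<odot> ev x r"
    using arg_cong[OF r, of "ev x"] unfolding ev_diff ev_mult by (simp add: algebra_simps)
  then have "(x - c *\<^sub>R e) \<odot> ev x r = (- poly q c) *\<^sub>R (e - v)"
    using nz by (simp add: v_def algebra_simps)
  moreover have "((x - c *\<^sub>R e) \<odot> ev x r) \<odot> d = (x - c *\<^sub>R e) \<odot> (ev x r \<odot> d)"
    using d by (intro gen_simps(5)[of _ x]) auto
  ultimately have "(x - c *\<^sub>R e) \<odot> (ev x r \<odot> d) = (- poly q c) *\<^sub>R e"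
    using d by simp
  then have "(x - c *\<^sub>R e) \<odot> ((- 1 / poly q c) *\<^sub>R (ev x r \<odot> d)) = e"
    using nz by simp
  with c show False unfolding spec_iff using d by blast
qed

text \<open>The spectrum is nonempty and \<open>|q|\<close> attains the value \<open>\<parallel>q(x)\<parallel>\<close> on it, since otherwise
  \<open>\<parallel>q(x)\<parallel>\<^sup>2 - q(x)\<^sup>2\<close> would be invertible. With the previous bound, \<open>\<parallel>q(x)\<parallel>\<close> is the maximum of \<open>|q|\<close> on
  the spectrum.\<close>

lemma norm_ev_le:
  assumes "\<And>c. c \<in> spec x \<Longrightarrow> \<bar>poly q c\<bar> \<le> K" "0 \<le> K"
  shows "norm (ev x q) \<le> K"
proof (rule ccontr)
  assume *: "\<not> norm (ev x q) \<le> K"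
  then have e: "e \<noteq> 0" using trivial_if_unit_zero[of "ev x q"] assms(2) by auto
  have root: "\<exists>c\<in>spec x. poly ([:(norm (ev x p))\<^sup>2:] - p * p) c = 0"
    if nz: "[:(norm (ev x p))\<^sup>2:] - p * p \<noteq> 0" for p
  proof (rule ccontr)
    assume "\<not> ?thesis"
    then obtain d where "d \<in> gen x" "ev x ([:(norm (ev x p))\<^sup>2:] - p * p) \<odot> d = e"
      using ev_invertible[OF nz, of x] by blast
    then show False
      using norm_attained_on_spectrum[OF gen_associative unit_in_gen _ _ e, of "ev x p" x d] by auto
  qed
  have "coeff ([:(norm (ev x [:0, 1:]))\<^sup>2:] - [:0, 1:] * [:0, 1:]) 2 \<noteq> 0"
    by (simp add: numeral_2_eq_2)
  then obtain c0 where c0: "c0 \<in> spec x" using root[of "[:0, 1:]"] by (metis coeff_0)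
  have "\<exists>c\<in>spec x. poly ([:(norm (ev x q))\<^sup>2:] - q * q) c = 0"
    using root[of q] c0 by (cases "[:(norm (ev x q))\<^sup>2:] - q * q = 0") auto
  then obtain c where c: "c \<in> spec x" "(norm (ev x q))\<^sup>2 = (poly q c)\<^sup>2"
    by (auto simp: power2_eq_square)
  then have "norm (ev x q) = \<bar>poly q c\<bar>" by (metis abs_norm_cancel power2_eq_iff_nonneg abs_ge_zero norm_ge_zero power2_abs)
  with assms(1)[OF c(1)] * show False by simp
qed

lemma compact_spec: "compact (spec x)"
  unfolding compact_eq_bounded_closed
proof
  show "bounded (spec x)"
    unfolding bounded_iff using poly_spec_le_norm[of _ x "[:0, 1:]"] by (auto intro!: exI[of _ "norm x"])
  have "open (- spec x)"
    unfolding open_dist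
  proof clarify
    fix c assume "c \<notin> spec x"
    then obtain y where y: "y \<in> gen x" "(x - c *\<^sub>R e) \<odot> y = e" by (auto simp: spec_iff)
    have "c' \<in> - spec x" if c': "dist c' c < 1 / (norm y + 1)" for c'
    proof -
      have "norm ((c' - c) *\<^sub>R y) \<le> \<bar>c' - c\<bar> * (norm y + 1)" by (simp add: mult_left_mono)
      also have "\<dots> < 1"
        using c' add_nonneg_pos[OF norm_ge_zero[of y] zero_less_one] by (simp add: dist_real_def pos_less_divide_eq)
      finally obtain d where d: "d \<in> gen x" "(e - (c' - c) *\<^sub>R y) \<odot> d = e"
        using neumann_inverse[OF gen_closed_subalgebra unit_in_gen, of "(c' - c) *\<^sub>R y" x] y by auto
      have "(x - c' *\<^sub>R e) \<odot> y = e - (c' - c) *\<^sub>R y"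
        using y(2) by (simp add: algebra_simps)
      moreover have "((x - c' *\<^sub>R e) \<odot> y) \<odot> d = (x - c' *\<^sub>R e) \<odot> (y \<odot> d)"
        using d y by (intro gen_simps(5)[of _ x]) auto
      ultimately show ?thesis using d y by (auto simp: spec_iff)
    qed
    then show "\<exists>\<epsilon>>0. \<forall>c'. dist c' c < \<epsilon> \<longrightarrow> c' \<in> - spec x"
      by (intro exI[of _ "1 / (norm y + 1)"]) (auto simp: add_nonneg_pos)
  qed
  then show "closed (spec x)" by (simp add: closed_def)
qed

end

subsection \<open>Continuous functional calculus\<close>

lemma polynomial_uniform_approximation:
  fixes f :: "real \<Rightarrow> real"
  assumes "compact S" "continuous_on S f"
  obtains q :: "nat \<Rightarrow> real poly" where "uniform_limit S (\<lambda>n. poly (q n)) f sequentially"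
proof -
  have "\<exists>q. \<forall>t\<in>S. \<bar>f t - poly q t\<bar> < 1 / (real n + 1)" for n
  proof -
    obtain g where g: "real_polynomial_function g" "\<And>t. t \<in> S \<Longrightarrow> \<bar>f t - g t\<bar> < 1 / (real n + 1)"
      using Stone_Weierstrass_real_polynomial_function[OF assms, of "1 / (real n + 1)"] by auto
    obtain a m where "g = (\<lambda>t. \<Sum>i\<le>m. a i * t ^ i)"
      using g(1) real_polynomial_function_iff_sum by blast
    then have "g t = poly (\<Sum>i\<le>m. monom (a i) i) t" for t
      by (simp add: poly_sum poly_monom)
    with g(2) show ?thesis by (intro exI[of _ "\<Sum>i\<le>m. monom (a i) i"]) simp
  qed
  then obtain q where q: "\<And>n t. t \<in> S \<Longrightarrow> \<bar>f t - poly (q n) t\<bar> < 1 / (real n + 1)"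
    by metis
  have "uniform_limit S (\<lambda>n. poly (q n)) f sequentially"
    unfolding uniform_limit_iff
  proof (intro allI impI)
    fix \<epsilon> :: real assume "0 < \<epsilon>"
    then have "\<forall>\<^sub>F n in sequentially. 1 / (real n + 1) < \<epsilon>"
      using order_tendstoD(2)[OF LIMSEQ_inverse_real_of_nat, of \<epsilon>] by (simp add: inverse_eq_divide add.commute)
    then show "\<forall>\<^sub>F n in sequentially. \<forall>t\<in>S. dist (poly (q n) t) (f t) < \<epsilon>"
    proof eventually_elim
      case (elim n)
      show ?case
      proof
        fix t assume "t \<in> S"
        from q[OF this, of n] elim show "dist (poly (q n) t) (f t) < \<epsilon>"
          by (simp add: dist_real_def abs_minus_commute)
      qed
    qed
  qed
  then show ?thesis using that by blast
qed

context unital_jb_algebra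
begin

text \<open>\<open>b\<close> is the value of \<open>f\<close> at \<open>x\<close>, as a relation: it is obtained from polynomials that approximate
  \<open>f\<close> uniformly on the spectrum.\<close>

definition calc :: "'a \<Rightarrow> (real \<Rightarrow> real) \<Rightarrow> 'a \<Rightarrow> bool"
  where "calc x f b \<longleftrightarrow> (\<exists>q. uniform_limit (spec x) (\<lambda>n. poly (q n)) f sequentially \<and>
    (\<lambda>n. ev x (q n)) \<longlonglongrightarrow> b)"

lemma calc_norm_le:
  assumes "calc x f b" "\<And>t. t \<in> spec x \<Longrightarrow> \<bar>f t\<bar> \<le> c" "0 \<le> c"
  shows "norm b \<le> c"
proof (rule field_le_epsilon)
  fix \<epsilon> :: real assume \<epsilon>: "0 < \<epsilon>"
  obtain q where q: "uniform_limit (spec x) (\<lambda>n. poly (q n)) f sequentially" "(\<lambda>n. ev x (q n)) \<longlonglongrightarrow> b"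
    using assms(1) by (auto simp: calc_def)
  have "\<forall>\<^sub>F n in sequentially. \<forall>t\<in>spec x. dist (poly (q n) t) (f t) < \<epsilon>"
    using q(1) \<epsilon> by (auto simp: uniform_limit_iff)
  then have "\<forall>\<^sub>F n in sequentially. norm (ev x (q n)) \<le> c + \<epsilon>"
  proof eventually_elim
    case (elim n)
    show ?case
    proof (rule norm_ev_le)
      fix t assume "t \<in> spec x"
      with elim assms(2)[OF this] show "\<bar>poly (q n) t\<bar> \<le> c + \<epsilon>"
        by (force simp: dist_real_def)
    qed (use assms \<epsilon> in auto)
  qed
  then show "norm b \<le> c + \<epsilon>"
    by (rule tendsto_upperbound[OF tendsto_norm[OF q(2)]]) simp
qed

lemma calc_le_norm:
  assumes "calc x f b" "t \<in> spec x"
  shows "\<bar>f t\<bar> \<le> norm b"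
proof -
  obtain q where q: "uniform_limit (spec x) (\<lambda>n. poly (q n)) f sequentially" "(\<lambda>n. ev x (q n)) \<longlonglongrightarrow> b"
    using assms(1) by (auto simp: calc_def)
  have "(\<lambda>n. \<bar>poly (q n) t\<bar>) \<longlonglongrightarrow> \<bar>f t\<bar>"
    by (intro tendsto_rabs tendsto_uniform_limitI[OF q(1) assms(2)])
  then show ?thesis
    by (rule LIMSEQ_le[OF _ tendsto_norm[OF q(2)]]) (use poly_spec_le_norm[OF assms(2)] in auto)
qed

lemma calc_continuous:
  assumes "calc x f b"
  shows "continuous_on (spec x) f"
proof -
  obtain q where q: "uniform_limit (spec x) (\<lambda>n. poly (q n)) f sequentially"
    using assms(1) by (auto simp: calc_def)
  show ?thesis
    by (rule uniform_limit_theorem[OF _ q]) (auto intro!: always_eventually continuous_intros)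
qed

lemma calc_bounded:
  assumes "calc x f b"
  shows "bounded (f ` spec x)"
  unfolding bounded_iff using calc_le_norm[OF assms] by (auto intro!: exI[of _ "norm b"])

lemma calc_add: "calc x f a \<Longrightarrow> calc x g b \<Longrightarrow> calc x (\<lambda>t. f t + g t) (a + b)"
  unfolding calc_def
proof (elim exE conjE)
  fix q r assume "uniform_limit (spec x) (\<lambda>n. poly (q n)) f sequentially" "(\<lambda>n. ev x (q n)) \<longlonglongrightarrow> a"
    "uniform_limit (spec x) (\<lambda>n. poly (r n)) g sequentially" "(\<lambda>n. ev x (r n)) \<longlonglongrightarrow> b"
  then have "uniform_limit (spec x) (\<lambda>n t. poly (q n) t + poly (r n) t) (\<lambda>t. f t + g t) sequentially"
    "(\<lambda>n. ev x (q n) + ev x (r n)) \<longlonglongrightarrow> a + b"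
    by (auto intro!: tendsto_add uniform_limit_add)
  then show "\<exists>q. uniform_limit (spec x) (\<lambda>n. poly (q n)) (\<lambda>t. f t + g t) sequentially \<and> (\<lambda>n. ev x (q n)) \<longlonglongrightarrow> a + b"
    by (intro exI[of _ "\<lambda>n. q n + r n"]) (simp add: poly_add[abs_def])
qed

lemma calc_mult:
  assumes f: "calc x f a" and g: "calc x g b"
  shows "calc x (\<lambda>t. f t * g t) (a \<odot> b)"
proof -
  obtain q r where q: "uniform_limit (spec x) (\<lambda>n. poly (q n)) f sequentially" "(\<lambda>n. ev x (q n)) \<longlonglongrightarrow> a"
    and r: "uniform_limit (spec x) (\<lambda>n. poly (r n)) g sequentially" "(\<lambda>n. ev x (r n)) \<longlonglongrightarrow> b"
    using f g by (auto simp: calc_def)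
  have "uniform_limit (spec x) (\<lambda>n t. poly (q n) t * poly (r n) t) (\<lambda>t. f t * g t) sequentially"
    by (intro uniform_lim_mult q r calc_bounded[OF f] calc_bounded[OF g])
  moreover have "(\<lambda>n. ev x (q n) \<odot> ev x (r n)) \<longlonglongrightarrow> a \<odot> b"
    by (intro tendsto_jp q r)
  ultimately show ?thesis
    unfolding calc_def by (intro exI[of _ "\<lambda>n. q n * r n"]) (simp add: poly_mult[abs_def])
qed

lemma calc_poly: "calc x (poly q) (ev x q)"
  unfolding calc_def by (intro exI[of _ "\<lambda>n. q"]) (auto intro: uniform_limit_const)

lemma calc_scale: "calc x f a \<Longrightarrow> calc x (\<lambda>t. c * f t) (c *\<^sub>R a)"
  using calc_mult[OF calc_poly[of x "[:c:]"], of f a] by simp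

lemma calc_diff: "calc x f a \<Longrightarrow> calc x g b \<Longrightarrow> calc x (\<lambda>t. f t - g t) (a - b)"
  using calc_add[of x f a _ "- 1 *\<^sub>R b", OF _ calc_scale[of x g b "-1"]] by simp

lemma calc_unique: "calc x f a \<Longrightarrow> calc x f b \<Longrightarrow> a = b"
  using calc_norm_le[OF calc_diff[of x f a f b], of 0] by simp

lemma calc_ex:
  assumes "continuous_on (spec x) f"
  obtains b where "calc x f b" "b \<in> gen x"
proof -
  obtain q where q: "uniform_limit (spec x) (\<lambda>n. poly (q n)) f sequentially"
    using polynomial_uniform_approximation[OF compact_spec assms] .
  have "Cauchy (\<lambda>n. ev x (q n))"
  proof (rule metric_CauchyI)
    fix \<epsilon> :: real assume \<epsilon>: "0 < \<epsilon>"
    then have "\<forall>\<^sub>F n in sequentially. \<forall>t\<in>spec x. dist (poly (q n) t) (f t) < \<epsilon>/4"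
      using q by (auto simp: uniform_limit_iff dest!: spec[of _ "\<epsilon>/4"])
    then obtain N where N: "\<And>n t. n \<ge> N \<Longrightarrow> t \<in> spec x \<Longrightarrow> dist (poly (q n) t) (f t) < \<epsilon>/4"
      by (auto simp: eventually_sequentially)
    show "\<exists>M. \<forall>m\<ge>M. \<forall>n\<ge>M. dist (ev x (q m)) (ev x (q n)) < \<epsilon>"
    proof (intro exI[of _ N] allI impI)
      fix m n assume mn: "m \<ge> N" "n \<ge> N"
      have "norm (ev x (q m - q n)) \<le> \<epsilon>/2"
      proof (rule norm_ev_le)
        fix t assume t: "t \<in> spec x"
        show "\<bar>poly (q m - q n) t\<bar> \<le> \<epsilon>/2"
          using N[OF mn(1) t] N[OF mn(2) t] unfolding dist_real_def poly_diff by linarith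
      qed (use \<epsilon> in simp)
      then show "dist (ev x (q m)) (ev x (q n)) < \<epsilon>" using \<epsilon> by (simp add: dist_norm)
    qed
  qed
  then obtain b where b: "(\<lambda>n. ev x (q n)) \<longlonglongrightarrow> b"
    using Cauchy_convergent convergent_def by blast
  then have "b \<in> gen x"
    using gen_simps(2) ev_in_gen by (metis closed_sequentially)
  with b q show ?thesis using that by (auto simp: calc_def)
qed

lemma calc_onto:
  assumes "b \<in> gen x"
  obtains f where "calc x f b"
proof -
  have "\<exists>c. (\<forall>n. c n \<in> range (ev x)) \<and> c \<longlonglongrightarrow> b"
    using assms by (simp only: gen_eq_closure_ev closure_sequential)
  then obtain c where c: "\<forall>n. \<exists>q. c n = ev x q" "c \<longlonglongrightarrow> b" by (auto simp: image_iff)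
  then obtain q where "\<And>n. c n = ev x (q n)" by metis
  then have "c = (\<lambda>n. ev x (q n))" by (rule ext)
  with c have q: "(\<lambda>n. ev x (q n)) \<longlonglongrightarrow> b" by simp
  have "uniformly_Cauchy_on (spec x) (\<lambda>n. poly (q n))"
  proof (rule uniformly_Cauchy_onI)
    fix \<epsilon> :: real assume "0 < \<epsilon>"
    then obtain M where M: "\<And>m n. m \<ge> M \<Longrightarrow> n \<ge> M \<Longrightarrow> dist (ev x (q m)) (ev x (q n)) < \<epsilon>"
      using metric_CauchyD[OF LIMSEQ_imp_Cauchy[OF q]] by metis
    have "dist (poly (q m) t) (poly (q n) t) < \<epsilon>" if "t \<in> spec x" "m \<ge> M" "n \<ge> M" for t m n
      using poly_spec_le_norm[OF that(1), of "q m - q n"] M[OF that(2,3)] by (simp add: dist_norm)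
    then show "\<exists>M. \<forall>t\<in>spec x. \<forall>m\<ge>M. \<forall>n\<ge>M. dist (poly (q m) t) (poly (q n) t) < \<epsilon>"
      by blast
  qed
  then obtain f where "uniform_limit (spec x) (\<lambda>n. poly (q n)) f sequentially"
    using Cauchy_uniformly_convergent uniformly_convergent_on_def by blast
  with q show ?thesis using that by (auto simp: calc_def)
qed

text \<open>Evaluation of polynomials is isometric for the supremum norm on the spectrum, so it extends to
  uniform limits of polynomials on one side and to the closure of the polynomials of \<open>x\<close> on the
  other.\<close>

lemma continuous_calculus_exists: "\<exists>\<Phi>. continuous_calculus (\<odot>) x \<Phi>"
proof
  define \<Phi> where "\<Phi> f = (THE b. calc x f b)" for f
  have \<Phi>: "\<Phi> f = b" if "calc x f b" for f b
    unfolding \<Phi>_def using that by (blast intro: calc_unique)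
  have C: "calc x f (\<Phi> f)" if "continuous_on (spec x) f" for f
    using calc_ex[OF that] \<Phi> by metis
  have gen: "\<Phi> f \<in> gen x" if "continuous_on (spec x) f" for f
    using calc_ex[OF that] \<Phi> by metis
  show "continuous_calculus (\<odot>) x \<Phi>"
    unfolding continuous_calculus_def Let_def jordan_unit_eq
  proof (intro conjI ballI allI impI)
    show "\<Phi> ` {f. continuous_on (spec x) f} = gen x"
    proof
      show "gen x \<subseteq> \<Phi> ` {f. continuous_on (spec x) f}"
      proof
        fix b assume "b \<in> gen x"
        then obtain f where f: "calc x f b" using calc_onto by blast
        then show "b \<in> \<Phi> ` {f. continuous_on (spec x) f}"
          using calc_continuous[OF f] \<Phi>[OF f] by blast
      qed
    qed (use gen in auto)
    have "poly [:1:] = (\<lambda>t. 1 :: real)" "poly [:0, 1:] = (\<lambda>t. t :: real)" by auto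
    then show "\<Phi> (\<lambda>t. 1) = e" "\<Phi> (\<lambda>t. t) = x"
      using \<Phi>[OF calc_poly[of x "[:1:]"]] \<Phi>[OF calc_poly[of x "[:0, 1:]"]] by simp_all
  next
    fix f g :: "real \<Rightarrow> real" assume f: "f \<in> {f. continuous_on (spec x) f}" and g: "g \<in> {f. continuous_on (spec x) f}"
    then show "\<Phi> (\<lambda>t. f t + g t) = \<Phi> f + \<Phi> g" "\<Phi> (\<lambda>t. f t * g t) = \<Phi> f \<odot> \<Phi> g"
      by (auto intro!: \<Phi> calc_add calc_mult C)
  next
    fix f :: "real \<Rightarrow> real" and c :: real assume f: "f \<in> {f. continuous_on (spec x) f}"
    then show "\<Phi> (\<lambda>t. c * f t) = c *\<^sub>R \<Phi> f"
      by (auto intro!: \<Phi> calc_scale C)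
    assume c: "0 \<le> c"
    show "(norm (\<Phi> f) \<le> c) = (\<forall>t\<in>spec x. \<bar>f t\<bar> \<le> c)"
      using f calc_norm_le[OF C, of f c] calc_le_norm[OF C, of f] c by force
  qed
qed

abbreviation fc :: "(real \<Rightarrow> real) \<Rightarrow> 'a \<Rightarrow> 'a"
  where "fc f x \<equiv> functional_calculus (\<odot>) f x"

lemma functional_calculus_continuous_calculus:
  "continuous_calculus (\<odot>) x (\<lambda>f. fc f x)"
  unfolding functional_calculus_def using someI_ex[OF continuous_calculus_exists[of x]] by simp

lemma
  assumes f: "continuous_on (spec x) f"
  shows fc_in_gen [simp, intro]: "fc f x \<in> gen x"
    and fc_scale: "fc (\<lambda>t. c * f t) x = c *\<^sub>R fc f x"
    and fc_norm_le_iff: "0 \<le> c \<Longrightarrow> norm (fc f x) \<le> c \<longleftrightarrow> (\<forall>t\<in>spec x. \<bar>f t\<bar> \<le> c)"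
  using functional_calculus_continuous_calculus[of x] f
  unfolding continuous_calculus_def Let_def by (blast, auto)

lemma
  assumes "continuous_on (spec x) f" "continuous_on (spec x) g"
  shows fc_add: "fc (\<lambda>t. f t + g t) x = fc f x + fc g x"
    and fc_mult: "fc (\<lambda>t. f t * g t) x = fc f x \<odot> fc g x"
  using functional_calculus_continuous_calculus[of x] assms
  unfolding continuous_calculus_def Let_def by auto

lemma fc_one [simp]: "fc (\<lambda>t. 1) x = e" and fc_id [simp]: "fc (\<lambda>t. t) x = x"
  using functional_calculus_continuous_calculus[of x]
  unfolding continuous_calculus_def Let_def jordan_unit_eq by auto

lemma fc_diff:
  assumes "continuous_on (spec x) f" "continuous_on (spec x) g"
  shows "fc (\<lambda>t. f t - g t) x = fc f x - fc g x"
  using fc_add[of x f "\<lambda>t. (-1) * g t"] fc_scale[of x g "-1"] assms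
  by (simp add: continuous_on_minus)

lemma fc_const: "fc (\<lambda>t. c) x = c *\<^sub>R e"
  using fc_scale[of x "\<lambda>t. 1" c] by simp

lemma fc_sum:
  assumes "\<And>i. i \<in> I \<Longrightarrow> continuous_on (spec x) (f i)"
  shows "fc (\<lambda>t. \<Sum>i\<in>I. f i t) x = (\<Sum>i\<in>I. fc (f i) x)"
  using assms
  by (induction I rule: infinite_finite_induct) (simp_all add: fc_const fc_add continuous_on_sum)

lemma fc_cong:
  assumes "continuous_on (spec x) f" "\<And>t. t \<in> spec x \<Longrightarrow> f t = g t"
  shows "fc f x = fc g x"
proof -
  have g: "continuous_on (spec x) g"
    using assms continuous_on_cong by force
  have "norm (fc (\<lambda>t. f t - g t) x) \<le> 0"
    using assms g by (subst fc_norm_le_iff) (auto intro!: continuous_intros)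
  then show ?thesis using fc_diff[OF assms(1) g] by simp
qed

lemma fc_poly: "fc (poly q) x = ev x q"
proof (induction q)
  case 0
  then show ?case using fc_const[of 0 x] by simp
next
  case (pCons a q)
  have "fc (\<lambda>t. a + t * poly q t) x = fc (\<lambda>t. a) x + fc (\<lambda>t. t) x \<odot> fc (poly q) x"
    by (subst fc_add, (intro continuous_intros)+) (subst fc_mult, (intro continuous_intros)+, simp)
  with pCons show ?case by (simp add: fc_const poly_pCons[abs_def])
qed

lemma fc_pos:
  assumes f: "continuous_on (spec x) f" and "\<And>t. t \<in> spec x \<Longrightarrow> 0 \<le> f t"
  shows "pos (fc f x)"
proof -
  have "pos (fc (\<lambda>t. sqrt (f t)) x \<odot> fc (\<lambda>t. sqrt (f t)) x)" by (rule pos_square)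
  also have "fc (\<lambda>t. sqrt (f t)) x \<odot> fc (\<lambda>t. sqrt (f t)) x = fc (\<lambda>t. sqrt (f t) * sqrt (f t)) x"
    using f by (intro fc_mult[symmetric] continuous_intros)
  also have "\<dots> = fc f x"
    using assms by (intro fc_cong) (auto intro!: continuous_intros)
  finally show ?thesis .
qed

lemma fc_norm_le:
  assumes "continuous_on (spec x) f" "\<And>t. t \<in> spec x \<Longrightarrow> \<bar>f t\<bar> \<le> c" "0 \<le> c"
  shows "norm (fc f x) \<le> c"
  using assms by (simp add: fc_norm_le_iff)

lemma fc_abs_le_norm:
  assumes "continuous_on (spec x) f" "t \<in> spec x"
  shows "\<bar>f t\<bar> \<le> norm (fc f x)"
  using assms fc_norm_le_iff[of x f "norm (fc f x)"] by simp

lemma spec_bounded: "t \<in> spec x \<Longrightarrow> \<bar>t\<bar> \<le> norm x"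
  using fc_abs_le_norm[of x "\<lambda>t. t" t] by simp

lemma spec_nonneg:
  assumes "pos x" "t \<in> spec x"
  shows "0 \<le> t"
proof -
  have "fc (\<lambda>t. norm x - t) x = norm x *\<^sub>R e - x"
    by (subst fc_diff) (auto intro!: continuous_intros simp: fc_const)
  then have "\<bar>norm x - t\<bar> \<le> norm (norm x *\<^sub>R e - x)"
    using fc_abs_le_norm[of x "\<lambda>t. norm x - t" t] assms(2) by (simp add: continuous_intros)
  also have "\<dots> \<le> norm x" using assms(1) by (simp add: pos_iff)
  finally show ?thesis by simp
qed

lemma pos_jordan_positive: "pos x \<longleftrightarrow> jordan_positive (\<odot>) x"
proof
  assume x: "pos x"
  have "fc sqrt x \<odot> fc sqrt x = fc (\<lambda>t. sqrt t * sqrt t) x"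
    by (intro fc_mult[symmetric] continuous_intros)
  also have "\<dots> = fc (\<lambda>t. t) x"
    using spec_nonneg[OF x] by (intro fc_cong) (auto intro!: continuous_intros)
  finally show "jordan_positive (\<odot>) x" unfolding jordan_positive_def by (metis fc_id)
qed (auto simp: jordan_positive_def)

lemma pos_antisym: "pos a \<Longrightarrow> pos (- a) \<Longrightarrow> a = 0"
  using norm_le_if_pos[of a 0] by simp

text \<open>A point of \<open>S\<close> outside \<open>T\<close> is separated from \<open>T\<close> by a tent function, and this by a polynomial.
  Compact sets of reals are thus determined by the suprema of polynomials on them.\<close>

lemma compact_subset_if_poly_bounds:
  fixes S T :: "real set"
  assumes S: "compact S" and T: "compact T"
    and le: "\<And>q K. 0 \<le> K \<Longrightarrow> (\<And>t. t \<in> T \<Longrightarrow> \<bar>poly q t\<bar> \<le> K) \<Longrightarrow> (\<And>t. t \<in> S \<Longrightarrow> \<bar>poly q t\<bar> \<le> K)"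
  shows "S \<subseteq> T"
proof (rule subsetI, rule ccontr)
  fix c assume c: "c \<in> S" "c \<notin> T"
  then obtain d where d: "d > 0" "\<And>t. t \<in> T \<Longrightarrow> d \<le> dist c t"
    using separate_point_closed[OF compact_imp_closed[OF T]] by blast
  define g where "g t = max 0 (1 - \<bar>t - c\<bar> / d)" for t
  have "continuous_on (S \<union> T) g" unfolding g_def using d by (auto intro!: continuous_intros)
  then obtain q where "uniform_limit (S \<union> T) (\<lambda>n. poly (q n)) g sequentially"
    using polynomial_uniform_approximation[OF compact_Un[OF S T]] by blast
  then have "\<forall>\<^sub>F n in sequentially. \<forall>t\<in>S \<union> T. dist (poly (q n) t) (g t) < 1/4"
    by (auto simp: uniform_limit_iff dest!: spec[of _ "1/4"])
  then obtain n where n: "\<And>t. t \<in> S \<union> T \<Longrightarrow> dist (poly (q n) t) (g t) < 1/4"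
    using eventually_happens'[OF sequentially_bot] by blast
  have "\<bar>poly (q n) t\<bar> \<le> 1/4" if "t \<in> T" for t
  proof -
    have "1 - \<bar>t - c\<bar> / d \<le> 0" using d(1) d(2)[OF that] by (simp add: dist_real_def abs_minus_commute)
    then show ?thesis using n[of t] that by (simp add: g_def dist_real_def)
  qed
  then have "\<bar>poly (q n) c\<bar> \<le> 1/4" using le[of "1/4" "q n"] c by simp
  moreover have "g c = 1" by (simp add: g_def)
  ultimately show False using n[of c] c by (simp add: dist_real_def)
qed

lemma ev_fc:
  assumes f: "continuous_on (spec x) f"
  shows "ev (fc f x) q = fc (\<lambda>t. poly q (f t)) x"
proof (induction q)
  case 0
  then show ?case using fc_const[of 0 x] by simp
next
  case (pCons a q)
  have c: "continuous_on (spec x) (\<lambda>t. poly q (f t))"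
    using f by (intro continuous_intros)
  have "fc (\<lambda>t. a + f t * poly q (f t)) x = fc (\<lambda>t. a) x + fc f x \<odot> fc (\<lambda>t. poly q (f t)) x"
    by (subst fc_add, (intro continuous_intros c f)+) (subst fc_mult, (intro continuous_intros c f)+, simp)
  with pCons show ?case by (simp add: fc_const)
qed

text \<open>Both sets carry the same suprema of polynomials, namely the norms \<open>\<parallel>q(f(x))\<parallel>\<close>.\<close>

lemma spectral_mapping:
  assumes f: "continuous_on (spec x) f"
  shows "spec (fc f x) = f ` spec x"
proof -
  have comp: "compact (f ` spec x)" using f compact_spec by (rule compact_continuous_image)
  have c: "continuous_on (spec x) (\<lambda>t. poly q (f t))" for q
    using f by (intro continuous_intros)
  have 1: "norm (ev (fc f x) q) \<le> K \<longleftrightarrow> (\<forall>t\<in>f ` spec x. \<bar>poly q t\<bar> \<le> K)" if "0 \<le> K" for q K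
    unfolding ev_fc[OF f] using fc_norm_le_iff[OF c that] by simp
  have 2: "norm (ev (fc f x) q) \<le> K \<longleftrightarrow> (\<forall>t\<in>spec (fc f x). \<bar>poly q t\<bar> \<le> K)" if "0 \<le> K" for q K
    unfolding fc_poly[symmetric] using that by (intro fc_norm_le_iff continuous_intros)
  show ?thesis
  proof
    show "spec (fc f x) \<subseteq> f ` spec x"
      using 1 2 by (intro compact_subset_if_poly_bounds compact_spec comp) blast
    show "f ` spec x \<subseteq> spec (fc f x)"
      using 1 2 by (intro compact_subset_if_poly_bounds[OF comp compact_spec]) blast
  qed
qed

text \<open>The two sides agree for polynomials \<open>g\<close>, and both depend continuously on \<open>g\<close>.\<close>

lemma fc_compose:
  assumes f: "continuous_on (spec x) f" and g: "continuous_on (f ` spec x) g"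
  shows "fc g (fc f x) = fc (\<lambda>t. g (f t)) x"
proof -
  note sm = spectral_mapping[OF f]
  have gf: "continuous_on (spec x) (\<lambda>t. g (f t))"
    using continuous_on_compose[OF f g] by (simp add: o_def)
  have c: "continuous_on (spec x) (\<lambda>t. poly q (f t))" for q
    using f by (intro continuous_intros)
  obtain q where q: "uniform_limit (f ` spec x) (\<lambda>n. poly (q n)) g sequentially"
    using polynomial_uniform_approximation[OF _ g] compact_continuous_image[OF f compact_spec] by blast
  have "norm (fc g (fc f x) - fc (\<lambda>t. g (f t)) x) \<le> 0"
  proof (rule field_le_epsilon)
    fix \<epsilon> :: real assume \<epsilon>: "0 < \<epsilon>"
    then have "\<forall>\<^sub>F n in sequentially. \<forall>t\<in>f ` spec x. dist (poly (q n) t) (g t) < \<epsilon>/2"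
      using q by (auto simp: uniform_limit_iff dest!: spec[of _ "\<epsilon>/2"])
    then obtain n where n: "\<And>t. t \<in> f ` spec x \<Longrightarrow> dist (poly (q n) t) (g t) < \<epsilon>/2"
      using eventually_happens'[OF sequentially_bot] by blast
    have "norm (fc (\<lambda>t. poly (q n) t - g t) (fc f x)) \<le> \<epsilon>/2"
      using n \<epsilon> g by (intro fc_norm_le) (auto simp: sm dist_real_def intro!: continuous_intros less_imp_le)
    then have 1: "norm (ev (fc f x) (q n) - fc g (fc f x)) \<le> \<epsilon>/2"
      using g by (subst (asm) fc_diff) (auto simp: sm fc_poly intro!: continuous_intros)
    have "norm (fc (\<lambda>t. poly (q n) (f t) - g (f t)) x) \<le> \<epsilon>/2"
      using n \<epsilon> by (intro fc_norm_le continuous_on_diff gf c) (force simp: dist_real_def)+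
    then have 2: "norm (ev (fc f x) (q n) - fc (\<lambda>t. g (f t)) x) \<le> \<epsilon>/2"
      by (subst (asm) fc_diff[OF c gf]) (simp add: ev_fc[OF f])
    from norm_triangle_mono[OF 1[unfolded norm_minus_commute[of "ev (fc f x) (q n)"]] 2]
    show "norm (fc g (fc f x) - fc (\<lambda>t. g (f t)) x) \<le> 0 + \<epsilon>" by simp
  qed
  then show ?thesis by simp
qed

end

section \<open>Weak* limits along filters\<close>

text \<open>Passing to a finer filter takes the place of passing to a subnet.\<close>

lemma compact_subfilter_limit:
  fixes f :: "'i \<Rightarrow> 'b::topological_space"
  assumes "compact S" "F \<noteq> bot" "\<forall>\<^sub>F i in F. f i \<in> S"
  obtains F' g where "F' \<le> F" "F' \<noteq> bot" "g \<in> S" "(f \<longlongrightarrow> g) F'"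
proof -
  have "filtermap f F \<noteq> bot" "eventually (\<lambda>x. x \<in> S) (filtermap f F)"
    using assms by (simp_all add: filtermap_bot_iff eventually_filtermap)
  then obtain g where g: "g \<in> S" "inf (nhds g) (filtermap f F) \<noteq> bot"
    using assms(1) unfolding compact_filter by blast
  define F' where "F' = inf F (filtercomap f (nhds g))"
  have "F' \<noteq> bot"
  proof
    assume "F' = bot"
    then have "eventually (\<lambda>i. False) F'" by simp
    then obtain P Q where P: "eventually P F" and Q: "eventually Q (filtercomap f (nhds g))"
      and PQ: "\<And>i. P i \<Longrightarrow> Q i \<Longrightarrow> False"
      unfolding F'_def eventually_inf by blast
    from Q obtain U where U: "eventually U (nhds g)" "\<And>i. U (f i) \<Longrightarrow> Q i"
      unfolding eventually_filtercomap by blast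
    have "eventually (\<lambda>x. \<not> U x) (filtermap f F)"
      unfolding eventually_filtermap using P by eventually_elim (use U PQ in blast)
    then have "eventually (\<lambda>x. False) (inf (nhds g) (filtermap f F))"
      unfolding eventually_inf using U(1) by blast
    with g show False by simp
  qed
  moreover have "(f \<longlongrightarrow> g) F'"
    by (simp add: F'_def filterlim_iff_le_filtercomap)
  ultimately show ?thesis
    using that[of F' g] g by (simp add: F'_def)
qed

text \<open>The values at \<open>y\<close> lie in the compact ball of radius \<open>R\<parallel>y\<parallel>\<close>, so Tychonoff's theorem gives a
  pointwise limit along a finer filter; linearity and the norm bound survive.\<close>

theorem banach_alaoglu_filter:
  fixes \<phi> :: "'i \<Rightarrow> ('x::real_normed_vector \<Rightarrow>\<^sub>L 'k::euclidean_space)"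
  assumes F: "F \<noteq> bot" and bd: "\<forall>\<^sub>F i in F. norm (\<phi> i) \<le> R"
  obtains F' and \<psi> :: "'x \<Rightarrow>\<^sub>L 'k" where "F' \<le> F" "F' \<noteq> bot" "norm \<psi> \<le> R" "\<And>y. ((\<lambda>i. \<phi> i y) \<longlongrightarrow> \<psi> y) F'"
proof -
  define S :: "('x \<Rightarrow> 'k) set" where "S = PiE UNIV (\<lambda>y. cball 0 (R * norm y))"
  have "compactin (product_topology (\<lambda>_. euclidean) UNIV) S"
    unfolding S_def by (simp add: compactin_PiE)
  then have "compact S"
    by (simp add: euclidean_product_topology)
  moreover have "\<forall>\<^sub>F i in F. blinfun_apply (\<phi> i) \<in> S"
    using bd
  proof eventually_elim
    case (elim i)
    show ?case
      unfolding S_def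
    proof (clarsimp simp: PiE_UNIV_domain)
      fix y show "norm (\<phi> i y) \<le> R * norm y"
        using norm_blinfun[of "\<phi> i" y] mult_right_mono[OF elim norm_ge_zero[of y]] by linarith
    qed
  qed
  ultimately obtain F' g where F': "F' \<le> F" "F' \<noteq> bot" and g: "g \<in> S"
    and lim: "((\<lambda>i. blinfun_apply (\<phi> i)) \<longlongrightarrow> g) F'"
    using compact_subfilter_limit[OF _ F] by metis
  have R: "0 \<le> R"
  proof -
    obtain i where "norm (\<phi> i) \<le> R" using eventually_happens'[OF F bd] by blast
    then show ?thesis using norm_ge_zero order_trans by blast
  qed
  have pt: "((\<lambda>i. \<phi> i y) \<longlongrightarrow> g y) F'" for y
  proof -
    have "limitin (product_topology (\<lambda>_. euclidean) UNIV) (\<lambda>i. blinfun_apply (\<phi> i)) g F'"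
      using lim by (simp add: euclidean_product_topology)
    then show ?thesis by (simp add: limitin_componentwise)
  qed
  have gb: "norm (g y) \<le> R * norm y" for y
    using g by (auto simp: S_def PiE_iff)
  have "bounded_linear g"
  proof (rule bounded_linear_intro[where K = R])
    show "g (x + y) = g x + g y" for x y
      using tendsto_unique[OF F'(2) pt[of "x + y"]] tendsto_add[OF pt[of x] pt[of y]]
      by (simp add: blinfun.add_right)
    show "g (c *\<^sub>R x) = c *\<^sub>R g x" for c x
      using tendsto_unique[OF F'(2) pt[of "c *\<^sub>R x"]] tendsto_scaleR[OF tendsto_const pt[of x], of c]
      by (simp add: blinfun.scaleR_right)
    show "norm (g x) \<le> norm x * R" for x using gb[of x] by (simp add: mult.commute)
  qed
  then have app: "blinfun_apply (Blinfun g) = g" by (rule bounded_linear_Blinfun_apply)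
  show ?thesis
    by (rule that[OF F', of "Blinfun g"]) (use R gb pt in \<open>auto simp: app intro: norm_blinfun_bound\<close>)
qed

text \<open>Weak* convergence of \<open>m\<close> to \<open>c\<close> along a filter, for a space identified by \<open>K\<close> with a dual.\<close>

definition wlim :: "('a \<Rightarrow> ('x::real_normed_vector \<Rightarrow>\<^sub>L 'k::real_normed_vector)) \<Rightarrow> 'i filter \<Rightarrow>
    ('i \<Rightarrow> 'a) \<Rightarrow> 'a \<Rightarrow> bool"
  where "wlim K F m c \<longleftrightarrow> (\<forall>y. ((\<lambda>i. K (m i) y) \<longlongrightarrow> K c y) F)"

lemma wlim_mono: "wlim K F m c \<Longrightarrow> F' \<le> F \<Longrightarrow> wlim K F' m c"
  by (auto simp: wlim_def intro: tendsto_mono)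

lemma wlim_const: "wlim K F (\<lambda>i. c) c"
  by (simp add: wlim_def)

lemma wlim_cong: "wlim K F m c \<Longrightarrow> \<forall>\<^sub>F i in F. m i = m' i \<Longrightarrow> wlim K F m' c"
  unfolding wlim_def
proof (intro allI)
  fix y
  assume lim: "\<forall>y. ((\<lambda>i. K (m i) y) \<longlongrightarrow> K c y) F" and "\<forall>\<^sub>F i in F. m i = m' i"
  then have "\<forall>\<^sub>F i in F. K (m i) y = K (m' i) y" by (auto elim: eventually_mono)
  then show "((\<lambda>i. K (m' i) y) \<longlongrightarrow> K c y) F"
    by (rule Lim_transform_eventually[OF spec[OF lim]])
qed

lemma wlim_add: "linear K \<Longrightarrow> wlim K F m c \<Longrightarrow> wlim K F m' c' \<Longrightarrow> wlim K F (\<lambda>i. m i + m' i) (c + c')"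
  by (auto simp: wlim_def linear_add blinfun.add_left intro: tendsto_add)

lemma wlim_scaleR: "linear K \<Longrightarrow> wlim K F m c \<Longrightarrow> wlim K F (\<lambda>i. r *\<^sub>R m i) (r *\<^sub>R c)"
  by (auto simp: wlim_def linear_scale blinfun.scaleR_left intro: tendsto_scaleR)

lemma wlim_diff: "linear K \<Longrightarrow> wlim K F m c \<Longrightarrow> wlim K F m' c' \<Longrightarrow> wlim K F (\<lambda>i. m i - m' i) (c - c')"
  using wlim_add[OF _ _ wlim_scaleR[of K F m' c' "-1"]] by force

lemma wlim_sum:
  assumes "linear K" "\<And>k. k \<in> I \<Longrightarrow> wlim K F (m k) (c k)"
  shows "wlim K F (\<lambda>i. \<Sum>k\<in>I. m k i) (\<Sum>k\<in>I. c k)"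
  using assms(2) by (induction I rule: infinite_finite_induct) (auto intro: wlim_const wlim_add[OF assms(1)])

lemma wlim_unique: "inj K \<Longrightarrow> F \<noteq> bot \<Longrightarrow> wlim K F m c \<Longrightarrow> wlim K F m c' \<Longrightarrow> c = c'"
proof -
  assume inj: "inj K" and F: "F \<noteq> bot" and lims: "wlim K F m c" "wlim K F m c'"
  have "K c = K c'"
  proof (rule blinfun_eqI)
    show "K c y = K c' y" for y
      by (rule tendsto_unique[OF F, of "\<lambda>i. K (m i) y"]) (use lims in \<open>simp_all add: wlim_def\<close>)
  qed
  then show "c = c'" using inj by (simp add: inj_eq)
qed

lemma wlim_norm_le:
  fixes K :: "'a::real_normed_vector \<Rightarrow> ('x::real_normed_vector \<Rightarrow>\<^sub>L 'k::real_normed_vector)"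
  assumes iso: "\<And>x. norm (K x) = norm x" and F: "F \<noteq> bot" and lim: "wlim K F m c"
    and bd: "\<forall>\<^sub>F i in F. norm (m i) \<le> R"
  shows "norm c \<le> R"
proof -
  obtain i where "norm (m i) \<le> R" using eventually_happens'[OF F bd] by blast
  then have R: "0 \<le> R" using norm_ge_zero order_trans by blast
  have "norm (K c) \<le> R"
  proof (rule norm_blinfun_bound[OF R])
    fix y
    show "norm (K c y) \<le> R * norm y"
    proof (rule tendsto_upperbound[OF _ _ F])
      show "((\<lambda>i. norm (K (m i) y)) \<longlongrightarrow> norm (K c y)) F"
        using lim by (auto simp: wlim_def intro: tendsto_norm)
      show "\<forall>\<^sub>F i in F. norm (K (m i) y) \<le> R * norm y"
        using bd
      proof eventually_elim
        case (elim i)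
        then show ?case
          using norm_blinfun[of "K (m i)" y] mult_right_mono[OF elim norm_ge_zero[of y]] by (simp add: iso)
      qed
    qed
  qed
  then show ?thesis by (simp add: iso)
qed

lemma weak_star_continuous_wlim:
  fixes f :: "'a \<Rightarrow> 'b::topological_space"
  assumes cont: "continuous_map (weak_star_topology K) euclidean f" and lim: "wlim K F m c"
  shows "((\<lambda>i. f (m i)) \<longlongrightarrow> f c) F"
proof (rule topological_tendstoI)
  fix U :: "'b set" assume U: "open U" "f c \<in> U"
  have "openin (weak_star_topology K) {a \<in> topspace (weak_star_topology K). f a \<in> U}"
    using cont U by (auto simp: continuous_map_def)
  moreover have "topspace (weak_star_topology K) = UNIV"
    by (simp add: weak_star_topology_def topspace_pullback_topology strong_operator_topology_topspace)
  ultimately obtain V where V: "openin strong_operator_topology V" "{a. f a \<in> U} = K -` V"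
    unfolding weak_star_topology_def openin_pullback_topology by auto
  then obtain W where W: "open W" "V = blinfun_apply -` W"
    unfolding strong_operator_topology_def openin_pullback_topology by auto
  have "limitin (product_topology (\<lambda>_. euclidean) UNIV) (\<lambda>i. blinfun_apply (K (m i))) (blinfun_apply (K c)) F"
    unfolding limitin_componentwise using lim by (auto simp: wlim_def)
  then have "((\<lambda>i. blinfun_apply (K (m i))) \<longlongrightarrow> blinfun_apply (K c)) F"
    by (simp add: euclidean_product_topology)
  moreover have "blinfun_apply (K c) \<in> W"
    using U V W by auto
  ultimately have "\<forall>\<^sub>F i in F. blinfun_apply (K (m i)) \<in> W"
    using W topological_tendstoD by blast
  then show "\<forall>\<^sub>F i in F. f (m i) \<in> U"
    by eventually_elim (use V W in auto)
qed

context jbw_algebra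
begin

lemma inj_J: "inj J"
proof (rule injI)
  fix a b assume "J a = J b"
  then have "norm (J (a - b)) = 0" by (simp add: linear_diff[OF dual_linear])
  then show "a = b" by (simp add: dual_isometric)
qed

lemma J_ball_compact:
  assumes F: "F \<noteq> bot" and bd: "\<forall>\<^sub>F i in F. norm (a i) \<le> R"
  obtains F' c where "F' \<le> F" "F' \<noteq> bot" "norm c \<le> R" "wlim J F' a c"
proof -
  obtain F' and \<psi> :: "'x \<Rightarrow>\<^sub>L real" where F': "F' \<le> F" "F' \<noteq> bot" "norm \<psi> \<le> R" "\<And>y. ((\<lambda>i. J (a i) y) \<longlongrightarrow> \<psi> y) F'"
    using banach_alaoglu_filter[OF F, of "\<lambda>i. J (a i)" R] bd by (auto simp: dual_isometric)
  obtain c where "\<psi> = J c" using dual_onto by auto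
  with F' that[of F' c] show ?thesis by (auto simp: wlim_def dual_isometric)
qed

lemmas J_norm_le = wlim_norm_le[OF dual_isometric]
lemmas J_unique = wlim_unique[OF inj_J]

end


section \<open>Existence of a unit\<close>

context jordan_algebra
begin

definition poly_mult :: "'a \<Rightarrow> real poly \<Rightarrow> 'a \<Rightarrow> 'a"
  where "poly_mult a q y = fold_coeffs (\<lambda>c z. c *\<^sub>R y + a \<odot> z) q 0"

lemma poly_mult_0 [simp]: "poly_mult a 0 y = 0"
  by (simp add: poly_mult_def)

lemma poly_mult_pCons [simp]: "poly_mult a (pCons c q) y = c *\<^sub>R y + a \<odot> poly_mult a q y"
  by (cases "q = 0 \<and> c = 0") (auto simp: poly_mult_def)

lemma poly_mult_add [simp]: "poly_mult a (p + q) y = poly_mult a p y + poly_mult a q y"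
  by (induction p q rule: poly_induct2) (simp_all add: algebra_simps)

lemma poly_mult_smult [simp]: "poly_mult a (smult c q) y = c *\<^sub>R poly_mult a q y"
  by (induction q) (simp_all add: algebra_simps)

lemma poly_mult_mult: "poly_mult a (p * q) y = poly_mult a p (poly_mult a q y)"
  by (induction p) simp_all

end

context jb_algebra
begin

abbreviation nonunital_gen :: "'a \<Rightarrow> 'a set"
  where "nonunital_gen a \<equiv> closure (span (range (ppow a)))"

lemma nonunital_gen_associative: "associative_subalgebra (nonunital_gen a)"
proof (rule closure_span_associative)
  fix x y assume "x \<in> range (ppow a)" "y \<in> range (ppow a)"
  then obtain m n where mn: "x = ppow a m" "y = ppow a n" by auto
  show "op_commute x y" by (simp only: mn op_commute_ppow)
  show "x \<odot> y \<in> span (range (ppow a))"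
    by (simp only: mn ppow_mult span_base rangeI)
qed

lemma ppow_in_nonunital_gen: "ppow a n \<in> nonunital_gen a"
  by (meson closure_subset rangeI span_base subsetD)

lemma norm_ppow: "norm (ppow a n) \<le> norm a ^ Suc n"
proof (induction n)
  case (Suc n)
  have "norm (ppow a (Suc n)) \<le> norm a * norm (ppow a n)" by (simp add: norm_jp_le)
  also have "\<dots> \<le> norm a * norm a ^ Suc n" by (intro mult_left_mono Suc) simp
  finally show ?case by simp
qed simp

lemma norm_ppow_less: "norm a < 1 \<Longrightarrow> norm (ppow a n) < 1"
  using norm_ppow[of a n] power_le_one[of "norm a" n] mult_left_mono[of "norm a ^ n" 1 "norm a"] by force

text \<open>The element \<open>d\<close> is \<open>(1 - v)\<^sup>1\<^sup>/\<^sup>2 c\<close>.\<close>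

lemma square_complement:
  assumes B: "associative_subalgebra B" and c: "c \<in> B" and v: "v \<in> B" "norm v < 1"
  obtains d where "d \<in> B" "d \<odot> d = c \<odot> c - v \<odot> (c \<odot> c)"
proof -
  note A = associative_subalgebraD[OF B]
  have cl: "closed_subalgebra B" using B by (simp add: associative_subalgebra_def)
  obtain w where w: "w \<in> B" "2 *\<^sub>R w = v + w \<odot> w" using square_root_fixpoint[OF cl v] .
  have 1: "c \<odot> (w \<odot> c) = w \<odot> (c \<odot> c)" using c w by (intro A(6)) auto
  have 2: "(w \<odot> c) \<odot> (w \<odot> c) = (w \<odot> w) \<odot> (c \<odot> c)"
  proof -
    have "(w \<odot> c) \<odot> (w \<odot> c) = w \<odot> (c \<odot> (w \<odot> c))" using c w A(3) by (intro A(5)) auto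
    also have "\<dots> = (w \<odot> w) \<odot> (c \<odot> c)" unfolding 1 using c w A(3) by (intro A(5)[symmetric]) auto
    finally show ?thesis .
  qed
  have "(c - w \<odot> c) \<odot> (c - w \<odot> c) = c \<odot> c - 2 *\<^sub>R (c \<odot> (w \<odot> c)) + (w \<odot> c) \<odot> (w \<odot> c)"
    by (simp add: scaleR_2 jp_commute[of "w \<odot> c" c])
  also have "\<dots> = c \<odot> c - (2 *\<^sub>R w - w \<odot> w) \<odot> (c \<odot> c)"
    by (simp add: 1 2)
  also have "2 *\<^sub>R w - w \<odot> w = v" using w by simp
  finally show ?thesis
    using that[of "c - w \<odot> c"] A(1,3) c w by (simp add: subspace_diff)
qed

lemma ppow_Suc_mult:
  assumes "y \<in> nonunital_gen a"
  shows "(a \<odot> y) \<in> nonunital_gen a" "ppow a (Suc n) \<odot> y = a \<odot> (ppow a n \<odot> y)"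
  using associative_subalgebraD(3,5)[OF nonunital_gen_associative[of a]] ppow_in_nonunital_gen[of a 0] assms by auto

text \<open>The polynomial \<open>p(t) = t + (t\<^sup>2 - t\<^sup>4)/2\<close> maps \<open>[-1,1]\<close> into itself, since
  \<open>1 - p(t)\<^sup>2 = (1 - t\<^sup>2)(1 - (t\<^sup>2 + t\<^sup>3)/2)(1 - (t\<^sup>3 - t\<^sup>2)/2)\<close> has a square root. Without a unit
  this is used after multiplication by \<open>p(a)\<^sup>2\<close>: the sum of \<open>p(a)\<^sup>4\<close> and a square is \<open>p(a)\<^sup>2\<close>.\<close>

lemma norm_pushed_up_strict:
  assumes a: "norm a < 1"
  shows "norm (a + (1/2) *\<^sub>R (ppow a 1 - ppow a 3)) \<le> 1"
proof -
  let ?B = "nonunital_gen a"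
  note A = associative_subalgebraD[OF nonunital_gen_associative[of a]]
  define p where "p = a + (1/2) *\<^sub>R (ppow a 1 - ppow a 3)"
  have in_B [simp]: "ppow a n \<in> ?B" "a \<in> ?B" "a \<odot> a \<in> ?B" for n
    using ppow_in_nonunital_gen[of a n] ppow_in_nonunital_gen[of a 0] ppow_in_nonunital_gen[of a 1] by simp_all
  have small: "norm (ppow a n) < 1" for n
    using a by (rule norm_ppow_less)
  \<comment> \<open>The three factors of \<open>1 - p\<^sup>2\<close> are absorbed one after the other.\<close>
  define v1 v2 where "v1 = (1/2) *\<^sub>R (ppow a 1 + ppow a 2)" and "v2 = (1/2) *\<^sub>R (ppow a 2 - ppow a 1)"
  have v: "v1 \<in> ?B" "v2 \<in> ?B" "norm v1 < 1" "norm v2 < 1"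
    using A(1) small[of 1] small[of 2] norm_triangle_ineq[of "ppow a 1" "ppow a 2"]
      norm_triangle_ineq4[of "ppow a 2" "ppow a 1"]
    by (auto simp: v1_def v2_def intro!: subspace_scale subspace_add subspace_diff)
  have p: "p \<in> ?B"
    using A(1) by (auto simp: p_def intro!: subspace_scale subspace_add subspace_diff)
  obtain d2 where d2: "d2 \<in> ?B" "d2 \<odot> d2 = p \<odot> p - v2 \<odot> (p \<odot> p)"
    using square_complement[OF nonunital_gen_associative p v(2,4)] .
  obtain d1 where d1: "d1 \<in> ?B" "d1 \<odot> d1 = d2 \<odot> d2 - v1 \<odot> (d2 \<odot> d2)"
    using square_complement[OF nonunital_gen_associative d2(1) v(1,3)] .
  obtain d0 where d0: "d0 \<in> ?B" "d0 \<odot> d0 = d1 \<odot> d1 - ppow a 1 \<odot> (d1 \<odot> d1)"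
    using square_complement[OF nonunital_gen_associative d1(1) in_B(1) small] .
  have act: "ppow a 1 \<odot> y = a \<odot> (a \<odot> y)" "ppow a 2 \<odot> y = a \<odot> (a \<odot> (a \<odot> y))"
    "ppow a 3 \<odot> y = a \<odot> (a \<odot> (a \<odot> (a \<odot> y)))" if "y \<in> ?B" for y
    using ppow_Suc_mult(2)[OF that] by (simp_all add: numeral_2_eq_2 numeral_3_eq_3 del: ppow.simps(2))
  have polys: "p \<odot> y = poly_mult a [:0, 1, 1/2, 0, -1/2:] y"
    "y - v2 \<odot> y = poly_mult a [:1, 0, 1/2, -1/2:] y"
    "y - v1 \<odot> y = poly_mult a [:1, 0, -1/2, -1/2:] y"
    "y - ppow a 1 \<odot> y = poly_mult a [:1, 0, -1:] y" if "y \<in> ?B" for y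
    using act[OF that] by (simp_all add: p_def v1_def v2_def algebra_simps)
  have "d0 \<odot> d0 = poly_mult a ([:1, 0, -1:] * [:1, 0, -1/2, -1/2:] * [:1, 0, 1/2, -1/2:]) (p \<odot> p)"
  proof -
    have P: "p \<odot> p \<in> ?B" "d2 \<odot> d2 \<in> ?B" "d1 \<odot> d1 \<in> ?B" using A(3) p d1(1) d2(1) by auto
    show ?thesis
      unfolding d0(2) polys(4)[OF P(3)] poly_mult_mult
      by (simp only: d1(2) polys(3)[OF P(2)]) (simp only: d2(2) polys(2)[OF P(1)])
  qed
  also have "[:1, 0, -1:] * [:1, 0, -1/2, -1/2:] * [:1, 0, 1/2, -1/2:]
     = 1 - [:0, 1, 1/2, 0, -1/2:] * [:0, 1, 1/2, 0, -1/2 :: real:]"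
    by (simp add: one_pCons)
  also have "poly_mult a (1 - [:0, 1, 1/2, 0, -1/2:] * [:0, 1, 1/2, 0, -1/2:]) (p \<odot> p)
    = p \<odot> p - poly_mult a ([:0, 1, 1/2, 0, -1/2:] * [:0, 1, 1/2, 0, -1/2:]) (p \<odot> p)"
    using poly_mult_add[of a 1 "smult (-1) ([:0, 1, 1/2, 0, -1/2:] * [:0, 1, 1/2, 0, -1/2:])" "p \<odot> p"]
    unfolding poly_mult_smult by (simp add: one_pCons)
  also have "poly_mult a ([:0, 1, 1/2, 0, -1/2:] * [:0, 1, 1/2, 0, -1/2:]) (p \<odot> p) = p \<odot> (p \<odot> (p \<odot> p))"
    unfolding poly_mult_mult using p A(3) by (simp only: polys(1)[symmetric])
  also have "p \<odot> (p \<odot> (p \<odot> p)) = (p \<odot> p) \<odot> (p \<odot> p)"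
    using p A(3) by (intro A(5)[symmetric]) auto
  finally have "(p \<odot> p) \<odot> (p \<odot> p) + d0 \<odot> d0 = p \<odot> p" by simp
  then have "(norm (p \<odot> p))\<^sup>2 \<le> norm (p \<odot> p)"
    using norm_square_le[of "p \<odot> p" d0] by (simp add: norm_square)
  then have "norm (p \<odot> p) \<le> 1"
  proof -
    assume le: "(norm (p \<odot> p))\<^sup>2 \<le> norm (p \<odot> p)"
    show ?thesis
    proof (rule ccontr)
      assume "\<not> norm (p \<odot> p) \<le> 1"
      then have "norm (p \<odot> p) * 1 < norm (p \<odot> p) * norm (p \<odot> p)"
        by (intro mult_strict_left_mono) auto
      with le show False by (simp add: power2_eq_square)
    qed
  qed
  then have "(norm p)\<^sup>2 \<le> 1\<^sup>2" by (simp add: norm_square)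
  then show ?thesis
    unfolding p_def[symmetric] by (rule power2_le_imp_le) simp
qed

lemma ppow_scale: "ppow (r *\<^sub>R a) n = r ^ Suc n *\<^sub>R ppow a n"
  by (induction n) (simp_all add: mult_ac)

lemma norm_pushed_up:
  assumes a: "norm a \<le> 1"
  shows "norm (a + (1/2) *\<^sub>R (ppow a 1 - ppow a 3)) \<le> 1"
proof (rule tendsto_upperbound)
  let ?f = "\<lambda>r::real. norm (r *\<^sub>R a + (1/2) *\<^sub>R (r^2 *\<^sub>R ppow a 1 - r^4 *\<^sub>R ppow a 3))"
  have "(?f \<longlongrightarrow> ?f 1) (at_left 1)" by (intro tendsto_intros)
  then show "(?f \<longlongrightarrow> norm (a + (1/2) *\<^sub>R (ppow a 1 - ppow a 3))) (at_left 1)" by simp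
  have "?f r \<le> 1" if "r \<in> {0<..<1}" for r
  proof -
    have "r * norm a \<le> r * 1" using that a by (intro mult_left_mono) auto
    then have "norm (r *\<^sub>R a) \<le> r" using that by (simp only: norm_scaleR) simp
    then have "norm (r *\<^sub>R a) < 1" using that by (elim le_less_trans) simp
    from norm_pushed_up_strict[OF this] show ?thesis
      unfolding ppow_scale by (simp add: eval_nat_numeral)
  qed
  then show "\<forall>\<^sub>F r in at_left 1. ?f r \<le> 1" by (intro eventually_at_leftI[of 0 1]) auto
qed simp

end

context normal_finite_faithful_trace
begin

lemmas trace_simps [simp] = linear_add[OF trace_linear] linear_diff[OF trace_linear]
  linear_scale[OF trace_linear] linear_neg[OF trace_linear] linear_0[OF trace_linear]

lemma trace_sum: "\<tau> (\<Sum>i\<in>I. f i) = (\<Sum>i\<in>I. \<tau> (f i))"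
  by (rule linear_sum[OF trace_linear])

lemma trace_square_nonneg [simp]: "0 \<le> \<tau> (x \<odot> x)"
  by (rule trace_positive) (auto simp: jordan_positive_def)

lemma trace_square_zero: "\<tau> (x \<odot> x) \<le> 0 \<Longrightarrow> x = 0"
  using trace_faithful[of "x \<odot> x"] norm_square[of x] by (force simp: jordan_positive_def)

lemma trace_move: "\<tau> ((a \<odot> x) \<odot> y) = \<tau> (x \<odot> (a \<odot> y))"
  using trace_assoc[of x a y] by (simp only: jp_commute[of a x])

lemma trace_wlim: "wlim J F a c \<Longrightarrow> ((\<lambda>i. \<tau> (a i)) \<longlongrightarrow> \<tau> c) F"
  by (rule weak_star_continuous_wlim[OF trace_normal])

text \<open>The unit ball is weak* compact and \<open>\<tau>\<close> is weak* continuous.\<close>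

lemma trace_attains_maximum:
  obtains m where "norm m \<le> 1" "\<And>a. norm a \<le> 1 \<Longrightarrow> \<tau> a \<le> \<tau> m"
proof -
  define T where "T = \<tau> ` {a. norm a \<le> 1}"
  have "bdd_above T"
  proof (rule ccontr)
    assume "\<not> bdd_above T"
    then have "\<forall>n. \<exists>a. norm a \<le> 1 \<and> real n < \<tau> a"
      unfolding T_def bdd_above_def by (auto simp: not_le)
    then obtain a where a: "\<And>n. norm (a n) \<le> 1" "\<And>n. real n < \<tau> (a n)" by metis
    obtain F' c where F': "F' \<le> sequentially" "F' \<noteq> bot" "norm c \<le> 1" "wlim J F' a c"
      using J_ball_compact[OF sequentially_bot, of a 1] a by auto
    have "\<forall>\<^sub>F n in F'. \<tau> c + 1 < \<tau> (a n)"
      using F'(1)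
    proof (rule filter_leD)
      have "\<forall>\<^sub>F n in sequentially. \<tau> c + 1 < real n"
        using filterlim_real_sequentially by (simp add: filterlim_at_top_dense)
      then show "\<forall>\<^sub>F n in sequentially. \<tau> c + 1 < \<tau> (a n)"
        by eventually_elim (use a(2) less_trans in blast)
    qed
    moreover have "\<forall>\<^sub>F n in F'. \<tau> (a n) < \<tau> c + 1"
      using order_tendstoD(2)[OF trace_wlim[OF F'(4)]] by simp
    ultimately have "\<forall>\<^sub>F n in F'. False" by eventually_elim simp
    with F' show False by simp
  qed
  have ne: "T \<noteq> {}" by (auto simp: T_def intro!: exI[of _ 0])
  have "\<exists>a. norm a \<le> 1 \<and> Sup T - 1 / (real n + 1) < \<tau> a" for n
    using less_cSup_iff[OF ne \<open>bdd_above T\<close>, of "Sup T - 1 / (real n + 1)"] by (auto simp: T_def)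
  then obtain a where a: "\<And>n. norm (a n) \<le> 1" "\<And>n. Sup T - 1 / (real n + 1) < \<tau> (a n)" by metis
  obtain F' c where F': "F' \<le> sequentially" "F' \<noteq> bot" "norm c \<le> 1" "wlim J F' a c"
    using J_ball_compact[OF sequentially_bot, of a 1] a by auto
  have "(\<lambda>n. Sup T - 1 / (real n + 1)) \<longlonglongrightarrow> Sup T - 0"
    by (intro tendsto_diff tendsto_const) (use LIMSEQ_inverse_real_of_nat in \<open>simp add: inverse_eq_divide add.commute\<close>)
  then have "((\<lambda>n. Sup T - 1 / (real n + 1)) \<longlongrightarrow> Sup T) F'"
    using F'(1) by (simp add: tendsto_mono)
  then have "Sup T \<le> \<tau> c"
    by (rule tendsto_le[OF F'(2) trace_wlim[OF F'(4)]]) (use a in \<open>auto intro!: always_eventually less_imp_le\<close>)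
  moreover have "\<tau> b \<le> Sup T" if "norm b \<le> 1" for b
    using that \<open>bdd_above T\<close> by (intro cSup_upper) (auto simp: T_def)
  ultimately show ?thesis using that F' by force
qed

text \<open>If \<open>m\<close> maximizes \<open>\<tau>\<close> on the unit ball, then \<open>\<tau>(m\<^sup>2) \<le> \<tau>(m\<^sup>4)\<close>, since \<open>m + (m\<^sup>2 - m\<^sup>4)/2\<close> is in the unit
  ball. Also \<open>\<tau>(m\<^sup>6) \<le> \<tau>(m\<^sup>4)\<close>, so \<open>\<tau>((m - m\<^sup>3)\<^sup>2) \<le> 0\<close>. Faithfulness gives \<open>m\<^sup>3 = m\<close>, hence
  \<open>m\<^sup>2\<close> is idempotent; and \<open>2(m\<^sup>2 - m) = (m\<^sup>2 - m)\<^sup>2\<close> shows that its trace is maximal, too.\<close>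

lemma maximal_idempotent:
  obtains f where "f \<odot> f = f" "norm f \<le> 1" "\<And>a. norm a \<le> 1 \<Longrightarrow> \<tau> a \<le> \<tau> f"
proof -
  obtain m where m: "norm m \<le> 1" "\<And>a. norm a \<le> 1 \<Longrightarrow> \<tau> a \<le> \<tau> m"
    using trace_attains_maximum by blast
  \<comment> \<open>Because of the shifted exponents these are the powers \<open>m\<^sup>2\<close> and \<open>m\<^sup>4\<close>.\<close>
  have 24: "\<tau> (ppow m 1) \<le> \<tau> (ppow m 3)"
    using m(2)[OF norm_pushed_up[OF m(1)]] by simp
  have 46: "\<tau> (ppow m 5) \<le> \<tau> (ppow m 3)"
  proof (rule tendsto_upperbound)
    have "((\<lambda>r::real. r^2 * \<tau> (ppow m 5)) \<longlongrightarrow> 1^2 * \<tau> (ppow m 5)) (at_left 1)"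
      by (intro tendsto_intros)
    then show "((\<lambda>r::real. r^2 * \<tau> (ppow m 5)) \<longlongrightarrow> \<tau> (ppow m 5)) (at_left 1)" by simp
    have "r^2 * \<tau> (ppow m 5) \<le> \<tau> (ppow m 3)" if r: "r \<in> {0<..<1}" for r
    proof -
      have "norm (ppow (r *\<^sub>R m) 1) < 1"
      proof -
        have "r * norm m \<le> r * 1" using r m(1) by (intro mult_left_mono) auto
        then have "norm (r *\<^sub>R m) \<le> r" using r by (simp only: norm_scaleR) simp
        then have "norm (r *\<^sub>R m) < 1" using r by (elim le_less_trans) simp
        then show ?thesis by (rule norm_ppow_less)
      qed
      then obtain d where "d \<odot> d = ppow (r *\<^sub>R m) 1 \<odot> ppow (r *\<^sub>R m) 1 -
          ppow (r *\<^sub>R m) 1 \<odot> (ppow (r *\<^sub>R m) 1 \<odot> ppow (r *\<^sub>R m) 1)"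
        using square_complement[OF nonunital_gen_associative ppow_in_nonunital_gen ppow_in_nonunital_gen] by metis
      then have "0 \<le> \<tau> (ppow (r *\<^sub>R m) 3 - ppow (r *\<^sub>R m) 5)"
        using trace_square_nonneg[of d] by (simp only: ppow_mult) (simp add: eval_nat_numeral)
      then have "0 \<le> r^4 * (\<tau> (ppow m 3) - r^2 * \<tau> (ppow m 5))"
        unfolding ppow_scale by (simp add: algebra_simps eval_nat_numeral)
      then show ?thesis using r by (simp add: zero_le_mult_iff)
    qed
    then show "\<forall>\<^sub>F r in at_left 1. r^2 * \<tau> (ppow m 5) \<le> \<tau> (ppow m 3)"
      by (intro eventually_at_leftI[of 0 1]) auto
  qed simp
  have pm: "ppow m 0 \<odot> ppow m 0 = ppow m 1" "ppow m 0 \<odot> ppow m 2 = ppow m 3" "ppow m 2 \<odot> ppow m 0 = ppow m 3"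
    "ppow m 2 \<odot> ppow m 2 = ppow m 5" "ppow m 1 \<odot> ppow m 1 = ppow m 3" "ppow m 1 \<odot> ppow m 0 = ppow m 2"
    "ppow m 0 \<odot> ppow m 1 = ppow m 2"
    unfolding ppow_mult by (simp_all add: eval_nat_numeral)
  have "(ppow m 0 - ppow m 2) \<odot> (ppow m 0 - ppow m 2) = ppow m 1 - ppow m 3 - (ppow m 3 - ppow m 5)"
    by (simp only: pm jp_bilinear_simps)
  then have "\<tau> ((ppow m 0 - ppow m 2) \<odot> (ppow m 0 - ppow m 2)) \<le> 0"
    using 24 46 by (simp del: jp_bilinear_simps ppow.simps)
  then have m3: "ppow m 2 = ppow m 0"
    using trace_square_zero[of "ppow m 0 - ppow m 2"] by (simp del: ppow.simps)
  define f where "f = ppow m 1"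
  have "f \<odot> f = f"
    using pm(1,2,5) m3 by (simp add: f_def del: ppow.simps)
  moreover have "norm f \<le> 1"
    unfolding f_def by (rule order_trans[OF norm_ppow power_le_one]) (use m in auto)
  moreover have "(f - m) \<odot> (f - m) = 2 *\<^sub>R (f - m)"
  proof -
    have "(f - ppow m 0) \<odot> (f - ppow m 0) = f - ppow m 2 - (ppow m 2 - f)"
      using pm \<open>f \<odot> f = f\<close> by (simp only: jp_bilinear_simps f_def)
    then show ?thesis using m3 by (simp add: scaleR_2)
  qed
  then have "0 \<le> \<tau> (2 *\<^sub>R (f - m))" by (metis trace_square_nonneg)
  then have "\<tau> m \<le> \<tau> f" by simp
  ultimately show ?thesis using that m(2) by force
qed

text \<open>The linearized identity gives \<open>f(f y\<^sup>2) = f y\<^sup>2\<close>, and then \<open>\<tau>((f y\<^sup>2)\<^sup>2) = \<tau>(f y\<^sup>4) = \<tau>((f y) y\<^sup>3) = 0\<close>.\<close>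

lemma annihilator_square:
  assumes f: "f \<odot> f = f" and y: "f \<odot> y = 0"
  shows "f \<odot> (y \<odot> y) = 0"
proof -
  define z where "z = y \<odot> y"
  define g where "g = f \<odot> z"
  have fg: "f \<odot> g = g"
    using linearized[of y y f f] f y by (simp add: jp_commute[of y f] jp_commute[of "y \<odot> y" f] g_def z_def)
  have "\<tau> (g \<odot> g) = \<tau> (z \<odot> (f \<odot> g))"
    using trace_move[of f z g] by (simp add: g_def)
  also have "\<dots> = \<tau> (z \<odot> (z \<odot> f))" by (simp add: fg) (simp only: g_def jp_commute)
  also have "\<dots> = \<tau> (f \<odot> (z \<odot> z))" by (simp only: trace_assoc jp_commute[of "z \<odot> z" f])
  also have "z \<odot> z = y \<odot> ppow y 2"
    using ppow_mult[of y 1 1] by (simp add: z_def eval_nat_numeral)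
  also have "\<tau> (f \<odot> (y \<odot> ppow y 2)) = 0" by (simp only: trace_assoc y) simp
  finally have "g = 0" using trace_square_zero[of g] by simp
  then show ?thesis by (simp add: g_def z_def)
qed

text \<open>A normalized square \<open>w\<close> annihilated by \<open>f\<close> could be added to \<open>f\<close> without leaving the unit ball:
  the \<open>2\<^sup>n\<close>-th power of \<open>f + w\<close> is the sum of \<open>f\<close> and the \<open>2\<^sup>n\<close>-th power of \<open>w\<close>, of norm at most \<open>2\<close>
  for every \<open>n\<close>. This contradicts maximality of \<open>\<tau>(f)\<close>.\<close>

lemma annihilator_trivial:
  assumes f: "f \<odot> f = f" "norm f \<le> 1" "\<And>a. norm a \<le> 1 \<Longrightarrow> \<tau> a \<le> \<tau> f" and y: "f \<odot> y = 0"
  shows "y = 0"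
proof (rule ccontr)
  assume "y \<noteq> 0"
  then have ny: "norm (y \<odot> y) > 0" by (simp add: norm_square)
  define w where "w = (1 / norm (y \<odot> y)) *\<^sub>R (y \<odot> y)"
  have w: "f \<odot> w = 0" "norm w = 1"
    using annihilator_square[OF f(1) y] ny by (simp_all add: w_def)
  define ww where "ww n = ((\<lambda>v. v \<odot> v) ^^ n) w" for n
  have ww: "f \<odot> ww n = 0 \<and> norm (ww n) = 1" for n
    by (induction n) (simp_all add: ww_def w annihilator_square[OF f(1)] norm_square)
  have sq: "(f + ww n) \<odot> (f + ww n) = f + ww (Suc n)" for n
    using ww[of n] f(1) by (simp add: jp_commute[of "ww n" f]) (simp add: ww_def)
  have pw: "norm (f + w) ^ (2 ^ n) = norm (f + ww n)" for n
  proof (induction n)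
    case (Suc n)
    have "norm (f + w) ^ (2 ^ Suc n) = (norm (f + ww n))\<^sup>2" by (metis Suc mult.commute power_Suc power_mult)
    then show ?case by (simp only: sq norm_square[symmetric])
  qed (simp add: ww_def)
  have bd: "norm (f + w) ^ (2 ^ n) \<le> 2" for n
    unfolding pw using norm_triangle_ineq[of f "ww n"] ww[of n] f(2) by simp
  have "norm (f + w) \<le> 1"
  proof (rule ccontr)
    assume gt: "\<not> norm (f + w) \<le> 1"
    then obtain n where "2 < norm (f + w) ^ n" using real_arch_pow[of "norm (f + w)" 2] by auto
    also have "\<dots> \<le> norm (f + w) ^ (2 ^ n)" using gt by (intro power_increasing) auto
    finally show False using bd[of n] by simp
  qed
  from f(3)[OF this] have "\<tau> (y \<odot> y) \<le> 0" using ny by (simp add: w_def divide_le_0_iff)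
  then show False using \<open>y \<noteq> 0\<close> trace_square_zero by blast
qed

text \<open>For an idempotent \<open>f\<close> the operator \<open>L_f\<close> satisfies \<open>2L\<^sup>3 - 3L\<^sup>2 + L = 0\<close> (Peirce). So \<open>f\<close> annihilates
  \<open>y - 3fy + 2f(fy)\<close>, which therefore vanishes for a maximal \<open>f\<close>. Taking traces yields \<open>\<tau>(f y) = \<tau>(y)\<close>,
  and then \<open>\<tau>((f x - x)\<^sup>2) = 0\<close>.\<close>

lemma unit_exists: "\<exists>f. \<forall>x. f \<odot> x = x"
proof -
  obtain f where f: "f \<odot> f = f" "norm f \<le> 1" "\<And>a. norm a \<le> 1 \<Longrightarrow> \<tau> a \<le> \<tau> f"
    using maximal_idempotent by blast
  have cubic: "f \<odot> y = 3 *\<^sub>R (f \<odot> (f \<odot> y)) - 2 *\<^sub>R (f \<odot> (f \<odot> (f \<odot> y)))" for y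
  proof -
    have "f \<odot> y = f \<odot> (f \<odot> y) + f \<odot> (f \<odot> y) + f \<odot> (f \<odot> y) - f \<odot> (f \<odot> (f \<odot> y)) - f \<odot> (f \<odot> (f \<odot> y))"
      using mult_by_triple_product[of f f f y] by (simp add: f(1))
    then show ?thesis using scaleR_left_distrib[of 1 2 "f \<odot> (f \<odot> y)"] by (simp add: scaleR_2 algebra_simps)
  qed
  have "y - 3 *\<^sub>R (f \<odot> y) + 2 *\<^sub>R (f \<odot> (f \<odot> y)) = 0" for y
  proof (rule annihilator_trivial[OF f])
    have "f \<odot> (y - 3 *\<^sub>R (f \<odot> y) + 2 *\<^sub>R (f \<odot> (f \<odot> y)))
      = f \<odot> y - (3 *\<^sub>R (f \<odot> (f \<odot> y)) - 2 *\<^sub>R (f \<odot> (f \<odot> (f \<odot> y))))" by simp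
    also have "\<dots> = 0" using cubic[of y] by (simp only: right_minus_eq)
    finally show "f \<odot> (y - 3 *\<^sub>R (f \<odot> y) + 2 *\<^sub>R (f \<odot> (f \<odot> y))) = 0" .
  qed
  then have "\<tau> (y - 3 *\<^sub>R (f \<odot> y) + 2 *\<^sub>R (f \<odot> (f \<odot> y))) = 0" for y by (metis linear_0 trace_linear)
  then have \<tau>f: "\<tau> (f \<odot> y) = \<tau> y" for y
  proof -
    have "\<tau> y - 3 * \<tau> (f \<odot> y) + 2 * \<tau> (f \<odot> (f \<odot> y)) = 0"
      using \<open>\<tau> (y - 3 *\<^sub>R (f \<odot> y) + 2 *\<^sub>R (f \<odot> (f \<odot> y))) = 0\<close> by simp
    moreover have "\<tau> (f \<odot> (f \<odot> y)) = \<tau> (f \<odot> y)"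
      using trace_assoc[of f f y] by (simp only: f(1))
    ultimately show ?thesis by linarith
  qed
  have "f \<odot> x - x = 0" for x
  proof (rule trace_square_zero)
    show "\<tau> ((f \<odot> x - x) \<odot> (f \<odot> x - x)) \<le> 0"
      using \<tau>f[of "x \<odot> (f \<odot> x - x)"] trace_assoc[of f x "f \<odot> x - x"] by (simp add: jp_bilinear_simps(3))
  qed
  then show ?thesis by auto
qed

lemma jordan_unit_left: "jordan_unit (\<odot>) \<odot> x = x"
proof -
  obtain f where f: "\<And>x. f \<odot> x = x" using unit_exists by blast
  have "jordan_unit (\<odot>) = f"
    unfolding jordan_unit_def
  proof (rule the_equality)
    show "g = f" if "\<forall>x. g \<odot> x = x" for g
      using that f[of g] jp_commute[of f g] by metis
  qed (use f in simp)
  then show ?thesis by (simp add: f)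
qed

end

sublocale normal_finite_faithful_trace \<subseteq> unital_jb_algebra jp "jordan_unit jp"
  by unfold_locales (rule jordan_unit_left)

section \<open>The trace as a positive form\<close>

text \<open>Krein's trick: for an operator that is symmetric for a positive form, iterating the
  Cauchy-Schwarz inequality replaces the norm of the form by the norm that bounds the operator.\<close>

lemma symmetric_form_bound:
  fixes B :: "'v::real_normed_vector \<Rightarrow> 'v \<Rightarrow> real" and T :: "'v \<Rightarrow> 'v"
  assumes CS: "\<And>u v. (B u v)\<^sup>2 \<le> B u u * B v v" and nonneg: "\<And>u. 0 \<le> B u u"
    and bound: "\<And>u. B u u \<le> C * (norm u)\<^sup>2"
    and sym: "\<And>u v. B (T u) v = B u (T v)"
    and T: "\<And>u. norm (T u) \<le> r * norm u" "0 \<le> r"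
  shows "\<bar>B (T v) v\<bar> \<le> r * B v v"
proof (rule ccontr)
  assume gt: "\<not> \<bar>B (T v) v\<bar> \<le> r * B v v"
  define b where "b n = B ((T ^^ n) v) v" for n
  have shift: "B ((T ^^ n) u) w = B u ((T ^^ n) w)" for n u w
    by (induction n arbitrary: u w) (simp_all add: sym funpow_swap1)
  have even: "B ((T ^^ n) v) ((T ^^ n) v) = b (2 * n)" for n
    by (simp add: b_def mult_2 funpow_add shift)
  have b0: "0 < b 0"
  proof (rule ccontr)
    assume "\<not> 0 < b 0"
    then have "b 0 = 0" using nonneg[of v] by (simp add: b_def)
    then show False using CS[of "T v" v] gt by (simp add: b_def)
  qed
  define s where "s = \<bar>b 1\<bar> / b 0"
  have s: "r < s" using gt b0 by (simp add: s_def b_def field_simps)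
  have lower: "s ^ (2 ^ k) * b 0 \<le> \<bar>b (2 ^ k)\<bar>" for k
  proof (induction k)
    case 0
    then show ?case using b0 by (simp add: s_def)
  next
    case (Suc k)
    have "(s ^ (2 ^ k) * b 0)\<^sup>2 \<le> (b (2 ^ k))\<^sup>2"
      using Suc s T(2) b0 by (subst power2_abs[symmetric]) (intro power_mono, auto)
    also have "\<dots> \<le> b (2 ^ Suc k) * b 0"
      using CS[of "(T ^^ (2 ^ k)) v" v] unfolding even by (simp add: b_def)
    finally have "s ^ (2 ^ Suc k) * b 0 * b 0 \<le> b (2 ^ Suc k) * b 0"
      by (simp add: power2_eq_square power_add mult_2 mult_ac)
    then have "s ^ (2 ^ Suc k) * b 0 \<le> b (2 ^ Suc k)" using b0 by simp
    then show ?case by linarith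
  qed
  have Tn: "norm ((T ^^ n) v) \<le> r ^ n * norm v" for n
  proof (induction n)
    case (Suc n)
    have "norm ((T ^^ Suc n) v) \<le> r * norm ((T ^^ n) v)" by (simp add: T)
    also have "\<dots> \<le> r * (r ^ n * norm v)" by (intro mult_left_mono Suc T)
    finally show ?case by (simp add: mult_ac)
  qed simp
  define D where "D = \<bar>C\<bar> * (norm v)\<^sup>2"
  have upper: "b (2 * n) \<le> D * r ^ (2 * n)" for n
  proof -
    have "b (2 * n) \<le> C * (norm ((T ^^ n) v))\<^sup>2" unfolding even[symmetric] by (rule bound)
    also have "\<dots> \<le> \<bar>C\<bar> * (norm ((T ^^ n) v))\<^sup>2" by (intro mult_right_mono) auto
    also have "\<dots> \<le> \<bar>C\<bar> * (r ^ n * norm v)\<^sup>2"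
      using Tn[of n] by (intro mult_left_mono power_mono) auto
    finally show ?thesis by (simp add: D_def power_mult_distrib mult_ac power_mult power2_eq_square flip: power_mult_distrib)
  qed
  have bnn: "0 \<le> b (2 * n)" for n using nonneg by (simp flip: even)
  have est: "s ^ (2 ^ Suc k) * b 0 \<le> D * r ^ (2 ^ Suc k)" for k
    using lower[of "Suc k"] upper[of "2 ^ k"] bnn[of "2 ^ k"] by simp
  have D: "0 \<le> D" by (simp add: D_def)
  show False
  proof (cases "r = 0")
    case True
    then show False using est[of 0] s b0 by (simp add: mult_le_0_iff)
  next
    case False
    then have r: "0 < r" using T(2) by simp
    then have q: "1 < s / r" using s by simp
    obtain n where "D / b 0 < (s / r) ^ n" using real_arch_pow[OF q] by blast
    also have "n \<le> 2 ^ Suc n" using less_exp[of n] by (simp add: less_imp_le trans_le_add1 mult_2)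
    then have "(s / r) ^ n \<le> (s / r) ^ (2 ^ Suc n)" using q by (intro power_increasing) auto
    finally have "D * r ^ (2 ^ Suc n) < s ^ (2 ^ Suc n) * b 0"
      using r b0 by (simp add: power_divide field_simps)
    with est[of n] show False by simp
  qed
qed

context normal_finite_faithful_trace
begin

abbreviation e :: 'a where "e \<equiv> jordan_unit (\<odot>)"

lemma trace_pos: "pos a \<Longrightarrow> 0 \<le> \<tau> a"
  by (simp add: pos_jordan_positive trace_positive)

lemma trace_unit_nonneg [simp]: "0 \<le> \<tau> e"
  by (simp add: trace_pos)

lemma trace_pos_zero: "pos a \<Longrightarrow> \<tau> a \<le> 0 \<Longrightarrow> a = 0"
  using trace_faithful[of a] by (force simp: pos_jordan_positive)

lemma trace_mono: "pos (b - a) \<Longrightarrow> \<tau> a \<le> \<tau> b"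
  using trace_pos[of "b - a"] by simp

lemma trace_abs_le: "\<bar>\<tau> a\<bar> \<le> norm a * \<tau> e"
  using trace_pos[OF pos_unit_minus[of a "norm a"]] trace_pos[OF pos_unit_plus[of a "norm a"]] by simp

lemma trace_cauchy_schwarz: "(\<tau> (x \<odot> y))\<^sup>2 \<le> \<tau> (x \<odot> x) * \<tau> (y \<odot> y)"
proof -
  have q: "0 \<le> \<tau> (x \<odot> x) + 2 * t * \<tau> (x \<odot> y) + t\<^sup>2 * \<tau> (y \<odot> y)" for t
    using trace_square_nonneg[of "x + t *\<^sub>R y"] by (simp add: jp_commute[of y x] power2_eq_square algebra_simps)
  show ?thesis
  proof (cases "\<tau> (y \<odot> y) = 0")
    case True
    then have "y = 0" using trace_square_zero by simp
    then show ?thesis by simp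
  next
    case False
    then have p: "0 < \<tau> (y \<odot> y)" by (simp add: order_less_le)
    have "0 \<le> \<tau> (x \<odot> x) - (\<tau> (x \<odot> y))\<^sup>2 / \<tau> (y \<odot> y)"
      using q[of "- \<tau> (x \<odot> y) / \<tau> (y \<odot> y)"] p by (simp add: power2_eq_square field_simps)
    then show ?thesis using p by (simp add: field_simps)
  qed
qed

lemma trace_square_le: "\<tau> (x \<odot> x) \<le> \<tau> e * (norm x)\<^sup>2"
  using trace_abs_le[of "x \<odot> x"] by (simp add: norm_square mult.commute)

text \<open>Multiplication by \<open>a\<close> is symmetric for the trace form.\<close>

lemma trace_mult_square_bound: "\<bar>\<tau> (a \<odot> (x \<odot> x))\<bar> \<le> norm a * \<tau> (x \<odot> x)"
proof -
  have "\<bar>\<tau> ((a \<odot> x) \<odot> x)\<bar> \<le> norm a * \<tau> (x \<odot> x)"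
    by (rule symmetric_form_bound[where B = "\<lambda>u v. \<tau> (u \<odot> v)" and T = "\<lambda>u. a \<odot> u" and C = "\<tau> e"])
      (simp_all add: trace_cauchy_schwarz trace_square_le trace_move norm_jp_le)
  then show ?thesis by (simp add: trace_assoc)
qed

lemma trace_mult_nonneg:
  assumes "pos a" "pos b"
  shows "0 \<le> \<tau> (a \<odot> b)"
proof -
  obtain x where x: "b = x \<odot> x" using assms(2) by (auto simp: pos_jordan_positive jordan_positive_def)
  have "norm (norm a *\<^sub>R e - a) \<le> norm a" using assms(1) by (simp add: pos_iff)
  then have "norm (norm a *\<^sub>R e - a) * \<tau> b \<le> norm a * \<tau> b"
    using trace_pos[OF assms(2)] by (rule mult_right_mono)
  moreover have "\<tau> ((norm a *\<^sub>R e - a) \<odot> b) \<le> norm (norm a *\<^sub>R e - a) * \<tau> b"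
    unfolding x using trace_mult_square_bound[of "norm a *\<^sub>R e - a" x] by linarith
  ultimately show ?thesis by simp
qed

lemma trace_mult_le: "pos b \<Longrightarrow> \<bar>\<tau> (a \<odot> b)\<bar> \<le> norm a * \<tau> b"
  using trace_mult_square_bound by (auto simp: pos_jordan_positive jordan_positive_def)

lemma trace_l1_le_l2: "pos a \<Longrightarrow> (\<tau> a)\<^sup>2 \<le> \<tau> e * \<tau> (a \<odot> a)"
  using trace_cauchy_schwarz[of e a] by simp

section \<open>Monotonicity of the square root\<close>

definition neg_part :: "'a \<Rightarrow> 'a"
  where "neg_part x = fc (\<lambda>t. max (- t) 0) x"

definition abs_val :: "'a \<Rightarrow> 'a"
  where "abs_val x = fc (\<lambda>t. \<bar>t\<bar>) x"

lemma abs_val: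
  "pos (abs_val x)" "pos (abs_val x - x)" "pos (abs_val x + x)" "norm (abs_val x) \<le> norm x"
  "abs_val x \<odot> abs_val x = x \<odot> x"
proof -
  show "pos (abs_val x)" unfolding abs_val_def by (intro fc_pos continuous_intros) simp
  have "abs_val x - x = fc (\<lambda>t. \<bar>t\<bar> - t) x" "abs_val x + x = fc (\<lambda>t. \<bar>t\<bar> + t) x"
    by (simp_all add: abs_val_def fc_diff fc_add continuous_intros)
  then show "pos (abs_val x - x)" "pos (abs_val x + x)"
    by (auto intro!: fc_pos continuous_intros)
  show "norm (abs_val x) \<le> norm x"
    unfolding abs_val_def by (rule fc_norm_le) (auto intro!: continuous_intros spec_bounded)
  have "abs_val x \<odot> abs_val x = fc (\<lambda>t. \<bar>t\<bar> * \<bar>t\<bar>) x"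
    unfolding abs_val_def by (intro fc_mult[symmetric] continuous_intros)
  also have "\<dots> = fc (\<lambda>t. t * t) x" by simp
  also have "\<dots> = x \<odot> x" by (subst fc_mult) (auto intro: continuous_intros)
  finally show "abs_val x \<odot> abs_val x = x \<odot> x" .
qed

lemma neg_part:
  defines "n x \<equiv> neg_part x"
  shows "pos (n x)" "x \<odot> n x = - (n x \<odot> n x)" "x \<odot> (n x \<odot> n x) = - (n x \<odot> (n x \<odot> n x))"
    "pos (n x \<odot> (n x \<odot> n x))" "pos (x + n x)"
proof -
  let ?m = "\<lambda>t::real. max (- t) 0"
  have n: "n x = fc ?m x" for x by (simp add: n_def neg_part_def)
  have nn: "n x \<odot> n x = fc (\<lambda>t. ?m t * ?m t) x" unfolding n by (intro fc_mult[symmetric] continuous_intros)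
  have nnn: "n x \<odot> (n x \<odot> n x) = fc (\<lambda>t. ?m t * (?m t * ?m t)) x"
    unfolding nn unfolding n by (intro fc_mult[symmetric] continuous_intros)
  show "pos (n x)" unfolding n by (intro fc_pos continuous_intros) simp
  show "pos (n x \<odot> (n x \<odot> n x))" unfolding nnn by (intro fc_pos continuous_intros) simp
  have "x \<odot> n x = fc (\<lambda>t. t * ?m t) x" unfolding n by (subst fc_mult) (auto intro!: continuous_intros)
  also have "\<dots> = fc (\<lambda>t. (-1) * (?m t * ?m t)) x" by (rule arg_cong[where f = "\<lambda>f. fc f x"]) (auto simp: max_def)
  also have "\<dots> = - (n x \<odot> n x)" unfolding nn by (subst fc_scale) (auto intro!: continuous_intros)
  finally show "x \<odot> n x = - (n x \<odot> n x)" .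
  have "x \<odot> (n x \<odot> n x) = fc (\<lambda>t. t * (?m t * ?m t)) x" unfolding nn by (subst fc_mult) (auto intro!: continuous_intros)
  also have "\<dots> = fc (\<lambda>t. (-1) * (?m t * (?m t * ?m t))) x"
    by (rule arg_cong[where f = "\<lambda>f. fc f x"]) (auto simp: max_def)
  also have "\<dots> = - (n x \<odot> (n x \<odot> n x))" unfolding nnn by (subst fc_scale) (auto intro!: continuous_intros)
  finally show "x \<odot> (n x \<odot> n x) = - (n x \<odot> (n x \<odot> n x))" .
  have "x + n x = fc (\<lambda>t. t + ?m t) x" unfolding n by (subst fc_add) (auto intro!: continuous_intros)
  then show "pos (x + n x)" by (auto intro!: fc_pos continuous_intros)
qed

text \<open>With \<open>z = b - a\<close> and \<open>c = a + b\<close> one has \<open>c z = b\<^sup>2 - a\<^sup>2 \<ge> 0\<close>. Pairing with the negative part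
  of \<open>z\<close> under the trace forces this part to vanish.\<close>

lemma square_root_monotone:
  assumes a: "pos a" and b: "pos b" and ab: "pos (b \<odot> b - a \<odot> a)"
  shows "pos (b - a)"
proof -
  define z where "z = b - a"
  define n where "n = neg_part z"
  note N = neg_part[of z, folded n_def]
  have "(a + b) \<odot> z = b \<odot> b - a \<odot> a" by (simp add: z_def jp_commute algebra_simps)
  then have "0 \<le> \<tau> (((a + b) \<odot> z) \<odot> n)" using trace_mult_nonneg[OF ab N(1)] by simp
  also have "\<tau> (((a + b) \<odot> z) \<odot> n) = \<tau> ((a + b) \<odot> (z \<odot> n))" by (simp only: trace_assoc)
  also have "\<dots> = - \<tau> (a \<odot> (n \<odot> n)) - \<tau> (b \<odot> (n \<odot> n))" by (simp add: N(2))
  finally have "\<tau> (a \<odot> (n \<odot> n)) = 0" "\<tau> (b \<odot> (n \<odot> n)) = 0"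
    using trace_mult_nonneg[OF a pos_square[of n]] trace_mult_nonneg[OF b pos_square[of n]] by linarith+
  then have "\<tau> (z \<odot> (n \<odot> n)) = 0" by (simp add: z_def)
  then have "\<tau> (n \<odot> (n \<odot> n)) = 0" by (simp add: N(3))
  then have "n \<odot> (n \<odot> n) = 0" using trace_pos_zero[OF N(4)] by simp
  then have "(n \<odot> n) \<odot> (n \<odot> n) = 0"
    using ppow_mult[of n 1 1] by (simp add: eval_nat_numeral)
  then have "norm n = 0" using norm_square[of "n \<odot> n"] norm_square[of n] by simp
  then show ?thesis using N(5) by (simp add: z_def)
qed

definition root2 :: "'a \<Rightarrow> 'a"
  where "root2 a = fc sqrt a"

lemma root2:
  assumes "pos a"
  shows "pos (root2 a)" "root2 a \<odot> root2 a = a" "(norm (root2 a))\<^sup>2 = norm a"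
proof -
  show "pos (root2 a)"
    unfolding root2_def using spec_nonneg[OF assms] by (intro fc_pos continuous_intros) auto
  have "root2 a \<odot> root2 a = fc (\<lambda>t. sqrt t * sqrt t) a"
    unfolding root2_def by (intro fc_mult[symmetric] continuous_intros)
  also have "\<dots> = fc (\<lambda>t. t) a"
    using spec_nonneg[OF assms] by (intro fc_cong) (auto intro!: continuous_intros)
  finally show 1: "root2 a \<odot> root2 a = a" by simp
  show "(norm (root2 a))\<^sup>2 = norm a" using norm_square[of "root2 a"] 1 by simp
qed

lemma root2_mono:
  assumes a: "pos a" and ab: "pos (b - a)"
  shows "pos (root2 b - root2 a)"
proof -
  have b: "pos b" using pos_add[OF a ab] by simp
  show ?thesis
    by (rule square_root_monotone[OF root2(1)[OF a] root2(1)[OF b]])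
      (simp only: root2(2)[OF a] root2(2)[OF b] ab)
qed

lemma root2_square:
  assumes "pos a"
  shows "root2 (a \<odot> a) = a"
proof -
  have "pos (root2 (a \<odot> a) - a)" "pos (a - root2 (a \<odot> a))"
    using root2(1,2)[OF pos_square[of a]] assms by (simp_all add: square_root_monotone)
  then show ?thesis using pos_antisym[of "root2 (a \<odot> a) - a"] by simp
qed

text \<open>With \<open>d = y\<^sup>1\<^sup>/\<^sup>2 - x\<^sup>1\<^sup>/\<^sup>2 \<ge> 0\<close> one has \<open>y - x = d\<^sup>2 + 2x\<^sup>1\<^sup>/\<^sup>2d\<close>, so \<open>\<tau>(d\<^sup>2) \<le> \<tau>(y - x)\<close>; the
  Cauchy-Schwarz inequality bounds \<open>\<tau>(d)\<close>.\<close>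

lemma powers_stormer:
  assumes x: "pos x" and yx: "pos (y - x)"
  shows "(\<tau> (root2 y - root2 x))\<^sup>2 \<le> \<tau> e * \<tau> (y - x)"
proof -
  define d where "d = root2 y - root2 x"
  have y: "pos y" using pos_add[OF x yx] by simp
  have d: "pos d" unfolding d_def by (rule root2_mono[OF x yx])
  have "y - x = (d + root2 x) \<odot> (d + root2 x) - root2 x \<odot> root2 x"
    by (simp only: d_def diff_add_cancel root2(2)[OF x] root2(2)[OF y])
  also have "\<dots> = d \<odot> d + 2 *\<^sub>R (root2 x \<odot> d)" by (simp add: jp_commute[of d "root2 x"] scaleR_2)
  finally have "\<tau> (d \<odot> d) \<le> \<tau> (y - x)"
    using trace_mult_nonneg[OF root2(1)[OF x] d] by simp
  then have "\<tau> e * \<tau> (d \<odot> d) \<le> \<tau> e * \<tau> (y - x)" by (intro mult_left_mono) auto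
  with trace_l1_le_l2[OF d] show ?thesis unfolding d_def by (rule order_trans)
qed

section \<open>Upper bounds of small trace\<close>

definition iter_square :: "nat \<Rightarrow> 'a \<Rightarrow> 'a" where "iter_square N = ((\<lambda>a. a \<odot> a) ^^ N)"
definition iter_root :: "nat \<Rightarrow> 'a \<Rightarrow> 'a" where "iter_root N = (root2 ^^ N)"

lemma iter_square_Suc: "iter_square (Suc N) a = iter_square N a \<odot> iter_square N a" and iter_square_0 [simp]: "iter_square 0 a = a"
  and iter_root_Suc: "iter_root (Suc N) a = root2 (iter_root N a)" and iter_root_0 [simp]: "iter_root 0 a = a"
  by (simp_all add: iter_square_def iter_root_def)

lemma pos_iter_square: "pos a \<Longrightarrow> pos (iter_square N a)" and pos_iter_root: "pos a \<Longrightarrow> pos (iter_root N a)"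
  by (cases N; simp add: iter_square_Suc) (induction N; simp add: iter_root_Suc root2)

lemma iter_root_iter_square: "pos a \<Longrightarrow> iter_root N (iter_square N a) = a"
proof (induction N arbitrary: a)
  case (Suc N)
  have "iter_square (Suc N) a = iter_square N (a \<odot> a)" by (simp only: iter_square_def funpow_Suc_right comp_def)
  then have "iter_root (Suc N) (iter_square (Suc N) a) = root2 (a \<odot> a)"
    using Suc.IH[of "a \<odot> a"] by (simp add: iter_root_Suc)
  then show ?case using root2_square Suc.prems by simp
qed simp

lemma iter_root_mono: "pos a \<Longrightarrow> pos (b - a) \<Longrightarrow> pos (iter_root N b - iter_root N a)"
  by (induction N) (simp_all add: iter_root_Suc root2_mono pos_iter_root)

lemma norm_iter_square: "norm (iter_square N a) = norm a ^ (2 ^ N)"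
proof (induction N)
  case (Suc N)
  then show ?case by (simp add: iter_square_Suc norm_square power2_eq_square mult_2 power_add)
qed simp

lemma norm_iter_root: "pos a \<Longrightarrow> norm (iter_root N a) ^ (2 ^ N) = norm a"
proof (induction N)
  case (Suc N)
  have "norm (iter_root (Suc N) a) ^ (2 ^ Suc N) = ((norm (root2 (iter_root N a)))\<^sup>2) ^ (2 ^ N)"
    by (simp add: iter_root_Suc flip: power_mult)
  then show ?case using Suc by (simp add: root2(3) pos_iter_root)
qed simp

lemma trace_iter_square_le: "pos b \<Longrightarrow> norm b \<le> 1 \<Longrightarrow> \<tau> (iter_square N b) \<le> \<tau> b"
proof (induction N)
  case (Suc N)
  have "norm (iter_square N b) \<le> 1" unfolding norm_iter_square using Suc.prems by (intro power_le_one) auto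
  then have "norm (iter_square N b) * \<tau> (iter_square N b) \<le> 1 * \<tau> (iter_square N b)"
    using Suc.prems by (intro mult_right_mono trace_pos pos_iter_square)
  then have "\<tau> (iter_square N b \<odot> iter_square N b) \<le> \<tau> (iter_square N b)"
    using trace_mult_le[OF pos_iter_square[OF Suc.prems(1)], of "iter_square N b" N] by linarith
  with Suc show ?case by (simp add: iter_square_Suc)
qed simp

text \<open>Each square root costs one application of the Powers-Stormer inequality, which replaces \<open>\<beta>\<^sup>2\<close>
  by \<open>\<beta>\<close>.\<close>

lemma trace_iter_root_increment:
  assumes "pos x" "pos y" "\<tau> y \<le> \<beta> ^ (2 ^ N)" "0 \<le> \<beta>" "\<tau> e \<le> C" "1 \<le> C"
  shows "\<tau> (iter_root N (x + y) - iter_root N x) \<le> C * \<beta>"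
  using assms(3,4)
proof (induction N arbitrary: \<beta>)
  case 0
  then show ?case using mult_right_mono[of 1 C \<beta>] assms(6) by simp
next
  case (Suc N)
  have y: "pos (iter_root N (x + y) - iter_root N x)" using assms by (intro iter_root_mono) simp_all
  have "\<tau> (iter_root N (x + y) - iter_root N x) \<le> C * \<beta>\<^sup>2"
    using Suc by (intro Suc.IH) (simp_all add: power_mult)
  then have "\<tau> e * \<tau> (iter_root N (x + y) - iter_root N x) \<le> C * (C * \<beta>\<^sup>2)"
    using assms(5,6) by (intro mult_mono trace_pos y) auto
  then have "(\<tau> (iter_root (Suc N) (x + y) - iter_root (Suc N) x))\<^sup>2 \<le> (C * \<beta>)\<^sup>2"
    using powers_stormer[OF pos_iter_root[OF assms(1)] y] by (simp add: iter_root_Suc power2_eq_square mult_ac)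
  then show ?case by (rule power2_le_imp_le) (use assms(6) Suc.prems in auto)
qed

text \<open>Upper bounds for finitely many positive elements. There is no lattice structure, but
  \<open>(a\<^sup>q + b\<^sup>q)\<^sup>1\<^sup>/\<^sup>q\<close> is an upper bound of \<open>a\<close> and \<open>b\<close>, by monotonicity of the square root when \<open>q\<close> is a
  power of two, and for large \<open>q\<close> its norm is close to the maximum of the two norms.\<close>

primrec bound_seq :: "(nat \<Rightarrow> 'a) \<Rightarrow> nat \<Rightarrow> 'a"
  where "bound_seq b 0 = 0"
  | "bound_seq b (Suc k) = iter_root k (iter_square k (bound_seq b k) + iter_square k (b k))"

lemma bound_seq_pos:
  assumes "\<And>k. pos (b k)"
  shows "pos (bound_seq b k)"
  by (induction k) (auto intro!: pos_iter_root pos_add pos_iter_square assms)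

lemma bound_seq_step:
  assumes b: "\<And>k. pos (b k)"
  shows "pos (bound_seq b (Suc k) - bound_seq b k)" "pos (bound_seq b (Suc k) - b k)"
proof -
  note p = bound_seq_pos[of b k, OF b] b[of k]
  have "pos (iter_root k (iter_square k (bound_seq b k) + iter_square k (b k)) - iter_root k (iter_square k (bound_seq b k)))"
    "pos (iter_root k (iter_square k (bound_seq b k) + iter_square k (b k)) - iter_root k (iter_square k (b k)))"
    using p by (auto intro!: iter_root_mono pos_iter_square)
  then show "pos (bound_seq b (Suc k) - bound_seq b k)" "pos (bound_seq b (Suc k) - b k)"
    using p by (simp_all add: iter_root_iter_square)
qed

lemma bound_seq_mono:
  assumes "\<And>k. pos (b k)" "m \<le> n"
  shows "pos (bound_seq b n - bound_seq b m)"
  using assms(2)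
proof (induction n rule: dec_induct)
  case (step n)
  have eq: "bound_seq b (Suc n) - bound_seq b m = (bound_seq b (Suc n) - bound_seq b n) + (bound_seq b n - bound_seq b m)" by simp
  show ?case unfolding eq by (rule pos_add[OF bound_seq_step(1)[OF assms(1)] step.IH])
qed simp

text \<open>The bounds \<open>M\<^sub>k\<close> on the norms satisfy \<open>M\<^sub>k\<^sub>+\<^sub>1 = 2\<^sup>1\<^sup>/\<^sup>q M\<^sub>k\<close> with \<open>q = 2\<^sup>k\<close>, and the product of these
  factors is at most \<open>4\<close>.\<close>

lemma bound_seq_norm:
  assumes b: "\<And>k. pos (b k)" "\<And>k. norm (b k) \<le> 1"
  shows "norm (bound_seq b k) \<le> 4"
proof -
  \<comment> \<open>The exponent is the sum of \<open>2\<^sup>-\<^sup>i\<close> over \<open>i < k\<close>.\<close>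
  define M where "M k = (2::real) powr (2 - 2 / 2 ^ k)" for k :: nat
  have M1: "1 \<le> M k" for k
  proof -
    have "(2::real) / 2 ^ k \<le> 2" by (simp add: divide_le_eq)
    then show ?thesis unfolding M_def by (intro ge_one_powr_ge_zero) auto
  qed
  have "norm (bound_seq b k) \<le> M k"
  proof (induction k)
    case 0
    then show ?case using M1[of 0] by simp
  next
    case (Suc k)
    let ?q = "2 ^ k :: nat"
    have "norm (bound_seq b (Suc k)) ^ ?q = norm (iter_square k (bound_seq b k) + iter_square k (b k))"
      using bound_seq_pos[of b k] b by (auto intro!: norm_iter_root pos_add pos_iter_square)
    also have "\<dots> \<le> norm (iter_square k (bound_seq b k)) + norm (iter_square k (b k))" by (rule norm_triangle_ineq)
    also have "\<dots> \<le> M k ^ ?q + 1"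
      unfolding norm_iter_square using Suc b by (intro add_mono power_mono power_le_one) auto
    also have "\<dots> \<le> 2 * M k ^ ?q" using one_le_power[OF M1[of k], of ?q] by simp
    also have "\<dots> = (2 powr (1 / 2 ^ k) * M k) ^ ?q"
    proof -
      have "((2::real) powr (1 / 2 ^ k)) ^ ?q = 2"
        by (simp add: powr_realpow[symmetric] powr_powr)
      then show ?thesis by (simp add: power_mult_distrib)
    qed
    also have "2 powr (1 / 2 ^ k) * M k = M (Suc k)"
      by (simp add: M_def powr_add[symmetric] field_simps)
    finally show ?case
      by (rule power_le_imp_le_base[of _ "?q - 1" , simplified]) (use M1[of "Suc k"] in auto)
  qed
  also have "M k \<le> 2 powr 2" unfolding M_def by (intro powr_mono) auto
  finally show ?thesis by (simp add: powr_numeral)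
qed

lemma bound_seq_trace:
  assumes b: "\<And>k. pos (b k)" "\<And>k. norm (b k) \<le> 1"
    and small: "\<And>k. \<tau> (b k) \<le> (\<epsilon> / 2 ^ k) ^ (2 ^ k)" and \<epsilon>: "0 \<le> \<epsilon>"
  shows "\<tau> (bound_seq b n) \<le> 2 * (\<tau> e + 1) * \<epsilon>"
proof -
  have "\<tau> (bound_seq b n) \<le> (\<tau> e + 1) * \<epsilon> * (\<Sum>k<n. (1/2) ^ k)"
  proof (induction n)
    case (Suc n)
    have "\<tau> (bound_seq b (Suc n)) - \<tau> (bound_seq b n)
      = \<tau> (iter_root n (iter_square n (bound_seq b n) + iter_square n (b n)) - iter_root n (iter_square n (bound_seq b n)))"
      using bound_seq_pos[of b n] b by (simp add: iter_root_iter_square)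
    also have "\<dots> \<le> (\<tau> e + 1) * (\<epsilon> / 2 ^ n)"
      using b bound_seq_pos[of b n] \<epsilon> order_trans[OF trace_iter_square_le small[of n]]
      by (intro trace_iter_root_increment pos_iter_square) auto
    finally show ?case using Suc by (simp add: algebra_simps power_divide)
  qed simp
  also have "(\<Sum>k<n. (1/2::real) ^ k) \<le> 2"
    using sum_le_suminf[of "\<lambda>k. (1/2::real) ^ k" "{..<n}"] by (simp add: suminf_geometric)
  then have "(\<tau> e + 1) * \<epsilon> * (\<Sum>k<n. (1/2) ^ k) \<le> (\<tau> e + 1) * \<epsilon> * 2"
    using \<epsilon> by (intro mult_left_mono) auto
  finally show ?thesis by (simp add: mult_ac)
qed

lemma wlim_J_pos:
  assumes F: "F \<noteq> bot" and lim: "wlim J F a c" and p: "\<forall>\<^sub>F i in F. pos (a i)"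
    and bd: "\<forall>\<^sub>F i in F. norm (a i) \<le> R"
  shows "pos c"
proof -
  have "wlim J F (\<lambda>i. R *\<^sub>R e - a i) (R *\<^sub>R e - c)"
    by (intro wlim_diff dual_linear wlim_const lim)
  then have "norm (R *\<^sub>R e - c) \<le> R"
  proof (rule J_norm_le[OF F])
    show "\<forall>\<^sub>F i in F. norm (R *\<^sub>R e - a i) \<le> R"
      using p bd by eventually_elim (rule pos_norm_unit_minus)
  qed
  then show ?thesis by (auto simp: pos_def)
qed

text \<open>The exponents \<open>2\<^sup>k\<close> grow fast enough to keep the successive bounds
  \<open>(T\<^sub>k\<^sup>q + b\<^sub>k\<^sup>q)\<^sup>1\<^sup>/\<^sup>q\<close> uniformly bounded in norm, while the Powers-Stormer inequality controls their
  trace because the traces of \<open>b\<^sub>k\<close> are assumed to decrease correspondingly fast.\<close>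

lemma upper_bound_of_small_trace:
  assumes b: "\<And>k. pos (b k)" "\<And>k. norm (b k) \<le> 1"
    and small: "\<And>k. \<tau> (b k) \<le> (\<epsilon> / 2 ^ k) ^ (2 ^ k)" and \<epsilon>: "0 \<le> \<epsilon>"
  obtains T where "\<And>k. pos (T - b k)" "\<tau> T \<le> 2 * (\<tau> e + 1) * \<epsilon>"
proof -
  obtain F' T where F': "F' \<le> sequentially" "F' \<noteq> bot" "norm T \<le> 4" and lim: "wlim J F' (bound_seq b) T"
    using J_ball_compact[OF sequentially_bot always_eventually, of "bound_seq b" 4] bound_seq_norm[OF b] by auto
  have "pos (T - b k)" for k
  proof (rule wlim_J_pos[OF F'(2)])
    show "wlim J F' (\<lambda>n. bound_seq b n - b k) (T - b k)"
      by (intro wlim_diff dual_linear wlim_const lim)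
    have "\<forall>\<^sub>F n in sequentially. pos (bound_seq b n - b k)"
      using eventually_ge_at_top[of "Suc k"]
    proof eventually_elim
      case (elim n)
      have eq: "bound_seq b n - b k = (bound_seq b n - bound_seq b (Suc k)) + (bound_seq b (Suc k) - b k)" by simp
      show ?case unfolding eq by (rule pos_add[OF bound_seq_mono[OF b(1) elim] bound_seq_step(2)[OF b(1)]])
    qed
    then show "\<forall>\<^sub>F n in F'. pos (bound_seq b n - b k)" by (rule filter_leD[OF F'(1)])
    show "\<forall>\<^sub>F n in F'. norm (bound_seq b n - b k) \<le> 4 + 1"
      by (rule always_eventually, rule allI, rule order_trans[OF norm_triangle_ineq4])
        (intro add_mono bound_seq_norm b)
  qed
  moreover have "\<tau> T \<le> 2 * (\<tau> e + 1) * \<epsilon>"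
    by (rule tendsto_upperbound[OF trace_wlim[OF lim] _ F'(2)])
      (use bound_seq_trace[OF b small \<epsilon>] in \<open>auto intro: always_eventually\<close>)
  ultimately show ?thesis using that by blast
qed

section \<open>Normality of the functionals induced by the trace\<close>

text \<open>Bernstein polynomials transported to \<open>[-1,1]\<close>.\<close>

definition bernstein :: "nat \<Rightarrow> nat \<Rightarrow> 'a \<Rightarrow> 'a"
  where "bernstein N k x = fc (\<lambda>t. Bernstein N k ((1 + t) / 2)) x"

lemma Bernstein_le_1:
  assumes "0 \<le> x" "x \<le> 1" "k \<le> n"
  shows "Bernstein n k x \<le> 1"
proof -
  have "Bernstein n k x \<le> (\<Sum>k\<le>n. Bernstein n k x)"
    using assms by (intro member_le_sum) (auto intro: Bernstein_nonneg)
  then show ?thesis by simp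
qed

lemma continuous_Bernstein: "continuous_on S (\<lambda>t. Bernstein N k ((1 + t) / 2))"
  unfolding Bernstein_def by (intro continuous_intros) auto

text \<open>A positive partition of unity with nodes \<open>2k/N - 1\<close>, whose first moment is \<open>x\<close> and whose second
  moment is close to \<open>x\<^sup>2\<close>: the classical moments of the binomial distribution.\<close>

lemma bernstein:
  assumes x: "norm x \<le> 1"
  shows "pos (bernstein N k x)" "k \<le> N \<Longrightarrow> norm (bernstein N k x) \<le> 1"
    "(\<Sum>k\<le>N. bernstein N k x) = e"
    "0 < N \<Longrightarrow> (\<Sum>k\<le>N. (2 * real k / real N - 1) *\<^sub>R bernstein N k x) = x"
    "0 < N \<Longrightarrow> (\<Sum>k\<le>N. (2 * real k / real N - 1)\<^sup>2 *\<^sub>R bernstein N k x)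
      = x \<odot> x + (1 / real N) *\<^sub>R (e - x \<odot> x)"
proof -
  have range: "0 \<le> (1 + t) / 2" "(1 + t) / 2 \<le> 1" if "t \<in> spec x" for t
    using spec_bounded[OF that] x by auto
  show "pos (bernstein N k x)" unfolding bernstein_def
    using range by (intro fc_pos continuous_Bernstein Bernstein_nonneg)
  show "norm (bernstein N k x) \<le> 1" if "k \<le> N"
    unfolding bernstein_def using range that Bernstein_nonneg Bernstein_le_1
    by (intro fc_norm_le continuous_Bernstein) (auto simp: abs_of_nonneg)
  have lin: "(\<Sum>k\<le>N. w k *\<^sub>R bernstein N k x) = fc (\<lambda>t. \<Sum>k\<le>N. w k * Bernstein N k ((1 + t) / 2)) x" for w
    unfolding bernstein_def by (subst fc_sum) (auto intro!: continuous_intros continuous_Bernstein simp: fc_scale continuous_Bernstein)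
  show "(\<Sum>k\<le>N. bernstein N k x) = e" using lin[of "\<lambda>_. 1"] by simp
  assume N: "0 < N"
  have S1: "(\<Sum>k\<le>N. real k * Bernstein N k u) = N * u" for u :: real by simp
  have S2: "(\<Sum>k\<le>N. real k * real k * Bernstein N k u) = N * (N - 1) * u\<^sup>2 + N * u" for u :: real
  proof -
    have "(\<Sum>k\<le>N. real k * real k * Bernstein N k u)
      = (\<Sum>k\<le>N. real k * (real k - 1) * Bernstein N k u) + (\<Sum>k\<le>N. real k * Bernstein N k u)"
      by (subst sum.distrib[symmetric], rule sum.cong) (simp_all add: algebra_simps)
    then show ?thesis using N by (simp add: of_nat_diff)
  qed
  have "(\<Sum>k\<le>N. (2 * real k / real N - 1) * Bernstein N k ((1 + t) / 2)) = t" for t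
  proof -
    have "(\<Sum>k\<le>N. (2 * real k / real N - 1) * Bernstein N k ((1 + t) / 2))
      = (2 / N) * (\<Sum>k\<le>N. real k * Bernstein N k ((1 + t) / 2)) - (\<Sum>k\<le>N. Bernstein N k ((1 + t) / 2))"
      by (simp add: algebra_simps sum_subtractf sum_distrib_left del: sum_k_Bernstein sum_Bernstein)
    then show ?thesis using N by (simp add: field_simps)
  qed
  then show "(\<Sum>k\<le>N. (2 * real k / real N - 1) *\<^sub>R bernstein N k x) = x" by (simp add: lin)
  have "(\<Sum>k\<le>N. (2 * real k / real N - 1)\<^sup>2 * Bernstein N k ((1 + t) / 2)) = t * t + (1 / real N) * (1 - t * t)" for t
  proof -
    have "(\<Sum>k\<le>N. (2 * real k / real N - 1)\<^sup>2 * Bernstein N k ((1 + t) / 2))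
      = (4 / N^2) * (\<Sum>k\<le>N. real k * real k * Bernstein N k ((1 + t) / 2))
        - (4 / N) * (\<Sum>k\<le>N. real k * Bernstein N k ((1 + t) / 2)) + (\<Sum>k\<le>N. Bernstein N k ((1 + t) / 2))"
      by (simp add: algebra_simps power2_eq_square sum_subtractf sum.distrib sum_distrib_left del: sum_k_Bernstein sum_Bernstein)
    also have "\<dots> = t * t + (1 / real N) * (1 - t * t)"
      unfolding S1 S2 sum_Bernstein using N by (simp add: field_simps power2_eq_square)
    finally show ?thesis .
  qed
  note nodes = this
  have "fc (\<lambda>t. t * t) x = x \<odot> x" by (subst fc_mult) (auto intro!: continuous_intros)
  then have "fc (\<lambda>t. 1 - t * t) x = e - x \<odot> x"
    using fc_diff[of x "\<lambda>t. 1" "\<lambda>t. t * t"] by (simp add: continuous_intros)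
  then have "fc (\<lambda>t. (1 / real N) * (1 - t * t)) x = (1 / real N) *\<^sub>R (e - x \<odot> x)"
    using fc_scale[of x "\<lambda>t. 1 - t * t" "1 / real N"] by (simp add: continuous_intros)
  moreover have "continuous_on (spec x) (\<lambda>t. t * t)" "continuous_on (spec x) (\<lambda>t. (1 / real N) * (1 - t * t))"
    by (intro continuous_intros)+
  ultimately have "fc (\<lambda>t. t * t + (1 / real N) * (1 - t * t)) x = x \<odot> x + (1 / real N) *\<^sub>R (e - x \<odot> x)"
    using \<open>fc (\<lambda>t. t * t) x = x \<odot> x\<close> by (simp only: fc_add)
  then show "(\<Sum>k\<le>N. (2 * real k / real N - 1)\<^sup>2 *\<^sub>R bernstein N k x) = x \<odot> x + (1 / real N) *\<^sub>R (e - x \<odot> x)"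
    by (simp only: lin nodes)
qed

text \<open>The argument is Kadison's inequality: in the limit the Bernstein partitions of unity of
  \<open>a i\<close> become a resolution \<open>\<Sum>q\<^sub>k = 1\<close> of \<open>c = \<Sum>\<lambda>\<^sub>kq\<^sub>k\<close> into positive elements, and
  \<open>\<tau>(c\<^sup>2) \<le> \<Sum>\<lambda>\<^sub>k\<^sup>2 \<tau>(q\<^sub>k)\<close>.\<close>

lemma trace_square_lower_semicontinuous:
  assumes F: "F \<noteq> bot" and lim: "wlim J F a c" and bd: "\<forall>\<^sub>F i in F. norm (a i) \<le> 1"
    and le: "\<forall>\<^sub>F i in F. \<tau> (a i \<odot> a i) \<le> r"
  shows "\<tau> (c \<odot> c) \<le> r"
proof -
  have step: "\<tau> (c \<odot> c) \<le> r + \<tau> e / real N" if N: "0 < N" for N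
  proof -
    define node where "node k = 2 * real k / real N - 1" for k
    have "\<exists>F'\<le>F. F' \<noteq> bot \<and> (\<exists>q. \<forall>k<n. wlim J F' (\<lambda>i. bernstein N k (a i)) (q k) \<and> pos (q k))"
      if "n \<le> Suc N" for n using that
    proof (induction n)
      case 0
      then show ?case using F by (intro exI[of _ F]) auto
    next
      case (Suc n)
      then obtain F1 q where F1: "F1 \<le> F" "F1 \<noteq> bot"
        and q: "\<And>k. k < n \<Longrightarrow> wlim J F1 (\<lambda>i. bernstein N k (a i)) (q k) \<and> pos (q k)" by auto
      have bd1: "\<forall>\<^sub>F i in F1. norm (a i) \<le> 1" by (rule filter_leD[OF F1(1) bd])
      have b1: "\<forall>\<^sub>F i in F1. norm (bernstein N n (a i)) \<le> 1" and p1: "\<forall>\<^sub>F i in F1. pos (bernstein N n (a i))"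
        using bd1 Suc.prems by (auto elim!: eventually_mono intro: bernstein)
      obtain F2 d where F2: "F2 \<le> F1" "F2 \<noteq> bot" "norm d \<le> 1" "wlim J F2 (\<lambda>i. bernstein N n (a i)) d"
        using J_ball_compact[OF F1(2) b1] by blast
      have "pos d"
        by (rule wlim_J_pos[OF F2(2,4) filter_leD[OF F2(1) p1] filter_leD[OF F2(1) b1]])
      then show ?case
        using F1(1) F2 wlim_mono[OF conjunct1[OF q] F2(1)] q
        by (intro exI[of _ F2] conjI exI[of _ "q(n := d)"]) (auto simp: less_Suc_eq)
    qed
    from this[OF order_refl] obtain F' q where F': "F' \<le> F" "F' \<noteq> bot"
      and "\<forall>k<Suc N. wlim J F' (\<lambda>i. bernstein N k (a i)) (q k) \<and> pos (q k)" by auto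
    then have q: "\<And>k. k \<le> N \<Longrightarrow> wlim J F' (\<lambda>i. bernstein N k (a i)) (q k)" "\<And>k. k \<le> N \<Longrightarrow> pos (q k)"
      by simp_all
    have bd': "\<forall>\<^sub>F i in F'. norm (a i) \<le> 1" by (rule filter_leD[OF F'(1) bd])
    have lin: "wlim J F' (\<lambda>i. \<Sum>k\<le>N. w k *\<^sub>R bernstein N k (a i)) (\<Sum>k\<le>N. w k *\<^sub>R q k)" for w
      by (intro wlim_sum wlim_scaleR dual_linear q) auto
    have sum1: "(\<Sum>k\<le>N. q k) = e"
    proof (rule J_unique[OF F'(2)])
      show "wlim J F' (\<lambda>i. e) (\<Sum>k\<le>N. q k)"
        by (rule wlim_cong[OF lin[of "\<lambda>_. 1", unfolded scaleR_one]]) (use bd' in \<open>auto elim!: eventually_mono simp: bernstein\<close>)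
    qed (rule wlim_const)
    have sumc: "(\<Sum>k\<le>N. node k *\<^sub>R q k) = c"
    proof (rule J_unique[OF F'(2)])
      show "wlim J F' a (\<Sum>k\<le>N. node k *\<^sub>R q k)"
        using lin[of node] by (rule wlim_cong) (use bd' N in \<open>auto elim!: eventually_mono simp: bernstein node_def\<close>)
    qed (rule wlim_mono[OF lim F'(1)])
    have "\<tau> (c \<odot> c) = (\<Sum>k\<le>N. \<Sum>l\<le>N. node k * node l * \<tau> (q k \<odot> q l))"
      unfolding sumc[symmetric] by (simp add: jp_sum_left jp_sum_right trace_sum sum_distrib_left mult_ac)
        (intro sum.cong refl, simp only: jp_commute)
    also have "\<dots> \<le> (\<Sum>k\<le>N. \<Sum>l\<le>N. ((node k)\<^sup>2 / 2 + (node l)\<^sup>2 / 2) * \<tau> (q k \<odot> q l))"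
    proof (intro sum_mono mult_right_mono)
      show "node k * node l \<le> (node k)\<^sup>2 / 2 + (node l)\<^sup>2 / 2" for k l
        using sum_squares_bound[of "node k" "node l"] by simp
    qed (use q in \<open>auto intro: trace_mult_nonneg\<close>)
    also have "\<dots> = (\<Sum>k\<le>N. \<Sum>l\<le>N. (node k)\<^sup>2 / 2 * \<tau> (q k \<odot> q l)) + (\<Sum>k\<le>N. \<Sum>l\<le>N. (node l)\<^sup>2 / 2 * \<tau> (q k \<odot> q l))"
      by (simp add: distrib_right sum.distrib)
    also have "(\<Sum>k\<le>N. \<Sum>l\<le>N. (node l)\<^sup>2 / 2 * \<tau> (q k \<odot> q l)) = (\<Sum>k\<le>N. \<Sum>l\<le>N. (node k)\<^sup>2 / 2 * \<tau> (q k \<odot> q l))"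
      by (subst sum.swap) (simp add: jp_commute)
    also have "(\<Sum>k\<le>N. \<Sum>l\<le>N. (node k)\<^sup>2 / 2 * \<tau> (q k \<odot> q l)) = (\<Sum>k\<le>N. (node k)\<^sup>2 / 2 * \<tau> (q k))"
    proof -
      have "(\<Sum>l\<le>N. \<tau> (q k \<odot> q l)) = \<tau> (q k)" for k
        by (simp add: sum1 flip: trace_sum jp_sum_right)
      then show ?thesis by (simp only: sum_distrib_left[symmetric])
    qed
    also have "(\<Sum>k\<le>N. (node k)\<^sup>2 / 2 * \<tau> (q k)) + (\<Sum>k\<le>N. (node k)\<^sup>2 / 2 * \<tau> (q k)) = \<tau> (\<Sum>k\<le>N. (node k)\<^sup>2 *\<^sub>R q k)"
      by (simp add: trace_sum mult.commute flip: sum.distrib)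
    also have "\<dots> \<le> r + \<tau> e / real N"
    proof (rule tendsto_upperbound[OF trace_wlim[OF lin[of "\<lambda>k. (node k)\<^sup>2"]] _ F'(2)])
      have "\<forall>\<^sub>F i in F'. \<tau> (a i \<odot> a i) \<le> r" by (rule filter_leD[OF F'(1) le])
      with bd' show "\<forall>\<^sub>F i in F'. \<tau> (\<Sum>k\<le>N. (node k)\<^sup>2 *\<^sub>R bernstein N k (a i)) \<le> r + \<tau> e / real N"
      proof eventually_elim
        case (elim i)
        have "0 \<le> \<tau> (a i \<odot> a i) / real N" using N by simp
        moreover have "\<tau> (\<Sum>k\<le>N. (node k)\<^sup>2 *\<^sub>R bernstein N k (a i))
          = \<tau> (a i \<odot> a i) + (\<tau> e / real N - \<tau> (a i \<odot> a i) / real N)"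
          using elim N by (simp add: bernstein(5) node_def diff_divide_distrib)
        ultimately show ?case using elim(2) by linarith
      qed
    qed
    finally show ?thesis .
  qed
  have "(\<lambda>n. r + \<tau> e * (1 / real (Suc n))) \<longlonglongrightarrow> r + \<tau> e * 0"
    by (intro tendsto_intros) (use LIMSEQ_inverse_real_of_nat in \<open>simp add: inverse_eq_divide\<close>)
  then have "(\<lambda>n. r + \<tau> e * (1 / real (Suc n))) \<longlonglongrightarrow> r" by simp
  then show ?thesis
    by (rule tendsto_lowerbound) (use step[of "Suc _"] in \<open>auto intro!: always_eventually simp del: of_nat_Suc\<close>)
qed

text \<open>Lower semicontinuity of \<open>\<tau>((x + s a)\<^sup>2)\<close>, divided by \<open>s\<close>, becomes a statement about the linear
  term \<open>\<tau>(x a)\<close> as \<open>s\<close> tends to \<open>0\<close>.\<close>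

lemma trace_mult_limit_le:
  assumes F: "F \<noteq> bot" and lim: "wlim J F a c" and bd: "\<forall>\<^sub>F i in F. norm (a i) \<le> R"
    and le: "\<forall>\<^sub>F i in F. \<tau> (x \<odot> a i) \<le> q"
  shows "\<tau> (x \<odot> c) \<le> q"
proof -
  obtain i where "norm (a i) \<le> R" using eventually_happens'[OF F bd] by blast
  then have R: "0 \<le> R" using norm_ge_zero order_trans by blast
  have step: "\<tau> (x \<odot> c) \<le> q + s * (\<tau> e * R\<^sup>2)" if s: "0 < s" for s
  proof -
    define M where "M = norm x + s * R + 1"
    have M: "0 < M" using s R by (simp add: M_def add_nonneg_pos)
    define u where "u i = (1/M) *\<^sub>R (x + s *\<^sub>R a i)" for i
    have sq: "\<tau> ((x + s *\<^sub>R b) \<odot> (x + s *\<^sub>R b)) = \<tau> (x \<odot> x) + 2 * s * \<tau> (x \<odot> b) + s\<^sup>2 * \<tau> (b \<odot> b)" for b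
      by (simp add: jp_commute[of b x] power2_eq_square algebra_simps)
    have "\<tau> (((1/M) *\<^sub>R (x + s *\<^sub>R c)) \<odot> ((1/M) *\<^sub>R (x + s *\<^sub>R c)))
        \<le> (\<tau> (x \<odot> x) + 2 * s * q + s\<^sup>2 * (\<tau> e * R\<^sup>2)) / M\<^sup>2"
    proof (rule trace_square_lower_semicontinuous[OF F, of u])
      show "wlim J F u ((1/M) *\<^sub>R (x + s *\<^sub>R c))"
        unfolding u_def by (intro wlim_scaleR wlim_add dual_linear wlim_const lim)
      show "\<forall>\<^sub>F i in F. norm (u i) \<le> 1"
        using bd
      proof eventually_elim
        case (elim i)
        have "norm (x + s *\<^sub>R a i) \<le> norm x + s * R"
          using s elim by (intro norm_triangle_le) simp
        then show ?case using M by (simp add: u_def M_def)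
      qed
      show "\<forall>\<^sub>F i in F. \<tau> (u i \<odot> u i) \<le> (\<tau> (x \<odot> x) + 2 * s * q + s\<^sup>2 * (\<tau> e * R\<^sup>2)) / M\<^sup>2"
        using bd le
      proof eventually_elim
        case (elim i)
        have "\<tau> (a i \<odot> a i) \<le> \<tau> e * R\<^sup>2"
          using trace_square_le[of "a i"] mult_left_mono[OF power_mono[OF elim(1) norm_ge_zero, of 2] trace_unit_nonneg] by linarith
        then have "\<tau> ((x + s *\<^sub>R a i) \<odot> (x + s *\<^sub>R a i)) \<le> \<tau> (x \<odot> x) + 2 * s * q + s\<^sup>2 * (\<tau> e * R\<^sup>2)"
          unfolding sq using elim s by (intro add_mono mult_left_mono) auto
        moreover have "\<tau> (u i \<odot> u i) = \<tau> ((x + s *\<^sub>R a i) \<odot> (x + s *\<^sub>R a i)) / M\<^sup>2"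
          unfolding u_def jp_bilinear_simps(5,6) trace_simps(3) by (simp add: power2_eq_square)
        ultimately show ?case using M by (simp add: divide_right_mono)
      qed
    qed
    also have "\<tau> (((1/M) *\<^sub>R (x + s *\<^sub>R c)) \<odot> ((1/M) *\<^sub>R (x + s *\<^sub>R c))) = \<tau> ((x + s *\<^sub>R c) \<odot> (x + s *\<^sub>R c)) / M\<^sup>2"
      unfolding jp_bilinear_simps(5,6) trace_simps(3) by (simp add: power2_eq_square)
    finally have "\<tau> ((x + s *\<^sub>R c) \<odot> (x + s *\<^sub>R c)) / M\<^sup>2 \<le> (\<tau> (x \<odot> x) + 2 * s * q + s\<^sup>2 * (\<tau> e * R\<^sup>2)) / M\<^sup>2" .
    moreover have "0 < M\<^sup>2" using M by simp
    ultimately have "\<tau> ((x + s *\<^sub>R c) \<odot> (x + s *\<^sub>R c)) \<le> \<tau> (x \<odot> x) + 2 * s * q + s\<^sup>2 * (\<tau> e * R\<^sup>2)"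
      by (simp only: divide_le_cancel simp_thms)
    then have "2 * s * \<tau> (x \<odot> c) + s\<^sup>2 * \<tau> (c \<odot> c) \<le> 2 * s * q + s\<^sup>2 * (\<tau> e * R\<^sup>2)"
      unfolding sq by linarith
    moreover have "0 \<le> s\<^sup>2 * \<tau> (c \<odot> c)" by simp
    ultimately have "2 * s * \<tau> (x \<odot> c) \<le> 2 * s * (q + s * (\<tau> e * R\<^sup>2) / 2)" by (simp add: algebra_simps power2_eq_square)
    then have "\<tau> (x \<odot> c) \<le> q + s * (\<tau> e * R\<^sup>2) / 2" using s by simp
    moreover have "0 \<le> s * (\<tau> e * R\<^sup>2)" using s by simp
    ultimately show ?thesis by linarith
  qed
  have "((\<lambda>s. q + s * (\<tau> e * R\<^sup>2)) \<longlongrightarrow> q + 0 * (\<tau> e * R\<^sup>2)) (at_right 0)" by (intro tendsto_intros)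
  then have "((\<lambda>s. q + s * (\<tau> e * R\<^sup>2)) \<longlongrightarrow> q) (at_right 0)" by simp
  then show ?thesis
    by (rule tendsto_lowerbound) (use step in \<open>auto intro: eventually_at_rightI[of 0 1]\<close>)
qed

lemma trace_mult_wlim:
  assumes lim: "wlim J F a c" and bd: "\<forall>\<^sub>F i in F. norm (a i) \<le> R"
  shows "((\<lambda>i. \<tau> (x \<odot> a i)) \<longlongrightarrow> \<tau> (x \<odot> c)) F"
proof -
  have lower: "\<forall>\<^sub>F i in F. q < \<tau> (x \<odot> a i)" if q: "q < \<tau> (x \<odot> c)" for q x
  proof (rule ccontr)
    assume *: "\<not> (\<forall>\<^sub>F i in F. q < \<tau> (x \<odot> a i))"
    define F' where "F' = inf F (principal {i. \<tau> (x \<odot> a i) \<le> q})"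
    have "F' \<noteq> bot"
      using * by (auto simp: F'_def trivial_limit_def eventually_inf_principal not_le elim: eventually_mono)
    moreover have "F' \<le> F" "\<forall>\<^sub>F i in F'. \<tau> (x \<odot> a i) \<le> q"
      by (simp_all add: F'_def eventually_inf_principal)
    ultimately have "\<tau> (x \<odot> c) \<le> q"
      by (intro trace_mult_limit_le[OF _ wlim_mono[OF lim] filter_leD[OF _ bd]])
    with q show False by simp
  qed
  show ?thesis
  proof (rule order_tendstoI)
    show "\<forall>\<^sub>F i in F. q < \<tau> (x \<odot> a i)" if "q < \<tau> (x \<odot> c)" for q by (rule lower[OF that])
    show "\<forall>\<^sub>F i in F. \<tau> (x \<odot> a i) < q" if "\<tau> (x \<odot> c) < q" for q
      using lower[of "- q" "- x"] that by simp
  qed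
qed

end

section \<open>Functionals of given norm\<close>

definition sublinear :: "('v::real_vector \<Rightarrow> real) \<Rightarrow> bool"
  where "sublinear p \<longleftrightarrow> (\<forall>x y. p (x + y) \<le> p x + p y) \<and> (\<forall>x. \<forall>t\<ge>0. p (t *\<^sub>R x) = t * p x)"

lemma sublinearD:
  assumes "sublinear p"
  shows "p (x + y) \<le> p x + p y" "0 \<le> t \<Longrightarrow> p (t *\<^sub>R x) = t * p x" "p 0 = 0" "- p (- x) \<le> p x"
proof -
  show 1: "p (x + y) \<le> p x + p y" "0 \<le> t \<Longrightarrow> p (t *\<^sub>R x) = t * p x" for x y t
    using assms by (auto simp: sublinear_def)
  show 0: "p 0 = 0" using 1(2)[of 0 0] by simp
  show "- p (- x) \<le> p x" using 1(1)[of x "- x"] 0 by simp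
qed

lemma sublinearI:
  assumes add: "\<And>x y. p (x + y) \<le> p x + p y" and zero: "p 0 = 0"
    and scale: "\<And>c v. 0 < c \<Longrightarrow> p (c *\<^sub>R v) \<le> c * p v"
  shows "sublinear p"
  unfolding sublinear_def
proof (intro conjI allI impI add)
  fix x and t :: real assume t: "0 \<le> t"
  show "p (t *\<^sub>R x) = t * p x"
  proof (cases "t = 0")
    case False
    with t have t: "0 < t" by simp
    have "p ((1/t) *\<^sub>R t *\<^sub>R x) \<le> (1/t) * p (t *\<^sub>R x)" using t by (intro scale) simp
    then have "t * p x \<le> p (t *\<^sub>R x)" using t by (simp add: le_divide_eq mult.commute)
    with scale[OF t, of x] show ?thesis by simp
  qed (simp add: zero)
qed

text \<open>The largest sublinear functional below \<open>p\<close> whose value at \<open>-x\<close> is at most \<open>-p x\<close>.\<close>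

definition flatten :: "('v::real_vector \<Rightarrow> real) \<Rightarrow> 'v \<Rightarrow> 'v \<Rightarrow> real"
  where "flatten p x v = (INF t\<in>{0..}. p (v + t *\<^sub>R x) - t * p x)"

lemma
  assumes p: "sublinear p"
  shows flatten_le: "0 \<le> t \<Longrightarrow> flatten p x v \<le> p (v + t *\<^sub>R x) - t * p x"
    and sublinear_flatten: "sublinear (flatten p x)"
proof -
  note P = sublinearD[OF p]
  have bd: "bdd_below ((\<lambda>t. p (v + t *\<^sub>R x) - t * p x) ` {0..})" for v
  proof (rule bdd_belowI2)
    fix t :: real assume "t \<in> {0..}"
    then have "t * p x = p ((v + t *\<^sub>R x) + (- v))" using P(2) by simp
    also have "\<dots> \<le> p (v + t *\<^sub>R x) + p (- v)" by (rule P(1))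
    finally show "- p (- v) \<le> p (v + t *\<^sub>R x) - t * p x" by simp
  qed
  show le: "flatten p x v \<le> p (v + t *\<^sub>R x) - t * p x" if "0 \<le> t" for t v
    unfolding flatten_def by (rule cINF_lower[OF bd]) (use that in simp)
  have greatest: "c \<le> flatten p x v" if "\<And>t. 0 \<le> t \<Longrightarrow> c \<le> p (v + t *\<^sub>R x) - t * p x" for c v
    unfolding flatten_def by (rule cINF_greatest) (use that in auto)
  have add: "flatten p x (v + w) \<le> flatten p x v + flatten p x w" for v w
  proof -
    have "flatten p x (v + w) - (p (w + s *\<^sub>R x) - s * p x) \<le> flatten p x v" if s: "0 \<le> s" for s
    proof (rule greatest)
      fix t :: real assume t: "0 \<le> t"
      have "flatten p x (v + w) \<le> p ((v + w) + (t + s) *\<^sub>R x) - (t + s) * p x" using s t by (intro le) simp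
      also have "(v + w) + (t + s) *\<^sub>R x = (v + t *\<^sub>R x) + (w + s *\<^sub>R x)" by (simp add: algebra_simps)
      finally show "flatten p x (v + w) - (p (w + s *\<^sub>R x) - s * p x) \<le> p (v + t *\<^sub>R x) - t * p x"
        using P(1)[of "v + t *\<^sub>R x" "w + s *\<^sub>R x"] by (simp add: algebra_simps)
    qed
    then have "flatten p x (v + w) - flatten p x v \<le> p (w + s *\<^sub>R x) - s * p x" if "0 \<le> s" for s
      using that by (simp add: algebra_simps)
    from greatest[OF this] show ?thesis by simp
  qed
  have scale_le: "flatten p x (c *\<^sub>R v) \<le> c * flatten p x v" if c: "0 < c" for c v
  proof -
    have "flatten p x (c *\<^sub>R v) / c \<le> flatten p x v"
    proof (rule greatest)
      fix t :: real assume t: "0 \<le> t"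
      have "flatten p x (c *\<^sub>R v) \<le> p (c *\<^sub>R v + (c * t) *\<^sub>R x) - (c * t) * p x" using c t by (intro le) simp
      also have "c *\<^sub>R v + (c * t) *\<^sub>R x = c *\<^sub>R (v + t *\<^sub>R x)" by (simp add: algebra_simps)
      also have "p (c *\<^sub>R (v + t *\<^sub>R x)) = c * p (v + t *\<^sub>R x)" using c by (intro P(2)) simp
      finally have "flatten p x (c *\<^sub>R v) \<le> (p (v + t *\<^sub>R x) - t * p x) * c" by (simp add: algebra_simps)
      then show "flatten p x (c *\<^sub>R v) / c \<le> p (v + t *\<^sub>R x) - t * p x"
        using c by (simp only: pos_divide_le_eq)
    qed
    then show ?thesis using c by (simp add: divide_le_eq mult.commute)
  qed
  have zero: "flatten p x 0 = 0"
  proof (rule antisym)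
    show "flatten p x 0 \<le> 0" using le[of 0 0] P(3) by simp
    show "0 \<le> flatten p x 0" by (rule greatest) (simp add: P(2))
  qed
  show "sublinear (flatten p x)" using add zero scale_le by (rule sublinearI)
qed

text \<open>A minimal sublinear functional equals each of its flattenings, hence is additive.\<close>

lemma linear_below_sublinear:
  assumes p: "sublinear (p :: 'v::real_vector \<Rightarrow> real)"
  obtains f where "linear f" "\<And>v. f v \<le> p v"
proof -
  define A where "A = {q. sublinear q \<and> (\<forall>v. q v \<le> p v)}"
  define R where "R f g \<longleftrightarrow> (\<forall>v. g v \<le> f v)" for f g :: "'v \<Rightarrow> real"
  have "\<exists>m\<in>A. \<forall>a\<in>A. R m a \<longrightarrow> a = m"
  proof (rule predicate_Zorn)
    show "partial_order_on A (relation_of R A)"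
      by (rule partial_order_on_relation_ofI) (auto simp: R_def fun_eq_iff intro!: antisym intro: order_trans)
  next
    fix C assume C: "C \<in> Chains (relation_of R A)"
    have CA: "q \<in> A" if "q \<in> C" for q
      using C that by (auto simp: Chains_def relation_of_def)
    have chain: "R q r \<or> R r q" if "q \<in> C" "r \<in> C" for q r
      using C that by (auto simp: Chains_def relation_of_def)
    show "\<exists>u\<in>A. \<forall>a\<in>C. R a u"
    proof (cases "C = {}")
      case True
      then show ?thesis using p by (auto simp: A_def)
    next
      case False
      define u where "u v = (INF q\<in>C. q v)" for v
      have bd: "bdd_below ((\<lambda>q. q v) ` C)" for v
      proof (rule bdd_belowI2)
        fix q assume "q \<in> C"
        then have "sublinear q" "q (- v) \<le> p (- v)" using CA by (auto simp: A_def)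
        then show "- p (- v) \<le> q v" using sublinearD(4)[of q v] by linarith
      qed
      have le: "u v \<le> q v" if "q \<in> C" for q v
        unfolding u_def using that by (intro cINF_lower bd)
      have greatest: "c \<le> u v" if "\<And>q. q \<in> C \<Longrightarrow> c \<le> q v" for c v
        unfolding u_def using that False by (intro cINF_greatest)
      have "u (v + w) \<le> u v + u w" for v w
      proof -
        have "u (v + w) - r w \<le> u v" if r: "r \<in> C" for r
        proof (rule greatest)
          fix q assume q: "q \<in> C"
          obtain s where s: "s \<in> C" "s v \<le> q v" "s w \<le> r w"
            using chain[OF q r] q r by (auto simp: R_def)
          have "u (v + w) \<le> s (v + w)" using le s by blast
          also have "\<dots> \<le> s v + s w" using CA[OF s(1)] sublinearD(1)[of s] by (simp add: A_def)
          finally show "u (v + w) - r w \<le> q v" using s by simp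
        qed
        then have *: "u (v + w) - u v \<le> r w" if "r \<in> C" for r using that by (simp add: algebra_simps)
        have "u (v + w) - u v \<le> u w" by (rule greatest) (rule *)
        then show ?thesis by simp
      qed
      moreover have "u 0 = 0"
      proof -
        have "(\<lambda>q. q 0) ` C = {0}" using False CA sublinearD(3) by (force simp: A_def)
        then show ?thesis by (simp add: u_def)
      qed
      moreover have "u (c *\<^sub>R v) \<le> c * u v" if c: "0 < c" for c v
      proof -
        have "u (c *\<^sub>R v) / c \<le> u v"
        proof (rule greatest)
          fix q assume q: "q \<in> C"
          then have "q (c *\<^sub>R v) = c * q v" using CA[OF q] sublinearD(2)[of q c v] c by (simp add: A_def)
          then show "u (c *\<^sub>R v) / c \<le> q v" using le[OF q, of "c *\<^sub>R v"] c by (simp add: divide_le_eq mult.commute)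
        qed
        then show ?thesis using c by (simp add: divide_le_eq mult.commute)
      qed
      ultimately have "sublinear u" by (rule sublinearI)
      moreover have "u v \<le> p v" for v
      proof -
        obtain q where q: "q \<in> C" using False by blast
        then have "q v \<le> p v" using CA by (auto simp: A_def)
        with le[OF q, of v] show ?thesis by simp
      qed
      ultimately show ?thesis using le by (intro bexI[of _ u]) (auto simp: A_def R_def)
    qed
  qed
  then obtain m where m: "sublinear m" "\<And>v. m v \<le> p v"
    and min: "\<And>a. a \<in> A \<Longrightarrow> R m a \<Longrightarrow> a = m" by (auto simp: A_def)
  have flat: "flatten m x = m" for x
  proof (rule min)
    have le: "flatten m x v \<le> m v" for v using flatten_le[OF m(1), of 0 x v] by simp
    show "R m (flatten m x)" using le by (simp add: R_def)
    show "flatten m x \<in> A"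
      unfolding A_def using sublinear_flatten[OF m(1)] le m(2) order_trans by blast
  qed
  have add: "m (v + x) = m v + m x" for v x
    using flatten_le[OF m(1), of 1 x v] sublinearD(1)[OF m(1), of v x] by (simp add: flat)
  have "linear m"
  proof
    show "m (v + x) = m v + m x" for v x by (rule add)
    fix c v
    have neg: "m (- v) = - m v" for v using add[of v "- v"] sublinearD(3)[OF m(1)] by simp
    show "m (c *\<^sub>R v) = c *\<^sub>R m v"
    proof (cases "0 \<le> c")
      case False
      then have "m ((- c) *\<^sub>R v) = - c * m v" by (intro sublinearD(2)[OF m(1)]) simp
      then show ?thesis using neg[of "c *\<^sub>R v"] by simp
    qed (simp add: sublinearD(2)[OF m(1)])
  qed
  with m show ?thesis using that by blast
qed

lemma sublinear_norm: "sublinear norm"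
  by (auto simp: sublinear_def norm_triangle_ineq)

text \<open>A linear functional below the norm flattened in the direction \<open>y\<close> takes the value \<open>\<parallel>y\<parallel>\<close> at \<open>y\<close>.\<close>

lemma norming_functional:
  fixes y :: "'v::real_normed_vector"
  obtains f where "linear f" "\<And>v. \<bar>f v\<bar> \<le> norm v" "f y = norm y"
proof -
  obtain f where f: "linear f" "\<And>v. f v \<le> flatten norm y v"
    using linear_below_sublinear[OF sublinear_flatten[OF sublinear_norm]] by blast
  have 1: "f v \<le> norm v" for v
    using f(2)[of v] flatten_le[OF sublinear_norm, of 0 y v] by simp
  have "f (- y) \<le> - norm y"
    using f(2)[of "- y"] flatten_le[OF sublinear_norm, of 1 y "- y"] by simp
  then have "norm y \<le> f y" by (simp add: linear_neg[OF f(1)])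
  moreover have "\<bar>f v\<bar> \<le> norm v" for v
    using 1[of v] 1[of "- v"] by (simp add: linear_neg[OF f(1)])
  ultimately show ?thesis using that[OF f(1)] 1[of y] by force
qed

lemma unimodular_rotation:
  obtains u :: complex where "cmod u = 1" "u * z = complex_of_real (cmod z)"
proof (cases "z = 0")
  case True
  then show ?thesis using that[of 1] by simp
next
  case False
  have "cnj (sgn z) * z = (z * cnj z) / complex_of_real (cmod z)" by (simp add: sgn_eq)
  also have "\<dots> = complex_of_real (cmod z)"
    using False by (simp add: complex_norm_square[symmetric] power2_eq_square)
  finally have "cnj (sgn z) * z = complex_of_real (cmod z)" .
  then show ?thesis using that[of "cnj (sgn z)"] False by (simp add: norm_sgn)
qed

lemma complex_linearD:
  assumes "complex_linear f"
  shows "f (x + y) = f x + f y" "f (c *\<^sub>C x) = c *\<^sub>C f x" "f (r *\<^sub>R x) = r *\<^sub>R f x" "f (x - y) = f x - f y" "f 0 = 0"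
proof -
  show 1: "f (x + y) = f x + f y" "f (c *\<^sub>C x) = c *\<^sub>C f x" for x y c
    using assms by (auto simp: complex_linear_def)
  show "f (r *\<^sub>R x) = r *\<^sub>R f x" for r x by (simp add: scaleR_scaleC 1)
  show "f (x - y) = f x - f y" using 1(1)[of "x - y" y] by simp
  show "f 0 = 0" using 1(1)[of 0 0] by simp
qed

lemma scaleC_one: "1 *\<^sub>C (x :: 'v::complex_vector) = x"
  using scaleR_scaleC[of 1 x] by simp

lemma scaleC_zero_right: "c *\<^sub>C (0 :: 'v::complex_vector) = 0"
  using scaleC_add_right[of c "0 :: 'v" 0] by simp

lemma scaleC_zero_left: "0 *\<^sub>C (x :: 'v::complex_vector) = 0"
  using scaleC_add_left[of 0 0 x] by simp

lemma scaleC_minus_right: "c *\<^sub>C (- x) = - (c *\<^sub>C (x :: 'v::complex_vector))"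
  using scaleC_add_right[of c x "- x"] by (simp add: scaleC_zero_right eq_neg_iff_add_eq_0 add.commute)

lemma scaleC_minus_left: "(- c) *\<^sub>C x = - (c *\<^sub>C (x :: 'v::complex_vector))"
  using scaleC_add_left[of c "- c" x] by (simp add: scaleC_zero_left eq_neg_iff_add_eq_0 add.commute)

lemma scaleC_diff_right: "c *\<^sub>C (x - y) = c *\<^sub>C x - c *\<^sub>C (y :: 'v::complex_vector)"
  using scaleC_add_right[of c x "- y"] by (simp add: scaleC_minus_right)

lemma scaleC_diff_left: "(c - d) *\<^sub>C x = c *\<^sub>C x - d *\<^sub>C (x :: 'v::complex_vector)"
  using scaleC_add_left[of c "- d" x] by (simp add: scaleC_minus_left)

lemma scaleC_scaleR: "c *\<^sub>C (r *\<^sub>R x) = r *\<^sub>R (c *\<^sub>C (x :: 'v::complex_vector))"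
  by (simp add: scaleR_scaleC scaleC_scaleC mult.commute)

lemmas scaleC_simps = scaleC_one scaleC_zero_right scaleC_zero_left scaleC_minus_right
  scaleC_minus_left scaleC_diff_right scaleC_diff_left scaleC_scaleR

section \<open>Weak* continuous functionals on a dual space\<close>

context jbw_star_algebra
begin

lemma K_linear: "linear K"
  using complex_linearD[OF dual_complex_linear] by (intro linearI) auto

lemma K_inj: "inj K"
proof (rule injI)
  fix a b assume "K a = K b"
  then have "norm (K (a - b)) = 0" by (simp add: complex_linearD[OF dual_complex_linear])
  then show "a = b" by (simp add: dual_isometric)
qed

lemma K_complex_linear: "complex_linear (blinfun_apply (K m))"
  using dual_onto by auto

lemmas K_right = complex_linearD[OF K_complex_linear]
lemmas K_left = complex_linearD[OF dual_complex_linear]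
lemmas K_unique = wlim_unique[OF K_inj]
lemmas K_norm_le = wlim_norm_le[OF dual_isometric]

lemma wlim_K_scaleC: "wlim K F m c \<Longrightarrow> wlim K F (\<lambda>i. \<alpha> *\<^sub>C m i) (\<alpha> *\<^sub>C c)"
  by (auto simp: wlim_def K_left(2) scaleC_complex_def intro: tendsto_mult_left)

lemma K_ball_compact:
  assumes F: "F \<noteq> bot" and bd: "\<forall>\<^sub>F i in F. norm (a i) \<le> R"
  obtains F' c where "F' \<le> F" "F' \<noteq> bot" "norm c \<le> R" "wlim K F' a c"
proof -
  obtain F' and \<psi> :: "'y \<Rightarrow>\<^sub>L complex"
    where F': "F' \<le> F" "F' \<noteq> bot" "norm \<psi> \<le> R" "\<And>y. ((\<lambda>i. K (a i) y) \<longlongrightarrow> \<psi> y) F'"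
    using banach_alaoglu_filter[OF F, of "\<lambda>i. K (a i)" R] bd by (auto simp: dual_isometric)
  have "\<psi> (c *\<^sub>C y) = c *\<^sub>C \<psi> y" for c y
  proof (rule tendsto_unique[OF F'(2) F'(4)])
    show "((\<lambda>i. K (a i) (c *\<^sub>C y)) \<longlongrightarrow> c *\<^sub>C \<psi> y) F'"
      unfolding K_right(2) scaleC_complex_def by (intro tendsto_mult_left F'(4))
  qed
  then have "complex_linear (blinfun_apply \<psi>)" by (simp add: complex_linear_def blinfun.add_right)
  then obtain c where "\<psi> = K c" using dual_onto by auto
  with F' that[of F' c] show ?thesis by (auto simp: wlim_def dual_isometric)
qed

text \<open>A real norming functional \<open>f\<close> is the real part of the complex linear functional
  \<open>v \<mapsto> f(v) - i f(iv)\<close> of the same norm, which is represented by an element of the dual.\<close>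

lemma K_norming:
  obtains m where "norm m \<le> 1" "norm y \<le> cmod (K m y)"
proof -
  obtain f where f: "linear f" "\<And>v. \<bar>f v\<bar> \<le> norm v" "f y = norm y"
    using norming_functional[of y] by blast
  define \<phi> where "\<phi> v = Complex (f v) (- f (\<i> *\<^sub>C v))" for v
  have add: "\<phi> (v + w) = \<phi> v + \<phi> w" for v w
    by (simp add: \<phi>_def scaleC_add_right linear_add[OF f(1)] complex_eq_iff)
  have scaleR: "\<phi> (r *\<^sub>R v) = r *\<^sub>R \<phi> v" for r v
    by (simp add: \<phi>_def scaleC_simps linear_scale[OF f(1)] complex_eq_iff)
  have i: "\<phi> (\<i> *\<^sub>C v) = \<i> * \<phi> v" for v
    by (simp add: \<phi>_def scaleC_scaleC scaleC_simps linear_neg[OF f(1)] complex_eq_iff)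
  have scaleC: "\<phi> (c *\<^sub>C v) = c * \<phi> v" for c v
  proof -
    have "c *\<^sub>C v = Re c *\<^sub>R v + Im c *\<^sub>R (\<i> *\<^sub>C v)"
      unfolding scaleR_scaleC scaleC_scaleC scaleC_add_left[symmetric] by (metis complex_eq mult.commute)
    then have "\<phi> (c *\<^sub>C v) = Re c *\<^sub>R \<phi> v + Im c *\<^sub>R (\<i> * \<phi> v)" by (simp only: add scaleR i)
    also have "\<dots> = c * \<phi> v" by (simp add: complex_eq_iff)
    finally show ?thesis .
  qed
  have bd: "cmod (\<phi> v) \<le> norm v" for v
  proof -
    obtain u where u: "cmod u = 1" "u * \<phi> v = complex_of_real (cmod (\<phi> v))" by (rule unimodular_rotation)
    have "cmod (\<phi> v) = Re (\<phi> (u *\<^sub>C v))" by (simp only: scaleC u) simp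
    also have "\<dots> \<le> norm (u *\<^sub>C v)" using f(2)[of "u *\<^sub>C v"] by (simp add: \<phi>_def)
    finally show ?thesis by (simp add: norm_scaleC u)
  qed
  have bl: "bounded_linear \<phi>"
    by (rule bounded_linear_intro[where K = 1]) (simp_all add: add scaleR bd)
  then have app: "blinfun_apply (Blinfun \<phi>) = \<phi>" by (rule bounded_linear_Blinfun_apply)
  have "complex_linear (blinfun_apply (Blinfun \<phi>))"
    by (simp add: app complex_linear_def add scaleC scaleC_complex_def)
  then obtain m where m: "Blinfun \<phi> = K m" using dual_onto by auto
  have "norm (Blinfun \<phi>) \<le> 1" by (rule norm_blinfun_bound) (simp_all add: app bd)
  then have "norm m \<le> 1" by (simp add: m dual_isometric)
  moreover have "norm y \<le> cmod (K m y)"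
  proof -
    have "K m y = \<phi> y" by (simp only: m[symmetric] app)
    moreover have "Re (\<phi> y) = norm y" by (simp add: \<phi>_def f(3))
    ultimately show ?thesis using complex_Re_le_cmod[of "\<phi> y"] by simp
  qed
  ultimately show ?thesis using that by blast
qed

text \<open>The finite-codimensional Hahn-Banach theorem: each constraint is removed by subtracting a
  multiple of one functional.\<close>

lemma approximation_modulo_kernel:
  assumes "finite Y" "linear (\<phi> :: 'm \<Rightarrow> real)" "0 \<le> \<epsilon>"
    and "\<And>m. (\<And>y. y \<in> Y \<Longrightarrow> Re (K m y) = 0) \<Longrightarrow> \<bar>\<phi> m\<bar> \<le> \<epsilon> * norm m"
  shows "\<exists>w. \<forall>m. \<bar>\<phi> m - Re (K m w)\<bar> \<le> \<epsilon> * norm m"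
  using assms(1,2,4)
proof (induction Y arbitrary: \<phi> rule: finite_induct)
  case empty
  then show ?case by (intro exI[of _ 0]) (simp add: K_right(5))
next
  case (insert y0 Y)
  define g where "g m = Re (K m y0)" for m
  define N where "N = {m. \<forall>y\<in>Y. Re (K m y) = 0}"
  have N: "a + b \<in> N" "r *\<^sub>R a \<in> N" "a - b \<in> N" if "a \<in> N" "b \<in> N" for a b r
    using that by (auto simp: N_def K_left blinfun.add_left blinfun.scaleR_left blinfun.diff_left)
  have g: "g (a - b) = g a - g b" "g (r *\<^sub>R a) = r * g a" for a b r
    by (simp_all add: g_def K_left blinfun.diff_left blinfun.scaleR_left)
  note lin = linear_diff[OF insert.prems(1)] linear_scale[OF insert.prems(1)]
  have bd: "\<bar>\<phi> m\<bar> \<le> \<epsilon> * norm m" if "m \<in> N" "g m = 0" for m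
    using that by (intro insert.prems(2)) (auto simp: N_def g_def)
  have "\<exists>c. \<forall>m\<in>N. \<bar>\<phi> m - c * g m\<bar> \<le> \<epsilon> * norm m"
  proof (cases "\<forall>m\<in>N. g m = 0")
    case True
    then show ?thesis using bd by (intro exI[of _ 0]) auto
  next
    case False
    then obtain u0 where u0: "u0 \<in> N" "g u0 \<noteq> 0" by blast
    define S where "S = {m \<in> N. g m = 1}"
    have "(1 / g u0) *\<^sub>R u0 \<in> S" using u0 N(2)[OF u0(1) u0(1)] by (simp add: S_def g)
    then have ne: "S \<noteq> {}" by blast
    have cross: "\<phi> m - \<epsilon> * norm m \<le> \<phi> m' + \<epsilon> * norm m'" if "m \<in> S" "m' \<in> S" for m m'
    proof -
      have "\<bar>\<phi> (m - m')\<bar> \<le> \<epsilon> * norm (m - m')"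
        using that N(3) by (intro bd) (auto simp: S_def g)
      also have "\<dots> \<le> \<epsilon> * (norm m + norm m')"
        by (intro mult_left_mono norm_triangle_ineq4 assms)
      finally show ?thesis by (simp add: lin algebra_simps abs_le_iff)
    qed
    define c where "c = (SUP m\<in>S. \<phi> m - \<epsilon> * norm m)"
    obtain m0 where m0: "m0 \<in> S" using ne by blast
    have bdd: "bdd_above ((\<lambda>m. \<phi> m - \<epsilon> * norm m) ` S)"
      using cross m0 by (intro bdd_aboveI2[of _ _ "\<phi> m0 + \<epsilon> * norm m0"]) auto
    have c1: "\<phi> m - \<epsilon> * norm m \<le> c" if "m \<in> S" for m
      unfolding c_def by (rule cSUP_upper[OF that bdd])
    have c2: "c \<le> \<phi> m + \<epsilon> * norm m" if "m \<in> S" for m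
      unfolding c_def using ne cross that by (intro cSUP_least) auto
    have "\<bar>\<phi> m - c * g m\<bar> \<le> \<epsilon> * norm m" if m: "m \<in> N" for m
    proof (cases "g m = 0")
      case False
      define s where "s = (1 / g m) *\<^sub>R m"
      have s: "s \<in> S" using m N(2)[OF m m] False by (simp add: S_def s_def g)
      have "\<bar>\<phi> s - c\<bar> \<le> \<epsilon> * norm s" using c1[OF s] c2[OF s] by (simp add: abs_le_iff)
      then have "\<bar>g m\<bar> * \<bar>\<phi> s - c\<bar> \<le> \<bar>g m\<bar> * (\<epsilon> * norm s)" by (rule mult_left_mono) simp
      moreover have "\<bar>g m\<bar> * \<bar>\<phi> s - c\<bar> = \<bar>\<phi> m - c * g m\<bar>"
        unfolding abs_mult[symmetric] s_def lin using False by (simp add: algebra_simps)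
      moreover have "\<bar>g m\<bar> * (\<epsilon> * norm s) = \<epsilon> * norm m" using False by (simp add: s_def)
      ultimately show ?thesis by simp
    qed (use bd m in simp)
    then show ?thesis by blast
  qed
  then obtain c where c: "\<And>m. m \<in> N \<Longrightarrow> \<bar>\<phi> m - c * g m\<bar> \<le> \<epsilon> * norm m" by blast
  have lin': "linear (\<lambda>m. \<phi> m - c * g m)"
    by (rule linearI) (simp_all add: linear_add[OF insert.prems(1)] linear_scale[OF insert.prems(1)]
        g_def K_left blinfun.add_left blinfun.scaleR_left algebra_simps)
  obtain w where w: "\<And>m. \<bar>\<phi> m - c * g m - Re (K m w)\<bar> \<le> \<epsilon> * norm m"
    using insert.IH[OF lin'] c by (auto simp: N_def)
  have "\<phi> m - Re (K m (w + c *\<^sub>R y0)) = \<phi> m - c * g m - Re (K m w)" for m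
    by (simp add: g_def K_right)
  with w show ?case by metis
qed

text \<open>Weak* continuity at \<open>0\<close> on the unit ball. Nets indexed by sets of elements of the predual
  suffice, since these index the basic weak* neighbourhoods of \<open>0\<close>.\<close>

definition ball_continuous :: "('m \<Rightarrow>\<^sub>L complex) \<Rightarrow> bool"
  where "ball_continuous \<phi> \<longleftrightarrow> (\<forall>(F :: 'y set filter) m. F \<noteq> bot \<longrightarrow> (\<forall>i. norm (m i) \<le> 1) \<longrightarrow> wlim K F m 0 \<longrightarrow>
    ((\<lambda>i. \<phi> (m i)) \<longlongrightarrow> 0) F)"

text \<open>Otherwise there would be a counterexample for every finite set \<open>Y\<close>, and these form a weak* null
  net in the unit ball on which \<open>\<phi>\<close> stays away from \<open>0\<close>.\<close>

lemma small_modulo_kernel: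
  assumes bc: "ball_continuous \<phi>" and \<epsilon>: "0 < \<epsilon>"
  obtains Y where "finite Y" "\<And>m. norm m \<le> 1 \<Longrightarrow> (\<And>y. y \<in> Y \<Longrightarrow> K m y = 0) \<Longrightarrow> cmod (\<phi> m) \<le> \<epsilon>"
proof (rule ccontr)
  assume no: "\<not> thesis"
  have "\<exists>m. norm m \<le> 1 \<and> (finite Y \<longrightarrow> (\<forall>y\<in>Y. K m y = 0) \<and> \<epsilon> < cmod (\<phi> m))" for Y
  proof (cases "finite Y")
    case True
    then show ?thesis using no that[of Y] by (meson not_le)
  next
    case False
    then show ?thesis by (intro exI[of _ 0]) simp
  qed
  then obtain m where m: "\<And>Y. norm (m Y) \<le> 1"
    "\<And>Y y. finite Y \<Longrightarrow> y \<in> Y \<Longrightarrow> K (m Y) y = 0" "\<And>Y. finite Y \<Longrightarrow> \<epsilon> < cmod (\<phi> (m Y))" by metis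
  let ?F = "finite_subsets_at_top UNIV :: 'y set filter"
  have "wlim K ?F m 0"
    unfolding wlim_def
  proof
    fix y
    have "\<forall>\<^sub>F Y in ?F. K (m Y) y = 0"
      unfolding eventually_finite_subsets_at_top by (rule exI[of _ "{y}"]) (auto intro: m(2))
    then have "((\<lambda>Y. K (m Y) y) \<longlongrightarrow> 0) ?F" by (rule tendsto_eventually)
    then show "((\<lambda>Y. K (m Y) y) \<longlongrightarrow> K 0 y) ?F" by (simp add: K_left)
  qed
  then have "((\<lambda>Y. \<phi> (m Y)) \<longlongrightarrow> 0) ?F"
    using bc m(1) by (simp add: ball_continuous_def)
  then have "\<forall>\<^sub>F Y in ?F. cmod (\<phi> (m Y)) < \<epsilon>"
    using \<epsilon> by (simp add: tendsto_iff dist_norm)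
  moreover have "\<forall>\<^sub>F Y in ?F. finite Y" by (rule eventually_finite_subsets_at_top_weakI) simp
  ultimately have "\<forall>\<^sub>F Y in ?F. False"
    by eventually_elim (use m(3) in fastforce)
  then show False by simp
qed

text \<open>A functional that is weak* continuous on the unit ball is, up to every \<open>\<epsilon>\<close>, evaluation at an
  element of the predual; completeness of the predual then gives an exact representation.\<close>

lemma ball_continuous_representation:
  assumes cl: "complex_linear (blinfun_apply \<phi>)" and bc: "ball_continuous \<phi>"
  obtains y where "\<And>m. \<phi> m = K m y"
proof -
  have approx: "\<exists>w. \<forall>m. cmod (\<phi> m - K m w) \<le> \<epsilon> * norm m" if \<epsilon>: "0 < \<epsilon>" for \<epsilon>
  proof -
    obtain Y where Y: "finite Y" "\<And>m. norm m \<le> 1 \<Longrightarrow> (\<And>y. y \<in> Y \<Longrightarrow> K m y = 0) \<Longrightarrow> cmod (\<phi> m) \<le> \<epsilon>"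
      using small_modulo_kernel[OF bc \<epsilon>] by blast
    have Ybd: "cmod (\<phi> m) \<le> \<epsilon> * norm m" if "\<And>y. y \<in> Y \<Longrightarrow> K m y = 0" for m
    proof (cases "m = 0")
      case False
      have "cmod (\<phi> ((1 / norm m) *\<^sub>R m)) \<le> \<epsilon>"
        using that False by (intro Y(2)) (simp_all add: K_left blinfun.scaleR_left)
      then show ?thesis using False by (simp add: blinfun.scaleR_right divide_le_eq)
    qed (simp add: blinfun.zero_right)
    have "\<exists>w. \<forall>m. \<bar>Re (\<phi> m) - Re (K m w)\<bar> \<le> \<epsilon> * norm m"
    proof (rule approximation_modulo_kernel[of "Y \<union> (\<lambda>y. \<i> *\<^sub>C y) ` Y"])
      show "finite (Y \<union> (\<lambda>y. \<i> *\<^sub>C y) ` Y)" using Y by simp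
      show "linear (\<lambda>m. Re (\<phi> m))"
        by (rule linearI) (simp_all add: blinfun.add_right blinfun.scaleR_right)
      fix m assume *: "\<And>y. y \<in> Y \<union> (\<lambda>y. \<i> *\<^sub>C y) ` Y \<Longrightarrow> Re (K m y) = 0"
      have "cmod (\<phi> m) \<le> \<epsilon> * norm m"
      proof (rule Ybd)
        fix y assume "y \<in> Y"
        then have "Re (K m y) = 0" "Re (K m (\<i> *\<^sub>C y)) = 0" using * by auto
        then show "K m y = 0" by (simp add: K_right scaleC_complex_def complex_eq_iff)
      qed
      then show "\<bar>Re (\<phi> m)\<bar> \<le> \<epsilon> * norm m" using abs_Re_le_cmod order_trans by blast
    qed (use \<epsilon> in simp)
    then obtain w where w: "\<And>m. \<bar>Re (\<phi> m) - Re (K m w)\<bar> \<le> \<epsilon> * norm m" by blast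
    have "cmod (\<phi> m - K m w) \<le> \<epsilon> * norm m" for m
    proof -
      obtain u where u: "cmod u = 1" "u * (\<phi> m - K m w) = complex_of_real (cmod (\<phi> m - K m w))"
        by (rule unimodular_rotation)
      have "\<phi> (u *\<^sub>C m) - K (u *\<^sub>C m) w = u * (\<phi> m - K m w)"
        by (simp add: complex_linearD[OF cl] K_left scaleC_complex_def algebra_simps)
      then have "cmod (\<phi> m - K m w) = Re (\<phi> (u *\<^sub>C m)) - Re (K (u *\<^sub>C m) w)"
        unfolding u(2) by (metis Re_complex_of_real minus_complex.sel(1))
      also have "\<dots> \<le> \<epsilon> * norm (u *\<^sub>C m)" using w[of "u *\<^sub>C m"] by simp
      finally show ?thesis by (simp add: norm_scaleC u)
    qed
    then show ?thesis by blast
  qed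
  have "\<exists>w. \<forall>m. cmod (\<phi> m - K m w) \<le> (1 / real (Suc n)) * norm m" for n
    by (rule approx) simp
  then obtain w where w: "\<And>n m. cmod (\<phi> m - K m (w n)) \<le> (1 / real (Suc n)) * norm m" by metis
  have diff: "norm (w k - w l) \<le> 1 / real (Suc k) + 1 / real (Suc l)" for k l
  proof -
    obtain m where m: "norm m \<le> 1" "norm (w k - w l) \<le> cmod (K m (w k - w l))" by (rule K_norming)
    have "K m (w k - w l) = (\<phi> m - K m (w l)) - (\<phi> m - K m (w k))" by (simp add: K_right)
    then have "cmod (K m (w k - w l)) \<le> cmod (\<phi> m - K m (w l)) + cmod (\<phi> m - K m (w k))"
      by (simp only: norm_triangle_ineq4)
    also have "\<dots> \<le> (1 / real (Suc l)) * 1 + (1 / real (Suc k)) * 1"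
      by (intro add_mono order_trans[OF w] mult_left_mono m) auto
    finally show ?thesis using m by simp
  qed
  have inv0: "(\<lambda>n. 1 / real (Suc n)) \<longlonglongrightarrow> 0"
    using LIMSEQ_inverse_real_of_nat by (simp add: inverse_eq_divide)
  have "Cauchy w"
  proof (rule metric_CauchyI)
    fix \<epsilon> :: real assume "0 < \<epsilon>"
    then have "\<forall>\<^sub>F n in sequentially. 1 / real (Suc n) < \<epsilon> / 2" using order_tendstoD(2)[OF inv0, of "\<epsilon>/2"] by simp
    then obtain M where M: "\<And>n. n \<ge> M \<Longrightarrow> 1 / real (Suc n) < \<epsilon> / 2" by (auto simp: eventually_sequentially)
    show "\<exists>M. \<forall>k\<ge>M. \<forall>l\<ge>M. dist (w k) (w l) < \<epsilon>"
    proof (intro exI[of _ M] allI impI)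
      fix k l assume "k \<ge> M" "l \<ge> M"
      then show "dist (w k) (w l) < \<epsilon>" using diff[of k l] M[of k] M[of l] by (simp add: dist_norm)
    qed
  qed
  then obtain y where y: "w \<longlonglongrightarrow> y" using Cauchy_convergent convergent_def by blast
  have "\<phi> m = K m y" for m
  proof -
    have "(\<lambda>n. \<phi> m - K m (w n)) \<longlonglongrightarrow> \<phi> m - K m y"
      by (intro tendsto_diff tendsto_const blinfun.tendsto y)
    moreover have "(\<lambda>n. \<phi> m - K m (w n)) \<longlonglongrightarrow> 0"
    proof (rule Lim_null_comparison)
      show "\<forall>\<^sub>F n in sequentially. cmod (\<phi> m - K m (w n)) \<le> (1 / real (Suc n)) * norm m"
        using w by (simp add: always_eventually)
      show "(\<lambda>n. (1 / real (Suc n)) * norm m) \<longlonglongrightarrow> 0" using tendsto_mult_right[OF inv0, of "norm m"] by simp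
    qed
    ultimately have "\<phi> m - K m y = 0" by (rule LIMSEQ_unique)
    then show ?thesis by simp
  qed
  then show ?thesis using that by blast
qed

lemma predual_iff: "\<phi> \<in> predual K \<longleftrightarrow> complex_linear (blinfun_apply \<phi>) \<and> ball_continuous \<phi>"
proof
  assume \<phi>: "\<phi> \<in> predual K"
  then have "((\<lambda>i. \<phi> (m i)) \<longlongrightarrow> \<phi> 0) F" if "wlim K F m 0" for F and m :: "'y set \<Rightarrow> 'm"
    using weak_star_continuous_wlim[OF _ that, of "blinfun_apply \<phi>"] by (simp add: predual_def)
  then show "complex_linear (blinfun_apply \<phi>) \<and> ball_continuous \<phi>"
    using \<phi> by (simp add: predual_def ball_continuous_def blinfun.zero_right)
next
  assume *: "complex_linear (blinfun_apply \<phi>) \<and> ball_continuous \<phi>"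
  then obtain y where y: "\<And>m. \<phi> m = K m y" using ball_continuous_representation by blast
  have "continuous_map (weak_star_topology K) euclidean ((\<lambda>f. blinfun_apply f y) \<circ> K)"
    unfolding weak_star_topology_def
    by (rule continuous_map_pullback[OF strong_operator_topology_continuous_evaluation])
  moreover have "(\<lambda>f. blinfun_apply f y) \<circ> K = blinfun_apply \<phi>" by (auto simp: y)
  ultimately show "\<phi> \<in> predual K" using * by (simp add: predual_def)
qed

text \<open>Continuity on the unit ball is preserved by norm limits, unlike pointwise evaluation at a fixed
  element; this is the reason for the characterization \<open>predual_iff\<close>.\<close>

lemma closed_predual: "closed (predual K)"
  unfolding closed_sequential_limits
proof (intro allI impI, elim conjE)
  fix \<phi> :: "nat \<Rightarrow> 'm \<Rightarrow>\<^sub>L complex" and \<psi>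
  assume \<phi>: "\<forall>n. \<phi> n \<in> predual K" and lim: "\<phi> \<longlonglongrightarrow> \<psi>"
  have pt: "(\<lambda>n. \<phi> n m) \<longlonglongrightarrow> \<psi> m" for m by (intro blinfun.tendsto lim tendsto_const)
  have cl: "complex_linear (blinfun_apply (\<phi> n))" and bc: "ball_continuous (\<phi> n)" for n
    using \<phi> by (auto simp: predual_iff)
  have "\<psi> (c *\<^sub>C m) = c *\<^sub>C \<psi> m" for c m
  proof (rule LIMSEQ_unique[OF pt])
    show "(\<lambda>n. \<phi> n (c *\<^sub>C m)) \<longlonglongrightarrow> c *\<^sub>C \<psi> m"
      unfolding complex_linearD(2)[OF cl] scaleC_complex_def by (intro tendsto_mult_left pt)
  qed
  then have "complex_linear (blinfun_apply \<psi>)" by (simp add: complex_linear_def blinfun.add_right)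
  moreover have "ball_continuous \<psi>"
    unfolding ball_continuous_def
  proof (intro allI impI)
    fix F :: "'y set filter" and m
    assume F: "F \<noteq> bot" and m: "\<forall>i. norm (m i) \<le> 1" and w: "wlim K F m 0"
    show "((\<lambda>i. \<psi> (m i)) \<longlongrightarrow> 0) F"
      unfolding tendsto_iff
    proof (intro allI impI)
      fix \<epsilon> :: real assume \<epsilon>: "0 < \<epsilon>"
      then have "\<forall>\<^sub>F n in sequentially. dist (\<phi> n) \<psi> < \<epsilon>/2" by (intro tendstoD[OF lim]) simp
      then obtain n where n: "dist (\<phi> n) \<psi> < \<epsilon>/2" using eventually_happens'[OF sequentially_bot] by blast
      have "((\<lambda>i. \<phi> n (m i)) \<longlongrightarrow> 0) F" using bc F m w by (simp add: ball_continuous_def)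
      then have "\<forall>\<^sub>F i in F. dist (\<phi> n (m i)) 0 < \<epsilon>/2" using \<epsilon> by (intro tendstoD) simp_all
      then show "\<forall>\<^sub>F i in F. dist (\<psi> (m i)) 0 < \<epsilon>"
      proof eventually_elim
        case (elim i)
        have "norm ((\<psi> - \<phi> n) (m i)) \<le> norm (\<psi> - \<phi> n) * norm (m i)" by (rule norm_blinfun)
        also have "\<dots> \<le> norm (\<psi> - \<phi> n) * 1" using m by (intro mult_left_mono) auto
        finally have "norm (\<psi> (m i) - \<phi> n (m i)) < \<epsilon>/2"
          using n by (simp add: blinfun.diff_left dist_norm norm_minus_commute)
        then show ?case using elim norm_triangle_sub[of "\<psi> (m i)" "\<phi> n (m i)"] by simp
      qed
    qed
  qed
  ultimately show "\<psi> \<in> predual K" by (simp add: predual_iff)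
qed

lemma predual_add: "\<phi> \<in> predual K \<Longrightarrow> \<psi> \<in> predual K \<Longrightarrow> \<phi> + \<psi> \<in> predual K"
  and predual_scaleC: "\<phi> \<in> predual K \<Longrightarrow> c *\<^sub>C \<phi> \<in> predual K"
  and predual_zero: "0 \<in> predual K"
proof -
  have add: "ball_continuous (\<phi> + \<psi>)" if "ball_continuous \<phi>" "ball_continuous \<psi>" for \<phi> \<psi>
    unfolding ball_continuous_def
  proof (intro allI impI)
    fix F :: "'y set filter" and m
    assume "F \<noteq> bot" "\<forall>i. norm (m i) \<le> 1" "wlim K F m 0"
    then have "((\<lambda>i. \<phi> (m i) + \<psi> (m i)) \<longlongrightarrow> 0 + 0) F"
      using that by (intro tendsto_add) (auto simp: ball_continuous_def)
    then show "((\<lambda>i. (\<phi> + \<psi>) (m i)) \<longlongrightarrow> 0) F" by (simp add: blinfun.add_left)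
  qed
  have scale: "ball_continuous (c *\<^sub>C \<phi>)" if "ball_continuous \<phi>" for c \<phi>
    unfolding ball_continuous_def
  proof (intro allI impI)
    fix F :: "'y set filter" and m
    assume "F \<noteq> bot" "\<forall>i. norm (m i) \<le> 1" "wlim K F m 0"
    then have "((\<lambda>i. c * \<phi> (m i)) \<longlongrightarrow> c * 0) F"
      using that by (intro tendsto_mult_left) (auto simp: ball_continuous_def)
    then show "((\<lambda>i. (c *\<^sub>C \<phi>) (m i)) \<longlongrightarrow> 0) F" by (simp add: scaleC_complex_def)
  qed
  show "\<phi> + \<psi> \<in> predual K" if "\<phi> \<in> predual K" "\<psi> \<in> predual K"
    using that add[of \<phi> \<psi>] unfolding predual_iff
    by (simp add: complex_linear_def blinfun.add_left blinfun.add_right scaleC_add_right)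
  show "c *\<^sub>C \<phi> \<in> predual K" if "\<phi> \<in> predual K"
    using that scale[of \<phi> c] unfolding predual_iff
    by (simp add: complex_linear_def blinfun.add_right scaleC_add_right scaleC_scaleC mult.commute)
  show "0 \<in> predual K"
    by (auto simp: predual_iff complex_linear_def ball_continuous_def scaleC_complex_def)
qed

end

section \<open>Independence of the weak* topology from the predual\<close>

lemma tendsto_if_subfilters:
  assumes "\<And>F'. F' \<le> F \<Longrightarrow> F' \<noteq> bot \<Longrightarrow> \<exists>F''\<le>F'. F'' \<noteq> bot \<and> (f \<longlongrightarrow> l) F''"
  shows "(f \<longlongrightarrow> l) F"
proof (rule topological_tendstoI, rule ccontr)
  fix U assume U: "open U" "l \<in> U" and no: "\<not> (\<forall>\<^sub>F i in F. f i \<in> U)"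
  define F' where "F' = inf F (principal {i. f i \<notin> U})"
  have "F' \<noteq> bot"
    using no by (auto simp: F'_def trivial_limit_def eventually_inf_principal elim: eventually_mono)
  moreover have "F' \<le> F" by (simp add: F'_def)
  ultimately obtain F'' where F'': "F'' \<le> F'" "F'' \<noteq> bot" "(f \<longlongrightarrow> l) F''" using assms by blast
  have "\<forall>\<^sub>F i in F'. f i \<notin> U" by (simp add: F'_def eventually_inf_principal)
  then have "\<forall>\<^sub>F i in F''. f i \<notin> U" by (rule filter_leD[OF F''(1)])
  moreover have "\<forall>\<^sub>F i in F''. f i \<in> U" using F''(3) U by (rule topological_tendstoD)
  ultimately have "\<forall>\<^sub>F i in F''. False" by eventually_elim simp
  with F'' show False by simp
qed

locale traced_jbw_star_algebra =
  A: normal_finite_faithful_trace jpA J \<tau> + associated_jbw_star_algebra jpA J jpM star K \<iota>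
  for jpA :: "'a::banach \<Rightarrow> 'a \<Rightarrow> 'a"  (infixl "\<diamondop>" 70)
    and J :: "'a \<Rightarrow> ('x::banach \<Rightarrow>\<^sub>L real)"
    and \<tau> :: "'a \<Rightarrow> real"
    and jpM :: "'m::complex_banach \<Rightarrow> 'm \<Rightarrow> 'm"  (infixl "\<odot>" 70)
    and star :: "'m \<Rightarrow> 'm"
    and K :: "'m \<Rightarrow> ('y::complex_banach \<Rightarrow>\<^sub>L complex)"
    and \<iota> :: "'a \<Rightarrow> 'm"
begin

lemmas iota_simps [simp] = linear_add[OF iota_linear] linear_diff[OF iota_linear]
  linear_scale[OF iota_linear] linear_neg[OF iota_linear] linear_0[OF iota_linear] iota_isometric

lemma inj_iota: "inj \<iota>"
proof (rule injI)
  fix a b assume "\<iota> a = \<iota> b"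
  then have "norm (\<iota> (a - b)) = 0" by simp
  then show "a = b" by (simp only: iota_isometric) simp
qed

lemma iota_eq_iff [simp]: "\<iota> a = \<iota> b \<longleftrightarrow> a = b"
  using inj_iota by (simp add: inj_eq)

lemma star_iota [simp]: "star (\<iota> a) = \<iota> a"
  using iota_range by blast

lemma jpM_scaleC_right: "x \<odot> (c *\<^sub>C y) = c *\<^sub>C (x \<odot> y)"
  by (metis jp_scaleC jp_commute)

definition cpx :: "'a \<Rightarrow> 'a \<Rightarrow> 'm"
  where "cpx a b = \<iota> a + \<i> *\<^sub>C \<iota> b"

definition re :: "'m \<Rightarrow> 'a" where "re m = inv \<iota> ((1/2) *\<^sub>C (m + star m))"
definition im :: "'m \<Rightarrow> 'a" where "im m = inv \<iota> ((- \<i>/2) *\<^sub>C (m - star m))"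

lemma star_diff: "star (x - y) = star x - star y"
  using star_add[of "x - y" y] by simp

lemma iota_re: "\<iota> (re m) = (1/2) *\<^sub>C (m + star m)"
proof -
  have "star ((1/2) *\<^sub>C (m + star m)) = (1/2) *\<^sub>C (m + star m)"
    by (simp add: star_scaleC star_add star_star add.commute)
  then have "(1/2) *\<^sub>C (m + star m) \<in> range \<iota>" using iota_range by blast
  then show ?thesis unfolding re_def by (rule f_inv_into_f)
qed

lemma iota_im: "\<iota> (im m) = (- \<i>/2) *\<^sub>C (m - star m)"
proof -
  have "star ((- \<i>/2) *\<^sub>C (m - star m)) = (\<i>/2) *\<^sub>C (star m - m)"
    by (simp add: star_scaleC star_diff star_star)
  also have "\<dots> = (- (\<i>/2)) *\<^sub>C (m - star m)"
    unfolding scaleC_minus_left scaleC_minus_right[symmetric] by simp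
  finally have "(- \<i>/2) *\<^sub>C (m - star m) \<in> range \<iota>" using iota_range by simp
  then show ?thesis unfolding im_def by (rule f_inv_into_f)
qed

lemma cpx_re_im: "cpx (re m) (im m) = m"
proof -
  have "cpx (re m) (im m) = (1/2) *\<^sub>C (m + star m) + (1/2) *\<^sub>C (m - star m)"
    by (simp add: cpx_def iota_re iota_im scaleC_scaleC)
  also have "\<dots> = (1/2) *\<^sub>C (m + m)" by (simp add: scaleC_add_right[symmetric])
  also have "\<dots> = (1/2 + 1/2) *\<^sub>C m" by (simp only: scaleC_add_left scaleC_add_right)
  finally show ?thesis by (simp add: scaleC_simps)
qed

lemma star_cpx: "star (cpx a b) = cpx a (- b)"
  by (simp add: cpx_def star_add star_scaleC scaleC_simps)

lemma re_cpx [simp]: "re (cpx a b) = a" and im_cpx [simp]: "im (cpx a b) = b"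
proof -
  have "\<iota> (re (cpx a b)) = (1/2) *\<^sub>C (\<iota> a + \<iota> a)"
    unfolding iota_re star_cpx by (simp add: cpx_def scaleC_simps)
  also have "\<dots> = (1/2 + 1/2) *\<^sub>C \<iota> a" by (simp only: scaleC_add_left scaleC_add_right)
  finally show "re (cpx a b) = a" by (simp add: scaleC_simps)
  have "\<iota> (im (cpx a b)) = (- \<i>/2) *\<^sub>C (\<i> *\<^sub>C \<iota> b + \<i> *\<^sub>C \<iota> b)"
    unfolding iota_im star_cpx by (simp add: cpx_def scaleC_simps)
  also have "\<dots> = ((- \<i>/2) * \<i> + (- \<i>/2) * \<i>) *\<^sub>C \<iota> b" by (simp only: scaleC_add_left scaleC_add_right scaleC_scaleC)
  finally show "im (cpx a b) = b" by (simp add: scaleC_simps)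
qed

lemma cpx_eq_iff: "cpx a b = cpx c d \<longleftrightarrow> a = c \<and> b = d"
  by (metis re_cpx im_cpx)

lemma cpx_add: "cpx a b + cpx c d = cpx (a + c) (b + d)"
  and cpx_diff: "cpx a b - cpx c d = cpx (a - c) (b - d)"
  and cpx_scaleR: "r *\<^sub>R cpx a b = cpx (r *\<^sub>R a) (r *\<^sub>R b)"
  and cpx_real: "cpx a 0 = \<iota> a" and cpx_zero: "cpx 0 0 = 0"
  by (simp_all add: cpx_def scaleC_add_right scaleC_simps scaleR_add_right algebra_simps)

lemma cpx_scaleC: "c *\<^sub>C cpx a b = cpx (Re c *\<^sub>R a - Im c *\<^sub>R b) (Re c *\<^sub>R b + Im c *\<^sub>R a)"
proof -
  have "c *\<^sub>C cpx a b = (complex_of_real (Re c) + \<i> * complex_of_real (Im c)) *\<^sub>C cpx a b"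
    by (metis complex_eq)
  also have "\<dots> = cpx (Re c *\<^sub>R a - Im c *\<^sub>R b) (Re c *\<^sub>R b + Im c *\<^sub>R a)"
    by (simp add: cpx_def scaleC_add_right scaleC_add_left scaleC_scaleC scaleR_scaleC scaleC_simps algebra_simps)
  finally show ?thesis .
qed

lemma re_add: "re (m + n) = re m + re n" and im_add: "im (m + n) = im m + im n"
proof -
  have "m + n = cpx (re m + re n) (im m + im n)" by (simp only: cpx_add[symmetric] cpx_re_im)
  then show "re (m + n) = re m + re n" "im (m + n) = im m + im n" by simp_all
qed

lemma re_scaleC: "re (c *\<^sub>C m) = Re c *\<^sub>R re m - Im c *\<^sub>R im m"
  and im_scaleC: "im (c *\<^sub>C m) = Re c *\<^sub>R im m + Im c *\<^sub>R re m"
proof -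
  have "c *\<^sub>C m = cpx (Re c *\<^sub>R re m - Im c *\<^sub>R im m) (Re c *\<^sub>R im m + Im c *\<^sub>R re m)"
    by (simp only: cpx_scaleC[symmetric] cpx_re_im)
  then show "re (c *\<^sub>C m) = Re c *\<^sub>R re m - Im c *\<^sub>R im m" "im (c *\<^sub>C m) = Re c *\<^sub>R im m + Im c *\<^sub>R re m"
    by simp_all
qed

lemma cpx_mult: "cpx a b \<odot> cpx c d = cpx (a \<diamondop> c - b \<diamondop> d) (a \<diamondop> d + b \<diamondop> c)"
  by (simp add: cpx_def jp_scaleC jpM_scaleC_right scaleC_scaleC iota_jp scaleC_add_right scaleC_simps algebra_simps)

lemma iota_mult_cpx: "\<iota> a \<odot> cpx b c = cpx (a \<diamondop> b) (a \<diamondop> c)"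
  using cpx_mult[of a 0 b c] by (simp add: cpx_real)

lemma norm_re_le: "norm (re m) \<le> norm m"
proof -
  have "norm (re m) = norm ((1/2) *\<^sub>C (m + star m))" by (simp flip: iota_re)
  also have "\<dots> \<le> (1/2) * (norm m + norm (star m))"
    by (simp add: norm_scaleC norm_triangle_ineq)
  finally show ?thesis by (simp add: norm_star)
qed

lemma norm_im_le: "norm (im m) \<le> norm m"
proof -
  have "norm (im m) = norm ((- \<i>/2) *\<^sub>C (m - star m))"
    using iota_isometric[of "im m"] by (simp only: iota_im)
  also have "\<dots> \<le> (1/2) * (norm m + norm (star m))"
    by (simp add: norm_scaleC norm_triangle_ineq4 norm_divide)
  finally show ?thesis by (simp add: norm_star)
qed

text \<open>The triple product of \<open>z = a + ib\<close>, with \<open>a\<close> and \<open>b\<close> in an associative subalgebra, is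
  \<open>(a\<^sup>2 + b\<^sup>2) z\<close>.\<close>

lemma norm_cpx_square_le:
  assumes B: "A.associative_subalgebra B" and a: "a \<in> B" and b: "b \<in> B"
  shows "(norm (cpx a b))\<^sup>2 \<le> norm (a \<diamondop> a + b \<diamondop> b)"
proof -
  note B' = A.associative_subalgebraD[OF B]
  define s where "s = a \<diamondop> a + b \<diamondop> b"
  let ?z = "cpx a b"
  have 1: "(a \<diamondop> b) \<diamondop> b = (b \<diamondop> b) \<diamondop> a" "(a \<diamondop> b) \<diamondop> a = (a \<diamondop> a) \<diamondop> b"
  proof -
    have "(a \<diamondop> b) \<diamondop> b = a \<diamondop> (b \<diamondop> b)" by (rule B'(5)[OF a b])
    then show "(a \<diamondop> b) \<diamondop> b = (b \<diamondop> b) \<diamondop> a" by (simp only: A.jp_commute)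
    have "(a \<diamondop> b) \<diamondop> a = a \<diamondop> (b \<diamondop> a)" by (rule B'(5)[OF a a])
    also have "\<dots> = (a \<diamondop> a) \<diamondop> b" using B'(5)[OF a b, of a] by (simp only: A.jp_commute[of b a])
    finally show "(a \<diamondop> b) \<diamondop> a = (a \<diamondop> a) \<diamondop> b" .
  qed
  have zz: "?z \<odot> star ?z = cpx s 0" "star ?z \<odot> ?z = cpx s 0"
    by (simp_all add: star_cpx cpx_mult s_def A.jp_commute[of b a])
  have "?z \<odot> ?z = cpx (a \<diamondop> a - b \<diamondop> b) (2 *\<^sub>R (a \<diamondop> b))"
    by (simp add: cpx_mult A.jp_commute[of b a] scaleR_2)
  then have "jordan_triple (\<odot>) ?z (star ?z) ?z = cpx (s \<diamondop> a) (s \<diamondop> b)"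
    unfolding jordan_triple_def zz
    by (simp add: star_cpx cpx_mult cpx_add cpx_diff cpx_eq_iff s_def 1 scaleR_2)
  also have "\<dots> = \<iota> s \<odot> ?z" by (simp add: iota_mult_cpx)
  finally have "norm ?z ^ 3 = norm (\<iota> s \<odot> ?z)" using norm_triple[of ?z] by simp
  also have "\<dots> \<le> norm s * norm ?z" using norm_jp_le[of "\<iota> s" ?z] by simp
  finally have "(norm ?z)\<^sup>2 * norm ?z \<le> norm s * norm ?z" by (simp add: power3_eq_cube power2_eq_square)
  then show ?thesis
    unfolding s_def by (cases "norm ?z = 0") auto
qed

lemma norm_cpx_unit_le:
  assumes "norm a \<le> R"
  shows "(norm (cpx a (t *\<^sub>R A.e)))\<^sup>2 \<le> R\<^sup>2 + t\<^sup>2"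
proof -
  have "(norm (cpx a (t *\<^sub>R A.e)))\<^sup>2 \<le> norm (a \<diamondop> a + (t *\<^sub>R A.e) \<diamondop> (t *\<^sub>R A.e))"
    by (rule norm_cpx_square_le[OF A.gen_associative[of a]]) auto
  also have "\<dots> \<le> (norm a)\<^sup>2 + norm ((t * t) *\<^sub>R A.e)"
    by (rule order_trans[OF norm_triangle_ineq]) (simp add: A.norm_square)
  also have "\<dots> \<le> R\<^sup>2 + t\<^sup>2"
    using power_mono[OF assms norm_ge_zero, of 2] A.norm_scaleR_unit[of "t * t"] by (simp add: power2_eq_square)
  finally show ?thesis .
qed

text \<open>For selfadjoint \<open>a\<close> one has \<open>\<parallel>a + it\<parallel>\<^sup>2 \<le> \<parallel>a\<parallel>\<^sup>2 + t\<^sup>2\<close> for all real \<open>t\<close>. These norm conditions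
  pass to weak* limits and force the imaginary part to vanish.\<close>

lemma selfadjoint_closed:
  assumes F: "F \<noteq> bot" and lim: "wlim K F (\<lambda>i. \<iota> (a i)) m" and bd: "\<forall>\<^sub>F i in F. norm (a i) \<le> R"
  obtains c where "m = \<iota> c" "norm c \<le> R"
proof -
  define b where "b = im m"
  have shift: "(norm (b + t *\<^sub>R A.e))\<^sup>2 \<le> R\<^sup>2 + t\<^sup>2" for t
  proof -
    have eq: "cpx (a i) (t *\<^sub>R A.e) = \<iota> (a i) + cpx 0 (t *\<^sub>R A.e)" for i
      by (simp add: cpx_def)
    have "wlim K F (\<lambda>i. cpx (a i) (t *\<^sub>R A.e)) (m + cpx 0 (t *\<^sub>R A.e))"
      unfolding eq by (intro wlim_add K_linear lim wlim_const)
    then have "norm (m + cpx 0 (t *\<^sub>R A.e)) \<le> sqrt (R\<^sup>2 + t\<^sup>2)"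
    proof (rule K_norm_le[OF F])
      show "\<forall>\<^sub>F i in F. norm (cpx (a i) (t *\<^sub>R A.e)) \<le> sqrt (R\<^sup>2 + t\<^sup>2)"
        using bd by eventually_elim (intro real_le_rsqrt norm_cpx_unit_le)
    qed
    moreover have "m + cpx 0 (t *\<^sub>R A.e) = cpx (re m) (b + t *\<^sub>R A.e)"
      using cpx_re_im[of m] cpx_add[of "re m" "im m" 0 "t *\<^sub>R A.e"] by (simp add: b_def)
    ultimately have "norm (b + t *\<^sub>R A.e) \<le> sqrt (R\<^sup>2 + t\<^sup>2)"
      using norm_im_le[of "cpx (re m) (b + t *\<^sub>R A.e)"] by simp
    from power_mono[OF this norm_ge_zero, of 2] show ?thesis by simp
  qed
  have lin: "A.pos (R\<^sup>2 *\<^sub>R A.e - (2 * t) *\<^sub>R b)" for t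
  proof -
    let ?u = "b + t *\<^sub>R A.e"
    have "A.pos ((R\<^sup>2 + t\<^sup>2) *\<^sub>R A.e - ?u \<diamondop> ?u)"
      by (rule A.pos_unit_minus) (simp only: A.norm_square shift)
    then have "A.pos ((R\<^sup>2 + t\<^sup>2) *\<^sub>R A.e - ?u \<diamondop> ?u + b \<diamondop> b)" by (intro A.pos_add A.pos_square)
    also have "(R\<^sup>2 + t\<^sup>2) *\<^sub>R A.e - ?u \<diamondop> ?u + b \<diamondop> b = R\<^sup>2 *\<^sub>R A.e - (2 * t) *\<^sub>R b"
      by (simp add: algebra_simps power2_eq_square flip: scaleR_2)
    finally show ?thesis .
  qed
  have pm: "A.pos ((-\<sigma>) *\<^sub>R b)" if \<sigma>: "\<sigma> = 1 \<or> \<sigma> = -1" for \<sigma> :: real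
  proof (rule A.pos_limit[OF sequentially_bot])
    have "(\<lambda>n. ((R\<^sup>2 / 2) * (1 / real (Suc n))) *\<^sub>R A.e - \<sigma> *\<^sub>R b) \<longlonglongrightarrow> ((R\<^sup>2 / 2) * 0) *\<^sub>R A.e - \<sigma> *\<^sub>R b"
      by (intro tendsto_intros) (use LIMSEQ_inverse_real_of_nat in \<open>simp add: inverse_eq_divide\<close>)
    then show "(\<lambda>n. ((R\<^sup>2 / 2) * (1 / real (Suc n))) *\<^sub>R A.e - \<sigma> *\<^sub>R b) \<longlonglongrightarrow> (-\<sigma>) *\<^sub>R b" by simp
    have "A.pos (((R\<^sup>2 / 2) * (1 / real (Suc n))) *\<^sub>R A.e - \<sigma> *\<^sub>R b)" for n
    proof -
      have "A.pos ((1 / (2 * real (Suc n))) *\<^sub>R (R\<^sup>2 *\<^sub>R A.e - (2 * (\<sigma> * real (Suc n))) *\<^sub>R b))"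
        by (intro A.pos_scale lin) simp
      also have "(1 / (2 * real (Suc n))) *\<^sub>R (R\<^sup>2 *\<^sub>R A.e - (2 * (\<sigma> * real (Suc n))) *\<^sub>R b)
        = ((R\<^sup>2 / 2) * (1 / real (Suc n))) *\<^sub>R A.e - \<sigma> *\<^sub>R b"
        by (simp add: scaleR_diff_right field_simps del: of_nat_Suc)
      finally show ?thesis .
    qed
    then show "\<forall>\<^sub>F n in sequentially. A.pos (((R\<^sup>2 / 2) * (1 / real (Suc n))) *\<^sub>R A.e - \<sigma> *\<^sub>R b)" by simp
  qed
  have "A.pos b" "A.pos (- b)" using pm[of "-1"] pm[of 1] by simp_all
  then have "b = 0" by (rule A.pos_antisym)
  then have "m = \<iota> (re m)" using cpx_re_im[of m] by (simp add: b_def cpx_real)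
  moreover have "norm m \<le> R" by (rule K_norm_le[OF F lim]) (use bd in simp)
  ultimately show ?thesis using that[of "re m"] norm_re_le[of m] by simp
qed

text \<open>Positivity of \<open>a\<close> with \<open>\<parallel>a\<parallel> \<le> R\<close> is the norm condition \<open>\<parallel>R - a\<parallel> \<le> R\<close>.\<close>

lemma wlim_K_pos:
  assumes F: "F \<noteq> bot" and lim: "wlim K F (\<lambda>i. \<iota> (a i)) (\<iota> c)" and p: "\<forall>\<^sub>F i in F. A.pos (a i)"
    and bd: "\<forall>\<^sub>F i in F. norm (a i) \<le> R"
  shows "A.pos c"
proof -
  have "wlim K F (\<lambda>i. \<iota> (R *\<^sub>R A.e) - \<iota> (a i)) (\<iota> (R *\<^sub>R A.e) - \<iota> c)"
    by (intro wlim_diff K_linear wlim_const lim)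
  then have "norm (\<iota> (R *\<^sub>R A.e) - \<iota> c) \<le> R"
  proof (rule K_norm_le[OF F])
    show "\<forall>\<^sub>F i in F. norm (\<iota> (R *\<^sub>R A.e) - \<iota> (a i)) \<le> R"
      using p bd
    proof eventually_elim
      case (elim i)
      then show ?case using A.pos_norm_unit_minus[of "a i" R] iota_isometric[of "R *\<^sub>R A.e - a i"]
        unfolding iota_simps(2) by simp
    qed
  qed
  then have "norm (R *\<^sub>R A.e - c) \<le> R" using iota_isometric[of "R *\<^sub>R A.e - c"] unfolding iota_simps(2) by simp
  then show ?thesis by (auto simp: A.pos_def)
qed

lemma K_selfadjoint_compact:
  assumes F: "F \<noteq> bot" and bd: "\<forall>\<^sub>F i in F. norm (a i) \<le> R"
  obtains F' c where "F' \<le> F" "F' \<noteq> bot" "norm c \<le> R" "wlim K F' (\<lambda>i. \<iota> (a i)) (\<iota> c)"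
proof -
  obtain F' m where F': "F' \<le> F" "F' \<noteq> bot" "norm m \<le> R" "wlim K F' (\<lambda>i. \<iota> (a i)) m"
    using K_ball_compact[OF F, of "\<lambda>i. \<iota> (a i)" R] bd by auto
  obtain c where "m = \<iota> c" "norm c \<le> R"
    using selfadjoint_closed[OF F'(2,4) filter_leD[OF F'(1) bd]] .
  with F' that show ?thesis by blast
qed

text \<open>From \<open>-T\<^sub>n \<le> b \<le> T\<^sub>n\<close> and \<open>\<tau>(T\<^sub>n) \<rightarrow> 0\<close> one gets \<open>\<tau>(b z) = 0\<close> for all positive \<open>z\<close>, in particular for
  \<open>z = \<parallel>b\<parallel> + b\<close>.\<close>

lemma bounded_below_trace_zero:
  assumes T: "\<And>n::nat. A.pos (T n - b)" "\<And>n. A.pos (T n + b)" and lim: "(\<lambda>n. \<tau> (T n)) \<longlonglongrightarrow> 0"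
  shows "b = 0"
proof -
  have zero: "\<tau> (b \<diamondop> z) = 0" if z: "A.pos z" for z
  proof -
    have "\<bar>\<tau> (b \<diamondop> z)\<bar> \<le> norm z * \<tau> (T n)" for n
    proof -
      have "A.pos (2 *\<^sub>R T n)" using A.pos_add[OF T(1)[of n] T(2)[of n]] by (simp add: scaleR_2)
      then have p: "A.pos (T n)" using A.pos_scale[of "2 *\<^sub>R T n" "1/2"] by simp
      have "0 \<le> \<tau> ((T n - b) \<diamondop> z)" "0 \<le> \<tau> ((T n + b) \<diamondop> z)"
        using T z by (auto intro: A.trace_mult_nonneg simp del: A.jp_bilinear_simps)
      moreover have "\<tau> (T n \<diamondop> z) \<le> norm z * \<tau> (T n)"
        using A.trace_mult_le[OF p, of z] by (simp add: A.jp_commute[of z])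
      ultimately show ?thesis by simp
    qed
    then have "\<bar>\<tau> (b \<diamondop> z)\<bar> \<le> norm z * 0"
      by (intro LIMSEQ_le_const[OF tendsto_mult_left[OF lim]]) auto
    then show ?thesis by simp
  qed
  have "A.pos (norm b *\<^sub>R A.e + b)" by (rule A.pos_unit_plus) simp
  from zero[OF this] zero[OF A.pos_unit] have "\<tau> (b \<diamondop> b) = 0" by simp
  then show ?thesis using A.trace_square_zero by simp
qed

text \<open>A convex subset of the unit ball that eventually contains a net converging to \<open>0\<close> weakly in
  \<open>L\<^sup>2\<close> contains elements of arbitrarily small \<open>L\<^sup>2\<close>-norm.\<close>

lemma convex_small_l2:
  assumes C: "convex C" "\<And>b. b \<in> C \<Longrightarrow> norm b \<le> 1" and F: "F \<noteq> bot" and d: "\<forall>\<^sub>F i in F. d i \<in> C"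
    and lim: "\<And>x. ((\<lambda>i. \<tau> (x \<diamondop> d i)) \<longlongrightarrow> 0) F" and \<epsilon>: "0 < \<epsilon>"
  obtains b where "b \<in> C" "\<tau> (b \<diamondop> b) < \<epsilon>"
proof (rule ccontr)
  assume no: "\<not> thesis"
  define D where "D = (INF b\<in>C. \<tau> (b \<diamondop> b))"
  obtain i where "d i \<in> C" using eventually_happens'[OF F d] by blast
  then have ne: "C \<noteq> {}" by blast
  have bdd: "bdd_below ((\<lambda>b. \<tau> (b \<diamondop> b)) ` C)" by (intro bdd_belowI2[of _ 0]) simp
  have low: "D \<le> \<tau> (b \<diamondop> b)" if "b \<in> C" for b unfolding D_def by (rule cINF_lower[OF bdd that])
  have D: "0 < D"
  proof -
    have "\<epsilon> \<le> D" unfolding D_def using no that ne by (intro cINF_greatest) (auto simp: not_less[symmetric])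
    with \<epsilon> show ?thesis by simp
  qed
  \<comment> \<open>Moving from a near minimizer \<open>b\<close> by a step \<open>s\<close> towards \<open>d i\<close> cannot decrease the square norm by
    more than the error in \<open>b\<close>; so \<open>\<tau>(b \<circ> d i)\<close> stays above \<open>D/2\<close>.\<close>
  define s where "s = min 1 (D / (8 * (\<tau> A.e + 1)))"
  have te: "0 < \<tau> A.e + 1" by (simp add: add_nonneg_pos)
  have s: "0 < s" "s \<le> 1" using D te by (auto simp: s_def)
  have "s * (\<tau> A.e + 1) \<le> D / (8 * (\<tau> A.e + 1)) * (\<tau> A.e + 1)"
    using te by (intro mult_right_mono) (auto simp: s_def)
  also have "\<dots> = D / 8"
  proof -
    have "D / (8 * q) * q = D / 8" if "0 < q" for q using that by simp
    from this[OF te] show ?thesis .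
  qed
  finally have s2: "s * \<tau> A.e \<le> D / 8" using s by (simp add: algebra_simps)
  obtain b where b: "b \<in> C" "\<tau> (b \<diamondop> b) < D + s * D / 2"
  proof -
    have "D < D + s * D / 2" using s D by simp
    then have "(INF b\<in>C. \<tau> (b \<diamondop> b)) < D + s * D / 2" by (simp only: D_def)
    then obtain b where "b \<in> C" "\<tau> (b \<diamondop> b) < D + s * D / 2"
      unfolding cINF_less_iff[OF ne bdd] by blast
    then show ?thesis using that by blast
  qed
  have "\<forall>\<^sub>F i in F. D / 2 \<le> \<tau> (b \<diamondop> d i)"
    using d
  proof eventually_elim
    case (elim i)
    have "(1 - s) *\<^sub>R b + s *\<^sub>R d i \<in> C" using C(1) b elim s by (intro convexD_alt) auto
    then have "D \<le> \<tau> (((1 - s) *\<^sub>R b + s *\<^sub>R d i) \<diamondop> ((1 - s) *\<^sub>R b + s *\<^sub>R d i))" by (rule low)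
    also have "(1 - s) *\<^sub>R b + s *\<^sub>R d i = b + s *\<^sub>R (d i - b)" by (simp add: algebra_simps)
    also have "\<tau> ((b + s *\<^sub>R (d i - b)) \<diamondop> (b + s *\<^sub>R (d i - b)))
      = \<tau> (b \<diamondop> b) + 2 * s * \<tau> (b \<diamondop> (d i - b)) + s * (s * \<tau> ((d i - b) \<diamondop> (d i - b)))"
      by (simp add: A.jp_commute[of "d i" b] algebra_simps)
    also have "\<tau> ((d i - b) \<diamondop> (d i - b)) \<le> \<tau> A.e * 4"
    proof -
      have "norm (d i - b) \<le> 2" using norm_triangle_ineq4[of "d i" b] C(2)[OF elim] C(2)[OF b(1)] by simp
      then have "(norm (d i - b))\<^sup>2 \<le> 4" using power_mono[of "norm (d i - b)" 2 2] by simp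
      then show ?thesis using A.trace_square_le[of "d i - b"] mult_left_mono[OF _ A.trace_unit_nonneg] by fastforce
    qed
    then have "s * (s * \<tau> ((d i - b) \<diamondop> (d i - b))) \<le> s * (s * (\<tau> A.e * 4))"
      using s by (intro mult_left_mono) auto
    also have "s * (s * (\<tau> A.e * 4)) = s * 4 * (s * \<tau> A.e)" by simp
    also have "\<dots> \<le> s * 4 * (D / 8)" using s s2 by (intro mult_left_mono) auto
    finally have "D \<le> \<tau> (b \<diamondop> b) + 2 * s * \<tau> (b \<diamondop> (d i - b)) + s * 4 * (D / 8)" by simp
    then have "0 \<le> s * (D + 2 * \<tau> (b \<diamondop> d i) - 2 * \<tau> (b \<diamondop> b))"
      using b(2) by (simp add: algebra_simps)
    then have "0 \<le> D + 2 * \<tau> (b \<diamondop> d i) - 2 * \<tau> (b \<diamondop> b)" using s by (simp add: zero_le_mult_iff)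
    then show ?case using low[OF b(1)] by simp
  qed
  moreover have "\<forall>\<^sub>F i in F. \<tau> (b \<diamondop> d i) < D / 2" using order_tendstoD(2)[OF lim[of b], of "D / 2"] D by simp
  ultimately have "\<forall>\<^sub>F i in F. False" by eventually_elim simp
  with F show False by simp
qed

lemma trace_abs_val_le: "(\<tau> (A.abs_val b))\<^sup>2 \<le> \<tau> A.e * \<tau> (b \<diamondop> b)"
  using A.trace_l1_le_l2[OF A.abs_val(1)[of b]] by (simp add: A.abs_val)

text \<open>A \<open>J\<close>-null net is weakly null in \<open>L\<^sup>2\<close>. If its \<open>K\<close>-limit \<open>g\<close> were nonzero, convex combinations
  would give a sequence that is null in \<open>L\<^sup>2\<close> but stays away from \<open>0\<close> with respect to \<open>K\<close>; upper bounds
  of small trace for its tails exclude this.\<close>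

lemma weak_star_limits_agree:
  assumes F: "F \<noteq> bot" and bd: "\<forall>\<^sub>F i in F. norm (a i) \<le> 1"
    and limK: "wlim K F (\<lambda>i. \<iota> (a i)) (\<iota> c)" and limJ: "wlim J F a h"
  shows "c = h"
proof (rule ccontr)
  assume "c \<noteq> h"
  define d where "d i = (1/2) *\<^sub>R (a i - h)" for i
  define g where "g = (1/2) *\<^sub>R (c - h)"
  have h: "norm h \<le> 1" by (rule A.J_norm_le[OF F limJ bd])
  have dbd: "\<forall>\<^sub>F i in F. norm (d i) \<le> 1"
    using bd
  proof eventually_elim
    case (elim i)
    then show ?case using norm_triangle_ineq4[of "a i" h] h by (simp add: d_def)
  qed
  have dK: "wlim K F (\<lambda>i. \<iota> (d i)) (\<iota> g)"
    unfolding d_def g_def iota_simps by (intro wlim_scaleR wlim_diff K_linear wlim_const limK)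
  have "wlim J F (\<lambda>i. (1/2) *\<^sub>R (a i - h)) ((1/2) *\<^sub>R (h - h))"
    by (intro wlim_scaleR wlim_diff A.dual_linear wlim_const limJ)
  then have dJ: "wlim J F d 0" by (simp add: d_def[abs_def])
  have dW: "((\<lambda>i. \<tau> (x \<diamondop> d i)) \<longlongrightarrow> 0) F" for x
    using A.trace_mult_wlim[OF dJ dbd, of x] by simp
  have "g \<noteq> 0" using \<open>c \<noteq> h\<close> by (simp add: g_def)
  then have "norm (K (\<iota> g)) \<noteq> 0" by (simp add: dual_isometric)
  then have "K (\<iota> g) \<noteq> 0" by auto
  then obtain y0 where y0: "K (\<iota> g) y0 \<noteq> 0"
    by (metis blinfun_eqI blinfun.zero_left)
  define y where "y = inverse (K (\<iota> g) y0) *\<^sub>C y0"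
  have y: "K (\<iota> g) y = 1" using y0 by (simp add: y_def K_right scaleC_complex_def)
  define C where "C = {b. norm b \<le> 1 \<and> 1/2 \<le> Re (K (\<iota> b) y)}"
  have convC: "convex C"
  proof (rule convexI)
    fix b b' and u v :: real assume *: "b \<in> C" "b' \<in> C" "0 \<le> u" "0 \<le> v" "u + v = 1"
    have "norm (u *\<^sub>R b + v *\<^sub>R b') \<le> u * norm b + v * norm b'"
      using * by (intro norm_triangle_le) simp
    also have "\<dots> \<le> u * 1 + v * 1" using * by (intro add_mono mult_left_mono) (auto simp: C_def)
    also have "\<dots> = 1" using * by simp
    finally have 1: "norm (u *\<^sub>R b + v *\<^sub>R b') \<le> 1" .
    have "u * (1/2) + v * (1/2) \<le> u * Re (K (\<iota> b) y) + v * Re (K (\<iota> b') y)"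
      using * by (intro add_mono mult_left_mono) (auto simp: C_def)
    moreover have "Re (K (\<iota> (u *\<^sub>R b + v *\<^sub>R b')) y) = u * Re (K (\<iota> b) y) + v * Re (K (\<iota> b') y)"
      by (simp add: K_left blinfun.add_left blinfun.scaleR_left)
    ultimately have "1/2 \<le> Re (K (\<iota> (u *\<^sub>R b + v *\<^sub>R b')) y)" using *(5) by linarith
    with 1 show "u *\<^sub>R b + v *\<^sub>R b' \<in> C" by (simp add: C_def)
  qed
  have dC: "\<forall>\<^sub>F i in F. d i \<in> C"
  proof -
    have "((\<lambda>i. Re (K (\<iota> (d i)) y)) \<longlongrightarrow> Re (K (\<iota> g) y)) F"
      using dK by (auto simp: wlim_def intro: tendsto_Re)
    then have "\<forall>\<^sub>F i in F. 1/2 < Re (K (\<iota> (d i)) y)"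
      by (rule order_tendstoD) (simp add: y)
    with dbd show ?thesis by eventually_elim (simp add: C_def)
  qed
  have normC: "norm b \<le> 1" if "b \<in> C" for b using that by (simp add: C_def)
  have small: "\<exists>b\<in>C. \<tau> (b \<diamondop> b) < \<epsilon>" if \<epsilon>: "0 < \<epsilon>" for \<epsilon>
    by (rule convex_small_l2[OF convC normC F dC dW \<epsilon>]) blast+
  \<comment> \<open>This makes every tail of the sequence satisfy the hypothesis of \<open>upper_bound_of_small_trace\<close>,
    with bounds whose traces tend to \<open>0\<close>.\<close>
  define \<delta> :: "nat \<Rightarrow> real" where "\<delta> k = (1 / 4 ^ k) ^ (2 ^ k)" for k
  have te: "0 < \<tau> A.e + 1" by (simp add: add_nonneg_pos)
  have "\<exists>b\<in>C. \<tau> (b \<diamondop> b) < (\<delta> k)\<^sup>2 / (\<tau> A.e + 1)" for k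
    using te by (intro small) (simp add: \<delta>_def)
  then obtain b where b: "\<And>k. b k \<in> C" "\<And>k. \<tau> (b k \<diamondop> b k) < (\<delta> k)\<^sup>2 / (\<tau> A.e + 1)" by metis
  have bn: "norm (b k) \<le> 1" for k using b(1)[of k] by (simp add: C_def)
  have ab: "\<tau> (A.abs_val (b k)) \<le> \<delta> k" for k
  proof (rule power2_le_imp_le)
    have "(\<tau> (A.abs_val (b k)))\<^sup>2 \<le> \<tau> A.e * \<tau> (b k \<diamondop> b k)" by (rule trace_abs_val_le)
    also have "\<dots> \<le> (\<tau> A.e + 1) * \<tau> (b k \<diamondop> b k)" by (intro mult_right_mono) auto
    also have "\<dots> \<le> (\<delta> k)\<^sup>2" using b(2)[of k] te by (simp add: less_divide_eq mult.commute)
    finally show "(\<tau> (A.abs_val (b k)))\<^sup>2 \<le> (\<delta> k)\<^sup>2" .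
  qed (simp add: \<delta>_def)
  have "\<exists>T. (\<forall>k. A.pos (T - A.abs_val (b (k + m)))) \<and> \<tau> T \<le> 2 * (\<tau> A.e + 1) * (1 / 2 ^ m)" for m
  proof -
    have sm: "\<tau> (A.abs_val (b (k + m))) \<le> (1 / 2 ^ m / 2 ^ k) ^ (2 ^ k)" for k
    proof -
      have "(1 / 4 ^ (k + m) :: real) ^ (2 ^ (k + m)) \<le> (1 / 4 ^ (k + m)) ^ (2 ^ k)"
      proof (rule power_decreasing)
        show "(2::nat) ^ k \<le> 2 ^ (k + m)" by (rule power_increasing) auto
        show "0 \<le> 1 / (4::real) ^ (k + m)" by simp
        show "1 / (4::real) ^ (k + m) \<le> 1" by (simp add: divide_le_eq)
      qed
      also have "\<dots> \<le> (1 / 2 ^ m / 2 ^ k) ^ (2 ^ k)"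
      proof (intro power_mono)
        have "(2::real) ^ (k + m) \<le> 4 ^ (k + m)" by (intro power_mono) auto
        then have "1 / 4 ^ (k + m) \<le> 1 / (2::real) ^ (k + m)" by (intro divide_left_mono) auto
        then show "1 / 4 ^ (k + m) \<le> 1 / 2 ^ m / (2::real) ^ k" by (simp add: power_add mult.commute)
      qed simp
      finally show ?thesis using ab[of "k + m"] by (simp add: \<delta>_def)
    qed
    obtain T where "\<And>k. A.pos (T - A.abs_val (b (k + m)))" "\<tau> T \<le> 2 * (\<tau> A.e + 1) * (1 / 2 ^ m)"
      using A.upper_bound_of_small_trace[of "\<lambda>k. A.abs_val (b (k + m))" "1 / 2 ^ m"]
        A.abs_val(1) order_trans[OF A.abs_val(4) bn] sm by auto
    then show ?thesis by blast
  qed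
  then obtain T where T: "\<And>m k. A.pos (T m - A.abs_val (b (k + m)))" "\<And>m. \<tau> (T m) \<le> 2 * (\<tau> A.e + 1) * (1 / 2 ^ m)"
    by metis
  have Tb: "A.pos (T m - b k)" "A.pos (T m + b k)" if "m \<le> k" for m k
  proof -
    have "A.pos (T m - A.abs_val (b k))" using T(1)[of m "k - m"] that by simp
    from A.pos_add[OF this A.abs_val(2)[of "b k"]] A.pos_add[OF this A.abs_val(3)[of "b k"]]
    show "A.pos (T m - b k)" "A.pos (T m + b k)" by simp_all
  qed
  obtain F' \<beta> where F': "F' \<le> sequentially" "F' \<noteq> bot" "norm \<beta> \<le> 1" "wlim K F' (\<lambda>i. \<iota> (b i)) (\<iota> \<beta>)"
  proof -
    have "\<forall>\<^sub>F i in sequentially. norm (b i) \<le> 1" using bn by simp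
    from K_selfadjoint_compact[OF sequentially_bot this] that show ?thesis by blast
  qed
  have tail: "\<forall>\<^sub>F k in F'. m \<le> k" for m by (rule filter_leD[OF F'(1) eventually_ge_at_top])
  have bnd: "\<forall>\<^sub>F k in F'. norm (T m - b k) \<le> norm (T m) + 1" "\<forall>\<^sub>F k in F'. norm (T m + b k) \<le> norm (T m) + 1" for m
    using bn by (auto intro!: always_eventually order_trans[OF norm_triangle_ineq] order_trans[OF norm_triangle_ineq4])
  have "A.pos (T m - \<beta>)" for m
  proof (rule wlim_K_pos[OF F'(2) _ _ bnd(1)])
    show "wlim K F' (\<lambda>k. \<iota> (T m - b k)) (\<iota> (T m - \<beta>))"
      unfolding iota_simps by (intro wlim_diff K_linear wlim_const F')
    show "\<forall>\<^sub>F k in F'. A.pos (T m - b k)" using tail[of m] by eventually_elim (rule Tb)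
  qed
  moreover have "A.pos (T m + \<beta>)" for m
  proof (rule wlim_K_pos[OF F'(2) _ _ bnd(2)])
    show "wlim K F' (\<lambda>k. \<iota> (T m + b k)) (\<iota> (T m + \<beta>))"
      unfolding iota_simps by (intro wlim_add K_linear wlim_const F')
    show "\<forall>\<^sub>F k in F'. A.pos (T m + b k)" using tail[of m] by eventually_elim (rule Tb)
  qed
  moreover have "(\<lambda>m. \<tau> (T m)) \<longlonglongrightarrow> 0"
  proof (rule tendsto_sandwich[OF _ _ tendsto_const])
    have "0 \<le> \<tau> (T m)" for m
    proof -
      have "A.pos (T m)" using A.pos_add[OF T(1)[of m 0] A.abs_val(1)[of "b (0 + m)"]] by simp
      then show ?thesis by (rule A.trace_pos)
    qed
    then show "\<forall>\<^sub>F m in sequentially. 0 \<le> \<tau> (T m)" by simp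
    show "\<forall>\<^sub>F m in sequentially. \<tau> (T m) \<le> 2 * (\<tau> A.e + 1) * (1/2) ^ m"
      using T(2) by (simp add: power_divide)
    show "(\<lambda>m. 2 * (\<tau> A.e + 1) * (1/2) ^ m) \<longlonglongrightarrow> 0"
      by (intro tendsto_mult_right_zero LIMSEQ_power_zero) simp
  qed
  ultimately have "\<beta> = 0" by (rule bounded_below_trace_zero)
  have "1/2 \<le> Re (K (\<iota> \<beta>) y)"
  proof (rule tendsto_lowerbound[OF _ _ F'(2)])
    show "((\<lambda>k. Re (K (\<iota> (b k)) y)) \<longlongrightarrow> Re (K (\<iota> \<beta>) y)) F'"
      using F'(4) by (auto simp: wlim_def intro: tendsto_Re)
    show "\<forall>\<^sub>F k in F'. 1/2 \<le> Re (K (\<iota> (b k)) y)" using b(1) by (simp add: C_def)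
  qed
  then show False by (simp add: \<open>\<beta> = 0\<close> K_left)
qed

text \<open>Every finer filter has a further refinement along which the net converges for \<open>J\<close>; the limit can
  only be \<open>0\<close>.\<close>

lemma trace_wlim_K:
  assumes bd: "\<forall>\<^sub>F i in F. norm (a i) \<le> 1" and limK: "wlim K F (\<lambda>i. \<iota> (a i)) 0"
  shows "((\<lambda>i. \<tau> (x \<diamondop> a i)) \<longlongrightarrow> 0) F"
proof (rule tendsto_if_subfilters)
  fix F' :: "'b filter" assume F': "F' \<le> F" "F' \<noteq> bot"
  have bd': "\<forall>\<^sub>F i in F'. norm (a i) \<le> 1" by (rule filter_leD[OF F'(1) bd])
  obtain F'' h where F'': "F'' \<le> F'" "F'' \<noteq> bot" "norm h \<le> 1" "wlim J F'' a h"
    using A.J_ball_compact[OF F'(2) bd'] by blast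
  have bd'': "\<forall>\<^sub>F i in F''. norm (a i) \<le> 1" by (rule filter_leD[OF F''(1) bd'])
  have "wlim K F'' (\<lambda>i. \<iota> (a i)) (\<iota> 0)" using wlim_mono[OF limK order_trans[OF F''(1) F'(1)]] by simp
  then have "h = 0" using weak_star_limits_agree[OF F''(2) bd'' _ F''(4)] by blast
  then have "((\<lambda>i. \<tau> (x \<diamondop> a i)) \<longlongrightarrow> 0) F''" using A.trace_mult_wlim[OF F''(4) bd'', of x] by simp
  then show "\<exists>F''\<le>F'. F'' \<noteq> bot \<and> ((\<lambda>i. \<tau> (x \<diamondop> a i)) \<longlongrightarrow> 0) F''"
    by (intro exI[of _ F''] conjI F''(1,2))
qed

text \<open>The selfadjoint part is weak* closed, so along refinements the two parts converge to selfadjoint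
  limits \<open>c\<close>, \<open>d\<close> with \<open>c + id = 0\<close>.\<close>

lemma wlim_K_parts:
  assumes bd: "\<forall>i. norm (m i) \<le> 1" and lim: "wlim K F m 0"
  shows "wlim K F (\<lambda>i. \<iota> (re (m i))) 0" "wlim K F (\<lambda>i. \<iota> (im (m i))) 0"
proof -
  have "((\<lambda>i. K (\<iota> (re (m i))) y) \<longlongrightarrow> 0) F \<and> ((\<lambda>i. K (\<iota> (im (m i))) y) \<longlongrightarrow> 0) F" for y
  proof -
    have "((\<lambda>i. (K (\<iota> (re (m i))) y, K (\<iota> (im (m i))) y)) \<longlongrightarrow> (0, 0)) F"
    proof (rule tendsto_if_subfilters)
      fix F' :: "'b filter" assume F': "F' \<le> F" "F' \<noteq> bot"
      have bds: "\<forall>\<^sub>F i in G. norm (re (m i)) \<le> 1" "\<forall>\<^sub>F i in G. norm (im (m i)) \<le> 1" for G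
        using bd order_trans[OF norm_re_le] order_trans[OF norm_im_le] by (auto intro!: always_eventually)
      obtain F1 c where F1: "F1 \<le> F'" "F1 \<noteq> bot" "norm c \<le> 1" "wlim K F1 (\<lambda>i. \<iota> (re (m i))) (\<iota> c)"
        using K_selfadjoint_compact[OF F'(2) bds(1)] by blast
      obtain F2 d where F2: "F2 \<le> F1" "F2 \<noteq> bot" "norm d \<le> 1" "wlim K F2 (\<lambda>i. \<iota> (im (m i))) (\<iota> d)"
        using K_selfadjoint_compact[OF F1(2) bds(2)] by blast
      have F1': "wlim K F2 (\<lambda>i. \<iota> (re (m i))) (\<iota> c)" by (rule wlim_mono[OF F1(4) F2(1)])
      have "wlim K F2 (\<lambda>i. \<iota> (re (m i)) + \<i> *\<^sub>C \<iota> (im (m i))) (\<iota> c + \<i> *\<^sub>C \<iota> d)"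
        by (intro wlim_add K_linear F1' wlim_K_scaleC F2(4))
      then have "wlim K F2 m (cpx c d)" using cpx_re_im by (simp add: cpx_def)
      moreover have "wlim K F2 m 0"
        by (rule wlim_mono[OF lim order_trans[OF F2(1) order_trans[OF F1(1) F'(1)]]])
      ultimately have "cpx c d = cpx 0 0" using K_unique[OF F2(2)] by (simp add: cpx_zero)
      then have "c = 0" "d = 0" by (simp_all add: cpx_eq_iff)
      then have "((\<lambda>i. (K (\<iota> (re (m i))) y, K (\<iota> (im (m i))) y)) \<longlongrightarrow> (0, 0)) F2"
        using F1' F2(4) by (intro tendsto_Pair) (auto simp: wlim_def K_left)
      then show "\<exists>F''\<le>F'. F'' \<noteq> bot \<and> ((\<lambda>i. (K (\<iota> (re (m i))) y, K (\<iota> (im (m i))) y)) \<longlongrightarrow> (0, 0)) F''"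
        by (intro exI[of _ F2] conjI order_trans[OF F2(1) F1(1)] F2(2))
    qed
    from tendsto_fst[OF this] tendsto_snd[OF this] show ?thesis by simp
  qed
  then show "wlim K F (\<lambda>i. \<iota> (re (m i))) 0" "wlim K F (\<lambda>i. \<iota> (im (m i))) 0"
    by (simp_all add: wlim_def K_left)
qed


section \<open>The embedding into the predual\<close>

abbreviation ctr :: "'m \<Rightarrow> complex"
  where "ctr \<equiv> trace_ext star \<iota> \<tau>"

abbreviation j :: "'m \<Rightarrow> ('m \<Rightarrow>\<^sub>L complex)"
  where "j \<equiv> trace_embedding (\<odot>) star \<iota> \<tau>"

lemma ctr_eq: "ctr m = Complex (\<tau> (re m)) (\<tau> (im m))"
  by (simp add: trace_ext_def re_def im_def)

lemma ctr_cpx [simp]: "ctr (cpx a b) = Complex (\<tau> a) (\<tau> b)"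
  by (simp add: ctr_eq)

lemma ctr_add: "ctr (m + n) = ctr m + ctr n"
  by (simp add: ctr_eq re_add im_add complex_eq_iff)

lemma ctr_scaleC: "ctr (c *\<^sub>C m) = c * ctr m"
  by (simp add: ctr_eq re_scaleC im_scaleC complex_eq_iff)

lemma ctr_scaleR: "ctr (r *\<^sub>R m) = r *\<^sub>R ctr m"
  by (simp only: scaleR_scaleC[of r m] ctr_scaleC scaleR_conv_of_real)

lemma ctr_bound: "cmod (ctr m) \<le> norm m * (2 * \<tau> A.e)"
proof -
  have "cmod (ctr m) \<le> \<bar>\<tau> (re m)\<bar> + \<bar>\<tau> (im m)\<bar>" using cmod_le[of "ctr m"] by (simp add: ctr_eq)
  also have "\<dots> \<le> norm m * \<tau> A.e + norm m * \<tau> A.e"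
    using norm_re_le[of m] norm_im_le[of m]
    by (intro add_mono order_trans[OF A.trace_abs_le] mult_right_mono) auto
  finally show ?thesis by simp
qed

lemma j_apply: "j x y = ctr (x \<odot> y)"
proof -
  have "bounded_linear (\<lambda>y. ctr (x \<odot> y))"
  proof (rule bounded_linear_intro[where K = "norm x * (2 * \<tau> A.e)"])
    fix y
    have "cmod (ctr (x \<odot> y)) \<le> norm (x \<odot> y) * (2 * \<tau> A.e)" by (rule ctr_bound)
    also have "\<dots> \<le> (norm x * norm y) * (2 * \<tau> A.e)" by (intro mult_right_mono norm_jp_le) simp
    finally show "cmod (ctr (x \<odot> y)) \<le> norm y * (norm x * (2 * \<tau> A.e))" by (simp add: mult_ac)
  qed (simp_all add: ctr_add ctr_scaleR)
  then show ?thesis by (simp add: trace_embedding_def bounded_linear_Blinfun_apply)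
qed

lemma j_norm_le: "norm (j x) \<le> 2 * \<tau> A.e * norm x"
proof (rule norm_blinfun_bound)
  fix y
  have "cmod (ctr (x \<odot> y)) \<le> norm (x \<odot> y) * (2 * \<tau> A.e)" by (rule ctr_bound)
  also have "\<dots> \<le> (norm x * norm y) * (2 * \<tau> A.e)" by (intro mult_right_mono norm_jp_le) simp
  finally show "norm (j x y) \<le> 2 * \<tau> A.e * norm x * norm y" by (simp add: j_apply mult_ac)
qed simp

lemma j_add: "j (x + y) = j x + j y" and j_scaleC: "j (c *\<^sub>C x) = c *\<^sub>C j x"
  by (auto intro!: blinfun_eqI simp: j_apply blinfun.add_left ctr_add jp_scaleC ctr_scaleC scaleC_complex_def)

lemma j_linear: "linear j"
  by (rule linearI) (simp_all add: j_add j_scaleC scaleR_scaleC)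

lemma j_diff: "j (x - y) = j x - j y"
  by (rule linear_diff[OF j_linear])

lemma inj_j: "inj j"
proof (rule injI)
  fix x y assume "j x = j y"
  then have "j (x - y) (star (x - y)) = 0" by (simp add: j_diff)
  then have "Re (ctr ((x - y) \<odot> star (x - y))) = 0" by (simp add: j_apply)
  moreover define a b where "a = re (x - y)" and "b = im (x - y)"
  have z: "x - y = cpx a b" by (simp add: a_def b_def cpx_re_im)
  ultimately have "\<tau> (a \<diamondop> a) + \<tau> (b \<diamondop> b) = 0" unfolding z by (simp add: star_cpx cpx_mult)
  then have "\<tau> (a \<diamondop> a) \<le> 0" "\<tau> (b \<diamondop> b) \<le> 0"
    using A.trace_square_nonneg[of a] A.trace_square_nonneg[of b] by linarith+
  then have "a = 0" "b = 0" by (auto dest: A.trace_square_zero)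
  then show "x = y" using z by (simp add: cpx_zero)
qed

lemma inv_j [simp]: "inv j (j x) = x"
  by (rule inv_f_f[OF inj_j])

lemma j_iota_in_predual: "j (\<iota> a) \<in> predual K"
  unfolding predual_iff
proof
  show "complex_linear (blinfun_apply (j (\<iota> a)))"
    by (auto simp: complex_linear_def j_apply ctr_add jpM_scaleC_right ctr_scaleC scaleC_complex_def)
  show "ball_continuous (j (\<iota> a))"
    unfolding ball_continuous_def
  proof (intro allI impI)
    fix F :: "'y set filter" and m
    assume F: "F \<noteq> bot" and bd: "\<forall>i. norm (m i) \<le> 1" and lim: "wlim K F m 0"
    have bds: "\<forall>\<^sub>F i in F. norm (re (m i)) \<le> 1" "\<forall>\<^sub>F i in F. norm (im (m i)) \<le> 1"
      using bd order_trans[OF norm_re_le] order_trans[OF norm_im_le] by (auto intro!: always_eventually)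
    have "((\<lambda>i. Complex (\<tau> (a \<diamondop> re (m i))) (\<tau> (a \<diamondop> im (m i)))) \<longlongrightarrow> Complex 0 0) F"
      by (intro tendsto_Complex trace_wlim_K bds wlim_K_parts[OF bd lim])
    moreover have "j (\<iota> a) (m i) = Complex (\<tau> (a \<diamondop> re (m i))) (\<tau> (a \<diamondop> im (m i)))" for i
    proof -
      have "\<iota> a \<odot> m i = cpx a 0 \<odot> cpx (re (m i)) (im (m i))" by (simp only: cpx_real cpx_re_im)
      then show ?thesis by (simp add: j_apply cpx_mult)
    qed
    ultimately show "((\<lambda>i. j (\<iota> a) (m i)) \<longlongrightarrow> 0) F" by (simp add: zero_complex.code)
  qed
qed

lemma j_in_predual: "j x \<in> predual K"
proof -
  have "j x = j (\<iota> (re x)) + \<i> *\<^sub>C j (\<iota> (im x))"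
    by (metis cpx_def cpx_re_im j_add j_scaleC)
  then show ?thesis by (simp add: predual_add predual_scaleC j_iota_in_predual)
qed


section \<open>Complex functional calculus and the L1-norm\<close>

text \<open>The real part of the inner product \<open>\<tau>(u v\<^sup>*)\<close>.\<close>

definition l2 :: "'m \<Rightarrow> 'm \<Rightarrow> real"
  where "l2 u v = \<tau> (re u \<diamondop> re v) + \<tau> (im u \<diamondop> im v)"

lemma l2_cauchy_schwarz: "(l2 u v)\<^sup>2 \<le> l2 u u * l2 v v"
proof -
  define p q a b c d where defs: "p = \<tau> (re u \<diamondop> re v)" "q = \<tau> (im u \<diamondop> im v)"
    "a = \<tau> (re u \<diamondop> re u)" "b = \<tau> (im u \<diamondop> im u)" "c = \<tau> (re v \<diamondop> re v)" "d = \<tau> (im v \<diamondop> im v)"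
  have nn: "0 \<le> a" "0 \<le> b" "0 \<le> c" "0 \<le> d" by (simp_all add: defs)
  have pq: "p\<^sup>2 \<le> a * c" "q\<^sup>2 \<le> b * d" unfolding defs by (rule A.trace_cauchy_schwarz)+
  have "(p * q)\<^sup>2 \<le> (a * c) * (b * d)"
    unfolding power_mult_distrib using pq nn by (intro mult_mono) auto
  also have "\<dots> \<le> ((a * d + b * c) / 2)\<^sup>2"
    using zero_le_square[of "a * d - b * c"] by (simp add: power2_eq_square algebra_simps)
  finally have "(p * q)\<^sup>2 \<le> ((a * d + b * c) / 2)\<^sup>2" .
  then have le: "p * q \<le> (a * d + b * c) / 2" by (rule power2_le_imp_le) (use nn in simp)
  have "(p + q)\<^sup>2 = p\<^sup>2 + q\<^sup>2 + 2 * (p * q)" by (simp add: power2_sum)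
  also have "\<dots> \<le> a * c + b * d + 2 * ((a * d + b * c) / 2)"
    by (intro add_mono mult_left_mono pq le) simp
  also have "\<dots> = (a + b) * (c + d)" by (simp add: algebra_simps)
  finally have "(p + q)\<^sup>2 \<le> (a + b) * (c + d)" .
  then show ?thesis by (simp add: l2_def defs)
qed

lemma l2_nonneg [simp]: "0 \<le> l2 u u"
  by (simp add: l2_def)

lemma l2_adjoint: "l2 (w \<odot> u) v = l2 u (star w \<odot> v)"
  by (subst (1 2) cpx_re_im[symmetric, of u], subst (1 2) cpx_re_im[symmetric, of v],
      subst (1 2) cpx_re_im[symmetric, of w])
    (simp add: l2_def star_cpx cpx_mult A.trace_move)

lemma l2_mult_bound: "l2 (w \<odot> u) (w \<odot> u) \<le> (norm w)\<^sup>2 * l2 u u"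
proof -
  have "\<bar>l2 (star w \<odot> (w \<odot> u)) u\<bar> \<le> (norm w)\<^sup>2 * l2 u u"
  proof (rule symmetric_form_bound[where B = l2 and T = "\<lambda>u. star w \<odot> (w \<odot> u)" and C = "2 * \<tau> A.e"])
    show "l2 u u \<le> 2 * \<tau> A.e * (norm u)\<^sup>2" for u
    proof -
      have "l2 u u \<le> \<tau> A.e * (norm u)\<^sup>2 + \<tau> A.e * (norm u)\<^sup>2"
        unfolding l2_def using norm_re_le[of u] norm_im_le[of u]
        by (intro add_mono order_trans[OF A.trace_square_le] mult_left_mono power_mono) auto
      then show ?thesis by simp
    qed
    show "l2 (star w \<odot> (w \<odot> u)) v = l2 u (star w \<odot> (w \<odot> v))" for u v
      using l2_adjoint[of "star w" "w \<odot> u" v] l2_adjoint[of w u "w \<odot> v"] by (simp add: star_star)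
    fix u
    have "norm (star w \<odot> (w \<odot> u)) \<le> norm (star w) * norm (w \<odot> u)" by (rule norm_jp_le)
    also have "\<dots> \<le> norm w * (norm w * norm u)"
      unfolding norm_star by (intro mult_left_mono norm_jp_le) simp
    finally show "norm (star w \<odot> (w \<odot> u)) \<le> (norm w)\<^sup>2 * norm u" by (simp add: power2_eq_square mult_ac)
  qed (auto intro: l2_cauchy_schwarz)
  moreover have "l2 (star w \<odot> (w \<odot> u)) u = l2 (w \<odot> u) (w \<odot> u)"
    using l2_adjoint[of "star w" "w \<odot> u" u] by (simp add: star_star)
  ultimately show ?thesis by simp
qed

text \<open>A Hoelder inequality: \<open>\<tau>((h k) w)\<close> is the inner product of \<open>k\<close> with \<open>(w h)\<^sup>*\<close>, and multiplication by
  \<open>w\<close> has norm at most \<open>\<parallel>w\<parallel>\<close> on \<open>L\<^sup>2\<close>.\<close>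

lemma norm_j_product_le: "norm (j (\<iota> h \<odot> k)) \<le> sqrt (\<tau> (h \<diamondop> h)) * sqrt (l2 k k)"
proof (rule norm_blinfun_bound)
  fix w
  obtain u where u: "cmod u = 1" "u * ctr ((\<iota> h \<odot> k) \<odot> w) = complex_of_real (cmod (ctr ((\<iota> h \<odot> k) \<odot> w)))"
    by (rule unimodular_rotation)
  define w' where "w' = u *\<^sub>C w"
  have "cmod (ctr ((\<iota> h \<odot> k) \<odot> w)) = Re (ctr ((\<iota> h \<odot> k) \<odot> w'))"
    unfolding w'_def jpM_scaleC_right ctr_scaleC u by simp
  also have "\<dots> = l2 k (star (w' \<odot> \<iota> h))"
  proof -
    define c d where "c = re k" and "d = im k"
    define a b where "a = re w'" and "b = im w'"
    have k: "k = cpx c d" and w: "w' = cpx a b" by (simp_all add: a_def b_def c_def d_def cpx_re_im)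
    have "Re (ctr ((\<iota> h \<odot> k) \<odot> w')) = \<tau> ((h \<diamondop> c) \<diamondop> a) - \<tau> ((h \<diamondop> d) \<diamondop> b)"
    proof -
      have "(\<iota> h \<odot> k) \<odot> w' = (cpx h 0 \<odot> cpx c d) \<odot> cpx a b" by (simp only: cpx_real k[symmetric] w[symmetric])
      then show ?thesis by (simp only: cpx_mult ctr_cpx complex.sel) simp
    qed
    also have "\<dots> = \<tau> (c \<diamondop> (a \<diamondop> h)) - \<tau> (d \<diamondop> (b \<diamondop> h))"
      by (simp only: A.trace_move A.jp_commute[of h a] A.jp_commute[of h b])
    also have "\<dots> = l2 k (star (w' \<odot> \<iota> h))"
    proof -
      have "star (w' \<odot> \<iota> h) = star (cpx a b \<odot> cpx h 0)" by (simp only: cpx_real w[symmetric])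
      then show ?thesis unfolding l2_def by (simp only: star_cpx cpx_mult re_cpx im_cpx c_def[symmetric] d_def[symmetric]) simp
    qed
    finally show ?thesis .
  qed
  also have "\<dots> \<le> sqrt (l2 k k * l2 (star (w' \<odot> \<iota> h)) (star (w' \<odot> \<iota> h)))"
    by (rule real_le_rsqrt[OF l2_cauchy_schwarz])
  also have "l2 (star (w' \<odot> \<iota> h)) (star (w' \<odot> \<iota> h)) = l2 (w' \<odot> \<iota> h) (w' \<odot> \<iota> h)"
    by (subst (1 2 3 4) cpx_re_im[symmetric, of "w' \<odot> \<iota> h"]) (simp only: star_cpx l2_def re_cpx im_cpx, simp)
  also have "sqrt (l2 k k * l2 (w' \<odot> \<iota> h) (w' \<odot> \<iota> h)) \<le> sqrt (l2 k k * ((norm w)\<^sup>2 * \<tau> (h \<diamondop> h)))"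
  proof (intro real_sqrt_le_mono mult_left_mono)
    have "l2 (\<iota> h) (\<iota> h) = \<tau> (h \<diamondop> h)" by (simp add: l2_def flip: cpx_real)
    then show "l2 (w' \<odot> \<iota> h) (w' \<odot> \<iota> h) \<le> (norm w)\<^sup>2 * \<tau> (h \<diamondop> h)"
      using l2_mult_bound[of w' "\<iota> h"] by (simp add: w'_def norm_scaleC u)
  qed simp
  finally show "norm (j (\<iota> h \<odot> k) w) \<le> sqrt (\<tau> (h \<diamondop> h)) * sqrt (l2 k k) * norm w"
    by (simp add: j_apply real_sqrt_mult mult_ac)
qed simp

text \<open>The functional calculus for complex-valued functions.\<close>

definition cfc :: "'a \<Rightarrow> (real \<Rightarrow> complex) \<Rightarrow> 'm"
  where "cfc x F = cpx (A.fc (\<lambda>t. Re (F t)) x) (A.fc (\<lambda>t. Im (F t)) x)"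

lemma cfc_norm_le:
  assumes F: "continuous_on (A.spec x) F" and le: "\<And>t. t \<in> A.spec x \<Longrightarrow> cmod (F t) \<le> c" and c: "0 \<le> c"
  shows "norm (cfc x F) \<le> c"
proof (rule power2_le_imp_le[OF _ c])
  note cont = continuous_on_Re[OF F] continuous_on_Im[OF F]
  have "(norm (cfc x F))\<^sup>2 \<le> norm (A.fc (\<lambda>t. Re (F t)) x \<diamondop> A.fc (\<lambda>t. Re (F t)) x
      + A.fc (\<lambda>t. Im (F t)) x \<diamondop> A.fc (\<lambda>t. Im (F t)) x)"
    unfolding cfc_def by (rule norm_cpx_square_le[OF A.gen_associative[of x]]) (auto intro: cont)
  also have "A.fc (\<lambda>t. Re (F t)) x \<diamondop> A.fc (\<lambda>t. Re (F t)) x + A.fc (\<lambda>t. Im (F t)) x \<diamondop> A.fc (\<lambda>t. Im (F t)) x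
    = A.fc (\<lambda>t. Re (F t) * Re (F t) + Im (F t) * Im (F t)) x"
    by (simp add: A.fc_add A.fc_mult cont continuous_on_mult)
  also have "norm \<dots> \<le> c\<^sup>2"
  proof (rule A.fc_norm_le)
    fix t assume "t \<in> A.spec x"
    from power_mono[OF le[OF this] norm_ge_zero, of 2]
    show "\<bar>Re (F t) * Re (F t) + Im (F t) * Im (F t)\<bar> \<le> c\<^sup>2" by (simp add: cmod_power2 flip: power2_eq_square)
  qed (auto intro!: continuous_intros cont)
  finally show "(norm (cfc x F))\<^sup>2 \<le> c\<^sup>2" .
qed

lemma iota_fc_mult_cfc:
  assumes g: "continuous_on (A.spec x) g" and F: "continuous_on (A.spec x) F"
  shows "\<iota> (A.fc g x) \<odot> cfc x F = cfc x (\<lambda>t. complex_of_real (g t) * F t)"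
  using continuous_on_Re[OF F] continuous_on_Im[OF F] g
  by (simp add: cfc_def iota_mult_cpx A.fc_mult)

lemma cfc_cong:
  assumes F: "continuous_on (A.spec x) F" and eq: "\<And>t. t \<in> A.spec x \<Longrightarrow> F t = G t"
  shows "cfc x F = cfc x G"
  unfolding cfc_def using assms
  by (intro arg_cong2[where f = cpx] A.fc_cong continuous_on_Re continuous_on_Im) auto

lemma cfc_add:
  assumes F: "continuous_on (A.spec x) F" and G: "continuous_on (A.spec x) G"
  shows "cfc x (\<lambda>t. F t + G t) = cfc x F + cfc x G"
  unfolding cfc_def cpx_add
  using continuous_on_Re[OF F] continuous_on_Im[OF F] continuous_on_Re[OF G] continuous_on_Im[OF G]
  by (simp add: A.fc_add)

lemma cfc_scaleC:
  assumes F: "continuous_on (A.spec x) F"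
  shows "cfc x (\<lambda>t. c * F t) = c *\<^sub>C cfc x F"
  unfolding cfc_def cpx_scaleC
  using continuous_on_Re[OF F] continuous_on_Im[OF F] by (simp add: A.fc_add A.fc_diff A.fc_scale continuous_on_mult)

lemma cfc_diff:
  assumes F: "continuous_on (A.spec x) F" and G: "continuous_on (A.spec x) G"
  shows "cfc x (\<lambda>t. F t - G t) = cfc x F - cfc x G"
  unfolding cfc_def cpx_diff
  using continuous_on_Re[OF F] continuous_on_Im[OF F] continuous_on_Re[OF G] continuous_on_Im[OF G]
  by (simp add: A.fc_diff)

lemma cfc_real: "cfc x (\<lambda>t. complex_of_real (f t)) = \<iota> (A.fc f x)"
  using A.fc_const[of 0 x] by (simp add: cfc_def cpx_real)

text \<open>\<open>F(x)\<close> is the product of \<open>G\<^sup>1\<^sup>/\<^sup>2(x)\<close> and \<open>(F/G\<^sup>1\<^sup>/\<^sup>2)(x)\<close>, whose \<open>L\<^sup>2\<close>-norms are at most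
  \<open>\<tau>(G(x))\<^sup>1\<^sup>/\<^sup>2\<close>.\<close>

lemma norm_j_cfc_le:
  assumes F: "continuous_on (A.spec x) F" and G: "continuous_on (A.spec x) G"
    and G0: "\<And>t. t \<in> A.spec x \<Longrightarrow> 0 < G t" and le: "\<And>t. t \<in> A.spec x \<Longrightarrow> cmod (F t) \<le> G t"
  shows "norm (j (cfc x F)) \<le> \<tau> (A.fc G x)"
proof -
  define h where "h = A.fc (\<lambda>t. sqrt (G t)) x"
  define H where "H t = F t / complex_of_real (sqrt (G t))" for t
  have ch: "continuous_on (A.spec x) (\<lambda>t. sqrt (G t))" by (intro continuous_intros G)
  have H: "continuous_on (A.spec x) H" unfolding H_def
    using G0 by (intro continuous_intros F G) force
  have "\<iota> h \<odot> cfc x H = cfc x (\<lambda>t. complex_of_real (sqrt (G t)) * H t)"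
    unfolding h_def by (rule iota_fc_mult_cfc[OF ch H])
  also have "\<dots> = cfc x F"
    using G0 by (intro cfc_cong[symmetric] F) (force simp: H_def)
  finally have prod: "\<iota> h \<odot> cfc x H = cfc x F" .
  have hh: "h \<diamondop> h = A.fc G x"
  proof -
    have "h \<diamondop> h = A.fc (\<lambda>t. sqrt (G t) * sqrt (G t)) x" unfolding h_def by (rule A.fc_mult[OF ch ch, symmetric])
    also have "\<dots> = A.fc G x"
      by (rule A.fc_cong[symmetric, OF G]) (use G0 in \<open>simp add: less_imp_le\<close>)
    finally show ?thesis .
  qed
  note cont = continuous_on_Re[OF H] continuous_on_Im[OF H]
  have "l2 (cfc x H) (cfc x H) = \<tau> (A.fc (\<lambda>t. Re (H t) * Re (H t) + Im (H t) * Im (H t)) x)"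
    by (simp add: l2_def cfc_def A.fc_add A.fc_mult cont continuous_on_mult)
  also have "\<dots> \<le> \<tau> (A.fc G x)"
  proof (rule A.trace_mono)
    have cc: "continuous_on (A.spec x) (\<lambda>t. Re (H t) * Re (H t) + Im (H t) * Im (H t))"
      by (intro continuous_intros cont)
    have "A.pos (A.fc (\<lambda>t. G t - (Re (H t) * Re (H t) + Im (H t) * Im (H t))) x)"
    proof (rule A.fc_pos)
      fix t assume t: "t \<in> A.spec x"
      have "Re (H t) * Re (H t) + Im (H t) * Im (H t) = (cmod (H t))\<^sup>2" by (simp add: cmod_power2 flip: power2_eq_square)
      also have "\<dots> = (cmod (F t))\<^sup>2 / G t" using G0[OF t] by (simp add: H_def norm_divide power_divide)
      also have "\<dots> \<le> (G t)\<^sup>2 / G t" using G0[OF t] le[OF t] by (intro divide_right_mono power_mono) auto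
      finally show "0 \<le> G t - (Re (H t) * Re (H t) + Im (H t) * Im (H t))"
        using G0[OF t] by (simp add: power2_eq_square)
    qed (intro continuous_intros G cont)
    then show "A.pos (A.fc G x - A.fc (\<lambda>t. Re (H t) * Re (H t) + Im (H t) * Im (H t)) x)"
      by (simp add: A.fc_diff[OF G cc])
  qed
  finally have l2: "l2 (cfc x H) (cfc x H) \<le> \<tau> (A.fc G x)" .
  have "norm (j (cfc x F)) \<le> sqrt (\<tau> (A.fc G x)) * sqrt (l2 (cfc x H) (cfc x H))"
    using norm_j_product_le[of h "cfc x H"] by (simp add: prod hh)
  also have "\<dots> \<le> sqrt (\<tau> (A.fc G x)) * sqrt (\<tau> (A.fc G x))"
    using l2 A.trace_square_nonneg[of h] by (intro mult_left_mono real_sqrt_le_mono) (simp_all add: hh)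
  also have "\<dots> = \<tau> (A.fc G x)" using A.trace_square_nonneg[of h] by (simp add: hh)
  finally show ?thesis .
qed

end

section \<open>The three lines theorem\<close>

lemma Re_square: "Re (z\<^sup>2) = (Re z)\<^sup>2 - (Im z)\<^sup>2"
  by (simp add: power2_eq_square)

text \<open>The factor \<open>exp(\<delta>(z\<^sup>2 - 1))\<close> has modulus at most \<open>1\<close> on the strip and makes \<open>h\<close> small on the
  horizontal sides of a long rectangle, to which the maximum principle applies.\<close>

lemma three_lines_unit:
  assumes cont: "continuous_on closed_strip h" and hol: "h holomorphic_on open_strip"
    and bd: "\<And>z. z \<in> closed_strip \<Longrightarrow> cmod (h z) \<le> B"
    and b0: "\<And>t. cmod (h (Complex 0 t)) \<le> 1" and b1: "\<And>t. cmod (h (Complex 1 t)) \<le> 1"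
    and \<theta>: "0 < \<theta>" "\<theta> < 1"
  shows "cmod (h (complex_of_real \<theta>)) \<le> 1"
proof -
  have step: "cmod (h (complex_of_real \<theta>)) \<le> exp (\<delta> * (1 - \<theta>\<^sup>2))" if \<delta>: "0 < \<delta>" for \<delta>
  proof -
    define k where "k z = h z * exp (complex_of_real \<delta> * (z\<^sup>2 - 1))" for z
    have nk: "cmod (k z) = cmod (h z) * exp (\<delta> * ((Re z)\<^sup>2 - (Im z)\<^sup>2 - 1))" for z
      by (simp add: k_def norm_mult Re_square)
    have B: "0 \<le> B" by (rule order_trans[OF norm_ge_zero bd[of 0]]) (simp add: closed_strip_def)
    define T where "T = sqrt (B / \<delta>) + 1"
    have T: "0 < T" using B \<delta> by (simp add: T_def add_nonneg_pos)
    have "B \<le> \<delta> * T\<^sup>2"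
    proof -
      have "B = \<delta> * (sqrt (B / \<delta>))\<^sup>2" using B \<delta> by simp
      also have "\<dots> \<le> \<delta> * T\<^sup>2" using \<delta> B by (intro mult_left_mono power_mono) (auto simp: T_def)
      finally show ?thesis .
    qed
    then have BT: "B * exp (- (\<delta> * T\<^sup>2)) \<le> 1"
    proof -
      assume "B \<le> \<delta> * T\<^sup>2"
      also have "\<dots> \<le> exp (\<delta> * T\<^sup>2)" using exp_ge_add_one_self[of "\<delta> * T\<^sup>2"] by linarith
      finally show ?thesis by (simp add: exp_minus divide_le_eq flip: divide_inverse)
    qed
    define S where "S = cbox (Complex 0 (- T)) (Complex 1 T)"
    have S: "z \<in> S \<longleftrightarrow> 0 \<le> Re z \<and> Re z \<le> 1 \<and> - T \<le> Im z \<and> Im z \<le> T" for z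
      by (auto simp: S_def in_cbox_complex_iff)
    have "cmod (k (complex_of_real \<theta>)) \<le> 1"
    proof (rule maximum_modulus_frontier[of k S])
      have int: "interior S = box (Complex 0 (- T)) (Complex 1 T)" by (simp add: S_def interior_cbox)
      have "interior S \<subseteq> open_strip" unfolding int by (auto simp: in_box_complex_iff open_strip_def)
      then show "k holomorphic_on interior S"
        unfolding k_def by (intro holomorphic_intros holomorphic_on_subset[OF hol])
      have "S \<subseteq> closed_strip" by (auto simp: S closed_strip_def)
      then show "continuous_on (closure S) k"
        unfolding k_def S_def[symmetric] by (simp add: S_def closure_cbox)
          (intro continuous_intros continuous_on_subset[OF cont], simp add: S_def)
      show "bounded S" by (simp add: S_def bounded_cbox)
      show "complex_of_real \<theta> \<in> S" using \<theta> T by (simp add: S)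
      fix z assume "z \<in> frontier S"
      then have z: "z \<in> S" "z \<notin> interior S" by (auto simp: frontier_def S_def closure_cbox)
      have e: "exp (\<delta> * ((Re z)\<^sup>2 - (Im z)\<^sup>2 - 1)) \<le> 1"
        using z(1) \<delta> by (simp add: S mult_le_0_iff power_le_one add_increasing2 diff_le_eq)
      show "cmod (k z) \<le> 1"
      proof (cases "Re z = 0 \<or> Re z = 1")
        case True
        then have "z = Complex 0 (Im z) \<or> z = Complex 1 (Im z)" by (auto simp: complex_eq_iff)
        then have "cmod (h z) \<le> 1" using b0 b1 by metis
        then show ?thesis unfolding nk using e by (intro mult_le_one) auto
      next
        case False
        then have im: "(Im z)\<^sup>2 = T\<^sup>2"
          using z by (auto simp: S int in_box_complex_iff power2_eq_iff)
        have "exp (\<delta> * ((Re z)\<^sup>2 - (Im z)\<^sup>2 - 1)) \<le> exp (- (\<delta> * T\<^sup>2))"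
        proof -
          have "(Re z)\<^sup>2 \<le> 1" using z(1) by (simp add: S power_le_one)
          then have "\<delta> * ((Re z)\<^sup>2 - T\<^sup>2 - 1) \<le> \<delta> * (- T\<^sup>2)" using \<delta> by (intro mult_left_mono) auto
          then show ?thesis by (simp add: im)
        qed
        moreover have "cmod (h z) \<le> B" using z(1) by (intro bd) (simp add: S closed_strip_def)
        ultimately have "cmod (k z) \<le> B * exp (- (\<delta> * T\<^sup>2))" unfolding nk using B by (intro mult_mono) auto
        with BT show ?thesis by simp
      qed
    qed
    then have "cmod (h (complex_of_real \<theta>)) * exp (\<delta> * (\<theta>\<^sup>2 - 1)) \<le> 1" by (simp add: nk)
    then have "cmod (h (complex_of_real \<theta>)) * exp (\<delta> * (\<theta>\<^sup>2 - 1)) * exp (\<delta> * (1 - \<theta>\<^sup>2)) \<le> 1 * exp (\<delta> * (1 - \<theta>\<^sup>2))"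
      by (rule mult_right_mono) simp
    also have "cmod (h (complex_of_real \<theta>)) * exp (\<delta> * (\<theta>\<^sup>2 - 1)) * exp (\<delta> * (1 - \<theta>\<^sup>2)) = cmod (h (complex_of_real \<theta>))"
      by (simp add: mult.assoc flip: exp_add distrib_left)
    finally show ?thesis by simp
  qed
  have "((\<lambda>\<delta>. exp (\<delta> * (1 - \<theta>\<^sup>2))) \<longlongrightarrow> exp (0 * (1 - \<theta>\<^sup>2))) (at_right 0)" by (intro tendsto_intros)
  then have "((\<lambda>\<delta>. exp (\<delta> * (1 - \<theta>\<^sup>2))) \<longlongrightarrow> 1) (at_right 0)" by simp
  then show ?thesis
    by (rule tendsto_lowerbound) (use step in \<open>auto intro: eventually_at_rightI[of 0 1]\<close>)
qed

theorem three_lines: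
  assumes cont: "continuous_on closed_strip h" and hol: "h holomorphic_on open_strip"
    and bd: "\<And>z. z \<in> closed_strip \<Longrightarrow> cmod (h z) \<le> B"
    and b0: "\<And>t. cmod (h (Complex 0 t)) \<le> M0" and b1: "\<And>t. cmod (h (Complex 1 t)) \<le> M1"
    and M: "0 < M0" "0 < M1" and \<theta>: "0 < \<theta>" "\<theta> < 1"
  shows "cmod (h (complex_of_real \<theta>)) \<le> M0 powr (1 - \<theta>) * M1 powr \<theta>"
proof -
  define k where "k z = h z * exp (- ((1 - z) * complex_of_real (ln M0) + z * complex_of_real (ln M1)))" for z
  have nk: "cmod (k z) = cmod (h z) * exp (- ((1 - Re z) * ln M0 + Re z * ln M1))" for z
    by (simp add: k_def norm_mult)
  have "cmod (k (complex_of_real \<theta>)) \<le> 1"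
  proof (rule three_lines_unit[OF _ _ _ _ _ \<theta>])
    show "continuous_on closed_strip k" unfolding k_def by (intro continuous_intros cont)
    show "k holomorphic_on open_strip" unfolding k_def by (intro holomorphic_intros hol)
    show "cmod (k (Complex 0 t)) \<le> 1" for t
      using b0[of t] M by (simp add: nk exp_minus divide_le_eq flip: divide_inverse)
    show "cmod (k (Complex 1 t)) \<le> 1" for t
      using b1[of t] M by (simp add: nk exp_minus divide_le_eq flip: divide_inverse)
    fix z assume z: "z \<in> closed_strip"
    have "- ((1 - Re z) * ln M0 + Re z * ln M1) \<le> 1 * \<bar>ln M0\<bar> + 1 * \<bar>ln M1\<bar>"
    proof -
      have "\<bar>(1 - Re z) * ln M0\<bar> \<le> 1 * \<bar>ln M0\<bar>"
        unfolding abs_mult by (rule mult_right_mono) (use z in \<open>simp_all add: closed_strip_def\<close>)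
      moreover have "\<bar>Re z * ln M1\<bar> \<le> 1 * \<bar>ln M1\<bar>"
        unfolding abs_mult by (rule mult_right_mono) (use z in \<open>simp_all add: closed_strip_def\<close>)
      ultimately show ?thesis by linarith
    qed
    then have "exp (- ((1 - Re z) * ln M0 + Re z * ln M1)) \<le> exp (\<bar>ln M0\<bar> + \<bar>ln M1\<bar>)" by simp
    moreover have "0 \<le> B" by (rule order_trans[OF norm_ge_zero bd[OF z]])
    ultimately show "cmod (k z) \<le> B * exp (\<bar>ln M0\<bar> + \<bar>ln M1\<bar>)"
      unfolding nk using bd[OF z] by (intro mult_mono) auto
  qed
  then have "cmod (h (complex_of_real \<theta>)) \<le> exp ((1 - \<theta>) * ln M0 + \<theta> * ln M1)"
    by (simp only: nk Re_complex_of_real exp_minus divide_inverse[symmetric]) (simp add: divide_le_eq)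
  also have "\<dots> = M0 powr (1 - \<theta>) * M1 powr \<theta>" using M by (simp add: exp_add powr_def)
  finally show ?thesis .
qed


section \<open>Estimates for exponentials\<close>

lemma exp_interpolate: "0 \<le> s \<Longrightarrow> s \<le> 1 \<Longrightarrow> exp (s * y) \<le> 1 + exp (y :: real)"
proof -
  assume s: "0 \<le> s" "s \<le> 1"
  show ?thesis
  proof (cases "0 \<le> y")
    case True
    then have "s * y \<le> 1 * y" using s by (intro mult_right_mono) auto
    then show ?thesis by (simp add: add_increasing)
  next
    case False
    then have "s * y \<le> 0" using s by (simp add: mult_le_0_iff)
    then show ?thesis by (simp add: add_increasing2)
  qed
qed

text \<open>Inside the strip a power of \<open>|y|\<close> is absorbed by moving \<open>s\<close> towards the boundary by \<open>d\<close>.\<close>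

lemma square_exp_interpolate:
  assumes d: "0 < d" "d \<le> s" "s \<le> 1 - d"
  shows "(1 + \<bar>y\<bar>)\<^sup>2 * exp (s * y) \<le> (2 + 8 / d\<^sup>2) * (1 + exp (y::real))"
proof -
  have y2: "y\<^sup>2 \<le> 4 / d\<^sup>2 * exp (d * \<bar>y\<bar>)"
  proof -
    have "d * \<bar>y\<bar> / 2 \<le> exp (d * \<bar>y\<bar> / 2)" using exp_ge_add_one_self[of "d * \<bar>y\<bar> / 2"] by linarith
    then have "(d * \<bar>y\<bar> / 2)\<^sup>2 \<le> (exp (d * \<bar>y\<bar> / 2))\<^sup>2" using d by (intro power_mono) auto
    also have "(exp (d * \<bar>y\<bar> / 2))\<^sup>2 = exp (d * \<bar>y\<bar>)" by (simp add: exp_double[symmetric] power2_eq_square flip: exp_add)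
    finally show ?thesis using d by (simp add: power_mult_distrib power_divide field_simps)
  qed
  have "exp (d * \<bar>y\<bar>) * exp (s * y) \<le> 1 + exp y"
  proof (cases "0 \<le> y")
    case True
    have "(s + d) * y \<le> 1 * y" using d True by (intro mult_right_mono) auto
    then have "exp (d * \<bar>y\<bar> + s * y) \<le> exp y" using True by (simp add: algebra_simps)
    then show ?thesis by (simp add: exp_add add_increasing)
  next
    case False
    then have "(s - d) * y \<le> 0" using d by (simp add: mult_le_0_iff)
    then have "exp (d * \<bar>y\<bar> + s * y) \<le> 1" using False by (simp add: algebra_simps)
    then show ?thesis by (simp add: exp_add add_increasing2)
  qed
  then have "4 / d\<^sup>2 * (exp (d * \<bar>y\<bar>) * exp (s * y)) \<le> 4 / d\<^sup>2 * (1 + exp y)" by (intro mult_left_mono) auto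
  moreover have "y\<^sup>2 * exp (s * y) \<le> 4 / d\<^sup>2 * exp (d * \<bar>y\<bar>) * exp (s * y)" using y2 by (rule mult_right_mono) simp
  ultimately have 1: "y\<^sup>2 * exp (s * y) \<le> 4 / d\<^sup>2 * (1 + exp y)" by (simp add: mult.assoc)
  have 2: "exp (s * y) \<le> 1 + exp y" using d by (intro exp_interpolate) auto
  have "(1 + \<bar>y\<bar>)\<^sup>2 \<le> 2 + 2 * y\<^sup>2"
    using zero_le_power2[of "1 - \<bar>y\<bar>"] by (simp add: power2_eq_square algebra_simps)
  then have "(1 + \<bar>y\<bar>)\<^sup>2 * exp (s * y) \<le> (2 + 2 * y\<^sup>2) * exp (s * y)" by (rule mult_right_mono) simp
  also have "\<dots> = 2 * exp (s * y) + 2 * (y\<^sup>2 * exp (s * y))" by (simp add: algebra_simps)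
  also have "\<dots> \<le> 2 * (1 + exp y) + 2 * (4 / d\<^sup>2 * (1 + exp y))" using 1 2 by (intro add_mono mult_left_mono) auto
  also have "\<dots> = (2 + 8 / d\<^sup>2) * (1 + exp y)" by (simp add: algebra_simps)
  finally show ?thesis .
qed

text \<open>The factor \<open>exp(\<delta>(z\<^sup>2 - \<theta>\<^sup>2))\<close> decays at infinity in the strip and equals \<open>1\<close> at \<open>\<theta>\<close>.\<close>

definition gauss_exp :: "real \<Rightarrow> real \<Rightarrow> complex \<Rightarrow> real \<Rightarrow> complex"
  where "gauss_exp \<delta> \<theta> z y = exp (z * complex_of_real y + complex_of_real \<delta> * (z\<^sup>2 - complex_of_real (\<theta>\<^sup>2)))"

definition gauss_exp' :: "real \<Rightarrow> real \<Rightarrow> complex \<Rightarrow> real \<Rightarrow> complex"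
  where "gauss_exp' \<delta> \<theta> z y = gauss_exp \<delta> \<theta> z y * (complex_of_real y + 2 * complex_of_real \<delta> * z)"

abbreviation gauss_rem :: "real \<Rightarrow> real \<Rightarrow> complex \<Rightarrow> complex \<Rightarrow> real \<Rightarrow> complex"
  where "gauss_rem \<delta> \<theta> z w y \<equiv> gauss_exp \<delta> \<theta> w y - gauss_exp \<delta> \<theta> z y - (w - z) * gauss_exp' \<delta> \<theta> z y"

lemma norm_gauss_exp: "cmod (gauss_exp \<delta> \<theta> z y) = exp (Re z * y + \<delta> * ((Re z)\<^sup>2 - (Im z)\<^sup>2 - \<theta>\<^sup>2))"
  by (simp add: gauss_exp_def Re_square)

lemma continuous_gauss_exp [continuous_intros]:
  "continuous_on S f \<Longrightarrow> continuous_on S (\<lambda>t. gauss_exp \<delta> \<theta> z (f t))"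
  "continuous_on S f \<Longrightarrow> continuous_on S (\<lambda>t. gauss_exp' \<delta> \<theta> z (f t))"
  unfolding gauss_exp'_def gauss_exp_def by (intro continuous_intros; assumption)+

lemma gauss_exp_derivative: "((\<lambda>z. gauss_exp \<delta> \<theta> z y) has_field_derivative gauss_exp' \<delta> \<theta> z y) (at z within S)"
  unfolding gauss_exp_def gauss_exp'_def by (rule derivative_eq_intros refl)+ (simp add: algebra_simps)

text \<open>Taylor's formula in \<open>z\<close>. The constants are uniform in \<open>y\<close> up to the factor \<open>1 + e\<^sup>y\<close>, which is the size
  of the exponential on the boundary of the strip. This uniformity is what allows the analytic
  families of different elements to be added.\<close>

lemma gauss_exp_expansion:
  assumes \<delta>: "0 \<le> \<delta>" and z: "z \<in> open_strip"
  obtains C d where "0 < d" "0 < C"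
    "\<And>y. cmod (gauss_exp' \<delta> \<theta> z y) \<le> C * (1 + exp y)"
    "\<And>y w. dist w z < d \<Longrightarrow> cmod (gauss_rem \<delta> \<theta> z w y) \<le> C * (cmod (w - z))\<^sup>2 * (1 + exp y)"
proof -
  define d where "d = min (Re z) (1 - Re z) / 2"
  have d: "0 < d" using z by (simp add: d_def open_strip_def)
  define M where "M = 1 + 2 * \<delta> * (cmod z + d + 1)"
  have M: "1 \<le> M" "2 * \<delta> \<le> M" "2 * \<delta> * (cmod z + d) \<le> M"
    using \<delta> d by (simp_all add: M_def algebra_simps)
  define C where "C = 2 * M\<^sup>2 * exp \<delta> * (2 + 8 / d\<^sup>2)"
  have strip: "d \<le> Re w" "Re w \<le> 1 - d" "cmod w \<le> cmod z + d" if "w \<in> ball z d" for w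
  proof -
    have wz: "cmod (w - z) < d" using that by (simp add: dist_norm norm_minus_commute)
    then have "\<bar>Re w - Re z\<bar> < d" using abs_Re_le_cmod[of "w - z"] by simp
    moreover have "2 * d \<le> Re z" "2 * d \<le> 1 - Re z" by (simp_all add: d_def)
    ultimately show "d \<le> Re w" "Re w \<le> 1 - d" by linarith+
    show "cmod w \<le> cmod z + d" using norm_triangle_sub[of w z] wz by simp
  qed
  have E: "cmod (gauss_exp \<delta> \<theta> w y) \<le> exp \<delta> * exp (Re w * y)" if w: "w \<in> ball z d" for w y
  proof -
    have "(Re w)\<^sup>2 \<le> 1" using strip[OF w] d by (intro power_le_one) auto
    then have "\<delta> * ((Re w)\<^sup>2 - (Im w)\<^sup>2 - \<theta>\<^sup>2) \<le> \<delta> * 1"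
      using \<delta> zero_le_power2[of "Im w"] zero_le_power2[of \<theta>] by (intro mult_left_mono) linarith+
    then show ?thesis by (simp add: norm_gauss_exp exp_add[symmetric])
  qed
  have lin: "cmod (complex_of_real y + 2 * complex_of_real \<delta> * w) \<le> M * (1 + \<bar>y\<bar>)" if w: "w \<in> ball z d" for w y
  proof -
    have "cmod (complex_of_real y + 2 * complex_of_real \<delta> * w) \<le> \<bar>y\<bar> + 2 * \<delta> * cmod w"
      using \<delta> by (intro norm_triangle_le) (simp add: norm_mult)
    also have "2 * \<delta> * cmod w \<le> 2 * \<delta> * (cmod z + d)" using \<delta> strip[OF w] by (intro mult_left_mono) auto
    also have "\<dots> \<le> M" by (rule M)
    also have "\<bar>y\<bar> + M \<le> M * (1 + \<bar>y\<bar>)" using M mult_right_mono[of 1 M "\<bar>y\<bar>"] by (simp add: algebra_simps)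
    finally show ?thesis by simp
  qed
  have comb: "2 * M\<^sup>2 * (1 + \<bar>y\<bar>)\<^sup>2 * (exp \<delta> * exp (Re w * y)) \<le> C * (1 + exp y)" if w: "w \<in> ball z d" for w y
  proof -
    have "(1 + \<bar>y\<bar>)\<^sup>2 * exp (Re w * y) \<le> (2 + 8 / d\<^sup>2) * (1 + exp y)"
      using d strip[OF w] by (intro square_exp_interpolate) auto
    then have "2 * M\<^sup>2 * exp \<delta> * ((1 + \<bar>y\<bar>)\<^sup>2 * exp (Re w * y)) \<le> 2 * M\<^sup>2 * exp \<delta> * ((2 + 8 / d\<^sup>2) * (1 + exp y))"
      by (intro mult_left_mono) auto
    then show ?thesis by (simp add: C_def mult_ac)
  qed
  have d1: "cmod (gauss_exp' \<delta> \<theta> z y) \<le> C * (1 + exp y)" for y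
  proof -
    have zb: "z \<in> ball z d" using d by simp
    have "cmod (gauss_exp' \<delta> \<theta> z y) \<le> (exp \<delta> * exp (Re z * y)) * (M * (1 + \<bar>y\<bar>))"
      unfolding gauss_exp'_def norm_mult[of "gauss_exp \<delta> \<theta> z y"] using E[OF zb, of y] lin[OF zb, of y] by (intro mult_mono) auto
    also have "M * (1 + \<bar>y\<bar>) \<le> 2 * M\<^sup>2 * (1 + \<bar>y\<bar>)\<^sup>2"
    proof -
      have "1 \<le> M * (1 + \<bar>y\<bar>)" using mult_mono[of 1 M 1 "1 + \<bar>y\<bar>"] M by simp
      then have "M * (1 + \<bar>y\<bar>) * 1 \<le> M * (1 + \<bar>y\<bar>) * (2 * (M * (1 + \<bar>y\<bar>)))" by (intro mult_left_mono) auto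
      then show ?thesis by (simp add: power2_eq_square mult_ac)
    qed
    then have "(exp \<delta> * exp (Re z * y)) * (M * (1 + \<bar>y\<bar>)) \<le> (exp \<delta> * exp (Re z * y)) * (2 * M\<^sup>2 * (1 + \<bar>y\<bar>)\<^sup>2)"
      by (intro mult_left_mono) auto
    also have "\<dots> \<le> C * (1 + exp y)" using comb[OF zb, of y] by (simp add: mult_ac)
    finally show ?thesis .
  qed
  have d2: "cmod (gauss_rem \<delta> \<theta> z w y) \<le> C * (cmod (w - z))\<^sup>2 * (1 + exp y)"
    if w: "dist w z < d" for w y
  proof -
    define f where "f i v = (if i = 0 then gauss_exp \<delta> \<theta> v y else if i = 1 then gauss_exp' \<delta> \<theta> v y
      else gauss_exp \<delta> \<theta> v y * ((complex_of_real y + 2 * complex_of_real \<delta> * v)\<^sup>2 + 2 * complex_of_real \<delta>))" for i :: nat and v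
    have "cmod (f 0 w - (\<Sum>i\<le>1. f i z * (w - z) ^ i / fact i)) \<le> (C * (1 + exp y)) * cmod (w - z) ^ Suc 1 / fact 1"
    proof (rule complex_Taylor[of "ball z d"])
      show "convex (ball z d)" "w \<in> ball z d" "z \<in> ball z d" using w d by (simp_all add: dist_commute)
      fix v assume v: "v \<in> ball z d"
      have "cmod ((complex_of_real y + 2 * complex_of_real \<delta> * v)\<^sup>2 + 2 * complex_of_real \<delta>) \<le> (M * (1 + \<bar>y\<bar>))\<^sup>2 + 2 * \<delta>"
        using lin[OF v, of y] \<delta> by (intro norm_triangle_le add_mono) (auto simp: norm_power norm_mult intro: power_mono)
      also have "2 * \<delta> \<le> (M * (1 + \<bar>y\<bar>))\<^sup>2"
      proof -
        have "2 * \<delta> \<le> M * 1" using M by simp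
        also have "\<dots> \<le> M * M" using M by (intro mult_left_mono) auto
        also have "\<dots> \<le> (M * (1 + \<bar>y\<bar>)) * (M * (1 + \<bar>y\<bar>))" using M mult_left_mono[of 1 "1 + \<bar>y\<bar>" M] by (intro mult_mono) auto
        finally show ?thesis by (simp add: power2_eq_square)
      qed
      finally have q: "cmod ((complex_of_real y + 2 * complex_of_real \<delta> * v)\<^sup>2 + 2 * complex_of_real \<delta>) \<le> 2 * M\<^sup>2 * (1 + \<bar>y\<bar>)\<^sup>2"
        by (simp add: power_mult_distrib)
      have "cmod (f (Suc 1) v) \<le> (exp \<delta> * exp (Re v * y)) * (2 * M\<^sup>2 * (1 + \<bar>y\<bar>)\<^sup>2)"
        unfolding f_def using E[OF v, of y] q by (simp add: norm_mult) (intro mult_mono, auto)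
      then show "cmod (f (Suc 1) v) \<le> C * (1 + exp y)" using comb[OF v, of y] by (simp add: mult_ac)
      fix i :: nat assume "i \<le> 1"
      then consider "i = 0" | "i = 1" by linarith
      then show "(f i has_field_derivative f (Suc i) v) (at v within ball z d)"
      proof cases
        case 1
        then show ?thesis using gauss_exp_derivative by (simp add: f_def[abs_def])
      next
        case 2
        have "((\<lambda>v. gauss_exp' \<delta> \<theta> v y) has_field_derivative (gauss_exp' \<delta> \<theta> v y * (complex_of_real y + 2 * complex_of_real \<delta> * v)
            + gauss_exp \<delta> \<theta> v y * (2 * complex_of_real \<delta>))) (at v within ball z d)"
          unfolding gauss_exp'_def[abs_def]
          by (rule derivative_eq_intros gauss_exp_derivative refl)+ (simp add: gauss_exp'_def algebra_simps)
        then show ?thesis using 2 by (simp add: f_def[abs_def] gauss_exp'_def power2_eq_square algebra_simps)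
      qed
    qed
    then show ?thesis by (simp add: f_def power2_eq_square mult_ac diff_diff_eq)
  qed
  have "0 < C" using M by (simp add: C_def add_pos_nonneg)
  then show ?thesis by (rule that[OF d _ d1 d2])
qed

lemma exp_difference: "cmod (exp a - exp b) \<le> exp (Re b) * (cmod (a - b) * exp (cmod (a - b)))"
proof -
  have "cmod (exp c - 1) \<le> cmod c * exp (cmod c)" for c :: complex
  proof -
    have "cmod (exp c - exp 0) \<le> exp (cmod c) * cmod (c - 0)"
    proof (rule field_differentiable_bound[of "cball 0 (cmod c)" exp exp])
      show "(exp has_field_derivative exp z) (at z within cball 0 (cmod c))" for z :: complex
        by (rule derivative_eq_intros refl)+ simp
      show "cmod (exp z) \<le> exp (cmod c)" if "z \<in> cball 0 (cmod c)" for z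
        using that complex_Re_le_cmod[of z] by simp
    qed auto
    then show ?thesis by (simp add: mult.commute)
  qed
  from this[of "a - b"] have "exp (Re b) * cmod (exp (a - b) - 1) \<le> exp (Re b) * (cmod (a - b) * exp (cmod (a - b)))"
    by (intro mult_left_mono) auto
  moreover have "exp a - exp b = exp b * (exp (a - b) - 1)" by (simp add: exp_diff field_simps)
  ultimately show ?thesis by (simp add: norm_mult)
qed


section \<open>The interpolation couple\<close>

context traced_jbw_star_algebra
begin

abbreviation snorm :: "('m \<Rightarrow>\<^sub>L complex) \<Rightarrow> real" where "snorm \<equiv> sum_norm (range j) (\<lambda>v. norm (inv j v)) (predual K) norm"

text \<open>The couple is ordered, since \<open>j\<close> maps into the predual; only the norm of the sum space is new.\<close>

lemma sum_space_eq: "sum_space (range j) (predual K) = predual K"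
proof
  show "sum_space (range j) (predual K) \<subseteq> predual K"
    by (auto simp: sum_space_def intro: predual_add j_in_predual)
  have "j 0 = 0" by (rule linear_0[OF j_linear])
  then have "\<exists>a b. v = a + b \<and> a \<in> range j \<and> b \<in> predual K" if "v \<in> predual K" for v
    using that by (intro exI[of _ 0] exI[of _ v]) (auto intro!: image_eqI[of _ _ 0])
  then show "predual K \<subseteq> sum_space (range j) (predual K)"
    by (auto simp: sum_space_def)
qed

lemma predual_diff: "\<phi> \<in> predual K \<Longrightarrow> \<psi> \<in> predual K \<Longrightarrow> \<phi> - \<psi> \<in> predual K"
  using predual_add[OF _ predual_scaleC[of \<psi> "-1"]] by (fastforce simp: scaleC_simps)

lemma snorm_set_bdd: "bdd_below {norm (inv j a) + norm b |a b. a \<in> range j \<and> b \<in> predual K \<and> v = a + b}"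
  by (rule bdd_belowI[of _ 0]) auto

lemma snorm_le:
  assumes "\<phi> \<in> predual K"
  shows "snorm (j a + \<phi>) \<le> norm a + norm \<phi>"
proof -
  have "\<exists>u w. norm a + norm \<phi> = norm (inv j u) + norm w \<and> u \<in> range j \<and> w \<in> predual K \<and> j a + \<phi> = u + w"
    using assms by (intro exI[of _ "j a"] exI[of _ \<phi>]) simp
  then show ?thesis
    unfolding sum_norm_def by (intro cInf_lower[OF _ snorm_set_bdd] CollectI)
qed

lemma snorm_j_le: "snorm (j a) \<le> norm a"
  using snorm_le[OF predual_zero, of a] by simp

lemma snorm_nonempty: "v \<in> predual K \<Longrightarrow> {norm (inv j a) + norm b |a b. a \<in> range j \<and> b \<in> predual K \<and> v = a + b} \<noteq> {}"
proof -
  assume "v \<in> predual K"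
  then have "v \<in> sum_space (range j) (predual K)" by (simp only: sum_space_eq)
  then show ?thesis unfolding sum_space_def by blast
qed

lemma snorm_greatest:
  assumes "v \<in> predual K" "\<And>a \<phi>. \<phi> \<in> predual K \<Longrightarrow> v = j a + \<phi> \<Longrightarrow> c \<le> norm a + norm \<phi>"
  shows "c \<le> snorm v"
  unfolding sum_norm_def by (rule cInf_greatest[OF snorm_nonempty[OF assms(1)]]) (use assms(2) in auto)

lemma snorm_nonneg: "v \<in> predual K \<Longrightarrow> 0 \<le> snorm v"
  by (rule snorm_greatest) auto

lemma snorm_split:
  assumes "v \<in> predual K" "snorm v < r"
  obtains a \<phi> where "\<phi> \<in> predual K" "v = j a + \<phi>" "norm a + norm \<phi> < r"
proof -
  obtain q where "q \<in> {norm (inv j a) + norm b |a b. a \<in> range j \<and> b \<in> predual K \<and> v = a + b}" "q < r"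
    using cInf_lessD[OF snorm_nonempty[OF assms(1)]] assms(2) unfolding sum_norm_def by blast
  then show ?thesis using that by auto
qed

text \<open>Bounds the norm of the embedding \<open>j\<close> and is at least \<open>1\<close>, so that the norm of the predual is bounded
  by this multiple of the norm of the sum space.\<close>

definition j_bound :: real where "j_bound = max 1 (2 * \<tau> A.e)"

lemma j_bound: "1 \<le> j_bound" "2 * \<tau> A.e \<le> j_bound" "0 < j_bound"
  by (auto simp: j_bound_def)

lemma bounded_linear_j: "bounded_linear j"
  by (rule bounded_linear_intro[where K = "2 * \<tau> A.e"])
    (use j_norm_le in \<open>simp_all add: linear_add[OF j_linear] linear_scale[OF j_linear] mult.commute\<close>)

lemma norm_le_snorm:
  assumes "v \<in> predual K"
  shows "norm v \<le> j_bound * snorm v"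
proof -
  have "norm v / j_bound \<le> snorm v"
  proof (rule snorm_greatest[OF assms])
    fix a \<phi> assume v: "v = j a + \<phi>"
    have "norm v \<le> norm (j a) + norm \<phi>" unfolding v by (rule norm_triangle_ineq)
    also have "norm (j a) \<le> j_bound * norm a"
      using j_norm_le[of a] mult_right_mono[OF j_bound(2) norm_ge_zero[of a]] by linarith
    also have "norm \<phi> \<le> j_bound * norm \<phi>" using mult_right_mono[OF j_bound(1) norm_ge_zero[of \<phi>]] by simp
    finally show "norm v / j_bound \<le> norm a + norm \<phi>" using j_bound by (simp add: divide_le_eq algebra_simps)
  qed
  then show ?thesis using j_bound by (simp add: divide_le_eq mult.commute)
qed

lemma snorm_triangle:
  assumes "v \<in> predual K" "w \<in> predual K"
  shows "snorm (v + w) \<le> snorm v + snorm w"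
proof (rule field_le_epsilon)
  fix \<epsilon> :: real assume \<epsilon>: "0 < \<epsilon>"
  obtain a \<phi> where 1: "\<phi> \<in> predual K" "v = j a + \<phi>" "norm a + norm \<phi> < snorm v + \<epsilon>/2"
    by (rule snorm_split[OF assms(1), of "snorm v + \<epsilon>/2"]) (use \<epsilon> in simp)
  obtain b \<psi> where 2: "\<psi> \<in> predual K" "w = j b + \<psi>" "norm b + norm \<psi> < snorm w + \<epsilon>/2"
    by (rule snorm_split[OF assms(2), of "snorm w + \<epsilon>/2"]) (use \<epsilon> in simp)
  have "v + w = j (a + b) + (\<phi> + \<psi>)" by (simp add: 1 2 j_add)
  then have "snorm (v + w) \<le> norm (a + b) + norm (\<phi> + \<psi>)" using snorm_le[OF predual_add[OF 1(1) 2(1)], of "a + b"] by simp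
  also have "\<dots> \<le> norm a + norm b + (norm \<phi> + norm \<psi>)" by (intro add_mono norm_triangle_ineq)
  finally show "snorm (v + w) \<le> snorm v + snorm w + \<epsilon>" using 1 2 by simp
qed

lemma snorm_scaleC:
  fixes c :: complex and v :: "'m \<Rightarrow>\<^sub>L complex"
  assumes "v \<in> predual K"
  shows "snorm (c *\<^sub>C v) \<le> cmod c * snorm v"
proof (cases "c = 0")
  case True
  then show ?thesis using snorm_j_le[of 0] by (simp add: scaleC_simps linear_0[OF j_linear])
next
  case False
  have "snorm (c *\<^sub>C v) / cmod c \<le> snorm v"
  proof (rule snorm_greatest[OF assms])
    fix a \<phi> assume *: "\<phi> \<in> predual K" "v = j a + \<phi>"
    have "c *\<^sub>C v = j (c *\<^sub>C a) + c *\<^sub>C \<phi>" by (simp add: * scaleC_add_right j_scaleC)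
    then have "snorm (c *\<^sub>C v) \<le> norm (c *\<^sub>C a) + norm (c *\<^sub>C \<phi>)"
      using snorm_le[OF predual_scaleC[OF *(1)], of "c *\<^sub>C a" c] by simp
    then show "snorm (c *\<^sub>C v) / cmod c \<le> norm a + norm \<phi>"
      using False by (simp add: norm_scaleC divide_le_eq algebra_simps)
  qed
  then show ?thesis using False by (simp add: divide_le_eq mult.commute)
qed

text \<open>The summands in decompositions \<open>v\<^sub>k = j(a\<^sub>k) + \<phi>\<^sub>k\<close> that almost attain the norm can be summed
  separately.\<close>

lemma snorm_series:
  assumes v: "\<And>k. v k \<in> predual K" and le: "\<And>k. snorm (v k) < \<beta> k" and sum: "summable \<beta>"
  shows "summable v" "suminf v \<in> predual K" "snorm (suminf v) \<le> suminf \<beta>"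
proof -
  have "\<exists>a \<phi>. \<phi> \<in> predual K \<and> v k = j a + \<phi> \<and> norm a + norm \<phi> < \<beta> k" for k
    by (rule snorm_split[OF v le[of k]]) blast
  then have "\<forall>k. \<exists>q. snd q \<in> predual K \<and> v k = j (fst q) + snd q \<and> norm (fst q) + norm (snd q) < \<beta> k" by simp
  from choice[OF this] obtain q where q: "\<forall>k. snd (q k) \<in> predual K \<and> v k = j (fst (q k)) + snd (q k)
      \<and> norm (fst (q k)) + norm (snd (q k)) < \<beta> k" ..
  define a \<phi> where "a k = fst (q k)" and "\<phi> k = snd (q k)" for k
  have *: "\<phi> k \<in> predual K" "v k = j (a k) + \<phi> k" "norm (a k) + norm (\<phi> k) < \<beta> k" for k
    using q by (simp_all add: a_def \<phi>_def)
  have "norm (norm (a k)) \<le> \<beta> k" "norm (norm (\<phi> k)) \<le> \<beta> k" for k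
    using *(3)[of k] norm_ge_zero[of "a k"] norm_ge_zero[of "\<phi> k"] by (simp_all del: norm_ge_zero)
  then have s: "summable (\<lambda>k. norm (a k))" "summable (\<lambda>k. norm (\<phi> k))"
    by (auto intro!: summable_comparison_test'[OF sum, of 0])
  have sa: "a sums suminf a" and sp: "\<phi> sums suminf \<phi>"
    using s by (auto intro: summable_sums summable_norm_cancel)
  have "(\<lambda>k. j (a k)) sums j (suminf a)" by (rule bounded_linear.sums[OF bounded_linear_j sa])
  then have "(\<lambda>k. j (a k) + \<phi> k) sums (j (suminf a) + suminf \<phi>)" using sp by (rule sums_add)
  then have vs: "v sums (j (suminf a) + suminf \<phi>)" by (simp flip: *(2))
  then show "summable v" by (rule sums_summable)
  have P: "suminf \<phi> \<in> predual K"
  proof (rule closed_sequentially[OF closed_predual])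
    show "(\<lambda>n. \<Sum>k<n. \<phi> k) \<longlonglongrightarrow> suminf \<phi>" using sp by (simp add: sums_def)
    show "(\<Sum>k<n. \<phi> k) \<in> predual K" for n
      by (induction n) (auto intro: predual_add predual_zero *(1))
  qed
  have eq: "suminf v = j (suminf a) + suminf \<phi>" using vs by (rule sums_unique[symmetric])
  then show "suminf v \<in> predual K" using P by (simp add: predual_add j_in_predual)
  have "snorm (suminf v) \<le> norm (suminf a) + norm (suminf \<phi>)" unfolding eq by (rule snorm_le[OF P])
  also have "\<dots> \<le> (\<Sum>k. norm (a k)) + (\<Sum>k. norm (\<phi> k))" by (intro add_mono summable_norm s)
  also have "\<dots> = (\<Sum>k. norm (a k) + norm (\<phi> k))" by (rule suminf_add[OF s])
  also have "\<dots> \<le> suminf \<beta>" using *(3) by (intro suminf_le summable_add s sum less_imp_le)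
  finally show "snorm (suminf v) \<le> suminf \<beta>" .
qed

end

section \<open>Analytic families of functions of an element\<close>

lemma tannery_zero:
  fixes \<beta> :: "nat \<Rightarrow> 'i \<Rightarrow> real"
  assumes "\<And>k. (\<beta> k \<longlongrightarrow> 0) F" "\<And>k i. 0 \<le> \<beta> k i" "\<And>k i. \<beta> k i \<le> b k" "summable b"
  shows "((\<lambda>i. \<Sum>k. \<beta> k i) \<longlongrightarrow> 0) F"
proof (cases "F = bot")
  case False
  have "\<forall>\<^sub>F (k, i) in at_top \<times>\<^sub>F F. norm (\<beta> k i) \<le> b k"
    using assms(2,3) by (intro always_eventually) auto
  from tannerys_theorem[OF assms(1) this assms(4) False] show ?thesis by simp
qed simp

lemma suminf_difference_tendsto:
  fixes g :: "nat \<Rightarrow> 'i \<Rightarrow> 'b::banach"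
  assumes lim: "\<And>k. ((\<lambda>w. norm (g k w - g k s)) \<longlongrightarrow> 0) F"
    and le: "\<And>k w. norm (g k w) \<le> b k" and sum: "summable b"
  shows "((\<lambda>w. norm ((\<Sum>k. g k w) - (\<Sum>k. g k s))) \<longlongrightarrow> 0) F"
proof (rule Lim_null_comparison)
  have s: "summable (\<lambda>k. norm (g k w))" for w
    by (rule summable_comparison_test'[OF sum, of 0]) (simp add: le)
  have d: "norm (g k w - g k s) \<le> 2 * b k" for k w
    using norm_triangle_ineq4[of "g k w" "g k s"] le[of k w] le[of k s] by linarith
  show "((\<lambda>w. \<Sum>k. norm (g k w - g k s)) \<longlongrightarrow> 0) F"
    by (rule tannery_zero[OF lim _ d]) (use sum in \<open>auto intro: summable_mult\<close>)
  have "norm ((\<Sum>k. g k w) - (\<Sum>k. g k s)) \<le> (\<Sum>k. norm (g k w - g k s))" for w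
  proof -
    have "(\<Sum>k. g k w) - (\<Sum>k. g k s) = (\<Sum>k. g k w - g k s)"
      by (rule suminf_diff) (rule summable_norm_cancel[OF s])+
    moreover have "summable (\<lambda>k. norm (g k w - g k s))"
      by (rule summable_comparison_test'[OF summable_mult[OF sum], of 0 _ 2]) (simp add: d)
    ultimately show ?thesis by (simp add: summable_norm)
  qed
  then show "\<forall>\<^sub>F w in F. norm (norm ((\<Sum>k. g k w) - (\<Sum>k. g k s))) \<le> (\<Sum>k. norm (g k w - g k s))"
    by simp
qed

lemma continuous_on_compact_bounded:
  fixes f :: "'i::topological_space \<Rightarrow> 'b::real_normed_vector"
  assumes "compact S" "continuous_on S f"
  shows "\<exists>E. \<forall>t\<in>S. norm (f t) \<le> \<bar>E\<bar>"
proof -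
  have "bounded (f ` S)" by (rule compact_imp_bounded[OF compact_continuous_image[OF assms(2,1)]])
  then obtain E where "\<forall>v\<in>f ` S. norm v \<le> E" by (auto simp: bounded_iff)
  then show ?thesis by (intro exI[of _ E]) (auto intro: order_trans[OF _ abs_ge_self])
qed

text \<open>A Taylor estimate of second order in the form required by the definition of
  holomorphy in a norm.\<close>

lemma difference_quotient_tendsto:
  fixes g :: "complex \<Rightarrow> 'b::complex_banach"
  assumes "0 < d" "\<And>w. dist w z < d \<Longrightarrow> norm (g w - g z - (w - z) *\<^sub>C D) \<le> C * (cmod (w - z))\<^sup>2"
  shows "((\<lambda>w. inverse (w - z) *\<^sub>C (g w - g z) - D) \<longlongrightarrow> 0) (at z)"
proof (rule Lim_null_comparison)
  have "((\<lambda>w. C * cmod (w - z)) \<longlongrightarrow> C * cmod (z - z)) (at z)" by (intro tendsto_intros)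
  then show "((\<lambda>w. C * cmod (w - z)) \<longlongrightarrow> 0) (at z)" by simp
  show "\<forall>\<^sub>F w in at z. norm (inverse (w - z) *\<^sub>C (g w - g z) - D) \<le> C * cmod (w - z)"
    unfolding eventually_at
  proof (intro exI[of _ d] conjI ballI impI)
    fix w assume w: "w \<noteq> z \<and> dist w z < d"
    have "inverse (w - z) *\<^sub>C (g w - g z) - D = inverse (w - z) *\<^sub>C (g w - g z - (w - z) *\<^sub>C D)"
    proof -
      have "inverse (w - z) *\<^sub>C (g w - g z - (w - z) *\<^sub>C D)
          = inverse (w - z) *\<^sub>C (g w - g z) - (inverse (w - z) * (w - z)) *\<^sub>C D"
        by (simp only: scaleC_diff_right scaleC_scaleC)
      then show ?thesis using w by (simp add: scaleC_one)
    qed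
    then have "norm (inverse (w - z) *\<^sub>C (g w - g z) - D) \<le> inverse (cmod (w - z)) * (C * (cmod (w - z))\<^sup>2)"
      using assms(2)[of w] w by (simp add: norm_scaleC norm_inverse mult_left_mono)
    also have "\<dots> = C * cmod (w - z)" using w by (simp add: power2_eq_square)
    finally show "norm (inverse (w - z) *\<^sub>C (g w - g z) - D) \<le> C * cmod (w - z)" .
  qed (fact assms(1))
qed

context traced_jbw_star_algebra
begin

lemma trace_fc_mono:
  assumes "continuous_on (A.spec x) f" "continuous_on (A.spec x) g" "\<And>t. t \<in> A.spec x \<Longrightarrow> f t \<le> g t"
  shows "\<tau> (A.fc f x) \<le> \<tau> (A.fc g x)"
proof (rule A.trace_mono)
  have "A.pos (A.fc (\<lambda>t. g t - f t) x)" using assms by (intro A.fc_pos continuous_intros) auto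
  then show "A.pos (A.fc g x - A.fc f x)" using assms by (simp add: A.fc_diff)
qed

lemma trace_fc_scale: "continuous_on (A.spec x) f \<Longrightarrow> \<tau> (A.fc (\<lambda>t. c * f t) x) = c * \<tau> (A.fc f x)"
  by (simp add: A.fc_scale)

text \<open>The data of an analytic family \<open>m exp(z y)\<close>. The bound on \<open>m\<close> controls the line \<open>Re z = 0\<close> and the
  bound on the trace controls the line \<open>Re z = 1\<close>.\<close>

definition admissible :: "'a \<Rightarrow> (real \<Rightarrow> real) \<Rightarrow> (real \<Rightarrow> real) \<Rightarrow> bool"
  where "admissible x m y \<longleftrightarrow> continuous_on (A.spec x) m \<and> continuous_on (A.spec x) y \<and>
    (\<forall>t\<in>A.spec x. \<bar>m t\<bar> \<le> 1) \<and> \<tau> (A.fc (\<lambda>t. exp (y t)) x) \<le> 1"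

lemma admissibleD:
  assumes "admissible x m y"
  shows "continuous_on (A.spec x) m" "continuous_on (A.spec x) y"
    "t \<in> A.spec x \<Longrightarrow> \<bar>m t\<bar> \<le> 1" "\<tau> (A.fc (\<lambda>t. exp (y t)) x) \<le> 1"
  using assms by (auto simp: admissible_def)

text \<open>Splitting \<open>F = F/(1 + e\<^sup>y) + F e\<^sup>y/(1 + e\<^sup>y)\<close>, the first part is small in the algebra and the second
  one in the predual.\<close>

lemma snorm_cfc_le:
  assumes adm: "admissible x m y" and F: "continuous_on (A.spec x) F"
    and le: "\<And>t. t \<in> A.spec x \<Longrightarrow> cmod (F t) \<le> B * (1 + exp (y t))" and B: "0 < B"
  shows "snorm (j (cfc x F)) \<le> 2 * B"
proof -
  note y = admissibleD(2)[OF adm]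
  define F1 where "F1 t = F t / complex_of_real (1 + exp (y t))" for t
  define F2 where "F2 t = F t * complex_of_real (exp (y t)) / complex_of_real (1 + exp (y t))" for t
  have pos: "0 < 1 + exp (y t)" for t by (simp add: add_pos_pos)
  have nz: "complex_of_real (1 + exp (y t)) \<noteq> 0" for t using pos[of t] of_real_eq_0_iff less_irrefl by metis
  have c1: "continuous_on (A.spec x) F1" unfolding F1_def by (intro continuous_intros F y ballI nz)
  have c2: "continuous_on (A.spec x) F2" unfolding F2_def by (intro continuous_intros F y ballI nz)
  have "F t = F1 t + F2 t" for t
  proof -
    have "F1 t + F2 t = F t * complex_of_real (1 + exp (y t)) / complex_of_real (1 + exp (y t))"
      unfolding F1_def F2_def add_divide_distrib[symmetric] by (simp add: algebra_simps)
    then show ?thesis using nz[of t] by simp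
  qed
  then have eq: "cfc x F = cfc x F1 + cfc x F2"
    using cfc_add[OF c1 c2] cfc_cong[OF F] by simp
  have b: "cmod (F t) / (1 + exp (y t)) \<le> B" if "t \<in> A.spec x" for t
    using le[OF that] pos[of t] by (simp add: divide_le_eq)
  have nn: "cmod (complex_of_real (1 + exp (y t))) = 1 + exp (y t)" for t
    using pos[of t] by (simp only: norm_of_real abs_of_pos)
  have 1: "norm (cfc x F1) \<le> B"
    by (rule cfc_norm_le[OF c1]) (use b B in \<open>simp_all only: F1_def norm_divide nn less_imp_le\<close>)
  have "norm (j (cfc x F2)) \<le> \<tau> (A.fc (\<lambda>t. B * exp (y t)) x)"
  proof (rule norm_j_cfc_le[OF c2])
    show "continuous_on (A.spec x) (\<lambda>t. B * exp (y t))" by (intro continuous_intros y)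
    show "0 < B * exp (y t)" for t using B by simp
    fix t assume t: "t \<in> A.spec x"
    have "cmod (F2 t) = cmod (F t) / (1 + exp (y t)) * exp (y t)"
      by (simp only: F2_def norm_divide norm_mult nn) simp
    also have "\<dots> \<le> B * exp (y t)" using b[OF t] by (rule mult_right_mono) simp
    finally show "cmod (F2 t) \<le> B * exp (y t)" .
  qed
  also have "\<dots> = B * \<tau> (A.fc (\<lambda>t. exp (y t)) x)" by (intro trace_fc_scale continuous_intros y)
  also have "\<dots> \<le> B * 1" using admissibleD(4)[OF adm] B by (intro mult_left_mono) auto
  finally have 2: "norm (j (cfc x F2)) \<le> B" by simp
  have "snorm (j (cfc x F)) \<le> norm (cfc x F1) + norm (j (cfc x F2))"
    unfolding eq j_add by (rule snorm_le[OF j_in_predual])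
  with 1 2 show ?thesis by simp
qed

definition family :: "real \<Rightarrow> real \<Rightarrow> real \<Rightarrow> 'a \<Rightarrow> (real \<Rightarrow> real) \<Rightarrow> (real \<Rightarrow> real) \<Rightarrow> complex \<Rightarrow> 'm"
  where "family \<delta> \<theta> N x m y z = cfc x (\<lambda>t. complex_of_real (N * m t) * gauss_exp \<delta> \<theta> z (y t))"

lemma family_continuous:
  assumes "admissible x m y"
  shows "continuous_on (A.spec x) (\<lambda>t. complex_of_real (N * m t) * gauss_exp \<delta> \<theta> z (y t))"
    "continuous_on (A.spec x) (\<lambda>t. complex_of_real (N * m t) * gauss_exp' \<delta> \<theta> z (y t))"
proof -
  note [continuous_intros] = admissibleD(1,2)[OF assms]
  show "continuous_on (A.spec x) (\<lambda>t. complex_of_real (N * m t) * gauss_exp \<delta> \<theta> z (y t))"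
    "continuous_on (A.spec x) (\<lambda>t. complex_of_real (N * m t) * gauss_exp' \<delta> \<theta> z (y t))"
    by (intro continuous_intros)+
qed

lemma gauss_exp_real: "gauss_exp \<delta> \<theta> (complex_of_real \<theta>) v = complex_of_real (exp (\<theta> * v))"
  by (simp add: gauss_exp_def exp_of_real flip: of_real_mult of_real_power)

lemma family_at:
  assumes adm: "admissible x m y" and eq: "\<And>t. t \<in> A.spec x \<Longrightarrow> N * m t * exp (\<theta> * y t) = f t"
  shows "family \<delta> \<theta> N x m y (complex_of_real \<theta>) = \<iota> (A.fc f x)"
proof -
  have "family \<delta> \<theta> N x m y (complex_of_real \<theta>) = cfc x (\<lambda>t. complex_of_real (f t))"
    unfolding family_def by (intro cfc_cong family_continuous[OF adm]) (simp add: gauss_exp_real flip: eq)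
  then show ?thesis by (simp add: cfc_real)
qed

lemma family_modulus_le:
  assumes adm: "admissible x m y" and N: "0 < N" and t: "t \<in> A.spec x"
  shows "cmod (complex_of_real (N * m t) * G) \<le> N * cmod G"
proof -
  have "N * (\<bar>m t\<bar> * cmod G) \<le> N * (1 * cmod G)"
    using admissibleD(3)[OF adm t] N by (intro mult_left_mono mult_right_mono) auto
  then show ?thesis using N by (simp add: norm_mult abs_mult mult.assoc)
qed

lemma exponent_le:
  assumes "0 \<le> \<delta>" "0 \<le> u" "u \<le> (1::real)"
  shows "\<delta> * (u\<^sup>2 - s\<^sup>2 - \<theta>\<^sup>2) \<le> \<delta> + - \<delta> * s\<^sup>2"
proof -
  have "u\<^sup>2 \<le> 1" using assms by (intro power_le_one) auto
  then have "\<delta> * (u\<^sup>2 - s\<^sup>2 - \<theta>\<^sup>2) \<le> \<delta> * (1 - s\<^sup>2)"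
    using assms(1) zero_le_power2[of \<theta>] by (intro mult_left_mono) linarith+
  then show ?thesis by (simp add: algebra_simps)
qed

lemma family_left:
  assumes adm: "admissible x m y" and N: "0 < N" and \<delta>: "0 \<le> \<delta>"
  shows "norm (family \<delta> \<theta> N x m y (Complex 0 s)) \<le> N * (exp \<delta> * exp (- \<delta> * s\<^sup>2))"
  unfolding family_def
proof (rule cfc_norm_le[OF family_continuous(1)[OF adm]])
  fix t assume t: "t \<in> A.spec x"
  have "cmod (gauss_exp \<delta> \<theta> (Complex 0 s) (y t)) \<le> exp \<delta> * exp (- \<delta> * s\<^sup>2)"
    using exponent_le[OF \<delta>, of 0 s \<theta>] by (simp add: norm_gauss_exp flip: exp_add)
  then have "N * cmod (gauss_exp \<delta> \<theta> (Complex 0 s) (y t)) \<le> N * (exp \<delta> * exp (- \<delta> * s\<^sup>2))"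
    using N by (intro mult_left_mono) auto
  with family_modulus_le[OF adm N t]
  show "cmod (complex_of_real (N * m t) * gauss_exp \<delta> \<theta> (Complex 0 s) (y t)) \<le> N * (exp \<delta> * exp (- \<delta> * s\<^sup>2))"
    by (rule order_trans)
qed (use N in simp)

lemma family_right:
  assumes adm: "admissible x m y" and N: "0 < N" and \<delta>: "0 \<le> \<delta>"
  shows "norm (j (family \<delta> \<theta> N x m y (Complex 1 s))) \<le> N * (exp \<delta> * exp (- \<delta> * s\<^sup>2))"
proof -
  note y = admissibleD(2)[OF adm]
  define c where "c = N * (exp \<delta> * exp (- \<delta> * s\<^sup>2))"
  have c: "0 < c" using N by (simp add: c_def)
  have "norm (j (family \<delta> \<theta> N x m y (Complex 1 s))) \<le> \<tau> (A.fc (\<lambda>t. c * exp (y t)) x)"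
    unfolding family_def
  proof (rule norm_j_cfc_le[OF family_continuous(1)[OF adm]])
    show "continuous_on (A.spec x) (\<lambda>t. c * exp (y t))" by (intro continuous_intros y)
    show "0 < c * exp (y t)" for t using c by simp
    fix t assume t: "t \<in> A.spec x"
    have "cmod (gauss_exp \<delta> \<theta> (Complex 1 s) (y t)) \<le> (exp \<delta> * exp (- \<delta> * s\<^sup>2)) * exp (y t)"
      using exponent_le[OF \<delta>, of 1 s \<theta>] by (simp add: norm_gauss_exp flip: exp_add)
    then have "N * cmod (gauss_exp \<delta> \<theta> (Complex 1 s) (y t)) \<le> N * ((exp \<delta> * exp (- \<delta> * s\<^sup>2)) * exp (y t))"
      using N by (intro mult_left_mono) auto
    with family_modulus_le[OF adm N t]
    show "cmod (complex_of_real (N * m t) * gauss_exp \<delta> \<theta> (Complex 1 s) (y t)) \<le> c * exp (y t)"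
      unfolding c_def mult.assoc[of N] by (rule order_trans)
  qed
  also have "\<dots> = c * \<tau> (A.fc (\<lambda>t. exp (y t)) x)" by (intro trace_fc_scale continuous_intros y)
  also have "\<dots> \<le> c * 1" using admissibleD(4)[OF adm] c by (intro mult_left_mono) auto
  finally show ?thesis by (simp add: c_def)
qed

lemma family_strip:
  assumes adm: "admissible x m y" and N: "0 < N" and \<delta>: "0 \<le> \<delta>" and z: "z \<in> closed_strip"
  shows "snorm (j (family \<delta> \<theta> N x m y z)) \<le> N * (2 * exp \<delta>)"
proof -
  have "snorm (j (family \<delta> \<theta> N x m y z)) \<le> 2 * (N * exp \<delta>)"
    unfolding family_def
  proof (rule snorm_cfc_le[OF adm family_continuous(1)[OF adm]])
    fix t assume t: "t \<in> A.spec x"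
    have r: "0 \<le> Re z" "Re z \<le> 1" using z by (auto simp: closed_strip_def)
    have "\<delta> * ((Re z)\<^sup>2 - (Im z)\<^sup>2 - \<theta>\<^sup>2) \<le> \<delta>"
      using exponent_le[OF \<delta> r, of "Im z" \<theta>] \<delta> zero_le_power2[of "Im z"] mult_nonneg_nonneg[of \<delta> "(Im z)\<^sup>2"] by linarith
    then have "cmod (gauss_exp \<delta> \<theta> z (y t)) \<le> exp \<delta> * exp (Re z * y t)"
      by (simp add: norm_gauss_exp flip: exp_add)
    also have "\<dots> \<le> exp \<delta> * (1 + exp (y t))" using exp_interpolate[OF r] by (intro mult_left_mono) auto
    finally have "N * cmod (gauss_exp \<delta> \<theta> z (y t)) \<le> N * (exp \<delta> * (1 + exp (y t)))"
      using N by (intro mult_left_mono) auto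
    with family_modulus_le[OF adm N t]
    show "cmod (complex_of_real (N * m t) * gauss_exp \<delta> \<theta> z (y t)) \<le> N * exp \<delta> * (1 + exp (y t))"
      unfolding mult.assoc[of N] by (rule order_trans)
  qed (use N in simp)
  then show ?thesis by (simp add: mult_ac)
qed

text \<open>For a single element the exponents are bounded on the spectrum, so the family is continuous
  even for the norm of the algebra.\<close>

lemma family_tendsto:
  assumes adm: "admissible x m y" and N: "0 < N"
  shows "((\<lambda>w. norm (family \<delta> \<theta> N x m y w - family \<delta> \<theta> N x m y z)) \<longlongrightarrow> 0) (at z within S)"
proof -
  note y = admissibleD(2)[OF adm]
  obtain E where E: "\<And>t. t \<in> A.spec x \<Longrightarrow> cmod (gauss_exp \<delta> \<theta> z (y t)) \<le> \<bar>E\<bar>"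
    using continuous_on_compact_bounded[OF A.compact_spec continuous_gauss_exp(1)[OF y]] by blast
  obtain Y where Y: "\<And>t. t \<in> A.spec x \<Longrightarrow> norm (y t) \<le> \<bar>Y\<bar>"
    using continuous_on_compact_bounded[OF A.compact_spec y] by blast
  define q where "q w = cmod (w - z) * \<bar>Y\<bar> + \<bar>\<delta>\<bar> * cmod (w\<^sup>2 - z\<^sup>2)" for w
  have "(q \<longlongrightarrow> q z) (at z within S)" unfolding q_def by (intro tendsto_intros)
  then have q0: "(q \<longlongrightarrow> 0) (at z within S)" by (simp add: q_def)
  show ?thesis
  proof (rule Lim_null_comparison)
    have "((\<lambda>w. N * (\<bar>E\<bar> * (q w * exp (q w)))) \<longlongrightarrow> N * (\<bar>E\<bar> * (0 * exp 0))) (at z within S)"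
      by (intro tendsto_intros q0)
    then show "((\<lambda>w. N * (\<bar>E\<bar> * (q w * exp (q w)))) \<longlongrightarrow> 0) (at z within S)" by simp
    have "norm (family \<delta> \<theta> N x m y w - family \<delta> \<theta> N x m y z) \<le> N * (\<bar>E\<bar> * (q w * exp (q w)))" for w
    proof -
      have q: "0 \<le> q w" by (simp add: q_def)
      let ?F = "\<lambda>w t. complex_of_real (N * m t) * gauss_exp \<delta> \<theta> w (y t)"
      have "norm (cfc x (\<lambda>t. ?F w t - ?F z t)) \<le> N * (\<bar>E\<bar> * (q w * exp (q w)))"
      proof (rule cfc_norm_le)
        show "continuous_on (A.spec x) (\<lambda>t. ?F w t - ?F z t)"
          by (intro continuous_on_diff family_continuous[OF adm])
        fix t assume t: "t \<in> A.spec x"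
        let ?a = "\<lambda>w. w * complex_of_real (y t) + complex_of_real \<delta> * (w\<^sup>2 - complex_of_real (\<theta>\<^sup>2))"
        have "?a w - ?a z = (w - z) * complex_of_real (y t) + complex_of_real \<delta> * (w\<^sup>2 - z\<^sup>2)"
          by (simp add: algebra_simps)
        then have "cmod (?a w - ?a z) \<le> cmod (w - z) * \<bar>y t\<bar> + \<bar>\<delta>\<bar> * cmod (w\<^sup>2 - z\<^sup>2)"
          by (metis norm_triangle_ineq norm_mult norm_of_real)
        also have "\<dots> \<le> q w" unfolding q_def using Y[OF t] by (intro add_mono mult_left_mono) simp_all
        finally have le: "cmod (?a w - ?a z) \<le> q w" .
        have "cmod (gauss_exp \<delta> \<theta> w (y t) - gauss_exp \<delta> \<theta> z (y t)) \<le> exp (Re (?a z)) * (cmod (?a w - ?a z) * exp (cmod (?a w - ?a z)))"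
          unfolding gauss_exp_def by (rule exp_difference)
        also have "exp (Re (?a z)) = cmod (gauss_exp \<delta> \<theta> z (y t))" by (simp only: gauss_exp_def norm_exp_eq_Re)
        also have "cmod (gauss_exp \<delta> \<theta> z (y t)) * (cmod (?a w - ?a z) * exp (cmod (?a w - ?a z))) \<le> \<bar>E\<bar> * (q w * exp (q w))"
          using le q by (intro mult_mono E t) auto
        finally have "N * cmod (gauss_exp \<delta> \<theta> w (y t) - gauss_exp \<delta> \<theta> z (y t)) \<le> N * (\<bar>E\<bar> * (q w * exp (q w)))"
          using N by (intro mult_left_mono) auto
        with family_modulus_le[OF adm N t]
        show "cmod (?F w t - ?F z t) \<le> N * (\<bar>E\<bar> * (q w * exp (q w)))"
          unfolding right_diff_distrib[symmetric] by (rule order_trans)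
      qed (use N q in simp)
      then show ?thesis by (simp only: family_def cfc_diff[OF family_continuous(1)[OF adm] family_continuous(1)[OF adm]])
    qed
    then show "\<forall>\<^sub>F w in at z within S. norm (norm (family \<delta> \<theta> N x m y w - family \<delta> \<theta> N x m y z)) \<le> N * (\<bar>E\<bar> * (q w * exp (q w)))"
      by simp
  qed
qed

definition family' :: "real \<Rightarrow> real \<Rightarrow> real \<Rightarrow> 'a \<Rightarrow> (real \<Rightarrow> real) \<Rightarrow> (real \<Rightarrow> real) \<Rightarrow> complex \<Rightarrow> 'm"
  where "family' \<delta> \<theta> N x m y z = cfc x (\<lambda>t. complex_of_real (N * m t) * gauss_exp' \<delta> \<theta> z (y t))"

abbreviation family_rem :: "real \<Rightarrow> real \<Rightarrow> real \<Rightarrow> 'a \<Rightarrow> (real \<Rightarrow> real) \<Rightarrow> (real \<Rightarrow> real) \<Rightarrow> complex \<Rightarrow> complex \<Rightarrow> 'm"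
  where "family_rem \<delta> \<theta> N x m y z w \<equiv> family \<delta> \<theta> N x m y w - family \<delta> \<theta> N x m y z - (w - z) *\<^sub>C family' \<delta> \<theta> N x m y z"

lemma family_remainder:
  assumes adm: "admissible x m y"
  shows "family_rem \<delta> \<theta> N x m y z w
    = cfc x (\<lambda>t. complex_of_real (N * m t) * gauss_rem \<delta> \<theta> z w (y t))"
proof -
  let ?F = "\<lambda>w t. complex_of_real (N * m t) * gauss_exp \<delta> \<theta> w (y t)"
  let ?G = "\<lambda>t. complex_of_real (N * m t) * gauss_exp' \<delta> \<theta> z (y t)"
  note c = family_continuous[OF adm]
  have c': "continuous_on (A.spec x) (\<lambda>t. (w - z) * ?G t)" "continuous_on (A.spec x) (\<lambda>t. ?F w t - ?F z t)"
    by (intro continuous_on_mult continuous_on_const continuous_on_diff c)+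
  have "family_rem \<delta> \<theta> N x m y z w
      = cfc x (\<lambda>t. ?F w t - ?F z t - (w - z) * ?G t)"
    unfolding family_def family'_def cfc_diff[OF c'(2,1)] cfc_diff[OF c(1) c(1)] cfc_scaleC[OF c(2)] ..
  also have "(\<lambda>t. ?F w t - ?F z t - (w - z) * ?G t)
      = (\<lambda>t. complex_of_real (N * m t) * gauss_rem \<delta> \<theta> z w (y t))"
    by (simp add: algebra_simps)
  finally show ?thesis .
qed

lemma family_remainder_continuous:
  assumes adm: "admissible x m y"
  shows "continuous_on (A.spec x) (\<lambda>t. complex_of_real (N * m t) * gauss_rem \<delta> \<theta> z w (y t))"
proof -
  note [continuous_intros] = admissibleD(1,2)[OF adm]
  show ?thesis by (intro continuous_intros)
qed

text \<open>The constants do not depend on the element, so that the estimate can be summed.\<close>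

lemma family_expansion:
  assumes \<delta>: "0 \<le> \<delta>" and z: "z \<in> open_strip"
  obtains C d where "0 < d" "0 < C"
    "\<And>x m y N. admissible x m y \<Longrightarrow> 0 < N \<Longrightarrow> snorm (j (family' \<delta> \<theta> N x m y z)) \<le> N * C"
    "\<And>x m y N w. admissible x m y \<Longrightarrow> 0 < N \<Longrightarrow> dist w z < d \<Longrightarrow> w \<noteq> z \<Longrightarrow>
      snorm (j (family_rem \<delta> \<theta> N x m y z w)) \<le> N * (C * (cmod (w - z))\<^sup>2)"
proof -
  obtain C d where d: "0 < d" and C: "0 < C"
    and 1: "\<And>y. cmod (gauss_exp' \<delta> \<theta> z y) \<le> C * (1 + exp y)"
    and 2: "\<And>y w. dist w z < d \<Longrightarrow> cmod (gauss_rem \<delta> \<theta> z w y) \<le> C * (cmod (w - z))\<^sup>2 * (1 + exp y)"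
    using gauss_exp_expansion[OF \<delta> z] by metis
  show ?thesis
  proof (rule that[of d "2 * C"])
    fix x m y and N :: real assume adm: "admissible x m y" and N: "0 < N"
    have "snorm (j (family' \<delta> \<theta> N x m y z)) \<le> 2 * (N * C)"
      unfolding family'_def
    proof (rule snorm_cfc_le[OF adm family_continuous(2)[OF adm]])
      fix t assume t: "t \<in> A.spec x"
      have "N * cmod (gauss_exp' \<delta> \<theta> z (y t)) \<le> N * (C * (1 + exp (y t)))" using N by (intro mult_left_mono 1) auto
      with family_modulus_le[OF adm N t]
      show "cmod (complex_of_real (N * m t) * gauss_exp' \<delta> \<theta> z (y t)) \<le> N * C * (1 + exp (y t))"
        unfolding mult.assoc[of N] by (rule order_trans)
    qed (use N C in simp)
    then show "snorm (j (family' \<delta> \<theta> N x m y z)) \<le> N * (2 * C)" by (simp add: mult_ac)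
    fix w assume w: "dist w z < d" "w \<noteq> z"
    have "snorm (j (family_rem \<delta> \<theta> N x m y z w)) \<le> 2 * (N * (C * (cmod (w - z))\<^sup>2))"
      unfolding family_remainder[OF adm]
    proof (rule snorm_cfc_le[OF adm family_remainder_continuous[OF adm]])
      fix t assume t: "t \<in> A.spec x"
      have "N * cmod (gauss_rem \<delta> \<theta> z w (y t)) \<le> N * (C * (cmod (w - z))\<^sup>2 * (1 + exp (y t)))"
        using N by (intro mult_left_mono 2 w) auto
      with family_modulus_le[OF adm N t]
      show "cmod (complex_of_real (N * m t) * gauss_rem \<delta> \<theta> z w (y t))
        \<le> N * (C * (cmod (w - z))\<^sup>2) * (1 + exp (y t))"
        unfolding mult.assoc[of N] by (rule order_trans)
    qed (use N C w in simp)
    then show "snorm (j (family_rem \<delta> \<theta> N x m y z w)) \<le> N * (2 * C * (cmod (w - z))\<^sup>2)"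
      by (simp add: mult_ac)
  qed (use d C in simp_all)
qed

lemma family_differentiable:
  assumes adm: "admissible x m y" and N: "0 < N" and \<delta>: "0 \<le> \<delta>" and z: "z \<in> open_strip"
  shows "((\<lambda>w. inverse (w - z) *\<^sub>C (family \<delta> \<theta> N x m y w - family \<delta> \<theta> N x m y z) - family' \<delta> \<theta> N x m y z) \<longlongrightarrow> 0) (at z)"
proof -
  note y = admissibleD(2)[OF adm]
  obtain C d where d: "0 < d" and C: "0 < C"
    and 2: "\<And>y w. dist w z < d \<Longrightarrow> cmod (gauss_rem \<delta> \<theta> z w y) \<le> C * (cmod (w - z))\<^sup>2 * (1 + exp y)"
    using gauss_exp_expansion[OF \<delta> z] by metis
  obtain E where "\<And>t. t \<in> A.spec x \<Longrightarrow> norm (exp (y t)) \<le> \<bar>E\<bar>"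
    using continuous_on_compact_bounded[OF A.compact_spec continuous_on_exp[OF y]] by blast
  then have E: "exp (y t) \<le> \<bar>E\<bar>" if "t \<in> A.spec x" for t using that by simp
  show ?thesis
  proof (rule difference_quotient_tendsto[OF d, where C = "N * C * (1 + \<bar>E\<bar>)"])
    fix w assume w: "dist w z < d"
    show "norm (family_rem \<delta> \<theta> N x m y z w) \<le> N * C * (1 + \<bar>E\<bar>) * (cmod (w - z))\<^sup>2"
      unfolding family_remainder[OF adm]
    proof (rule cfc_norm_le[OF family_remainder_continuous[OF adm]])
      fix t assume t: "t \<in> A.spec x"
      have "N * cmod (gauss_rem \<delta> \<theta> z w (y t)) \<le> N * (C * (cmod (w - z))\<^sup>2 * (1 + exp (y t)))"
        using N by (intro mult_left_mono 2 w) auto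
      also have "\<dots> \<le> N * (C * (cmod (w - z))\<^sup>2 * (1 + \<bar>E\<bar>))"
        using N C E[OF t] by (intro mult_left_mono add_left_mono) auto
      also have "\<dots> = N * C * (1 + \<bar>E\<bar>) * (cmod (w - z))\<^sup>2" by (simp add: mult_ac)
      finally show "cmod (complex_of_real (N * m t) * gauss_rem \<delta> \<theta> z w (y t))
        \<le> N * C * (1 + \<bar>E\<bar>) * (cmod (w - z))\<^sup>2"
        by (rule order_trans[OF family_modulus_le[OF adm N t]])
    qed (use N C in simp)
  qed
qed

end

section \<open>Functions of Calderon's class\<close>

text \<open>Without this the suprema in the norm of Calderon's class would carry no information.\<close>

lemma bdd_above_boundary:
  fixes \<phi> :: "real \<Rightarrow> 'b::real_normed_vector"
  assumes cont: "\<And>s. ((\<lambda>t. norm (\<phi> t - \<phi> s)) \<longlongrightarrow> 0) (at s)"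
    and lim: "((\<lambda>t. norm (\<phi> t)) \<longlongrightarrow> 0) at_infinity"
  shows "bdd_above (range (\<lambda>t. norm (\<phi> t)))"
proof -
  have "isCont \<phi> s" for s
    unfolding isCont_def using cont[of s] by (subst LIM_zero_iff[symmetric]) (rule tendsto_norm_zero_cancel)
  then have c: "continuous_on S \<phi>" for S by (simp add: continuous_at_imp_continuous_on)
  have "\<forall>\<^sub>F t in at_infinity. norm (\<phi> t) < 1" using order_tendstoD(2)[OF lim] by simp
  then obtain b where b: "\<And>t. b \<le> norm t \<Longrightarrow> norm (\<phi> t) < 1" by (auto simp: eventually_at_infinity)
  obtain E where E: "\<And>t. t \<in> {- \<bar>b\<bar>..\<bar>b\<bar>} \<Longrightarrow> norm (\<phi> t) \<le> \<bar>E\<bar>"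
    using continuous_on_compact_bounded[OF compact_Icc c] by blast
  have "norm (\<phi> t) \<le> max 1 \<bar>E\<bar>" for t
  proof (cases "b \<le> norm t")
    case True
    then show ?thesis using b[of t] by simp
  next
    case False
    then have "t \<in> {- \<bar>b\<bar>..\<bar>b\<bar>}" by auto
    from E[OF this] show ?thesis by simp
  qed
  then show ?thesis by (intro bdd_aboveI2)
qed

context traced_jbw_star_algebra
begin

abbreviation strip_functions :: "(complex \<Rightarrow> ('m \<Rightarrow>\<^sub>L complex)) set"
  where "strip_functions \<equiv> calderon_class (range j) (\<lambda>v. norm (inv j v)) (predual K) norm"
abbreviation strip_norm :: "(complex \<Rightarrow> ('m \<Rightarrow>\<^sub>L complex)) \<Rightarrow> real"
  where "strip_norm \<equiv> calderon_norm (\<lambda>v. norm (inv j v)) norm"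
abbreviation theta_space :: "real \<Rightarrow> ('m \<Rightarrow>\<^sub>L complex) set"
  where "theta_space \<equiv> interp_space (range j) (\<lambda>v. norm (inv j v)) (predual K) norm"
abbreviation theta_norm :: "real \<Rightarrow> ('m \<Rightarrow>\<^sub>L complex) \<Rightarrow> real"
  where "theta_norm \<equiv> interp_norm (range j) (\<lambda>v. norm (inv j v)) (predual K) norm"

lemma strip_functionsD:
  assumes f: "f \<in> strip_functions"
  shows "z \<in> closed_strip \<Longrightarrow> f z \<in> predual K"
    "\<exists>B. \<forall>z\<in>closed_strip. snorm (f z) \<le> B"
    "z \<in> closed_strip \<Longrightarrow> ((\<lambda>w. snorm (f w - f z)) \<longlongrightarrow> 0) (at z within closed_strip)"
    "z \<in> open_strip \<Longrightarrow> \<exists>D\<in>predual K. ((\<lambda>w. snorm (inverse (w - z) *\<^sub>C (f w - f z) - D)) \<longlongrightarrow> 0) (at z within open_strip)"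
    "f (Complex 0 t) \<in> range j" "f (Complex 1 t) \<in> predual K"
    "((\<lambda>w. norm (inv j (f (Complex 0 w) - f (Complex 0 t)))) \<longlongrightarrow> 0) (at t)"
    "((\<lambda>w. norm (inv j (f (Complex 0 w)))) \<longlongrightarrow> 0) at_infinity"
    "((\<lambda>w. norm (f (Complex 1 w) - f (Complex 1 t))) \<longlongrightarrow> 0) (at t)"
    "((\<lambda>w. norm (f (Complex 1 w))) \<longlongrightarrow> 0) at_infinity"
  using f unfolding calderon_class_def sum_space_eq norm_continuous_on_def norm_holomorphic_on_def mem_Collect_eq
  by (elim conjE; simp; fail)+

lemma strip_norm_left:
  assumes f: "f \<in> strip_functions"
  shows "norm (inv j (f (Complex 0 t))) \<le> strip_norm f"
proof -
  have fj: "f (Complex 0 t) = j (inv j (f (Complex 0 t)))" for t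
    by (rule f_inv_into_f[symmetric, OF strip_functionsD(5)[OF f]])
  have "inv j (f (Complex 0 w) - f (Complex 0 t)) = inv j (f (Complex 0 w)) - inv j (f (Complex 0 t))" for w t
    by (subst (1) fj[of w], subst (1) fj[of t]) (simp only: inv_j flip: j_diff)
  then have "bdd_above (range (\<lambda>t. norm (inv j (f (Complex 0 t)))))"
    using strip_functionsD(7,8)[OF f] by (intro bdd_above_boundary) simp_all
  then have "norm (inv j (f (Complex 0 t))) \<le> (SUP t. norm (inv j (f (Complex 0 t))))"
    by (intro cSUP_upper UNIV_I)
  then show ?thesis by (simp add: calderon_norm_def)
qed

lemma strip_norm_right:
  assumes f: "f \<in> strip_functions"
  shows "norm (f (Complex 1 t)) \<le> strip_norm f"
proof -
  have "bdd_above (range (\<lambda>t. norm (f (Complex 1 t))))"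
    using strip_functionsD(9,10)[OF f] by (intro bdd_above_boundary) simp_all
  then have "norm (f (Complex 1 t)) \<le> (SUP t. norm (f (Complex 1 t)))"
    by (intro cSUP_upper UNIV_I)
  then show ?thesis by (simp add: calderon_norm_def)
qed

lemma strip_norm_nonneg: "f \<in> strip_functions \<Longrightarrow> 0 \<le> strip_norm f"
  by (rule order_trans[OF norm_ge_zero strip_norm_right])

lemma predual_apply: "\<phi> \<in> predual K \<Longrightarrow> \<phi> (c *\<^sub>C v) = c * \<phi> v"
  by (simp add: predual_def complex_linear_def scaleC_complex_def)

lemma open_open_strip: "open open_strip"
proof -
  have "open ({z. 0 < Re z} \<inter> {z. Re z < 1})"
    by (intro open_Int open_halfspace_Re_gt open_halfspace_Re_lt)
  also have "{z. 0 < Re z} \<inter> {z. Re z < 1} = open_strip" by (auto simp: open_strip_def)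
  finally show ?thesis .
qed

lemma open_strip_subset: "open_strip \<subseteq> closed_strip"
  by (auto simp: open_strip_def closed_strip_def)

text \<open>On the line \<open>Re z = 0\<close> the functional \<open>f(z)\<close> is \<open>\<tau>\<^sub>a\<close> with \<open>\<parallel>a\<parallel>\<close> bounded, and \<open>\<tau>\<^sub>a(g(z)) = \<tau>\<^sub>g\<^sub>(\<^sub>z\<^sub>)(a)\<close>;
  on \<open>Re z = 1\<close> the norm of \<open>f(z)\<close> as a functional is bounded. So \<open>g\<close> has to be bounded in the predual
  on the first line and in the algebra on the second one.\<close>

lemma pairing_three_lines:
  assumes f: "f \<in> strip_functions"
    and g: "\<And>z. z \<in> closed_strip \<Longrightarrow> ((\<lambda>w. norm (g w - g z)) \<longlongrightarrow> 0) (at z)"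
    and gd: "\<And>z. z \<in> open_strip \<Longrightarrow> \<exists>D. ((\<lambda>w. inverse (w - z) *\<^sub>C (g w - g z) - D) \<longlongrightarrow> 0) (at z)"
    and gb: "\<And>z. z \<in> closed_strip \<Longrightarrow> norm (g z) \<le> G"
    and g0: "\<And>t. norm (j (g (Complex 0 t))) \<le> c" and g1: "\<And>t. norm (g (Complex 1 t)) \<le> c"
    and c: "0 < c" and \<theta>: "0 < \<theta>" "\<theta> < 1"
  shows "cmod (f (complex_of_real \<theta>) (g (complex_of_real \<theta>))) \<le> strip_norm f * c"
proof -
  define h where "h z = f z (g z)" for z
  have df: "f w - f z \<in> predual K" if "w \<in> closed_strip" "z \<in> closed_strip" for w z
    by (intro predual_diff strip_functionsD(1)[OF f] that)
  have cf: "continuous_on closed_strip f"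
    unfolding continuous_on_def
  proof
    fix z assume z: "z \<in> closed_strip"
    have "((\<lambda>w. f w - f z) \<longlongrightarrow> 0) (at z within closed_strip)"
    proof (rule Lim_null_comparison)
      show "((\<lambda>w. j_bound * snorm (f w - f z)) \<longlongrightarrow> 0) (at z within closed_strip)"
        using tendsto_mult_left[OF strip_functionsD(3)[OF f z], of j_bound] by simp
      show "\<forall>\<^sub>F w in at z within closed_strip. norm (f w - f z) \<le> j_bound * snorm (f w - f z)"
        unfolding eventually_at by (intro exI[of _ 1] conjI ballI impI norm_le_snorm df z) simp_all
    qed
    then show "(f \<longlongrightarrow> f z) (at z within closed_strip)" by (rule LIM_zero_cancel)
  qed
  have gc: "isCont g z" if "z \<in> closed_strip" for z
    unfolding isCont_def using g[OF that] by (subst LIM_zero_iff[symmetric]) (rule tendsto_norm_zero_cancel)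
  have ch: "continuous_on closed_strip h" unfolding h_def
    by (intro continuous_intros cf continuous_at_imp_continuous_on ballI gc)
  have hh: "h holomorphic_on open_strip"
    unfolding holomorphic_on_open[OF open_open_strip]
  proof
    fix z assume z: "z \<in> open_strip"
    then have zc: "z \<in> closed_strip" using open_strip_subset by blast
    obtain D where D: "D \<in> predual K" "((\<lambda>w. snorm (inverse (w - z) *\<^sub>C (f w - f z) - D)) \<longlongrightarrow> 0) (at z within open_strip)"
      using strip_functionsD(4)[OF f z] by blast
    obtain D' where D': "((\<lambda>w. inverse (w - z) *\<^sub>C (g w - g z) - D') \<longlongrightarrow> 0) (at z)" using gd[OF z] by blast
    have at: "at z within open_strip = at z" by (rule at_within_open[OF z open_open_strip])
    have "((\<lambda>w. inverse (w - z) *\<^sub>C (f w - f z) - D) \<longlongrightarrow> 0) (at z within open_strip)"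
    proof (rule Lim_null_comparison)
      show "((\<lambda>w. j_bound * snorm (inverse (w - z) *\<^sub>C (f w - f z) - D)) \<longlongrightarrow> 0) (at z within open_strip)"
        using tendsto_mult_left[OF D(2), of j_bound] by simp
      have "inverse (w - z) *\<^sub>C (f w - f z) - D \<in> predual K" if "w \<in> open_strip" for w
        using that open_strip_subset by (intro predual_diff predual_scaleC df zc D) auto
      then show "\<forall>\<^sub>F w in at z within open_strip. norm (inverse (w - z) *\<^sub>C (f w - f z) - D) \<le> j_bound * snorm (inverse (w - z) *\<^sub>C (f w - f z) - D)"
        unfolding eventually_at by (intro exI[of _ 1] conjI ballI impI norm_le_snorm) simp_all
    qed
    then have qf: "((\<lambda>w. inverse (w - z) *\<^sub>C (f w - f z)) \<longlongrightarrow> D) (at z)" unfolding at by (rule LIM_zero_cancel)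
    have qg: "((\<lambda>w. inverse (w - z) *\<^sub>C (g w - g z)) \<longlongrightarrow> D') (at z)" using D' by (rule LIM_zero_cancel)
    have "(g \<longlongrightarrow> g z) (at z)" using gc[OF zc] by (simp add: isCont_def)
    then have "((\<lambda>w. (inverse (w - z) *\<^sub>C (f w - f z)) (g w) + f z (inverse (w - z) *\<^sub>C (g w - g z))) \<longlongrightarrow> D (g z) + f z D') (at z)"
      by (intro tendsto_intros qf qg)
    moreover have "(inverse (w - z) *\<^sub>C (f w - f z)) (g w) + f z (inverse (w - z) *\<^sub>C (g w - g z)) = (h w - h z) / (w - z)" for w
      by (simp add: predual_apply[OF strip_functionsD(1)[OF f zc]] scaleC_complex_def h_def blinfun.diff_left blinfun.diff_right
          divide_inverse algebra_simps)
    ultimately have "(h has_field_derivative D (g z) + f z D') (at z)" by (simp add: has_field_derivative_iff)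
    then show "\<exists>f'. (h has_field_derivative f') (at z)" by blast
  qed
  obtain B where B: "\<And>z. z \<in> closed_strip \<Longrightarrow> snorm (f z) \<le> B" using strip_functionsD(2)[OF f] by blast
  have hb: "cmod (h z) \<le> (j_bound * B) * G" if z: "z \<in> closed_strip" for z
  proof -
    have "norm (f z) \<le> j_bound * B"
      using norm_le_snorm[OF strip_functionsD(1)[OF f z]] mult_left_mono[OF B[OF z], of j_bound] j_bound by linarith
    then have "norm (f z) * norm (g z) \<le> (j_bound * B) * G"
      using gb[OF z] order_trans[OF norm_ge_zero] by (intro mult_mono) auto
    then show ?thesis unfolding h_def using norm_blinfun[of "f z" "g z"] by linarith
  qed
  have step: "cmod (h (complex_of_real \<theta>)) \<le> (strip_norm f + \<epsilon>) * c" if \<epsilon>: "0 < \<epsilon>" for \<epsilon>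
  proof -
    have C: "0 < strip_norm f + \<epsilon>" using strip_norm_nonneg[OF f] \<epsilon> by simp
    define M where "M = (strip_norm f + \<epsilon>) * c"
    have M: "0 < M" using C c by (simp add: M_def)
    have "cmod (h (complex_of_real \<theta>)) \<le> M powr (1 - \<theta>) * M powr \<theta>"
    proof (rule three_lines[OF ch hh hb _ _ M M \<theta>])
      fix t
      have fj: "f (Complex 0 t) = j (inv j (f (Complex 0 t)))"
        by (rule f_inv_into_f[symmetric, OF strip_functionsD(5)[OF f]])
      have "h (Complex 0 t) = j (g (Complex 0 t)) (inv j (f (Complex 0 t)))"
        unfolding h_def by (subst fj) (simp only: j_apply jp_commute[of "g (Complex 0 t)" "inv j (f (Complex 0 t))"])
      then have "cmod (h (Complex 0 t)) \<le> norm (j (g (Complex 0 t))) * norm (inv j (f (Complex 0 t)))"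
        using norm_blinfun[of "j (g (Complex 0 t))" "inv j (f (Complex 0 t))"] by simp
      also have "\<dots> \<le> c * (strip_norm f + \<epsilon>)"
        using strip_norm_left[OF f, of t] g0[of t] C c \<epsilon> by (intro mult_mono) auto
      finally show "cmod (h (Complex 0 t)) \<le> M" by (simp add: M_def mult.commute)
      have "cmod (h (Complex 1 t)) \<le> norm (f (Complex 1 t)) * norm (g (Complex 1 t))"
        unfolding h_def by (rule norm_blinfun)
      also have "\<dots> \<le> (strip_norm f + \<epsilon>) * c"
        using strip_norm_right[OF f, of t] g1[of t] C c \<epsilon> by (intro mult_mono) auto
      finally show "cmod (h (Complex 1 t)) \<le> M" by (simp add: M_def)
    qed
    also have "\<dots> = M" using M by (simp flip: powr_add)
    finally show ?thesis by (simp add: M_def)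
  qed
  show ?thesis
  proof (rule field_le_epsilon)
    fix \<epsilon> :: real assume "0 < \<epsilon>"
    then show "cmod (f (complex_of_real \<theta>) (g (complex_of_real \<theta>))) \<le> strip_norm f * c + \<epsilon>"
      using step[of "\<epsilon> / c"] c by (simp add: h_def algebra_simps)
  qed
qed

text \<open>The pairing with constant functions \<open>g\<close>.\<close>

lemma norm_le_strip_norm:
  assumes f: "f \<in> strip_functions" and \<theta>: "0 < \<theta>" "\<theta> < 1"
  shows "norm (f (complex_of_real \<theta>)) \<le> j_bound * strip_norm f"
proof (rule norm_blinfun_bound)
  show "0 \<le> j_bound * strip_norm f" using j_bound strip_norm_nonneg[OF f] by simp
  fix u
  show "norm (f (complex_of_real \<theta>) u) \<le> j_bound * strip_norm f * norm u"
  proof (cases "u = 0")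
    case False
    have "cmod (f (complex_of_real \<theta>) u) \<le> strip_norm f * (j_bound * norm u)"
    proof (rule pairing_three_lines[OF f _ _ _ _ _ _ \<theta>, where G = "norm u"])
      show "\<exists>D. ((\<lambda>w. inverse (w - z) *\<^sub>C (u - u) - D) \<longlongrightarrow> 0) (at z)" for z
        by (rule exI[of _ 0]) (simp add: scaleC_simps)
      show "norm (j u) \<le> j_bound * norm u"
        using j_norm_le[of u] mult_right_mono[OF j_bound(2) norm_ge_zero[of u]] by linarith
      show "norm u \<le> j_bound * norm u" using mult_right_mono[OF j_bound(1) norm_ge_zero[of u]] by simp
      show "0 < j_bound * norm u" using j_bound False by simp
    qed simp_all
    then show ?thesis by (simp add: mult_ac)
  qed simp
qed

text \<open>The reflection \<open>z \<mapsto> 1 - z\<close> exchanges the two lines. For the three lines theorem boundedness is enough,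
  hence \<open>\<delta> = 0\<close>.\<close>

lemma pairing_le:
  assumes f: "f \<in> strip_functions" and adm: "admissible x m y" and \<theta>: "0 < \<theta>" "\<theta> < 1"
  shows "cmod (f (complex_of_real \<theta>) (family 0 (1 - \<theta>) 1 x m y (complex_of_real (1 - \<theta>)))) \<le> strip_norm f"
proof -
  define k where "k = family 0 (1 - \<theta>) 1 x m y"
  define g where "g z = k (1 - z)" for z
  have r: "filterlim (\<lambda>w. 1 - w) (at (1 - z)) (at z)" for z :: complex
  proof (rule filterlim_atI)
    show "((\<lambda>w. 1 - w) \<longlongrightarrow> 1 - z) (at z)" by (intro tendsto_intros)
    show "\<forall>\<^sub>F w in at z. 1 - w \<noteq> 1 - z" by (auto simp: eventually_at intro: exI[of _ 1])
  qed
  have "cmod (f (complex_of_real \<theta>) (g (complex_of_real \<theta>))) \<le> strip_norm f * 1"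
  proof -
    obtain E where E: "\<And>t. t \<in> A.spec x \<Longrightarrow> norm (exp (y t)) \<le> \<bar>E\<bar>"
      using continuous_on_compact_bounded[OF A.compact_spec continuous_on_exp[OF admissibleD(2)[OF adm]]] by blast
    show ?thesis
    proof (rule pairing_three_lines[OF f _ _ _ _ _ _ \<theta>, where G = "1 + \<bar>E\<bar>"])
      show "((\<lambda>w. norm (g w - g z)) \<longlongrightarrow> 0) (at z)" for z
        unfolding g_def k_def
        by (rule filterlim_compose[OF family_tendsto[OF adm zero_less_one] r])
      show "\<exists>D. ((\<lambda>w. inverse (w - z) *\<^sub>C (g w - g z) - D) \<longlongrightarrow> 0) (at z)" if z: "z \<in> open_strip" for z
      proof
        have "1 - z \<in> open_strip" using z by (simp add: open_strip_def)
        from family_differentiable[OF adm zero_less_one order_refl this, of "1 - \<theta>"]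
        have "((\<lambda>w. inverse (w - (1 - z)) *\<^sub>C (k w - k (1 - z)) - family' 0 (1 - \<theta>) 1 x m y (1 - z)) \<longlongrightarrow> 0) (at (1 - z))"
          unfolding k_def .
        from filterlim_compose[OF this r]
        have "((\<lambda>w. - (inverse ((1 - w) - (1 - z)) *\<^sub>C (k (1 - w) - k (1 - z)) - family' 0 (1 - \<theta>) 1 x m y (1 - z))) \<longlongrightarrow> - 0) (at z)"
          by (rule tendsto_minus)
        moreover have "- (inverse ((1 - w) - (1 - z)) *\<^sub>C (k (1 - w) - k (1 - z)) - family' 0 (1 - \<theta>) 1 x m y (1 - z))
          = inverse (w - z) *\<^sub>C (g w - g z) - (- family' 0 (1 - \<theta>) 1 x m y (1 - z))" for w
        proof -
          have "inverse ((1 - w) - (1 - z)) = - inverse (w - z)"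
            by (subst inverse_minus_eq[symmetric]) simp
          then show ?thesis by (simp add: g_def scaleC_minus_left)
        qed
        ultimately show "((\<lambda>w. inverse (w - z) *\<^sub>C (g w - g z) - (- family' 0 (1 - \<theta>) 1 x m y (1 - z))) \<longlongrightarrow> 0) (at z)"
          by (simp only: minus_zero)
      qed
      show "norm (g z) \<le> 1 + \<bar>E\<bar>" if z: "z \<in> closed_strip" for z
        unfolding g_def k_def family_def
      proof (rule cfc_norm_le[OF family_continuous(1)[OF adm]])
        fix t assume t: "t \<in> A.spec x"
        have "cmod (gauss_exp 0 (1 - \<theta>) (1 - z) (y t)) = exp ((1 - Re z) * y t)" by (simp add: norm_gauss_exp)
        also have "\<dots> \<le> 1 + exp (y t)" using z by (intro exp_interpolate) (simp_all add: closed_strip_def)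
        also have "\<dots> \<le> 1 + \<bar>E\<bar>" using E[OF t] by simp
        finally show "cmod (complex_of_real (1 * m t) * gauss_exp 0 (1 - \<theta>) (1 - z) (y t)) \<le> 1 + \<bar>E\<bar>"
          using family_modulus_le[OF adm zero_less_one t, of "gauss_exp 0 (1 - \<theta>) (1 - z) (y t)"] by simp
      qed simp
      fix t
      have e: "1 - Complex 0 t = Complex 1 (- t)" "1 - Complex 1 t = Complex 0 (- t)" by (simp_all add: complex_eq_iff)
      show "norm (j (g (Complex 0 t))) \<le> 1"
        using family_right[OF adm zero_less_one order_refl, of "1 - \<theta>" "- t"] by (simp add: g_def k_def e)
      show "norm (g (Complex 1 t)) \<le> 1"
        using family_left[OF adm zero_less_one order_refl, of "1 - \<theta>" "- t"] by (simp add: g_def k_def e)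
    qed simp
  qed
  then show ?thesis by (simp add: g_def k_def)
qed

text \<open>The value of the reflected family at \<open>\<theta>\<close> has norm at most one for the exponent conjugate to
  \<open>1/\<theta>\<close>; with \<open>m\<close> close to the sign and \<open>y\<close> to the logarithm of the normalized power \<open>|t|\<^sup>1\<^sup>/\<^sup>\<theta>\<close>, its
  pairing with \<open>x\<close> is close to the norm of \<open>x\<close>.\<close>

lemma trace_duality_le:
  assumes f: "f1 \<in> strip_functions" "f2 \<in> strip_functions" and \<theta>: "0 < \<theta>" "\<theta> < 1"
    and eq: "j (\<iota> x) = f1 (complex_of_real \<theta>) + f2 (complex_of_real \<theta>)" and adm: "admissible x m y"
  shows "\<tau> (A.fc (\<lambda>t. t * (m t * exp ((1 - \<theta>) * y t))) x) \<le> strip_norm f1 + strip_norm f2"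
proof -
  define u where "u = family 0 (1 - \<theta>) 1 x m y (complex_of_real (1 - \<theta>))"
  have c: "continuous_on (A.spec x) (\<lambda>t. m t * exp ((1 - \<theta>) * y t))"
    by (intro continuous_intros admissibleD[OF adm])
  have u: "u = \<iota> (A.fc (\<lambda>t. m t * exp ((1 - \<theta>) * y t)) x)"
    unfolding u_def by (rule family_at[OF adm]) simp
  have "x \<diamondop> A.fc (\<lambda>t. m t * exp ((1 - \<theta>) * y t)) x = A.fc (\<lambda>t. t * (m t * exp ((1 - \<theta>) * y t))) x"
    by (subst A.fc_mult[OF continuous_on_id c]) simp
  then have "j (\<iota> x) u = complex_of_real (\<tau> (A.fc (\<lambda>t. t * (m t * exp ((1 - \<theta>) * y t))) x))"
    by (simp add: u j_apply flip: iota_jp) (metis cpx_real ctr_cpx linear_0[OF A.trace_linear] complex_of_real_def)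
  then have "\<tau> (A.fc (\<lambda>t. t * (m t * exp ((1 - \<theta>) * y t))) x) \<le> cmod (j (\<iota> x) u)" by simp
  also have "\<dots> \<le> cmod (f1 (complex_of_real \<theta>) u) + cmod (f2 (complex_of_real \<theta>) u)"
    by (simp add: eq blinfun.add_left norm_triangle_ineq)
  also have "\<dots> \<le> strip_norm f1 + strip_norm f2" unfolding u_def by (intro add_mono pairing_le f adm \<theta>)
  finally show ?thesis .
qed


section \<open>Series of analytic families\<close>

lemma snorm_diff: "v \<in> predual K \<Longrightarrow> w \<in> predual K \<Longrightarrow> snorm (v - w) \<le> snorm v + snorm w"
  using snorm_triangle[OF _ predual_scaleC[of w "-1"], of v] snorm_scaleC[of w "-1"] by (simp add: scaleC_simps)

text \<open>The strict inequality that is needed for choosing decompositions is restored by adding a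
  geometric series of arbitrarily small sum.\<close>

lemma snorm_series_le:
  assumes v: "\<And>k. v k \<in> predual K" and le: "\<And>k. snorm (v k) \<le> \<beta> k" and sum: "summable \<beta>"
  shows "summable v" "suminf v \<in> predual K" "snorm (suminf v) \<le> suminf \<beta>"
proof -
  define \<gamma> where "\<gamma> \<epsilon> k = \<beta> k + \<epsilon> * (1/2) ^ Suc k" for \<epsilon> :: real and k
  have s: "\<gamma> \<epsilon> sums (suminf \<beta> + \<epsilon> * 1)" for \<epsilon>
    unfolding \<gamma>_def by (intro sums_add sums_mult power_half_series summable_sums sum)
  have lt: "snorm (v k) < \<gamma> \<epsilon> k" if "0 < \<epsilon>" for k \<epsilon>
  proof -
    have "0 < \<epsilon> * (1/2) ^ Suc k" using that by simp
    with le[of k] show ?thesis unfolding \<gamma>_def by linarith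
  qed
  show "summable v" "suminf v \<in> predual K" by (rule snorm_series[OF v lt[of 1] sums_summable[OF s]]; simp)+
  show "snorm (suminf v) \<le> suminf \<beta>"
  proof (rule field_le_epsilon)
    fix \<epsilon> :: real assume "0 < \<epsilon>"
    from snorm_series(3)[OF v lt[OF this] sums_summable[OF s]]
    show "snorm (suminf v) \<le> suminf \<beta> + \<epsilon>" by (simp add: sums_unique[OF s, symmetric])
  qed
qed

text \<open>All conditions of Calderon's class pass to the series. Continuity follows by dominated
  convergence from continuity of the single families, with bounds proportional to \<open>N k\<close>; holomorphy
  follows from the uniform second order expansion; on the line \<open>Re z = 0\<close> the series converges
  already in the algebra.\<close>

theorem series_in_class:
  fixes \<theta> :: real
  assumes adm: "\<And>k. admissible (x k) (m k) (y k)" and N: "\<And>k. 0 < N k" and sum: "summable N" and \<delta>: "0 < \<delta>"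
  defines "F \<equiv> \<lambda>z. \<Sum>k. j (family \<delta> \<theta> (N k) (x k) (m k) (y k) z)"
  shows "F \<in> strip_functions" "strip_norm F \<le> suminf N * exp \<delta>"
    "z \<in> closed_strip \<Longrightarrow> summable (\<lambda>k. j (family \<delta> \<theta> (N k) (x k) (m k) (y k) z))"
proof -
  note \<delta>' = less_imp_le[OF \<delta>]
  define W where "W k = family \<delta> \<theta> (N k) (x k) (m k) (y k)" for k
  have F: "F z = (\<Sum>k. j (W k z))" for z by (simp add: F_def W_def)
  have strip: "snorm (j (W k z)) \<le> N k * (2 * exp \<delta>)" if "z \<in> closed_strip" for k z
    unfolding W_def by (rule family_strip[OF adm N \<delta>' that])
  note S = snorm_series_le[where v = "\<lambda>k. j (W k z)" for z, OF j_in_predual strip summable_mult2[OF sum]]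
  show "summable (\<lambda>k. j (family \<delta> \<theta> (N k) (x k) (m k) (y k) z))" if "z \<in> closed_strip"
    using S(1)[OF that] by (simp add: W_def)
  have FP: "F z \<in> predual K" if "z \<in> closed_strip" for z unfolding F by (rule S(2)[OF that])
  have Wt: "((\<lambda>w. norm (W k w - W k z)) \<longlongrightarrow> 0) (at z within T)" for k z T
    unfolding W_def by (rule family_tendsto[OF adm N])

  have cont: "((\<lambda>w. snorm (F w - F z)) \<longlongrightarrow> 0) (at z within closed_strip)" if z: "z \<in> closed_strip" for z
  proof (rule Lim_null_comparison)
    \<comment> \<open>The first bound tends to \<open>0\<close> for each \<open>k\<close>, the second one is summable.\<close>
    define \<beta> where "\<beta> k w = min (norm (W k w - W k z)) (N k * (4 * exp \<delta>))" for k w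
    have \<beta>: "0 \<le> \<beta> k w" "\<beta> k w \<le> N k * (4 * exp \<delta>)" for k w
      using less_imp_le[OF N] by (simp_all add: \<beta>_def)
    have s: "summable (\<lambda>k. N k * (4 * exp \<delta>))" by (rule summable_mult2[OF sum])
    show "((\<lambda>w. \<Sum>k. \<beta> k w) \<longlongrightarrow> 0) (at z within closed_strip)"
    proof (rule tannery_zero[OF _ \<beta> s])
      fix k
      show "(\<beta> k \<longlongrightarrow> 0) (at z within closed_strip)"
        by (rule Lim_null_comparison[OF always_eventually Wt[of k z]]) (use \<beta>(1) in \<open>simp add: \<beta>_def\<close>)
    qed
    have "norm (snorm (F w - F z)) \<le> (\<Sum>k. \<beta> k w)" if w: "w \<in> closed_strip" for w
    proof -
      have eq: "F w - F z = (\<Sum>k. j (W k w - W k z))"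
        unfolding F j_diff by (rule suminf_diff[OF S(1)[OF w] S(1)[OF z]])
      have "snorm (j (W k w - W k z)) \<le> \<beta> k w" for k
        using snorm_j_le[of "W k w - W k z"] snorm_diff[OF j_in_predual j_in_predual, of "W k w" "W k z"] strip[OF w, of k] strip[OF z, of k]
        by (simp add: \<beta>_def j_diff)
      moreover have "summable (\<lambda>k. \<beta> k w)"
        by (rule summable_comparison_test'[OF s, of 0]) (use \<beta> in simp)
      ultimately have "snorm (F w - F z) \<le> (\<Sum>k. \<beta> k w)"
        unfolding eq by (intro snorm_series_le(3) j_in_predual)
      then show ?thesis using snorm_nonneg[OF predual_diff[OF FP[OF w] FP[OF z]]] by simp
    qed
    then show "\<forall>\<^sub>F w in at z within closed_strip. norm (snorm (F w - F z)) \<le> (\<Sum>k. \<beta> k w)"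
      unfolding eventually_at by (intro exI[of _ 1]) simp
  qed

  have holo: "\<exists>D\<in>predual K. ((\<lambda>w. snorm (inverse (w - z) *\<^sub>C (F w - F z) - D)) \<longlongrightarrow> 0) (at z within open_strip)"
    if z: "z \<in> open_strip" for z
  proof -
    have zc: "z \<in> closed_strip" using z open_strip_subset by blast
    obtain C d where d: "0 < d" and C: "0 < C"
      and 1: "\<And>x m y N. admissible x m y \<Longrightarrow> 0 < N \<Longrightarrow> snorm (j (family' \<delta> \<theta> N x m y z)) \<le> N * C"
      and 2: "\<And>x m y N w. admissible x m y \<Longrightarrow> 0 < N \<Longrightarrow> dist w z < d \<Longrightarrow> w \<noteq> z \<Longrightarrow>
        snorm (j (family_rem \<delta> \<theta> N x m y z w)) \<le> N * (C * (cmod (w - z))\<^sup>2)"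
      using family_expansion[OF \<delta>' z, where \<theta> = \<theta>] by metis
    define W' where "W' k = family' \<delta> \<theta> (N k) (x k) (m k) (y k) z" for k
    have W'1: "snorm (j (W' k)) \<le> N k * C" for k unfolding W'_def by (rule 1[OF adm N])
    note S' = snorm_series_le[where v = "\<lambda>k. j (W' k)", OF j_in_predual W'1 summable_mult2[OF sum]]
    define D where "D = (\<Sum>k. j (W' k))"
    have D: "D \<in> predual K" unfolding D_def by (rule S'(2))
    have est: "norm (snorm (inverse (w - z) *\<^sub>C (F w - F z) - D)) \<le> suminf N * C * cmod (w - z)"
      if w: "w \<in> open_strip" "w \<noteq> z" "dist w z < d" for w
    proof -
      have wc: "w \<in> closed_strip" using w open_strip_subset by blast
      define R where "R = F w - F z - (w - z) *\<^sub>C D"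
      have RP: "R \<in> predual K" unfolding R_def by (intro predual_diff predual_scaleC FP wc zc D)
      have sD: "summable (\<lambda>k. (w - z) *\<^sub>C j (W' k))" "(w - z) *\<^sub>C D = (\<Sum>k. (w - z) *\<^sub>C j (W' k))"
        unfolding D_def using S'(1) by (rule bounded_linear.summable[OF bounded_linear_scaleC] bounded_linear.suminf[OF bounded_linear_scaleC])+
      have "R = (\<Sum>k. j (W k w - W k z - (w - z) *\<^sub>C W' k))"
        unfolding R_def F sD(2) j_diff j_scaleC
        by (simp only: suminf_diff[OF S(1)[OF wc] S(1)[OF zc]]
            suminf_diff[OF summable_diff[OF S(1)[OF wc] S(1)[OF zc]] sD(1)])
      also have "snorm \<dots> \<le> (\<Sum>k. N k * (C * (cmod (w - z))\<^sup>2))"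
        by (rule snorm_series_le(3)[OF j_in_predual _ summable_mult2[OF sum]])
          (unfold W_def W'_def, rule 2[OF adm N w(3,2)])
      also have "\<dots> = suminf N * (C * (cmod (w - z))\<^sup>2)" by (rule suminf_mult2[OF sum, symmetric])
      finally have snR: "snorm R \<le> suminf N * (C * (cmod (w - z))\<^sup>2)" .
      have eq: "inverse (w - z) *\<^sub>C (F w - F z) - D = inverse (w - z) *\<^sub>C R"
      proof -
        have "inverse (w - z) *\<^sub>C R = inverse (w - z) *\<^sub>C (F w - F z) - (inverse (w - z) * (w - z)) *\<^sub>C D"
          by (simp only: R_def scaleC_diff_right[of _ "F w - F z"] scaleC_scaleC)
        then show ?thesis using w by (simp add: scaleC_one)
      qed
      have "snorm (inverse (w - z) *\<^sub>C R) \<le> inverse (cmod (w - z)) * (suminf N * (C * (cmod (w - z))\<^sup>2))"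
        using snorm_scaleC[OF RP, of "inverse (w - z)"] mult_left_mono[OF snR, of "inverse (cmod (w - z))"]
        by (simp add: norm_inverse)
      also have "\<dots> = suminf N * C * cmod (w - z)" using w by (simp add: power2_eq_square)
      finally show ?thesis unfolding eq using snorm_nonneg[OF predual_scaleC[OF RP]] by simp
    qed
    have "((\<lambda>w. snorm (inverse (w - z) *\<^sub>C (F w - F z) - D)) \<longlongrightarrow> 0) (at z within open_strip)"
    proof (rule Lim_null_comparison)
      have "((\<lambda>w. suminf N * C * cmod (w - z)) \<longlongrightarrow> suminf N * C * cmod (z - z)) (at z within open_strip)"
        by (intro tendsto_intros)
      then show "((\<lambda>w. suminf N * C * cmod (w - z)) \<longlongrightarrow> 0) (at z within open_strip)" by simp
      show "\<forall>\<^sub>F w in at z within open_strip. norm (snorm (inverse (w - z) *\<^sub>C (F w - F z) - D)) \<le> suminf N * C * cmod (w - z)"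
        unfolding eventually_at using d est by (intro exI[of _ d]) simp
    qed
    with D show ?thesis by blast
  qed

  define b where "b s k = N k * (exp \<delta> * exp (- \<delta> * s\<^sup>2))" for s k
  have bsum: "summable (b s)" "suminf (b s) = suminf N * (exp \<delta> * exp (- \<delta> * s\<^sup>2))" for s
    unfolding b_def by (rule summable_mult2[OF sum], rule suminf_mult2[OF sum, symmetric])
  have bN: "b s k \<le> N k * exp \<delta>" for s k
    unfolding b_def using N[of k] \<delta> by (intro mult_left_mono) (simp_all add: mult_le_cancel_left1)
  have sumN: "0 \<le> suminf N" using less_imp_le[OF N] by (intro suminf_nonneg sum)
  have bs: "suminf N * (exp \<delta> * exp (- \<delta> * s\<^sup>2)) \<le> suminf N * exp \<delta>" for s :: real
    using sumN \<delta> by (intro mult_left_mono) (simp_all add: mult_le_cancel_left1)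
  have decay: "((\<lambda>s. suminf N * (exp \<delta> * exp (- \<delta> * s\<^sup>2))) \<longlongrightarrow> 0) at_infinity"
  proof -
    have "((\<lambda>s. exp (- \<delta> * s\<^sup>2)) \<longlongrightarrow> 0) (at_infinity :: real filter)"
      unfolding at_infinity_eq_at_top_bot by (rule filterlim_sup) (use \<delta> in real_asymp)+
    from tendsto_mult_left[OF this, of "suminf N * exp \<delta>"] show ?thesis by (simp add: mult.assoc)
  qed

  have L: "norm (W k (Complex 0 s)) \<le> b s k" for k s
    unfolding W_def b_def by (rule family_left[OF adm N \<delta>'])
  have sL: "summable (\<lambda>k. norm (W k (Complex 0 s)))" for s
    by (rule summable_comparison_test'[OF bsum(1)[of s], of 0]) (simp add: L)
  define V where "V s = (\<Sum>k. W k (Complex 0 s))" for s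
  have FV: "F (Complex 0 s) = j (V s)" for s
    unfolding F V_def by (rule bounded_linear.suminf[OF bounded_linear_j summable_norm_cancel[OF sL], symmetric])
  have VN: "norm (V s) \<le> suminf N * (exp \<delta> * exp (- \<delta> * s\<^sup>2))" for s
  proof -
    have "norm (V s) \<le> (\<Sum>k. norm (W k (Complex 0 s)))" unfolding V_def by (rule summable_norm[OF sL])
    also have "\<dots> \<le> suminf (b s)" by (rule suminf_le[OF L sL bsum(1)])
    finally show ?thesis by (simp add: bsum)
  qed
  have Vt: "((\<lambda>w. norm (V w - V s)) \<longlongrightarrow> 0) (at s)" for s
    unfolding V_def
  proof (rule suminf_difference_tendsto[where b = "\<lambda>k. N k * exp \<delta>"])
    fix k
    have "filterlim (Complex 0) (at (Complex 0 s)) (at s)"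
      by (rule filterlim_atI) (auto intro!: tendsto_Complex tendsto_intros simp: eventually_at intro: exI[of _ 1])
    from filterlim_compose[OF Wt[of k "Complex 0 s" UNIV] this]
    show "((\<lambda>w. norm (W k (Complex 0 w) - W k (Complex 0 s))) \<longlongrightarrow> 0) (at s)" .
    show "norm (W k (Complex 0 w)) \<le> N k * exp \<delta>" for w by (rule order_trans[OF L bN])
  qed (rule summable_mult2[OF sum])

  have R: "norm (j (W k (Complex 1 s))) \<le> b s k" for k s
    unfolding W_def b_def by (rule family_right[OF adm N \<delta>'])
  have sR: "summable (\<lambda>k. norm (j (W k (Complex 1 s))))" for s
    by (rule summable_comparison_test'[OF bsum(1)[of s], of 0]) (simp add: R)
  have FN: "norm (F (Complex 1 s)) \<le> suminf N * (exp \<delta> * exp (- \<delta> * s\<^sup>2))" for s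
  proof -
    have "norm (F (Complex 1 s)) \<le> (\<Sum>k. norm (j (W k (Complex 1 s))))" unfolding F by (rule summable_norm[OF sR])
    also have "\<dots> \<le> suminf (b s)" by (rule suminf_le[OF R sR bsum(1)])
    finally show ?thesis by (simp add: bsum)
  qed
  have Ft: "((\<lambda>w. norm (F (Complex 1 w) - F (Complex 1 s))) \<longlongrightarrow> 0) (at s)" for s
    unfolding F
  proof (rule suminf_difference_tendsto[where b = "\<lambda>k. N k * exp \<delta>"])
    fix k
    have "filterlim (Complex 1) (at (Complex 1 s)) (at s)"
      by (rule filterlim_atI) (auto intro!: tendsto_Complex tendsto_intros simp: eventually_at intro: exI[of _ 1])
    from filterlim_compose[OF Wt[of k "Complex 1 s" UNIV] this]
    have t: "((\<lambda>w. norm (W k (Complex 1 w) - W k (Complex 1 s))) \<longlongrightarrow> 0) (at s)" .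
    show "((\<lambda>w. norm (j (W k (Complex 1 w)) - j (W k (Complex 1 s)))) \<longlongrightarrow> 0) (at s)"
    proof (rule Lim_null_comparison)
      show "((\<lambda>w. 2 * \<tau> A.e * norm (W k (Complex 1 w) - W k (Complex 1 s))) \<longlongrightarrow> 0) (at s)"
        using tendsto_mult_left[OF t, of "2 * \<tau> A.e"] by simp
      show "\<forall>\<^sub>F w in at s. norm (norm (j (W k (Complex 1 w)) - j (W k (Complex 1 s)))) \<le> 2 * \<tau> A.e * norm (W k (Complex 1 w) - W k (Complex 1 s))"
        by (intro always_eventually allI) (simp only: real_norm_def abs_norm_cancel j_norm_le flip: j_diff)
    qed
    show "norm (j (W k (Complex 1 w))) \<le> N k * exp \<delta>" for w by (rule order_trans[OF R bN])
  qed (rule summable_mult2[OF sum])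

  have "\<forall>z\<in>closed_strip. snorm (F z) \<le> (\<Sum>k. N k * (2 * exp \<delta>))" unfolding F by (intro ballI S(3))
  moreover have "((\<lambda>w. norm (V w)) \<longlongrightarrow> 0) at_infinity"
    by (rule Lim_null_comparison[OF always_eventually decay])
      (intro allI, simp only: real_norm_def abs_norm_cancel VN)
  moreover have "((\<lambda>w. norm (F (Complex 1 w))) \<longlongrightarrow> 0) at_infinity"
    by (rule Lim_null_comparison[OF always_eventually decay])
      (intro allI, simp only: real_norm_def abs_norm_cancel FN)
  moreover have "Complex 1 t \<in> closed_strip" for t by (simp add: closed_strip_def)
  ultimately show "F \<in> strip_functions"
    unfolding calderon_class_def sum_space_eq norm_continuous_on_def norm_holomorphic_on_def mem_Collect_eq
    using cont holo FP Vt Ft by (auto simp: FV simp flip: j_diff)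
  have "(SUP t. norm (inv j (F (Complex 0 t)))) \<le> suminf N * exp \<delta>" "(SUP t. norm (F (Complex 1 t))) \<le> suminf N * exp \<delta>"
    using order_trans[OF VN bs] order_trans[OF FN bs] by (auto intro!: cSUP_least simp: FV)
  then show "strip_norm F \<le> suminf N * exp \<delta>" by (simp add: calderon_norm_def)
qed

lemma theta_norm_le: "f \<in> strip_functions \<Longrightarrow> theta_norm \<theta> (f (complex_of_real \<theta>)) \<le> strip_norm f"
  unfolding interp_norm_def
  by (rule cInf_lower) (auto intro!: bdd_belowI[of _ 0] simp: strip_norm_nonneg)

text \<open>The Gaussian factor costs \<open>e\<^sup>\<delta>\<close>, and \<open>\<delta>\<close> can be chosen arbitrarily small.\<close>

theorem interp_series:
  assumes adm: "\<And>k. admissible (x k) (m k) (y k)" and N: "\<And>k. 0 < N k" and sum: "summable N"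
    and eq: "\<And>k t. t \<in> A.spec (x k) \<Longrightarrow> N k * m k t * exp (\<theta> * y k t) = t" and \<theta>: "0 < \<theta>" "\<theta> < 1"
  shows "summable (\<lambda>k. j (\<iota> (x k)))" "(\<Sum>k. j (\<iota> (x k))) \<in> theta_space \<theta>" "theta_norm \<theta> (\<Sum>k. j (\<iota> (x k))) \<le> suminf N"
proof -
  define F where "F \<delta> = (\<lambda>z. \<Sum>k. j (family \<delta> \<theta> (N k) (x k) (m k) (y k) z))" for \<delta>
  note F = series_in_class[where x = x and m = m and y = y and N = N and \<theta> = \<theta>, OF adm N sum, folded F_def]
  have at: "family \<delta> \<theta> (N k) (x k) (m k) (y k) (complex_of_real \<theta>) = \<iota> (x k)" for \<delta> k
    using family_at[OF adm eq, of k \<delta>] by simp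
  have v: "F \<delta> (complex_of_real \<theta>) = (\<Sum>k. j (\<iota> (x k)))" for \<delta> by (simp add: F_def at)
  have "complex_of_real \<theta> \<in> closed_strip" using \<theta> by (simp add: closed_strip_def)
  from F(3)[OF zero_less_one this] show "summable (\<lambda>k. j (\<iota> (x k)))" by (simp add: at)
  show "(\<Sum>k. j (\<iota> (x k))) \<in> theta_space \<theta>"
    unfolding interp_space_def mem_Collect_eq
    by (intro exI[of _ "F 1"] conjI F(1) v[symmetric] zero_less_one)
  have "theta_norm \<theta> (\<Sum>k. j (\<iota> (x k))) \<le> suminf N * exp \<delta>" if "0 < \<delta>" for \<delta>
    using theta_norm_le[OF F(1)[OF that], of \<theta>] F(2)[OF that] by (simp add: v)
  moreover have "((\<lambda>\<delta>. suminf N * exp \<delta>) \<longlongrightarrow> suminf N * exp 0) (at_right 0)" by (intro tendsto_intros)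
  ultimately show "theta_norm \<theta> (\<Sum>k. j (\<iota> (x k))) \<le> suminf N"
    by (intro tendsto_lowerbound[of "\<lambda>\<delta>. suminf N * exp \<delta>" _ "at_right 0"]) (auto intro: eventually_at_rightI[of 0 1])
qed

end

section \<open>Iochum's norm\<close>

text \<open>A substitute for \<open>|t|\<close> that does not vanish, so that logarithms and quotients are continuous.\<close>

definition smooth_abs :: "real \<Rightarrow> real \<Rightarrow> real" where "smooth_abs \<epsilon> t = sqrt (t\<^sup>2 + \<epsilon>\<^sup>2)"

lemma smooth_abs_pos: "0 < \<epsilon> \<Longrightarrow> 0 < smooth_abs \<epsilon> t"
  by (simp add: smooth_abs_def add_nonneg_pos)

lemma abs_le_smooth_abs: "\<bar>t\<bar> \<le> smooth_abs \<epsilon> t"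
  by (simp add: smooth_abs_def real_le_rsqrt)

lemma smooth_abs_le: "0 \<le> \<epsilon> \<Longrightarrow> smooth_abs \<epsilon> t \<le> \<bar>t\<bar> + \<epsilon>"
  unfolding smooth_abs_def by (rule real_le_lsqrt) (simp_all add: power2_sum)

lemma square_div_smooth_abs:
  assumes "0 < \<epsilon>"
  shows "smooth_abs \<epsilon> t - \<epsilon> \<le> t * (t / smooth_abs \<epsilon> t)"
proof -
  note p = smooth_abs_pos[OF assms, of t]
  have "\<epsilon> \<le> smooth_abs \<epsilon> t" using assms by (simp add: smooth_abs_def real_le_rsqrt)
  then have "\<epsilon> * \<epsilon> \<le> \<epsilon> * smooth_abs \<epsilon> t" using assms by (intro mult_left_mono) auto
  moreover have "smooth_abs \<epsilon> t * smooth_abs \<epsilon> t = t * t + \<epsilon> * \<epsilon>"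
    by (simp add: smooth_abs_def power2_eq_square)
  ultimately have "(smooth_abs \<epsilon> t - \<epsilon>) * smooth_abs \<epsilon> t \<le> t * t" by (simp add: algebra_simps)
  then show ?thesis using p by (simp add: pos_le_divide_eq)
qed

lemma abs_div_smooth_abs_le: "0 < \<epsilon> \<Longrightarrow> \<bar>t / smooth_abs \<epsilon> t\<bar> \<le> 1"
  using abs_le_smooth_abs[of t \<epsilon>] smooth_abs_pos[of \<epsilon> t] by (simp add: abs_divide)

lemma continuous_on_smooth_abs [continuous_intros]: "continuous_on S (smooth_abs \<epsilon>)"
  unfolding smooth_abs_def[abs_def] by (intro continuous_intros)

lemma continuous_on_abs_powr: "0 < r \<Longrightarrow> continuous_on S (\<lambda>t::real. \<bar>t\<bar> powr r)"
  by (intro continuous_on_powr' continuous_intros) auto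

lemma continuous_on_smooth_abs_powr: "0 < \<epsilon> \<Longrightarrow> continuous_on S (\<lambda>t. smooth_abs \<epsilon> t powr r)"
  by (intro continuous_on_powr continuous_intros) (use smooth_abs_pos in \<open>auto simp: less_imp_neq[symmetric]\<close>)

lemma continuous_on_div_smooth_abs: "0 < \<epsilon> \<Longrightarrow> continuous_on S (\<lambda>t. t / smooth_abs \<epsilon> t)"
  by (intro continuous_intros) (use smooth_abs_pos in \<open>auto simp: less_imp_neq[symmetric]\<close>)

context traced_jbw_star_algebra
begin

definition lp_power :: "real \<Rightarrow> 'a \<Rightarrow> real" where "lp_power r x = \<tau> (A.fc (\<lambda>t. \<bar>t\<bar> powr r) x)"
definition lp_norm :: "real \<Rightarrow> 'a \<Rightarrow> real" where "lp_norm r x = lp_power r x powr (1 / r)"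

lemma lp_power_nonneg: "0 < r \<Longrightarrow> 0 \<le> lp_power r x"
  unfolding lp_power_def by (intro A.trace_pos A.fc_pos continuous_on_abs_powr) auto

lemma jordan_abs_eq: "jordan_abs jpA x = A.fc (\<lambda>t. \<bar>t\<bar>) x"
proof -
  have "x \<diamondop> x = A.fc (\<lambda>t. t * t) x" by (subst A.fc_mult) (simp_all add: continuous_on_id)
  then have "jordan_abs jpA x = A.fc sqrt (A.fc (\<lambda>t. t * t) x)" by (simp add: jordan_abs_def)
  also have "\<dots> = A.fc (\<lambda>t. sqrt (t * t)) x" by (intro A.fc_compose continuous_intros)
  finally show ?thesis by simp
qed

lemma iochum_norm_eq: "0 < r \<Longrightarrow> iochum_norm jpA \<tau> (ereal r) x = lp_norm r x"
proof -
  assume r: "0 < r"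
  have "A.fc (\<lambda>t. t powr r) (A.fc (\<lambda>t. \<bar>t\<bar>) x) = A.fc (\<lambda>t. \<bar>t\<bar> powr r) x"
    by (rule A.fc_compose) (use r in \<open>auto intro!: continuous_intros continuous_on_powr'\<close>)
  then show ?thesis by (simp add: iochum_norm_def lp_norm_def lp_power_def jordan_abs_eq)
qed

text \<open>\<open>(t\<^sup>2 + \<epsilon>\<^sup>2)\<^sup>1\<^sup>/\<^sup>2\<close> tends to \<open>|t|\<close> uniformly, and powers are uniformly continuous on bounded intervals.\<close>

lemma lp_power_approximation:
  assumes r: "0 < r" and \<eta>: "0 < \<eta>"
  obtains \<epsilon> where "0 < \<epsilon>" "\<tau> (A.fc (\<lambda>t. smooth_abs \<epsilon> t powr r) x) \<le> lp_power r x + \<eta>"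
proof -
  define M where "M = norm x"
  define \<eta>' where "\<eta>' = \<eta> / (\<tau> A.e + 1)"
  have te: "0 < \<tau> A.e + 1" using A.trace_unit_nonneg by linarith
  have \<eta>': "0 < \<eta>'" using \<eta> te by (simp add: \<eta>'_def)
  have "uniformly_continuous_on {0..M + 1} (\<lambda>s. s powr r)"
    by (intro compact_uniformly_continuous continuous_on_powr' continuous_intros) (use r in auto)
  then obtain d where d: "0 < d" and close: "\<And>s s'. s \<in> {0..M + 1} \<Longrightarrow> s' \<in> {0..M + 1} \<Longrightarrow> dist s' s < d \<Longrightarrow> dist (s' powr r) (s powr r) < \<eta>'"
    using \<eta>' unfolding uniformly_continuous_on_def by metis
  define \<epsilon> where "\<epsilon> = min 1 (d / 2)"
  have \<epsilon>: "0 < \<epsilon>" "\<epsilon> \<le> 1" "\<epsilon> < d" using d by (simp_all add: \<epsilon>_def min_def)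
  have "\<tau> (A.fc (\<lambda>t. smooth_abs \<epsilon> t powr r) x) \<le> \<tau> (A.fc (\<lambda>t. \<bar>t\<bar> powr r + \<eta>') x)"
  proof (rule trace_fc_mono)
    show "continuous_on (A.spec x) (\<lambda>t. smooth_abs \<epsilon> t powr r)" by (rule continuous_on_smooth_abs_powr[OF \<epsilon>(1)])
    show "continuous_on (A.spec x) (\<lambda>t. \<bar>t\<bar> powr r + \<eta>')" by (intro continuous_on_add continuous_on_const continuous_on_abs_powr r)
    fix t assume "t \<in> A.spec x"
    then have "\<bar>t\<bar> \<le> M" by (simp add: M_def A.spec_bounded)
    then have "\<bar>t\<bar> \<in> {0..M + 1}" "smooth_abs \<epsilon> t \<in> {0..M + 1}" "dist (smooth_abs \<epsilon> t) \<bar>t\<bar> < d"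
      using abs_le_smooth_abs[of t \<epsilon>] smooth_abs_le[of \<epsilon> t] smooth_abs_pos[of \<epsilon> t] \<epsilon> by (auto simp: dist_real_def)
    from close[OF this] show "smooth_abs \<epsilon> t powr r \<le> \<bar>t\<bar> powr r + \<eta>'" by (simp add: dist_real_def)
  qed
  also have "\<dots> = lp_power r x + \<eta>' * \<tau> A.e"
    by (simp add: A.fc_add continuous_on_abs_powr[OF r] A.fc_const lp_power_def)
  also have "\<dots> \<le> lp_power r x + \<eta>' * (\<tau> A.e + 1)" using \<eta>' by simp
  also have "\<dots> = lp_power r x + \<eta>" using te by (simp add: \<eta>'_def)
  finally show ?thesis by (rule that[OF \<epsilon>(1)])
qed

text \<open>The pair \<open>m(t) = t/(t\<^sup>2 + \<epsilon>\<^sup>2)\<^sup>1\<^sup>/\<^sup>2\<close>, \<open>y(t) = r log((t\<^sup>2 + \<epsilon>\<^sup>2)\<^sup>1\<^sup>/\<^sup>2/N)\<close>. The strict inequality leaves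
  room for \<open>\<epsilon> > 0\<close>.\<close>

lemma admissible_if_lp_norm_less:
  assumes r: "1 < r" and lt: "lp_norm r x < N"
  shows "\<exists>m y. admissible x m y \<and> (\<forall>t\<in>A.spec x. N * m t * exp (1 / r * y t) = t)"
proof -
  have r0: "0 < r" using r by simp
  have N: "0 < N" using lt le_less_trans[of 0 "lp_norm r x" N] by (simp add: lp_norm_def)
  have "lp_power r x = lp_norm r x powr r" using lp_power_nonneg[OF r0, of x] r0 by (simp add: lp_norm_def powr_powr)
  also have "\<dots> < N powr r" using lt r0 by (intro powr_less_mono2) (simp_all add: lp_norm_def)
  finally have "0 < N powr r - lp_power r x" by simp
  from lp_power_approximation[OF r0 this, of x]
  obtain \<epsilon> where \<epsilon>: "0 < \<epsilon>" and le: "\<tau> (A.fc (\<lambda>t. smooth_abs \<epsilon> t powr r) x) \<le> N powr r" by auto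
  note p = smooth_abs_pos[OF \<epsilon>]
  define m where "m t = t / smooth_abs \<epsilon> t" for t
  define y where "y t = r * ln (smooth_abs \<epsilon> t / N)" for t
  have ey: "exp (y t) = N powr (- r) * smooth_abs \<epsilon> t powr r" for t
  proof -
    have "exp (y t) = (smooth_abs \<epsilon> t / N) powr r" using p[of t] N by (simp add: y_def powr_def)
    also have "\<dots> = smooth_abs \<epsilon> t powr r / N powr r" using p[of t] N by (simp add: powr_divide)
    finally show ?thesis by (simp add: powr_minus divide_inverse mult.commute)
  qed
  have "admissible x m y"
    unfolding admissible_def
  proof (intro conjI ballI)
    show "continuous_on (A.spec x) m" unfolding m_def by (rule continuous_on_div_smooth_abs[OF \<epsilon>])
    show "continuous_on (A.spec x) y" unfolding y_def
      using p N by (intro continuous_intros) (auto simp: less_imp_neq[symmetric])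
    show "\<bar>m t\<bar> \<le> 1" for t unfolding m_def by (rule abs_div_smooth_abs_le[OF \<epsilon>])
    have "\<tau> (A.fc (\<lambda>t. exp (y t)) x) = N powr (- r) * \<tau> (A.fc (\<lambda>t. smooth_abs \<epsilon> t powr r) x)"
      unfolding ey by (rule trace_fc_scale[OF continuous_on_smooth_abs_powr[OF \<epsilon>]])
    also have "\<dots> \<le> N powr (- r) * N powr r" by (intro mult_left_mono le) simp
    also have "\<dots> = 1" using N by (simp flip: powr_add)
    finally show "\<tau> (A.fc (\<lambda>t. exp (y t)) x) \<le> 1" .
  qed
  moreover have "N * m t * exp (1 / r * y t) = t" for t
    using p[of t] N r0 by (simp add: m_def y_def)
  ultimately show ?thesis by blast
qed

text \<open>With \<open>\<rho> = (t\<^sup>2 + \<epsilon>\<^sup>2)\<^sup>1\<^sup>/\<^sup>2\<close>, \<open>S = \<tau>(\<rho>\<^sup>r(x))\<close> and \<open>y = log(\<rho>\<^sup>r/S)\<close>, the dual element is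
  \<open>(t/\<rho>)\<rho>\<^sup>r\<^sup>-\<^sup>1/S\<^sup>1\<^sup>-\<^sup>1\<^sup>/\<^sup>r\<close>. Up to a term proportional to \<open>\<epsilon>\<close> its trace against \<open>x\<close> is at least
  \<open>S\<^sup>1\<^sup>/\<^sup>r\<close>, which is not smaller than the norm of \<open>x\<close>.\<close>

lemma lp_norm_le_strip_norm:
  assumes r: "1 < r" and f: "f1 \<in> strip_functions" "f2 \<in> strip_functions"
    and eq: "j (\<iota> x) = f1 (complex_of_real (1 / r)) + f2 (complex_of_real (1 / r))"
  shows "lp_norm r x \<le> strip_norm f1 + strip_norm f2"
proof (cases "lp_power r x = 0")
  case True
  then show ?thesis using strip_norm_nonneg[OF f(1)] strip_norm_nonneg[OF f(2)] by (simp add: lp_norm_def)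
next
  case False
  have r0: "0 < r" using r by simp
  define s where "s = lp_power r x"
  have s: "0 < s" using False lp_power_nonneg[OF r0, of x] by (simp add: s_def)
  define c where "c = strip_norm f1 + strip_norm f2"
  define q where "q = 1 - 1 / r"
  have q: "0 < q" "q + 1 / r = 1" "r * q = r - 1" using r by (simp_all add: q_def algebra_simps)
  define Q where "Q = (norm x + 1) powr (r - 1) * \<tau> A.e * s powr (- q)"
  have Q: "0 \<le> Q" by (simp add: Q_def)
  have bound: "lp_norm r x \<le> c + \<epsilon> * Q" if \<epsilon>: "0 < \<epsilon>" "\<epsilon> \<le> 1" for \<epsilon>
  proof -
    note p = smooth_abs_pos[OF \<epsilon>(1)]
    define S where "S = \<tau> (A.fc (\<lambda>t. smooth_abs \<epsilon> t powr r) x)"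
    have sS: "s \<le> S"
      unfolding s_def lp_power_def S_def
      by (intro trace_fc_mono continuous_on_abs_powr continuous_on_smooth_abs_powr r0 \<epsilon> powr_mono2 abs_le_smooth_abs) (use r0 in auto)
    have S: "0 < S" using s sS by simp
    define m where "m t = t / smooth_abs \<epsilon> t" for t
    define y where "y t = r * ln (smooth_abs \<epsilon> t) - ln S" for t
    have ey: "exp (y t) = (1 / S) * smooth_abs \<epsilon> t powr r" for t
      using p[of t] S by (simp add: y_def exp_diff powr_def)
    have eq': "exp (q * y t) = S powr (- q) * smooth_abs \<epsilon> t powr (r - 1)" for t
    proof -
      have "q * y t = (r * q) * ln (smooth_abs \<epsilon> t) + (- q) * ln S" by (simp add: y_def algebra_simps)
      then have "exp (q * y t) = exp ((r - 1) * ln (smooth_abs \<epsilon> t)) * exp ((- q) * ln S)" by (simp only: q(3) exp_add)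
      then show ?thesis using p[of t] S by (simp add: powr_def)
    qed
    have cm: "continuous_on (A.spec x) m" unfolding m_def by (rule continuous_on_div_smooth_abs[OF \<epsilon>(1)])
    have cy: "continuous_on (A.spec x) y" unfolding y_def
      using p by (intro continuous_intros) (auto simp: less_imp_neq[symmetric])
    have adm: "admissible x m y"
      unfolding admissible_def
    proof (intro conjI ballI cm cy)
      show "\<bar>m t\<bar> \<le> 1" for t unfolding m_def by (rule abs_div_smooth_abs_le[OF \<epsilon>(1)])
      have "\<tau> (A.fc (\<lambda>t. exp (y t)) x) = (1 / S) * S"
        unfolding ey S_def by (rule trace_fc_scale[OF continuous_on_smooth_abs_powr[OF \<epsilon>(1)]])
      then show "\<tau> (A.fc (\<lambda>t. exp (y t)) x) \<le> 1" using S by simp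
    qed
    define b where "b = \<epsilon> * (norm x + 1) powr (r - 1)"
    have "S powr (- q) * (S - b * \<tau> A.e) = \<tau> (A.fc (\<lambda>t. S powr (- q) * (smooth_abs \<epsilon> t powr r - b)) x)"
      using continuous_on_smooth_abs_powr[OF \<epsilon>(1), of "A.spec x" r]
      by (simp add: trace_fc_scale continuous_on_diff A.fc_diff A.fc_const S_def)
    also have "\<dots> \<le> \<tau> (A.fc (\<lambda>t. t * (m t * exp (q * y t))) x)"
    proof (rule trace_fc_mono)
      show "continuous_on (A.spec x) (\<lambda>t. S powr (- q) * (smooth_abs \<epsilon> t powr r - b))"
        by (intro continuous_intros continuous_on_smooth_abs_powr \<epsilon>)
      show "continuous_on (A.spec x) (\<lambda>t. t * (m t * exp (q * y t)))" by (intro continuous_intros cm cy)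
      fix t assume "t \<in> A.spec x"
      then have "\<bar>t\<bar> \<le> norm x" by (rule A.spec_bounded)
      then have "smooth_abs \<epsilon> t \<le> norm x + 1" using smooth_abs_le[of \<epsilon> t] \<epsilon> by linarith
      then have "smooth_abs \<epsilon> t powr (r - 1) \<le> (norm x + 1) powr (r - 1)" using p[of t] r by (intro powr_mono2) auto
      then have "\<epsilon> * smooth_abs \<epsilon> t powr (r - 1) \<le> b" unfolding b_def using \<epsilon> by (intro mult_left_mono) auto
      then have "smooth_abs \<epsilon> t powr r - b \<le> smooth_abs \<epsilon> t * smooth_abs \<epsilon> t powr (r - 1) - \<epsilon> * smooth_abs \<epsilon> t powr (r - 1)"
        using p[of t] by (simp add: powr_mult_base)
      also have "\<dots> = (smooth_abs \<epsilon> t - \<epsilon>) * smooth_abs \<epsilon> t powr (r - 1)" by (simp add: left_diff_distrib)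
      also have "\<dots> \<le> (t * m t) * smooth_abs \<epsilon> t powr (r - 1)"
        unfolding m_def by (rule mult_right_mono[OF square_div_smooth_abs[OF \<epsilon>(1)]]) simp
      finally have "S powr (- q) * (smooth_abs \<epsilon> t powr r - b) \<le> S powr (- q) * ((t * m t) * smooth_abs \<epsilon> t powr (r - 1))"
        by (rule mult_left_mono) simp
      then show "S powr (- q) * (smooth_abs \<epsilon> t powr r - b) \<le> t * (m t * exp (q * y t))"
        unfolding eq' by (simp add: mult_ac)
    qed
    also have "\<dots> \<le> c"
      unfolding c_def q_def by (rule trace_duality_le[OF f _ _ eq adm]) (use r in auto)
    finally have 1: "S powr (- q) * (S - b * \<tau> A.e) \<le> c" .
    have "S powr (- q) * S = S powr (1 / r)"
    proof -
      have "S powr (- q) * S = S powr (- q) * S powr 1" using S by simp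
      also have "\<dots> = S powr (- q + 1)" by (rule powr_add[symmetric])
      also have "- q + 1 = 1 / r" by (simp add: q_def)
      finally show ?thesis .
    qed
    then have "S powr (1 / r) \<le> c + b * \<tau> A.e * S powr (- q)" using 1 by (simp add: algebra_simps)
    moreover have "b * \<tau> A.e * S powr (- q) \<le> b * \<tau> A.e * s powr (- q)"
      using s sS q(1) \<epsilon> by (intro mult_left_mono powr_mono2') (auto simp: b_def)
    moreover have "lp_norm r x \<le> S powr (1 / r)" unfolding lp_norm_def s_def[symmetric] using s sS r0 by (intro powr_mono2) auto
    ultimately show ?thesis by (simp add: b_def Q_def mult_ac)
  qed
  have "((\<lambda>\<epsilon>. c + \<epsilon> * Q) \<longlongrightarrow> c + 0 * Q) (at_right 0)" by (intro tendsto_intros)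
  then have "lp_norm r x \<le> c + 0 * Q"
    by (rule tendsto_lowerbound) (use bound in \<open>auto intro!: eventually_at_rightI[of 0 1]\<close>)
  then show ?thesis by (simp add: c_def)
qed

text \<open>The upper bound is \<open>norm_j_cfc_le\<close> for \<open>|t| \<le> (t\<^sup>2 + \<epsilon>\<^sup>2)\<^sup>1\<^sup>/\<^sup>2\<close>; the lower bound is the value of \<open>\<tau>\<^sub>x\<close> at
  \<open>(t/(t\<^sup>2 + \<epsilon>\<^sup>2)\<^sup>1\<^sup>/\<^sup>2)(x)\<close>, an approximate sign of \<open>x\<close>.\<close>

lemma norm_j_iota: "norm (j (\<iota> x)) = lp_norm 1 x"
proof -
  define s where "s = \<tau> (A.fc (\<lambda>t. \<bar>t\<bar>) x)"
  have "A.fc (\<lambda>t. \<bar>t\<bar> powr 1) x = A.fc (\<lambda>t. \<bar>t\<bar>) x" by (rule A.fc_cong) (auto intro!: continuous_intros)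
  then have s: "lp_norm 1 x = s" using lp_power_nonneg[of 1 x] by (simp add: lp_norm_def lp_power_def s_def)
  have ce: "\<tau> (A.fc (\<lambda>t. \<bar>t\<bar> + a) x) = s + a * \<tau> A.e" for a
    by (subst A.fc_add) (auto intro!: continuous_intros simp: A.fc_const s_def)
  have up: "norm (j (\<iota> x)) \<le> s + \<epsilon> * \<tau> A.e" if \<epsilon>: "0 < \<epsilon>" for \<epsilon>
  proof -
    have "norm (j (cfc x (\<lambda>t. complex_of_real t))) \<le> \<tau> (A.fc (smooth_abs \<epsilon>) x)"
      by (rule norm_j_cfc_le) (auto intro!: continuous_intros smooth_abs_pos \<epsilon> simp: abs_le_smooth_abs)
    also have "\<dots> \<le> \<tau> (A.fc (\<lambda>t. \<bar>t\<bar> + \<epsilon>) x)"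
      by (rule trace_fc_mono) (use \<epsilon> in \<open>auto intro!: continuous_intros smooth_abs_le\<close>)
    finally show ?thesis by (simp add: ce cfc_real[of x "\<lambda>t. t"])
  qed
  have low: "s - \<epsilon> * \<tau> A.e \<le> norm (j (\<iota> x))" if \<epsilon>: "0 < \<epsilon>" for \<epsilon>
  proof -
    define u where "u = A.fc (\<lambda>t. t / smooth_abs \<epsilon> t) x"
    note cu = continuous_on_div_smooth_abs[OF \<epsilon>, of "A.spec x"]
    have "norm u \<le> 1" unfolding u_def by (rule A.fc_norm_le[OF cu]) (use abs_div_smooth_abs_le[OF \<epsilon>] in simp_all)
    have xu: "x \<diamondop> u = A.fc (\<lambda>t. t * (t / smooth_abs \<epsilon> t)) x"
      unfolding u_def by (subst A.fc_mult[OF continuous_on_id cu]) simp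
    have "s + (- \<epsilon>) * \<tau> A.e \<le> \<tau> (x \<diamondop> u)"
      unfolding ce[symmetric] xu
    proof (rule trace_fc_mono)
      show "continuous_on (A.spec x) (\<lambda>t. t * (t / smooth_abs \<epsilon> t))" by (intro continuous_on_mult cu continuous_on_id)
      show "\<bar>t\<bar> + - \<epsilon> \<le> t * (t / smooth_abs \<epsilon> t)" for t
        using square_div_smooth_abs[OF \<epsilon>, of t] abs_le_smooth_abs[of t \<epsilon>] by linarith
    qed (intro continuous_intros)
    also have "\<dots> \<le> cmod (j (\<iota> x) (\<iota> u))"
    proof -
      have "j (\<iota> x) (\<iota> u) = ctr (cpx (x \<diamondop> u) 0)" by (simp add: j_apply cpx_real iota_jp)
      then show ?thesis using complex_Re_le_cmod[of "j (\<iota> x) (\<iota> u)"] by simp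
    qed
    also have "\<dots> \<le> norm (j (\<iota> x)) * norm (\<iota> u)" by (rule norm_blinfun)
    also have "\<dots> \<le> norm (j (\<iota> x)) * 1" using \<open>norm u \<le> 1\<close> by (intro mult_left_mono) simp_all
    finally show ?thesis by simp
  qed
  have "((\<lambda>\<epsilon>. s + \<epsilon> * \<tau> A.e) \<longlongrightarrow> s + 0 * \<tau> A.e) (at_right 0)" "((\<lambda>\<epsilon>. s - \<epsilon> * \<tau> A.e) \<longlongrightarrow> s - 0 * \<tau> A.e) (at_right 0)"
    by (intro tendsto_intros)+
  note limits = this
  have "norm (j (\<iota> x)) \<le> s + 0 * \<tau> A.e"
    by (rule tendsto_lowerbound[OF limits(1)]) (use up in \<open>auto intro!: eventually_at_rightI[of 0 1]\<close>)
  moreover have "s - 0 * \<tau> A.e \<le> norm (j (\<iota> x))"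
    by (rule tendsto_upperbound[OF limits(2)]) (use low in \<open>auto intro!: eventually_at_rightI[of 0 1]\<close>)
  ultimately show ?thesis by (simp add: s)
qed

lemma theta_norm_greatest:
  assumes v: "v \<in> theta_space \<theta>" and le: "\<And>f. f \<in> strip_functions \<Longrightarrow> f (complex_of_real \<theta>) = v \<Longrightarrow> c \<le> strip_norm f"
  shows "c \<le> theta_norm \<theta> v"
  unfolding interp_norm_def
proof (rule cInf_greatest)
  show "{strip_norm f |f. f \<in> strip_functions \<and> f (complex_of_real \<theta>) = v} \<noteq> {}" using v by (auto simp: interp_space_def)
  fix q assume "q \<in> {strip_norm f |f. f \<in> strip_functions \<and> f (complex_of_real \<theta>) = v}"
  then show "c \<le> q" using le by auto
qed

lemma norm_le_theta_norm:
  assumes "v \<in> theta_space \<theta>" "0 < \<theta>" "\<theta> < 1"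
  shows "norm v \<le> j_bound * theta_norm \<theta> v"
proof -
  have "norm v / j_bound \<le> theta_norm \<theta> v"
    using norm_le_strip_norm[OF _ assms(2,3)] j_bound by (intro theta_norm_greatest[OF assms(1)]) (auto simp: divide_le_eq mult.commute)
  then show ?thesis using j_bound by (simp add: divide_le_eq mult.commute)
qed

lemma interp_series_lp_norm:
  assumes r: "1 < r" and lt: "\<And>k. lp_norm r (d k) < N k" and sum: "summable N"
  shows "summable (\<lambda>k. j (\<iota> (d k)))" "(\<Sum>k. j (\<iota> (d k))) \<in> theta_space (1 / r)" "theta_norm (1 / r) (\<Sum>k. j (\<iota> (d k))) \<le> suminf N"
proof -
  have "\<forall>k. \<exists>q. admissible (d k) (fst q) (snd q) \<and> (\<forall>t\<in>A.spec (d k). N k * fst q t * exp (1 / r * snd q t) = t)"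
    using admissible_if_lp_norm_less[OF r lt] by simp
  from choice[OF this] obtain q where q: "\<forall>k. admissible (d k) (fst (q k)) (snd (q k)) \<and>
      (\<forall>t\<in>A.spec (d k). N k * fst (q k) t * exp (1 / r * snd (q k) t) = t)" ..
  have N: "0 < N k" for k using lt[of k] le_less_trans[of 0 "lp_norm r (d k)" "N k"] by (simp add: lp_norm_def)
  have "admissible (d k) (fst (q k)) (snd (q k))" "t \<in> A.spec (d k) \<Longrightarrow> N k * fst (q k) t * exp (1 / r * snd (q k) t) = t" for k t
    using q by blast+
  note * = interp_series[where x = d and m = "\<lambda>k. fst (q k)" and y = "\<lambda>k. snd (q k)" and N = N and \<theta> = "1 / r",
      OF this(1) N sum this(2)]
  show "summable (\<lambda>k. j (\<iota> (d k)))" "(\<Sum>k. j (\<iota> (d k))) \<in> theta_space (1 / r)" "theta_norm (1 / r) (\<Sum>k. j (\<iota> (d k))) \<le> suminf N"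
    using * r by simp_all
qed

end

section \<open>Extension to the completion\<close>

lemma extend_to_completion:
  fixes \<kappa> :: "'a::real_vector \<Rightarrow> 'l::banach" and B :: "'a \<Rightarrow> 'b::banach"
  assumes \<kappa>: "linear \<kappa>" and dense: "closure (range \<kappa>) = UNIV" and B: "linear B"
    and le: "\<And>x. norm (B x) \<le> c * norm (\<kappa> x)"
  obtains T where "linear T" "\<And>x. T (\<kappa> x) = B x"
    "\<And>X u. (\<lambda>n. \<kappa> (X n)) \<longlonglongrightarrow> u \<Longrightarrow> (\<lambda>n. B (X n)) \<longlonglongrightarrow> T u"
proof -
  define B0 where "B0 v = B (SOME x. \<kappa> x = v)" for v
  have eqB: "B x = B x'" if "\<kappa> x = \<kappa> x'" for x x'
    using le[of "x - x'"] that by (simp add: linear_diff[OF \<kappa>] linear_diff[OF B])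
  have B0: "B0 (\<kappa> x) = B x" for x
    unfolding B0_def by (rule eqB) (rule someI[of "\<lambda>z. \<kappa> z = \<kappa> x" x], simp)
  have lip: "dist (B0 v) (B0 w) \<le> \<bar>c\<bar> * dist v w" if vw: "v \<in> range \<kappa>" "w \<in> range \<kappa>" for v w
  proof -
    obtain x z where "v = \<kappa> x" "w = \<kappa> z" using vw by blast
    then have "dist (B0 v) (B0 w) \<le> c * dist v w"
      using le[of "x - z"] by (simp add: B0 dist_norm linear_diff[OF \<kappa>] linear_diff[OF B])
    also have "\<dots> \<le> \<bar>c\<bar> * dist v w" by (intro mult_right_mono) auto
    finally show ?thesis .
  qed
  have "uniformly_continuous_on (range \<kappa>) B0"
    unfolding uniformly_continuous_on_def
  proof (intro allI impI)
    fix \<epsilon> :: real assume \<epsilon>: "0 < \<epsilon>"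
    show "\<exists>d>0. \<forall>x\<in>range \<kappa>. \<forall>x'\<in>range \<kappa>. dist x' x < d \<longrightarrow> dist (B0 x') (B0 x) < \<epsilon>"
    proof (intro exI[of _ "\<epsilon> / (\<bar>c\<bar> + 1)"] conjI ballI impI)
      show "0 < \<epsilon> / (\<bar>c\<bar> + 1)" using \<epsilon> by (simp add: add_nonneg_pos)
      fix v w assume vw: "v \<in> range \<kappa>" "w \<in> range \<kappa>" and d: "dist w v < \<epsilon> / (\<bar>c\<bar> + 1)"
      have "dist (B0 w) (B0 v) \<le> (\<bar>c\<bar> + 1) * dist w v"
        using lip[OF vw(2,1)] zero_le_dist[of w v] by (simp add: distrib_right add_increasing2)
      also have "\<dots> < \<epsilon>" using d by (simp add: pos_less_divide_eq add_nonneg_pos mult.commute)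
      finally show "dist (B0 w) (B0 v) < \<epsilon>" .
    qed
  qed
  then obtain T where T: "uniformly_continuous_on (closure (range \<kappa>)) T" and ext: "\<And>v. v \<in> range \<kappa> \<Longrightarrow> B0 v = T v"
    by (rule uniformly_continuous_on_extension_on_closure) blast
  have cT: "continuous_on UNIV T" using uniformly_continuous_imp_continuous[OF T] by (simp add: dense)
  have T\<kappa>: "T (\<kappa> x) = B x" for x using ext[of "\<kappa> x"] by (simp add: B0)
  have lim: "(\<lambda>n. B (X n)) \<longlonglongrightarrow> T u" if "(\<lambda>n. \<kappa> (X n)) \<longlonglongrightarrow> u" for X u
    using continuous_on_tendsto_compose[OF cT that] by (simp add: T\<kappa>)
  have seq: "\<exists>X. (\<lambda>n. \<kappa> (X n)) \<longlonglongrightarrow> u" for u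
  proof -
    have "u \<in> closure (range \<kappa>)" by (simp add: dense)
    then obtain V where V: "\<forall>n. V n \<in> range \<kappa>" "V \<longlonglongrightarrow> u" by (auto simp: closure_sequential)
    then have "\<forall>n. \<exists>x. V n = \<kappa> x" by blast
    from choice[OF this] obtain X where "\<forall>n. V n = \<kappa> (X n)" ..
    then have "V = (\<lambda>n. \<kappa> (X n))" by auto
    with V(2) show ?thesis by blast
  qed
  have "linear T"
  proof (rule linearI)
    fix u v and r :: real
    obtain X Y where X: "(\<lambda>n. \<kappa> (X n)) \<longlonglongrightarrow> u" and Y: "(\<lambda>n. \<kappa> (Y n)) \<longlonglongrightarrow> v" using seq by meson
    have "(\<lambda>n. \<kappa> (X n + Y n)) \<longlonglongrightarrow> u + v" unfolding linear_add[OF \<kappa>] by (intro tendsto_intros X Y)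
    from lim[OF this] have "(\<lambda>n. B (X n) + B (Y n)) \<longlonglongrightarrow> T (u + v)" by (simp add: linear_add[OF B])
    moreover have "(\<lambda>n. B (X n) + B (Y n)) \<longlonglongrightarrow> T u + T v" by (intro tendsto_intros lim X Y)
    ultimately show "T (u + v) = T u + T v" by (rule LIMSEQ_unique)
    have "(\<lambda>n. \<kappa> (r *\<^sub>R X n)) \<longlonglongrightarrow> r *\<^sub>R u" unfolding linear_scale[OF \<kappa>] by (intro tendsto_intros X)
    from lim[OF this] have "(\<lambda>n. r *\<^sub>R B (X n)) \<longlonglongrightarrow> T (r *\<^sub>R u)" by (simp add: linear_scale[OF B])
    moreover have "(\<lambda>n. r *\<^sub>R B (X n)) \<longlonglongrightarrow> r *\<^sub>R T u" by (intro tendsto_intros lim X)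
    ultimately show "T (r *\<^sub>R u) = r *\<^sub>R T u" by (rule LIMSEQ_unique)
  qed
  then show ?thesis using T\<kappa> lim by (rule that)
qed

lemma dense_approximation:
  assumes "closure (range \<kappa>) = UNIV" "0 < \<eta>"
  obtains x where "dist (\<kappa> x) u < \<eta>"
proof -
  have "u \<in> closure (range \<kappa>)" using assms by simp
  then show ?thesis using that assms(2) unfolding closure_approachable by blast
qed

context traced_jbw_star_algebra
begin

lemma j_iota_linear: "linear (\<lambda>x. j (\<iota> x))"
  using linear_compose[OF iota_linear j_linear] by (simp add: o_def)

text \<open>\<open>A\<close> is complete for its own norm, so the dense subspace \<open>\<kappa>(A)\<close> is the whole completion.\<close>

lemma isometry_infinity:
  fixes \<kappa> :: "'a \<Rightarrow> 'l::banach"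
  assumes \<kappa>: "linear \<kappa>" and iso: "\<And>x. norm (\<kappa> x) = norm x" and dense: "closure (range \<kappa>) = UNIV"
  shows "\<exists>T :: 'l \<Rightarrow> ('m \<Rightarrow>\<^sub>L complex). linear T \<and> (\<forall>u. T u \<in> range j \<and> norm (inv j (T u)) = norm u) \<and> (\<forall>x. T (\<kappa> x) = j (\<iota> x))"
proof -
  have "norm (j (\<iota> x)) \<le> (2 * \<tau> A.e) * norm (\<kappa> x)" for x
    using j_norm_le[of "\<iota> x"] by (simp add: iso)
  then obtain T where T: "linear T" "\<And>x. T (\<kappa> x) = j (\<iota> x)"
    using extend_to_completion[OF \<kappa> dense j_iota_linear] by metis
  have bl: "bounded_linear \<kappa>"
    by (rule bounded_linear_intro[where K = 1]) (simp_all add: linear_add[OF \<kappa>] linear_scale[OF \<kappa>] iso)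
  have "complete (range \<kappa>)"
    by (rule complete_isometric_image[OF zero_less_one subspace_UNIV bl])
      (simp_all add: iso complete_UNIV)
  then have "closed (range \<kappa>)" by (rule complete_imp_closed)
  then have "range \<kappa> = UNIV" using dense by simp
  then have "\<exists>x. u = \<kappa> x" for u by blast
  then have "T u \<in> range j \<and> norm (inv j (T u)) = norm u" for u
    using T(2) iso by (metis inv_j iota_isometric rangeI)
  then show ?thesis using T by blast
qed

text \<open>\<open>j\<close> is isometric on \<open>\<kappa>(A)\<close>, and the predual is closed in the space of bounded functionals.\<close>

lemma isometry_one:
  fixes \<kappa> :: "'a \<Rightarrow> 'l::banach"
  assumes \<kappa>: "linear \<kappa>" and iso: "\<And>x. norm (\<kappa> x) = lp_norm 1 x" and dense: "closure (range \<kappa>) = UNIV"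
  shows "\<exists>T :: 'l \<Rightarrow> ('m \<Rightarrow>\<^sub>L complex). linear T \<and> (\<forall>u. T u \<in> predual K \<and> norm (T u) = norm u) \<and> (\<forall>x. T (\<kappa> x) = j (\<iota> x))"
proof -
  have n: "norm (j (\<iota> x)) = norm (\<kappa> x)" for x by (simp add: norm_j_iota iso)
  then have "norm (j (\<iota> x)) \<le> 1 * norm (\<kappa> x)" for x by simp
  then obtain T where T: "linear T" "\<And>x. T (\<kappa> x) = j (\<iota> x)"
      "\<And>X u. (\<lambda>n. \<kappa> (X n)) \<longlonglongrightarrow> u \<Longrightarrow> (\<lambda>n. j (\<iota> (X n))) \<longlonglongrightarrow> T u"
    using extend_to_completion[OF \<kappa> dense j_iota_linear] by metis
  have "T u \<in> predual K \<and> norm (T u) = norm u" for u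
  proof -
    have "\<forall>n. \<exists>x. dist (\<kappa> x) u < 1 / real (Suc n)"
      using dense_approximation[OF dense] by (metis of_nat_0_less_iff zero_less_Suc zero_less_divide_1_iff)
    from choice[OF this] obtain X where X: "\<forall>n. dist (\<kappa> (X n)) u < 1 / real (Suc n)" ..
    have l: "(\<lambda>n. \<kappa> (X n)) \<longlonglongrightarrow> u"
    proof (rule metric_tendsto_imp_tendsto[where f = "\<lambda>n. 1 / real (Suc n)" and a = 0])
      show "(\<lambda>n. 1 / real (Suc n)) \<longlonglongrightarrow> 0" using LIMSEQ_inverse_real_of_nat by (simp add: divide_inverse)
      show "\<forall>\<^sub>F n in sequentially. dist (\<kappa> (X n)) u \<le> dist (1 / real (Suc n)) 0"
        using X by (intro always_eventually) (simp add: less_imp_le)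
    qed
    note l' = T(3)[OF l]
    have "T u \<in> predual K" by (rule closed_sequentially[OF closed_predual j_in_predual l'])
    moreover have "(\<lambda>n. norm (\<kappa> (X n))) \<longlonglongrightarrow> norm (T u)" using tendsto_norm[OF l'] by (simp add: n)
    then have "norm (T u) = norm u" using tendsto_norm[OF l] by (rule LIMSEQ_unique)
    ultimately show ?thesis by simp
  qed
  then show ?thesis using T by blast
qed

text \<open>Single elements give a bound for \<open>j\<close>, so that \<open>T\<close> exists as an extension into the bounded functionals.
  Its values are identified as elements of the interpolation space by rapidly convergent series,
  and the norm is bounded from below by approximating \<open>u\<close> in the completion.\<close>

lemma isometry_between:
  fixes \<kappa> :: "'a \<Rightarrow> 'l::banach"
  assumes r: "1 < r" and \<kappa>: "linear \<kappa>" and iso: "\<And>x. norm (\<kappa> x) = lp_norm r x" and dense: "closure (range \<kappa>) = UNIV"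
  shows "\<exists>T :: 'l \<Rightarrow> ('m \<Rightarrow>\<^sub>L complex). linear T \<and> (\<forall>u. T u \<in> theta_space (1 / r) \<and> theta_norm (1 / r) (T u) = norm u) \<and> (\<forall>x. T (\<kappa> x) = j (\<iota> x))"
proof -
  have \<theta>: "0 < 1 / r" "1 / r < 1" using r by simp_all
  have "norm (j (\<iota> x)) \<le> j_bound * norm (\<kappa> x)" for x
  proof (rule field_le_epsilon)
    fix \<eta>' :: real assume \<eta>': "0 < \<eta>'"
    define \<eta> where "\<eta> = \<eta>' / j_bound"
    have \<eta>: "0 < \<eta>" using \<eta>' j_bound by (simp add: \<eta>_def)
    \<comment> \<open>The series with a single nonzero term; the geometric part of \<open>N\<close> makes its members strictly larger
      than the norms of the terms.\<close>
    define N where "N k = (if k = 0 then norm (\<kappa> x) else 0) + \<eta> * (1/2) ^ Suc k" for k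
    define d where "d k = (if k = 0 then x else 0)" for k :: nat
    have "(\<lambda>k. if k = 0 then norm (\<kappa> x) else 0) sums norm (\<kappa> x)" using sums_single[of 0 "\<lambda>k. norm (\<kappa> x)"] by simp
    then have sN: "N sums (norm (\<kappa> x) + \<eta> * 1)" unfolding N_def by (intro sums_add sums_mult power_half_series)
    have lt: "lp_norm r (d k) < N k" for k
      using \<eta> by (simp add: d_def N_def linear_0[OF \<kappa>] flip: iso)
    note S = interp_series_lp_norm[OF r lt sums_summable[OF sN]]
    have "(\<lambda>k. j (\<iota> (d k))) = (\<lambda>k. if k = 0 then j (\<iota> x) else 0)"
      by (auto simp: d_def linear_0[OF j_linear])
    then have v: "(\<Sum>k. j (\<iota> (d k))) = j (\<iota> x)" using sums_unique[OF sums_single[of 0 "\<lambda>k. j (\<iota> x)"]] by simp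
    have "norm (j (\<iota> x)) \<le> j_bound * theta_norm (1 / r) (j (\<iota> x))" using norm_le_theta_norm[OF S(2) \<theta>] by (simp only: v)
    also have "\<dots> \<le> j_bound * (norm (\<kappa> x) + \<eta>)"
      using S(3) j_bound unfolding v sums_unique[OF sN, symmetric] by (intro mult_left_mono) auto
    also have "\<dots> = j_bound * norm (\<kappa> x) + \<eta>'" using j_bound by (simp add: \<eta>_def algebra_simps)
    finally show "norm (j (\<iota> x)) \<le> j_bound * norm (\<kappa> x) + \<eta>'" .
  qed
  then obtain T where T: "linear T" "\<And>x. T (\<kappa> x) = j (\<iota> x)"
      "\<And>X u. (\<lambda>n. \<kappa> (X n)) \<longlonglongrightarrow> u \<Longrightarrow> (\<lambda>n. j (\<iota> (X n))) \<longlonglongrightarrow> T u"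
    using extend_to_completion[OF \<kappa> dense j_iota_linear] by metis

  have upper: "T u \<in> theta_space (1 / r) \<and> theta_norm (1 / r) (T u) \<le> norm u + 2 * \<eta>" if \<eta>: "0 < \<eta>" for u \<eta>
  proof -
    have "\<forall>n. \<exists>x. dist (\<kappa> x) u < \<eta> / 4 * (1/2) ^ n"
      using dense_approximation[OF dense, of "\<eta> / 4 * (1/2) ^ n" u for n] \<eta> by (metis divide_pos_pos mult_pos_pos zero_less_numeral zero_less_one zero_less_power)
    from choice[OF this] obtain X where "\<forall>n. dist (\<kappa> (X n)) u < \<eta> / 4 * (1/2) ^ n" ..
    then have X: "norm (\<kappa> (X n) - u) < \<eta> / 4 * (1/2) ^ n" for n by (simp add: dist_norm)
    have l: "(\<lambda>n. \<kappa> (X n)) \<longlonglongrightarrow> u"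
    proof (rule LIM_zero_cancel, rule Lim_null_comparison)
      have "(\<lambda>n. \<eta> / 4 * (1/2) ^ n) \<longlonglongrightarrow> \<eta> / 4 * 0" by (intro tendsto_intros LIMSEQ_power_zero) simp
      then show "(\<lambda>n. \<eta> / 4 * (1/2) ^ n) \<longlonglongrightarrow> 0" by simp
      show "\<forall>\<^sub>F n in sequentially. norm (\<kappa> (X n) - u) \<le> \<eta> / 4 * (1/2) ^ n"
        using X by (intro always_eventually allI less_imp_le)
    qed
    \<comment> \<open>The element \<open>u\<close> is the sum of the images of \<open>d k\<close>, and \<open>N\<close> bounds their norms.\<close>
    define N where "N k = (if k = 0 then norm u + \<eta> else \<eta> * (1/2) ^ k)" for k
    define d where "d k = (case k of 0 \<Rightarrow> X 0 | Suc n \<Rightarrow> X (Suc n) - X n)" for k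
    have sN: "N sums (norm u + 2 * \<eta>)"
    proof -
      have "(\<lambda>k. \<eta> * (1/2) ^ Suc k) sums (\<eta> * 1)" by (intro sums_mult power_half_series)
      then have "(\<lambda>k. N (Suc k)) sums (\<eta> * 1)" by (simp add: N_def)
      then show ?thesis by (subst (asm) sums_Suc_iff) (simp add: N_def add.commute)
    qed
    have lt: "lp_norm r (d k) < N k" for k
    proof (cases k)
      case 0
      have "norm (\<kappa> (X 0)) \<le> norm (\<kappa> (X 0) - u) + norm u" by (metis diff_add_cancel norm_triangle_ineq)
      then show ?thesis using X[of 0] \<eta> 0 by (simp add: d_def N_def flip: iso)
    next
      case (Suc n)
      have "norm (\<kappa> (X (Suc n) - X n)) = norm ((\<kappa> (X (Suc n)) - u) - (\<kappa> (X n) - u))" by (simp add: linear_diff[OF \<kappa>])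
      also have "\<dots> \<le> norm (\<kappa> (X (Suc n)) - u) + norm (\<kappa> (X n) - u)" by (rule norm_triangle_ineq4)
      also have "\<dots> < \<eta> / 4 * (1/2) ^ Suc n + \<eta> / 4 * (1/2) ^ n" by (intro add_strict_mono X)
      also have "\<dots> \<le> \<eta> * (1/2) ^ Suc n" using \<eta> by (simp add: field_simps)
      finally show ?thesis using Suc by (simp add: d_def N_def flip: iso)
    qed
    note S = interp_series_lp_norm[OF r lt sums_summable[OF sN]]
    have partial: "(\<Sum>k<Suc n. j (\<iota> (d k))) = j (\<iota> (X n))" for n
      by (induction n) (simp_all add: d_def j_diff)
    have "(\<lambda>n. \<Sum>k<n. j (\<iota> (d k))) \<longlonglongrightarrow> T u"
      by (rule LIMSEQ_imp_Suc) (unfold partial, rule T(3)[OF l])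
    then have v: "(\<Sum>k. j (\<iota> (d k))) = T u" by (simp add: sums_def sums_unique[symmetric])
    show ?thesis using S(2,3) unfolding v sums_unique[OF sN, symmetric] by simp
  qed
  have le: "theta_norm (1 / r) (T u) \<le> norm u" for u
  proof (rule field_le_epsilon)
    fix \<eta> :: real assume "0 < \<eta>"
    then show "theta_norm (1 / r) (T u) \<le> norm u + \<eta>" using upper[of "\<eta> / 2" u] by simp
  qed
  have mem: "T u \<in> theta_space (1 / r)" for u using upper[OF zero_less_one] by blast
  have ge: "norm u \<le> theta_norm (1 / r) (T u)" for u
  proof (rule theta_norm_greatest[OF mem])
    fix f assume f: "f \<in> strip_functions" "f (complex_of_real (1 / r)) = T u"
    show "norm u \<le> strip_norm f"
    proof (rule field_le_epsilon)
      fix \<eta> :: real assume \<eta>: "0 < \<eta>"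
      then have "0 < \<eta> / 2" by simp
      then obtain x where x: "dist (\<kappa> x) u < \<eta> / 2" by (rule dense_approximation[OF dense])
      have "theta_norm (1 / r) (T (\<kappa> x - u)) < \<eta> / 2" using le[of "\<kappa> x - u"] x by (simp add: dist_norm)
      then have "\<not> \<eta> / 2 \<le> theta_norm (1 / r) (T (\<kappa> x - u))" by simp
      then have "\<not> (\<forall>f2. f2 \<in> strip_functions \<longrightarrow> f2 (complex_of_real (1 / r)) = T (\<kappa> x - u) \<longrightarrow> \<eta> / 2 \<le> strip_norm f2)"
        using theta_norm_greatest[OF mem, of "\<kappa> x - u" "\<eta> / 2"] by (rule contrapos_nn) simp
      then obtain f2 where f2: "f2 \<in> strip_functions" "f2 (complex_of_real (1 / r)) = T (\<kappa> x - u)" "strip_norm f2 < \<eta> / 2"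
        by (auto simp: not_le)
      \<comment> \<open>The second summand has norm less than \<open>\<eta>/2\<close>.\<close>
      have "T u + T (\<kappa> x - u) = j (\<iota> x)" by (simp add: T(2) flip: linear_add[OF T(1)])
      then have "j (\<iota> x) = f (complex_of_real (1 / r)) + f2 (complex_of_real (1 / r))" by (simp only: f(2) f2(2))
      from lp_norm_le_strip_norm[OF r f(1) f2(1) this] have "norm (\<kappa> x) < strip_norm f + \<eta> / 2" using f2(3) by (simp add: iso)
      moreover have "norm u \<le> norm (\<kappa> x) + dist (\<kappa> x) u"
        unfolding dist_norm by (metis norm_minus_commute norm_triangle_sub)
      ultimately show "norm u \<le> strip_norm f + \<eta>" using x by linarith
    qed
  qed
  show ?thesis by (intro exI[of _ T] conjI allI T(1,2) mem order_antisym le ge)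
qed

theorem isometric_embedding:
  fixes \<kappa> :: "'a \<Rightarrow> 'l::banach"
  assumes p: "1 \<le> p" and compl: "is_completion (iochum_norm jpA \<tau> p) \<kappa>"
  shows "\<exists>T :: 'l \<Rightarrow> ('m \<Rightarrow>\<^sub>L complex). linear T \<and>
    (\<forall>u. T u \<in> Lp_space j (predual K) p \<and> Lp_norm j (predual K) p (T u) = norm u) \<and>
    (\<forall>x. T (\<kappa> x) = j (\<iota> x))"
proof -
  have \<kappa>: "linear \<kappa>" "\<And>x. norm (\<kappa> x) = iochum_norm jpA \<tau> p x" "closure (range \<kappa>) = UNIV"
    using compl by (simp_all add: is_completion_def)
  show ?thesis
  proof (cases p)
    case (real r)
    then have r: "1 \<le> r" using p by (simp add: one_ereal_def)
    have iso: "norm (\<kappa> x) = lp_norm r x" for x using r by (simp add: \<kappa>(2) real iochum_norm_eq)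
    show ?thesis
    proof (cases "r = 1")
      case True
      have iso1: "\<And>x. norm (\<kappa> x) = lp_norm 1 x" using iso True by simp
      show ?thesis unfolding Lp_space_def Lp_norm_def
        using isometry_one[OF \<kappa>(1) iso1 \<kappa>(3)] by (simp add: real True one_ereal_def)
    next
      case False
      then have r1: "1 < r" using r by simp
      show ?thesis unfolding Lp_space_def Lp_norm_def
        using isometry_between[OF r1 \<kappa>(1) iso \<kappa>(3)] False by (simp add: real one_ereal_def)
    qed
  next
    case PInf
    have iso: "norm (\<kappa> x) = norm x" for x by (simp add: \<kappa>(2) PInf iochum_norm_def)
    show ?thesis unfolding Lp_space_def Lp_norm_def
      using isometry_infinity[OF \<kappa>(1) iso \<kappa>(3)] by (simp add: PInf)
  next
    case MInf
    with p show ?thesis by simp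
  qed
qed

end

theorem theorem3p15:
  fixes jpA :: "'a::banach \<Rightarrow> 'a \<Rightarrow> 'a"
    and J :: "'a \<Rightarrow> ('x::banach \<Rightarrow>\<^sub>L real)"
    and \<tau> :: "'a \<Rightarrow> real"
    and jpM :: "'m::complex_banach \<Rightarrow> 'm \<Rightarrow> 'm"
    and star :: "'m \<Rightarrow> 'm"
    and K :: "'m \<Rightarrow> ('y::complex_banach \<Rightarrow>\<^sub>L complex)"
    and \<iota> :: "'a \<Rightarrow> 'm"
    and p :: ereal
    and \<kappa> :: "'a \<Rightarrow> 'l::banach"
  defines "j \<equiv> trace_embedding jpM star \<iota> \<tau>"
  assumes "normal_finite_faithful_trace jpA J \<tau>"
    and "associated_jbw_star_algebra jpA J jpM star K \<iota>"
    and "1 \<le> p"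
    and "is_completion (iochum_norm jpA \<tau> p) \<kappa>"
  shows "\<exists>T :: 'l \<Rightarrow> ('m \<Rightarrow>\<^sub>L complex).
    linear T \<and>
    (\<forall>u. T u \<in> Lp_space j (predual K) p \<and> Lp_norm j (predual K) p (T u) = norm u) \<and>
    (\<forall>x. T (\<kappa> x) = j (\<iota> x))"
proof -
  interpret traced_jbw_star_algebra jpA J \<tau> jpM star K \<iota>
    unfolding traced_jbw_star_algebra_def using assms(2,3) by simp
  show ?thesis unfolding j_def by (rule isometric_embedding[OF assms(4,5)])
qed

end
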